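(* Let $U$ be a coordinate neighbourhood (of a supermanifold of dimension $(p,q)$) with two retractions $\gamma$ and $\gamma'$. Let $u_0=(u_{1,0},\dots,u_{p,0})$ be a coordinate system on $U_0$, set $u=\gamma^*(u_0)$, and let $\partial_{u_1},\dots,\partial_{u_p}$ be the even coordinate derivations of a coordinate system $x=(u,\xi)$ on $U$ with even part $u$. Let $\omega\in|\mathrm{Ber}|U$ be a Berezin density (or $\omega\in\mathrm{Ber}\,U$ a Berezin form, with $U_0$ oriented). Then $\omega$ is integrable with respect to $\gamma'$ and $$\int_{(U,\gamma')}\omega=\int_{(U,\gamma)}\omega+\sum_{i\neq0}\frac1{i!}\int_{(U,\gamma)}\omega\big(\gamma'^*(u_0)-\gamma^*(u_0)\big)^i.\partial_u^i,$$ if the right hand side exists. Here the sum is finite and extends over $i\in\mathbb Z_{\ge0}^p\setminus\{0\}$.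
   Context: **Supermanifolds.** Supermanifolds are real smooth supermanifolds (ringed spaces) $M=(M_0,\mathcal O_M)$, with $M_0$ Hausdorff and second countable. $j_M\colon M_0\to M$ is the canonical embedding, $f_0=j_M^*(f)$. A *retraction* on $U$ is a morphism $\gamma\colon U\to U_0$ with $\gamma\circ j_U=\mathrm{id}_{U_0}$. A coordinate system is $x=(u,\xi)$ with $u$ even and $\xi$ odd. The retraction associated with $x$ is the unique $\gamma$ with $\gamma^*(u_0)=u$; then superfunctions expand uniquely as $f=\sum_{\nu\in\{0,1\}^q}\gamma^*(f_\nu)\xi^\nu$, and $\partial_{u_i}f=\sum_\nu\gamma^*(\partial f_\nu/\partial u_{i,0})\xi^\nu$. **Berezin densities and forms.** Locally a Berezin density is $\omega=f|Dx|=(-1)^{|f||Dx|}|Dx|f$, with $|Dx|$ of a fixed (arbitrary) parity $b(p,q)\in\mathbb Z_2$, and $f|Dx|=f\frac{|Dx|}{|Dy|}|Dy|$ for $y=(v,\eta)$, where $\frac{|Dx|}{|Dy|}=\mathrm{sgn}\big(j^*\det(\partial u/\partial v)\big)\,\mathrm{Ber}\begin{pmatrix}\partial u/\partial v&\partial \xi/\partial v\\ \partial u/\partial\eta&\partial\xi/\partial\eta\end{pmatrix}$, $\mathrm{Ber}\begin{pmatrix}R&S\\ T&V\end{pmatrix}=\det(R-SV^{-1}T)\det V^{-1}$. Berezin forms $fDx$ are defined in the same way without the sign factor. **Integral.** Fix an arbitrary sign function $s(p,q)\in\mathbb Z_2$. For a retraction $\gamma$ associated with $x=(u,\xi)$ and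 $\omega=f|Dx|$ (resp. $fDx$), $\gamma_!\omega=(-1)^{s(p,q)}f_{(1,\dots,1)}|du_0|$ (resp. $(-1)^{s(p,q)}f_{(1,\dots,1)}du_0$). $\omega$ is *integrable with respect to $\gamma$* if $\gamma_!\omega$ is integrable on $U_0$, and then $\int_{(U,\gamma)}\omega:=\int_{U_0}\gamma_!\omega$. **Action of differential operators.** There is a unique right action $(\omega,A)\mapsto\omega.A$ of differential operators on Berezin densities (and forms), extending right multiplication by superfunctions, with $\omega.X=-(-1)^{|X||\omega|}\mathcal L_X\omega$ for superderivations $X$, where $\mathcal L_{g\partial_{x_i}}(f|Dx|)=(-1)^{|g||x_i|}\partial_{x_i}(gf)|Dx|$ (same formula with $Dx$). **Multi-indices.** $i!=i_1!\cdots i_p!$, $\partial_u^i=\partial_{u_p}^{i_p}\cdots\partial_{u_1}^{i_1}$, $(\gamma'^*(u_0)-\gamma^*(u_0))^i=\prod_s(\gamma'^*(u_{s,0})-\gamma^*(u_{s,0}))^{i_s}$. The integrand is $\big(\omega(\gamma'^*(u_0)-\gamma^*(u_0))^i\big).\partial_u^i$. *)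

theory Defs
  imports "HOL-Analysis.Analysis" "HOL-Algebra.Module"
begin

section \<open>Grassmann algebras\<close>

text \<open>
  A family of coefficients \<open>a\<close> stands for the (formal) sum of \<open>a I \<xi>\<^sup>I\<close> over the finite sets
  \<open>I\<close> of naturals, where \<open>\<xi>\<^sup>I\<close> is the product of the generators \<open>\<xi>\<^sub>i\<close>, \<open>i \<in> I\<close>, in increasing
  order.  The Grassmann algebra on \<open>q\<close> generators consists of the elements whose coefficients
  vanish unless \<open>I \<subseteq> {..<q}\<close>; odd indices are numbered from \<open>0\<close> throughout.
\<close>

typedef grass = "{a :: nat set \<Rightarrow> real. \<forall>I. infinite I \<longrightarrow> a I = 0}"
  morphisms gcoeff Grass
  by (rule exI[of _ "\<lambda>_. 0"]) simp

setup_lifting type_definition_grass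

text \<open>\<open>\<xi>\<^sup>I \<xi>\<^sup>J = gsgn I J \<xi>\<^bsup>I \<union> J\<^esup>\<close> for disjoint \<open>I\<close>, \<open>J\<close>.\<close>

definition gsgn :: "nat set \<Rightarrow> nat set \<Rightarrow> real" where
  "gsgn I J = (-1) ^ card {(i, j). i \<in> I \<and> j \<in> J \<and> j < i}"

lemma finite_inversions:
  fixes I J :: "nat set"
  assumes "finite I" "finite J"
  shows "finite {(i, j). i \<in> I \<and> j \<in> J \<and> j < i}"
  by (rule finite_subset[of _ "I \<times> J"]) (use assms in auto)

lemma gsgn_Un_left:
  assumes "finite I" "finite J" "finite K" "I \<inter> J = {}"
  shows "gsgn (I \<union> J) K = gsgn I K * gsgn J K"
proof -
  have "{(i, j). i \<in> I \<union> J \<and> j \<in> K \<and> j < i} =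
      {(i, j). i \<in> I \<and> j \<in> K \<and> j < i} \<union> {(i, j). i \<in> J \<and> j \<in> K \<and> j < i}" by auto
  moreover have "{(i, j). i \<in> I \<and> j \<in> K \<and> j < i} \<inter> {(i, j). i \<in> J \<and> j \<in> K \<and> j < i} = {}"
    using assms(4) by auto
  ultimately show ?thesis
    using assms unfolding gsgn_def by (simp add: card_Un_disjoint finite_inversions power_add)
qed

lemma gsgn_Un_right:
  assumes "finite I" "finite J" "finite K" "J \<inter> K = {}"
  shows "gsgn I (J \<union> K) = gsgn I J * gsgn I K"
proof -
  have "{(i, j). i \<in> I \<and> j \<in> J \<union> K \<and> j < i} =
      {(i, j). i \<in> I \<and> j \<in> J \<and> j < i} \<union> {(i, j). i \<in> I \<and> j \<in> K \<and> j < i}" by auto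
  moreover have "{(i, j). i \<in> I \<and> j \<in> J \<and> j < i} \<inter> {(i, j). i \<in> I \<and> j \<in> K \<and> j < i} = {}"
    using assms(4) by auto
  ultimately show ?thesis
    using assms unfolding gsgn_def by (simp add: card_Un_disjoint finite_inversions power_add)
qed

lemma gsgn_empty [simp]: "gsgn {} J = 1" "gsgn I {} = 1"
  by (simp_all add: gsgn_def)

instantiation grass :: real_algebra_1
begin

lift_definition zero_grass :: grass is "\<lambda>_. 0" by simp

lift_definition one_grass :: grass is "\<lambda>I. if I = {} then 1 else 0" by auto

lift_definition plus_grass :: "grass \<Rightarrow> grass \<Rightarrow> grass" is "\<lambda>a b I. a I + b I" by simp

lift_definition minus_grass :: "grass \<Rightarrow> grass \<Rightarrow> grass" is "\<lambda>a b I. a I - b I" by simp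

lift_definition uminus_grass :: "grass \<Rightarrow> grass" is "\<lambda>a I. - a I" by simp

lift_definition scaleR_grass :: "real \<Rightarrow> grass \<Rightarrow> grass" is "\<lambda>r a I. r * a I" by simp

lift_definition times_grass :: "grass \<Rightarrow> grass \<Rightarrow> grass"
  is "\<lambda>a b K. \<Sum>I\<in>Pow K. gsgn I (K - I) * a I * b (K - I)"
  by (simp add: finite_Pow_iff)

instance
proof
  fix a b c :: grass and r t :: real
  show "a * b * c = a * (b * c)"
  proof (transfer, rule ext)
    fix a b c :: "nat set \<Rightarrow> real" and K :: "nat set"
    show "(\<Sum>I\<in>Pow K. gsgn I (K - I) * (\<Sum>J\<in>Pow I. gsgn J (I - J) * a J * b (I - J)) * c (K - I)) =
      (\<Sum>J\<in>Pow K. gsgn J (K - J) * a J *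
        (\<Sum>L\<in>Pow (K - J). gsgn L (K - J - L) * b L * c (K - J - L)))" (is "?l = ?r")
    proof (cases "finite K")
      case True
      have fin: "finite I" if "I \<subseteq> K" for I
        using True that finite_subset by blast
      have "?l = (\<Sum>(I, J)\<in>Sigma (Pow K) Pow.
          gsgn I (K - I) * gsgn J (I - J) * a J * b (I - J) * c (K - I))"
        using True fin
        by (subst sum.Sigma[symmetric]) (auto simp: sum_distrib_left sum_distrib_right mult_ac)
      also have "\<dots> = (\<Sum>(J, L)\<in>Sigma (Pow K) (\<lambda>J. Pow (K - J)).
          gsgn J (K - J) * gsgn L (K - J - L) * a J * b L * c (K - J - L))"
      proof (rule sum.reindex_bij_witness
          [where j = "\<lambda>(I, J). (J, I - J)" and i = "\<lambda>(J, L). (J \<union> L, J)"])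
        fix z assume "z \<in> Sigma (Pow K) Pow"
        then obtain I J where z: "z = (I, J)" and I: "I \<subseteq> K" and J: "J \<subseteq> I" by auto
        have e: "K - J - (I - J) = K - I" "K - J = (I - J) \<union> (K - I)" "I = J \<union> (I - J)"
          using I J by auto
        have f: "finite J" "finite (I - J)" "finite (K - I)" using I J fin by auto
        have "gsgn I (K - I) = gsgn J (K - I) * gsgn (I - J) (K - I)"
          by (subst e(3), rule gsgn_Un_left) (use f in auto)
        moreover have "gsgn J (K - J) = gsgn J (I - J) * gsgn J (K - I)"
          by (subst e(2), rule gsgn_Un_right) (use f in auto)
        ultimately show "(case (case z of (I, J) \<Rightarrow> (J, I - J)) of (J, L) \<Rightarrow>
            gsgn J (K - J) * gsgn L (K - J - L) * a J * b L * c (K - J - L)) =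
          (case z of (I, J) \<Rightarrow> gsgn I (K - I) * gsgn J (I - J) * a J * b (I - J) * c (K - I))"
          by (simp add: z e(1))
      qed auto
      also have "\<dots> = ?r"
        using True fin
        by (subst sum.Sigma[symmetric]) (auto simp: sum_distrib_left sum_distrib_right mult_ac)
      finally show ?thesis .
    qed (simp add: finite_Pow_iff)
  qed
  show "1 * a = a"
  proof (transfer, rule ext)
    fix a :: "nat set \<Rightarrow> real" and K :: "nat set"
    assume a: "\<forall>I. infinite I \<longrightarrow> a I = 0"
    show "(\<Sum>I\<in>Pow K. gsgn I (K - I) * (if I = {} then 1 else 0) * a (K - I)) = a K"
    proof (cases "finite K")
      case True
      have "(\<Sum>I\<in>Pow K. gsgn I (K - I) * (if I = {} then 1 else 0) * a (K - I)) =
          (\<Sum>I\<in>Pow K. if I = {} then a K else 0)"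
        by (intro sum.cong) auto
      then show ?thesis using True by simp
    qed (simp add: a finite_Pow_iff)
  qed
  show "a * 1 = a"
  proof (transfer, rule ext)
    fix a :: "nat set \<Rightarrow> real" and K :: "nat set"
    assume a: "\<forall>I. infinite I \<longrightarrow> a I = 0"
    show "(\<Sum>I\<in>Pow K. gsgn I (K - I) * a I * (if K - I = {} then 1 else 0)) = a K"
    proof (cases "finite K")
      case True
      have "(\<Sum>I\<in>Pow K. gsgn I (K - I) * a I * (if K - I = {} then 1 else 0)) =
          (\<Sum>I\<in>Pow K. if I = K then a K else 0)"
        by (intro sum.cong) auto
      then show ?thesis using True by simp
    qed (simp add: a finite_Pow_iff)
  qed
  show "(0 :: grass) \<noteq> 1" by transfer (metis zero_neq_one)
qed (transfer; force simp: algebra_simps sum.distrib sum_distrib_left sum_subtractf)+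

end

lift_definition ggen :: "nat \<Rightarrow> grass" is "\<lambda>j I. if I = {j} then 1 else 0" by auto

text \<open>The left derivative with respect to the generator \<open>\<xi>\<^sub>j\<close>.\<close>

lift_definition gder :: "nat \<Rightarrow> grass \<Rightarrow> grass"
  is "\<lambda>j a I. if j \<in> I then 0 else (-1) ^ card {i \<in> I. i < j} * a (insert j I)"
  by simp

text \<open>Leibniz determinant; it is used only for matrices with (commuting) even entries.\<close>

definition gdet :: "'i::linorder set \<Rightarrow> ('i \<Rightarrow> 'i \<Rightarrow> grass) \<Rightarrow> grass" where
  "gdet I A = (\<Sum>\<pi> | \<pi> permutes I.
      of_int (sign \<pi>) * prod_list (map (\<lambda>i. A i (\<pi> i)) (sorted_list_of_set I)))"

definition ginv :: "nat \<Rightarrow> (nat \<Rightarrow> nat \<Rightarrow> grass) \<Rightarrow> nat \<Rightarrow> nat \<Rightarrow> grass" where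
  "ginv q A = (THE B. (\<forall>i j. \<not> (i < q \<and> j < q) \<longrightarrow> B i j = 0) \<and>
      (\<forall>i<q. \<forall>j<q. (\<Sum>k<q. A i k * B k j) = (if i = j then 1 else 0) \<and>
                   (\<Sum>k<q. B i k * A k j) = (if i = j then 1 else 0)))"

text \<open>The Berezinian \<open>Ber (R, S; T, V) = det (R - S V\<^sup>-\<^sup>1 T) det V\<^sup>-\<^sup>1\<close>.\<close>

definition gber :: "nat \<Rightarrow> ('p::{finite,linorder} \<Rightarrow> 'p \<Rightarrow> grass) \<Rightarrow> ('p \<Rightarrow> nat \<Rightarrow> grass) \<Rightarrow>
    (nat \<Rightarrow> 'p \<Rightarrow> grass) \<Rightarrow> (nat \<Rightarrow> nat \<Rightarrow> grass) \<Rightarrow> grass" where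
  "gber q R S T V =
    gdet UNIV (\<lambda>a b. R a b - (\<Sum>k<q. \<Sum>l<q. S a k * ginv q V k l * T l b)) * gdet {..<q} (ginv q V)"


section \<open>Smooth functions on open subsets of \<open>\<real>\<^sup>p\<close>\<close>

definition pd :: "'p::finite \<Rightarrow> (real ^ 'p \<Rightarrow> real) \<Rightarrow> real ^ 'p \<Rightarrow> real" where
  "pd a f w = frechet_derivative f (at w) (axis a 1)"

primrec Ck_on :: "nat \<Rightarrow> (real ^ 'p::finite) set \<Rightarrow> (real ^ 'p \<Rightarrow> real) \<Rightarrow> bool" where
  "Ck_on 0 W f \<longleftrightarrow> continuous_on W f"
| "Ck_on (Suc k) W f \<longleftrightarrow> f differentiable_on W \<and> (\<forall>a. Ck_on k W (pd a f))"

definition smooth_on :: "(real ^ 'p::finite) set \<Rightarrow> (real ^ 'p \<Rightarrow> real) \<Rightarrow> bool" where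
  "smooth_on W f \<longleftrightarrow> (\<forall>k. Ck_on k W f)"

definition gpd :: "'p::finite \<Rightarrow> (real ^ 'p \<Rightarrow> grass) \<Rightarrow> real ^ 'p \<Rightarrow> grass" where
  "gpd a f w = Grass (\<lambda>I. if finite I then pd a (\<lambda>z. gcoeff (f z) I) w else 0)"


section \<open>Ringed superspaces\<close>

text \<open>In all gradings \<open>False\<close> is the even and \<open>True\<close> the odd parity.\<close>

record 's superalg = "(real, 's) module" +
  grade :: "bool \<Rightarrow> 's set"

definition real_ring :: "real ring" where
  "real_ring = \<lparr>carrier = UNIV, mult = (*), one = 1, zero = 0, add = (+)\<rparr>"

locale superalgebra = ring A + Module.module real_ring A
    for A :: "('s, 'z) superalg_scheme" (structure) +
  assumes smult_mult_left: "\<lbrakk>f \<in> carrier A; g \<in> carrier A\<rbrakk> \<Longrightarrow> (r \<odot> f) \<otimes> g = r \<odot> (f \<otimes> g)"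
    and smult_mult_right: "\<lbrakk>f \<in> carrier A; g \<in> carrier A\<rbrakk> \<Longrightarrow> f \<otimes> (r \<odot> g) = r \<odot> (f \<otimes> g)"
    and grade_carrier: "grade A d \<subseteq> carrier A"
    and grade_zero: "\<zero> \<in> grade A d"
    and grade_add: "\<lbrakk>f \<in> grade A d; g \<in> grade A d\<rbrakk> \<Longrightarrow> f \<oplus> g \<in> grade A d"
    and grade_smult: "f \<in> grade A d \<Longrightarrow> r \<odot> f \<in> grade A d"
    and grade_decomp: "f \<in> carrier A \<Longrightarrow>
      \<exists>!(g, h). g \<in> grade A False \<and> h \<in> grade A True \<and> f = g \<oplus> h"
    and grade_one: "\<one> \<in> grade A False"
    and grade_mult: "\<lbrakk>f \<in> grade A d; g \<in> grade A e\<rbrakk> \<Longrightarrow> f \<otimes> g \<in> grade A (d \<noteq> e)"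
    and supercommutative: "\<lbrakk>f \<in> grade A d; g \<in> grade A e\<rbrakk> \<Longrightarrow>
      f \<otimes> g = (if d \<and> e then \<ominus> (g \<otimes> f) else g \<otimes> f)"

definition superalgebra_hom ::
    "('s, 'z) superalg_scheme \<Rightarrow> ('t, 'y) superalg_scheme \<Rightarrow> ('s \<Rightarrow> 't) set" where
  "superalgebra_hom A B = {h \<in> ring_hom A B.
      (\<forall>r. \<forall>f\<in>carrier A. h (r \<odot>\<^bsub>A\<^esub> f) = r \<odot>\<^bsub>B\<^esub> h f) \<and>
      (\<forall>d. h ` grade A d \<subseteq> grade B d)}"

definition hpart :: "('s, 'z) superalg_scheme \<Rightarrow> bool \<Rightarrow> 's \<Rightarrow> 's" where
  "hpart A d f = (THE g. g \<in> grade A d \<and> (\<exists>h\<in>grade A (\<not> d). f = g \<oplus>\<^bsub>A\<^esub> h))"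

record ('x, 's) superspace =
  base :: "'x topology"
  sect :: "'x set \<Rightarrow> 's superalg"
  res :: "'x set \<Rightarrow> 'x set \<Rightarrow> 's \<Rightarrow> 's"

text \<open>\<open>res X V W\<close> is the restriction map from \<open>sect X V\<close> to \<open>sect X W\<close>.\<close>

definition superringed_space :: "('x, 's) superspace \<Rightarrow> bool" where
  "superringed_space X \<longleftrightarrow>
    (\<forall>V. openin (base X) V \<longrightarrow> superalgebra (sect X V)) \<and>
    (\<forall>V W. openin (base X) V \<longrightarrow> openin (base X) W \<longrightarrow> W \<subseteq> V \<longrightarrow>
      res X V W \<in> superalgebra_hom (sect X V) (sect X W)) \<and>
    (\<forall>V. openin (base X) V \<longrightarrow> (\<forall>f\<in>carrier (sect X V). res X V V f = f)) \<and>
    (\<forall>V W T. openin (base X) V \<longrightarrow> openin (base X) W \<longrightarrow> openin (base X) T \<longrightarrow>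
      T \<subseteq> W \<longrightarrow> W \<subseteq> V \<longrightarrow> (\<forall>f\<in>carrier (sect X V). res X W T (res X V W f) = res X V T f)) \<and>
    (\<forall>\<V>. (\<forall>V\<in>\<V>. openin (base X) V) \<longrightarrow>
      (\<forall>f\<in>carrier (sect X (\<Union>\<V>)). \<forall>g\<in>carrier (sect X (\<Union>\<V>)).
        (\<forall>V\<in>\<V>. res X (\<Union>\<V>) V f = res X (\<Union>\<V>) V g) \<longrightarrow> f = g)) \<and>
    (\<forall>\<V> s. (\<forall>V\<in>\<V>. openin (base X) V \<and> s V \<in> carrier (sect X V)) \<longrightarrow>
      (\<forall>V\<in>\<V>. \<forall>W\<in>\<V>. res X V (V \<inter> W) (s V) = res X W (V \<inter> W) (s W)) \<longrightarrow>
      (\<exists>f\<in>carrier (sect X (\<Union>\<V>)). \<forall>V\<in>\<V>. res X (\<Union>\<V>) V f = s V))"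

definition open_subspace :: "('x, 's) superspace \<Rightarrow> 'x set \<Rightarrow> ('x, 's) superspace" where
  "open_subspace X U = \<lparr>base = subtopology (base X) U, sect = sect X, res = res X\<rparr>"

text \<open>
  A morphism \<open>\<phi>\<close> from \<open>X\<close> to \<open>Y\<close> is the pair of its underlying continuous map and of the family of
  its pullback maps, from the sections of \<open>Y\<close> on an open set \<open>V\<close> to those of \<open>X\<close> on the preimage.
\<close>

type_synonym ('x, 'y, 's, 't) morph = "('x \<Rightarrow> 'y) \<times> ('y set \<Rightarrow> 't \<Rightarrow> 's)"

definition preimg :: "('x, 's) superspace \<Rightarrow> ('x, 'y, 's, 't) morph \<Rightarrow> 'y set \<Rightarrow> 'x set" where
  "preimg X \<phi> V = {m \<in> topspace (base X). fst \<phi> m \<in> V}"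

definition morphism ::
    "('x, 's) superspace \<Rightarrow> ('y, 't) superspace \<Rightarrow> ('x, 'y, 's, 't) morph \<Rightarrow> bool" where
  "morphism X Y \<phi> \<longleftrightarrow> continuous_map (base X) (base Y) (fst \<phi>) \<and>
    (\<forall>V. openin (base Y) V \<longrightarrow>
      snd \<phi> V \<in> superalgebra_hom (sect Y V) (sect X (preimg X \<phi> V))) \<and>
    (\<forall>V W. openin (base Y) V \<longrightarrow> openin (base Y) W \<longrightarrow> W \<subseteq> V \<longrightarrow>
      (\<forall>f\<in>carrier (sect Y V).
        snd \<phi> W (res Y V W f) = res X (preimg X \<phi> V) (preimg X \<phi> W) (snd \<phi> V f)))"

definition isomorphism ::
    "('x, 's) superspace \<Rightarrow> ('y, 't) superspace \<Rightarrow> ('x, 'y, 's, 't) morph \<Rightarrow> bool" where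
  "isomorphism X Y \<phi> \<longleftrightarrow> morphism X Y \<phi> \<and> homeomorphic_map (base X) (base Y) (fst \<phi>) \<and>
    (\<forall>V. openin (base Y) V \<longrightarrow>
      bij_betw (snd \<phi> V) (carrier (sect Y V)) (carrier (sect X (preimg X \<phi> V))))"

definition comp_morph :: "('y, 't) superspace \<Rightarrow> ('y, 'z, 't, 'r) morph \<Rightarrow>
    ('x, 'y, 's, 't) morph \<Rightarrow> ('x, 'z, 's, 'r) morph" where
  "comp_morph Y \<psi> \<phi> = (fst \<psi> \<circ> fst \<phi>, \<lambda>V. snd \<phi> (preimg Y \<psi> V) \<circ> snd \<psi> V)"

definition id_morph :: "('x, 'x, 's, 's) morph" where
  "id_morph = (\<lambda>m. m, \<lambda>V f. f)"

text \<open>Equality of morphisms; the values outside of the carriers are irrelevant.\<close>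

definition morph_eq :: "('x, 's) superspace \<Rightarrow> ('y, 't) superspace \<Rightarrow>
    ('x, 'y, 's, 't) morph \<Rightarrow> ('x, 'y, 's, 't) morph \<Rightarrow> bool" where
  "morph_eq X Y \<phi> \<psi> \<longleftrightarrow> (\<forall>m\<in>topspace (base X). fst \<phi> m = fst \<psi> m) \<and>
    (\<forall>V. openin (base Y) V \<longrightarrow> (\<forall>f\<in>carrier (sect Y V). snd \<phi> V f = snd \<psi> V f))"


section \<open>Supermanifolds\<close>

text \<open>Superalgebras of functions on \<open>V\<close>, normalised to be \<open>0\<close> outside of \<open>V\<close>.\<close>

definition fun_superalg :: "'x set \<Rightarrow> (bool \<Rightarrow> ('x \<Rightarrow> 'a::real_algebra_1) set) \<Rightarrow>
    ('x \<Rightarrow> 'a) set \<Rightarrow> ('x \<Rightarrow> 'a) superalg" where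
  "fun_superalg V G C = \<lparr>carrier = C, mult = \<lambda>f g m. f m * g m, one = \<lambda>m. if m \<in> V then 1 else 0,
      zero = \<lambda>m. 0, add = \<lambda>f g m. f m + g m, smult = \<lambda>r f m. r *\<^sub>R f m, grade = G\<rparr>"

definition fun_res :: "'x set \<Rightarrow> 'x set \<Rightarrow> ('x \<Rightarrow> 'a::zero) \<Rightarrow> 'x \<Rightarrow> 'a" where
  "fun_res V W f m = (if m \<in> W then f m else 0)"

definition domain_sections :: "nat \<Rightarrow> (real ^ 'p::finite) set \<Rightarrow> (real ^ 'p \<Rightarrow> grass) set" where
  "domain_sections q V = {f. (\<forall>I. smooth_on V (\<lambda>w. gcoeff (f w) I)) \<and>
      (\<forall>w I. \<not> I \<subseteq> {..<q} \<longrightarrow> gcoeff (f w) I = 0) \<and> (\<forall>w. w \<notin> V \<longrightarrow> f w = 0)}"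

text \<open>The open subspace of \<open>\<real>\<^bsup>p|q\<^esup>\<close> over an open set \<open>W\<close>.\<close>

definition superdomain ::
    "nat \<Rightarrow> (real ^ 'p::finite) set \<Rightarrow> (real ^ 'p, real ^ 'p \<Rightarrow> grass) superspace" where
  "superdomain q W = \<lparr>base = top_of_set W,
      sect = \<lambda>V. fun_superalg V
        (\<lambda>d. {f \<in> domain_sections q V. \<forall>w I. odd (card I) \<noteq> d \<longrightarrow> gcoeff (f w) I = 0})
        (domain_sections q V),
      res = fun_res\<rparr>"

text \<open>
  A coordinate system \<open>x = (u, \<xi>)\<close> is represented by the isomorphism onto an open subspace of
  \<open>\<real>\<^bsup>p|q\<^esup>\<close> under which \<open>u\<close> and \<open>\<xi>\<close> are the pullbacks of the standard coordinates.
\<close>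

type_synonym ('m, 'p, 's) chart = "('m, real ^ 'p, 's, real ^ 'p \<Rightarrow> grass) morph"

definition crange :: "('m, 's) superspace \<Rightarrow> ('m, 'p::finite, 's) chart \<Rightarrow> (real ^ 'p) set" where
  "crange X x = fst x ` topspace (base X)"

definition coord_sys :: "('m, 's) superspace \<Rightarrow> nat \<Rightarrow> ('m, 'p::finite, 's) chart \<Rightarrow> bool" where
  "coord_sys X q x \<longleftrightarrow> open (crange X x) \<and> isomorphism X (superdomain q (crange X x)) x"

definition supermanifold :: "'p::finite itself \<Rightarrow> nat \<Rightarrow> ('m, 's) superspace \<Rightarrow> bool" where
  "supermanifold _ q M \<longleftrightarrow> superringed_space M \<and>
    Hausdorff_space (base M) \<and> second_countable (base M) \<and>
    (\<forall>m\<in>topspace (base M). \<exists>V. openin (base M) V \<and> m \<in> V \<and>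
      (\<exists>x :: ('m, 'p, 's) chart. coord_sys (open_subspace M V) q x))"

text \<open>
  The value \<open>f\<^sub>0(m)\<close> of a superfunction \<open>f\<close> on \<open>V\<close>: the unique number \<open>t\<close> for which \<open>f - t\<close> is not
  invertible in any neighbourhood of \<open>m\<close>.
\<close>

definition bval :: "('m, 's) superspace \<Rightarrow> 'm set \<Rightarrow> 's \<Rightarrow> 'm \<Rightarrow> real" where
  "bval X V f m = (THE t. \<forall>W. openin (base X) W \<longrightarrow> m \<in> W \<longrightarrow> W \<subseteq> V \<longrightarrow>
      res X V W f \<ominus>\<^bsub>sect X W\<^esub> (t \<odot>\<^bsub>sect X W\<^esub> \<one>\<^bsub>sect X W\<^esub>) \<notin> Units (sect X W))"

text \<open>
  The underlying manifold \<open>X\<^sub>0\<close>, whose smooth functions are the functions that are locally of the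
  form \<open>f\<^sub>0\<close>, and its canonical embedding \<open>j\<close> into \<open>X\<close>.
\<close>

definition reduced_sections :: "('m, 's) superspace \<Rightarrow> 'm set \<Rightarrow> ('m \<Rightarrow> real) set" where
  "reduced_sections X V = {g. (\<forall>m. m \<notin> V \<longrightarrow> g m = 0) \<and>
      (\<forall>m\<in>V. \<exists>W f. openin (base X) W \<and> m \<in> W \<and> W \<subseteq> V \<and> f \<in> carrier (sect X W) \<and>
        (\<forall>z\<in>W. g z = bval X W f z))}"

definition reduced_space :: "('m, 's) superspace \<Rightarrow> ('m, 'm \<Rightarrow> real) superspace" where
  "reduced_space X = \<lparr>base = base X,
      sect = \<lambda>V. fun_superalg V (\<lambda>d. if d then {\<lambda>_. 0} else reduced_sections X V)
        (reduced_sections X V),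
      res = fun_res\<rparr>"

definition jmor :: "('m, 's) superspace \<Rightarrow> ('m, 'm, 'm \<Rightarrow> real, 's) morph" where
  "jmor X = (\<lambda>m. m, \<lambda>V f m. if m \<in> V then bval X V f m else 0)"

definition super_retraction :: "('m, 's) superspace \<Rightarrow> ('m, 'm, 's, 'm \<Rightarrow> real) morph \<Rightarrow> bool" where
  "super_retraction X \<gamma> \<longleftrightarrow> morphism X (reduced_space X) \<gamma> \<and>
    morph_eq (reduced_space X) (reduced_space X) (comp_morph X \<gamma> (jmor X)) id_morph"


section \<open>Coordinates\<close>

text \<open>
  In this section \<open>x\<close> is a coordinate system on all of \<open>X\<close>.  \<open>cpull X x\<close> is the pullback of global
  sections along \<open>x\<close>, and \<open>crep X q x\<close> is its inverse, the expansion
  \<open>f = \<Sum>\<^sub>\<nu> \<gamma>\<^sup>*(f\<^sub>\<nu>) \<xi>\<^sup>\<nu>\<close> of a superfunction: the coefficient at \<open>I\<close> of \<open>crep X q x f\<close>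
  is \<open>f\<^sub>\<nu>\<close>, as a function of \<open>u\<^sub>0\<close>, for the indicator function \<open>\<nu>\<close> of \<open>I\<close>.
\<close>

definition cpull :: "('m, 's) superspace \<Rightarrow> ('m, 'p::finite, 's) chart \<Rightarrow>
    (real ^ 'p \<Rightarrow> grass) \<Rightarrow> 's" where
  "cpull X x F = snd x (crange X x) (\<lambda>w. if w \<in> crange X x then F w else 0)"

definition crep :: "('m, 's) superspace \<Rightarrow> nat \<Rightarrow> ('m, 'p::finite, 's) chart \<Rightarrow>
    's \<Rightarrow> real ^ 'p \<Rightarrow> grass" where
  "crep X q x f = the_inv_into (domain_sections q (crange X x)) (snd x (crange X x)) f"

definition ucoord :: "('m, 's) superspace \<Rightarrow> ('m, 'p::finite, 's) chart \<Rightarrow> 'p \<Rightarrow> 's" where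
  "ucoord X x a = cpull X x (\<lambda>w. of_real (w $ a))"

definition xicoord :: "('m, 's) superspace \<Rightarrow> ('m, 'p::finite, 's) chart \<Rightarrow> nat \<Rightarrow> 's" where
  "xicoord X x j = cpull X x (\<lambda>w. ggen j)"

definition du :: "('m, 's) superspace \<Rightarrow> nat \<Rightarrow> ('m, 'p::finite, 's) chart \<Rightarrow> 'p \<Rightarrow> 's \<Rightarrow> 's" where
  "du X q x a f = cpull X x (gpd a (crep X q x f))"

definition dxi :: "('m, 's) superspace \<Rightarrow> nat \<Rightarrow> ('m, 'p::finite, 's) chart \<Rightarrow> nat \<Rightarrow> 's \<Rightarrow> 's" where
  "dxi X q x j f = cpull X x (\<lambda>w. gder j (crep X q x f w))"

text \<open>\<open>\<gamma>\<close> is the retraction associated with \<open>x = (u, \<xi>)\<close>, i.e. \<open>\<gamma>\<^sup>*(u\<^sub>0) = u\<close>.\<close>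

definition associated :: "('m, 's) superspace \<Rightarrow> ('m, 'p::finite, 's) chart \<Rightarrow>
    ('m, 'm, 's, 'm \<Rightarrow> real) morph \<Rightarrow> bool" where
  "associated X x \<gamma> \<longleftrightarrow> (\<forall>a. snd \<gamma> (topspace (base X))
      (snd (jmor X) (topspace (base X)) (ucoord X x a)) = ucoord X x a)"


section \<open>Berezin densities and Berezin forms\<close>

datatype kind = Density | Form

text \<open>
  The quotient \<open>|Dx| / |Dy|\<close> (resp. \<open>Dx / Dy\<close>), for \<open>x = (u, \<xi>)\<close> and \<open>y = (v, \<eta>)\<close>.  The rows of the
  Jacobian are indexed by the coordinates \<open>(v, \<eta>)\<close> that are differentiated by; its entries are
  evaluated pointwise in the coordinates \<open>y\<close>.
\<close>

definition quot :: "kind \<Rightarrow> ('m, 's) superspace \<Rightarrow> nat \<Rightarrow> ('m, 'p::{finite,linorder}, 's) chart \<Rightarrow>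
    ('m, 'p, 's) chart \<Rightarrow> 's" where
  "quot k X q x y = cpull X y (\<lambda>w.
    let R = (\<lambda>a b. gpd a (crep X q y (ucoord X x b)) w);
        S = (\<lambda>a j. gpd a (crep X q y (xicoord X x j)) w);
        T = (\<lambda>i b. gder i (crep X q y (ucoord X x b) w));
        V = (\<lambda>i j. gder i (crep X q y (xicoord X x j) w))
    in (case k of Density \<Rightarrow> of_real (sgn (gcoeff (gdet UNIV R) {})) | Form \<Rightarrow> 1) * gber q R S T V)"

text \<open>
  A Berezin density (form) \<open>\<omega>\<close> is given by its coefficients: \<open>\<omega> = \<omega> x |Dx|\<close> (resp. \<open>\<omega> x Dx\<close>) for
  every coordinate system \<open>x\<close>.  Conversely \<open>ber_of k X q x f\<close> is \<open>f |Dx|\<close> (resp. \<open>f Dx\<close>).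
\<close>

type_synonym ('m, 'p, 's) berezin = "('m, 'p, 's) chart \<Rightarrow> 's"

definition berezin_sections ::
    "kind \<Rightarrow> ('m, 's) superspace \<Rightarrow> nat \<Rightarrow> ('m, 'p::{finite,linorder}, 's) berezin set" where
  "berezin_sections k X q = {\<omega>. \<forall>x. coord_sys X q x \<longrightarrow>
      \<omega> x \<in> carrier (sect X (topspace (base X))) \<and>
      (\<forall>y. coord_sys X q y \<longrightarrow> \<omega> y = \<omega> x \<otimes>\<^bsub>sect X (topspace (base X))\<^esub> quot k X q x y)}"

definition ber_of :: "kind \<Rightarrow> ('m, 's) superspace \<Rightarrow> nat \<Rightarrow> ('m, 'p::{finite,linorder}, 's) chart \<Rightarrow>
    's \<Rightarrow> ('m, 'p, 's) berezin" where
  "ber_of k X q x f = (\<lambda>y. f \<otimes>\<^bsub>sect X (topspace (base X))\<^esub> quot k X q x y)"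


section \<open>The right action of differential operators\<close>

text \<open>
  \<open>b\<close> is the parity of \<open>|Dx|\<close> and \<open>Dx\<close>.  For homogeneous \<open>f\<close> and \<open>g\<close>,
  \<open>(f |Dx|) g = (-1)\<^bsup>|g| b\<^esup> (f g) |Dx|\<close>, because \<open>f |Dx| = (-1)\<^bsup>|f| b\<^esup> |Dx| f\<close>.
\<close>

definition rmult :: "bool \<Rightarrow> ('m, 's) superspace \<Rightarrow> ('m, 'p::finite, 's) berezin \<Rightarrow> 's \<Rightarrow>
    ('m, 'p, 's) berezin" where
  "rmult b X \<omega> g = (let A = sect X (topspace (base X)) in
    (\<lambda>x. \<omega> x \<otimes>\<^bsub>A\<^esub> hpart A False g \<oplus>\<^bsub>A\<^esub>
      (if b then \<ominus>\<^bsub>A\<^esub> (\<omega> x \<otimes>\<^bsub>A\<^esub> hpart A True g) else \<omega> x \<otimes>\<^bsub>A\<^esub> hpart A True g)))"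

text \<open>
  The coefficient with respect to \<open>|Dx|\<close> of the Lie derivative of \<open>f |Dx|\<close> along a homogeneous
  superderivation \<open>D\<close> of parity \<open>d\<close>: writing \<open>D\<close> as the sum of the \<open>g\<^sub>a \<partial>\<^sub>x\<^sub>a\<close> with \<open>g\<^sub>a = D(x\<^sub>a)\<close>, it is
  the sum of the \<open>(-1)\<^bsup>|g\<^sub>a| |x\<^sub>a|\<^esup> \<partial>\<^sub>x\<^sub>a(g\<^sub>a f)\<close>, where \<open>|g\<^sub>a| = d + 1\<close> for the odd coordinates.
\<close>

definition lie_coeff :: "('m, 's) superspace \<Rightarrow> nat \<Rightarrow> ('m, 'p::finite, 's) chart \<Rightarrow> bool \<Rightarrow>
    ('s \<Rightarrow> 's) \<Rightarrow> 's \<Rightarrow> 's" where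
  "lie_coeff X q x d D f = (let A = sect X (topspace (base X)) in
    (\<Oplus>\<^bsub>A\<^esub>a\<in>UNIV. du X q x a (D (ucoord X x a) \<otimes>\<^bsub>A\<^esub> f)) \<oplus>\<^bsub>A\<^esub>
    (\<Oplus>\<^bsub>A\<^esub>j\<in>{..<q}. let h = dxi X q x j (D (xicoord X x j) \<otimes>\<^bsub>A\<^esub> f) in
        if d then h else \<ominus>\<^bsub>A\<^esub> h))"

text \<open>
  \<open>\<omega>.D = -(-1)\<^bsup>|D| |\<omega>|\<^esup> L\<^sub>D \<omega>\<close>, extended additively to inhomogeneous \<open>\<omega>\<close>; the parity of \<open>f |Dx|\<close> is
  \<open>|f| + b\<close>.  The coordinate system \<open>x\<close> is used for the evaluation of the Lie derivative.
\<close>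

definition ract :: "bool \<Rightarrow> kind \<Rightarrow> ('m, 's) superspace \<Rightarrow> nat \<Rightarrow>
    ('m, 'p::{finite,linorder}, 's) chart \<Rightarrow> bool \<Rightarrow> ('s \<Rightarrow> 's) \<Rightarrow>
    ('m, 'p, 's) berezin \<Rightarrow> ('m, 'p, 's) berezin" where
  "ract b k X q x d D \<omega> = (let A = sect X (topspace (base X)) in
    ber_of k X q x (\<Oplus>\<^bsub>A\<^esub>e\<in>UNIV. let h = lie_coeff X q x d D (hpart A e (\<omega> x)) in
        if d \<and> (e \<noteq> b) then h else \<ominus>\<^bsub>A\<^esub> h))"

text \<open>
  The action of \<open>\<partial>\<^sub>u\<^sup>i\<close>, the composite of the powers of the derivations \<open>\<partial>\<^sub>u\<^sub>p, \<dots>, \<partial>\<^sub>u\<^sub>1\<close> in which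
  \<open>\<partial>\<^sub>u\<^sub>p\<close> is outermost.  By \<open>\<omega>.(A B) = (\<omega>.A).B\<close> the derivation with
  the largest index acts first.
\<close>

definition ract_du :: "bool \<Rightarrow> kind \<Rightarrow> ('m, 's) superspace \<Rightarrow> nat \<Rightarrow>
    ('m, 'p::{finite,linorder}, 's) chart \<Rightarrow> ('p \<Rightarrow> nat) \<Rightarrow>
    ('m, 'p, 's) berezin \<Rightarrow> ('m, 'p, 's) berezin" where
  "ract_du b k X q x i \<omega> =
    fold (\<lambda>a. ract b k X q x False (du X q x a) ^^ i a) (rev (sorted_list_of_set UNIV)) \<omega>"

definition mpow :: "('s, 'z) ring_scheme \<Rightarrow> ('p::{finite,linorder} \<Rightarrow> 's) \<Rightarrow> ('p \<Rightarrow> nat) \<Rightarrow> 's" where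
  "mpow A n i = foldr (\<lambda>a g. (n a [^]\<^bsub>A\<^esub> i a) \<otimes>\<^bsub>A\<^esub> g) (sorted_list_of_set UNIV) \<one>\<^bsub>A\<^esub>"


section \<open>The integral\<close>

text \<open>
  An orientation of the underlying manifold of \<open>X\<close>, which is assumed to have global coordinates:
  \<open>e v m = 1\<close> if the coordinate map \<open>v\<close> is positively oriented at \<open>m\<close>, and \<open>e v m = -1\<close> otherwise.
\<close>

definition orientation :: "'p::finite itself \<Rightarrow> ('m, 's) superspace \<Rightarrow>
    (('m \<Rightarrow> real ^ 'p) \<Rightarrow> 'm \<Rightarrow> real) \<Rightarrow> bool" where
  "orientation _ X e \<longleftrightarrow> (\<forall>v :: ('m, 'p, 'm \<Rightarrow> real) chart. coord_sys (reduced_space X) 0 v \<longrightarrow>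
    continuous_map (base X) euclideanreal (e (fst v)) \<and>
    (\<forall>m\<in>topspace (base X). \<bar>e (fst v) m\<bar> = 1) \<and>
    (\<forall>w :: ('m, 'p, 'm \<Rightarrow> real) chart. coord_sys (reduced_space X) 0 w \<longrightarrow>
      (\<forall>m\<in>topspace (base X). e (fst w) m = e (fst v) m *
        sgn (det (\<chi> a b. pd a (\<lambda>z. fst v (inv_into (topspace (base X)) (fst w) z) $ b) (fst w m))))))"

text \<open>
  \<open>fibre_coeff s X q x \<omega>\<close> is the coefficient of \<open>\<gamma>\<^sub>! \<omega>\<close> with respect to \<open>|du\<^sub>0|\<close> (resp. \<open>du\<^sub>0\<close>), as a
  function of \<open>u\<^sub>0\<close>, where \<open>\<gamma>\<close> is the retraction associated with \<open>x = (u, \<xi>)\<close>.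
\<close>

definition fibre_coeff :: "(nat \<Rightarrow> nat \<Rightarrow> bool) \<Rightarrow> ('m, 's) superspace \<Rightarrow> nat \<Rightarrow>
    ('m, 'p::finite, 's) chart \<Rightarrow> ('m, 'p, 's) berezin \<Rightarrow> real ^ 'p \<Rightarrow> real" where
  "fibre_coeff s X q x \<omega> w = (if s CARD('p) q then -1 else 1) * gcoeff (crep X q x (\<omega> x) w) {..<q}"

text \<open>The density (form) \<open>\<gamma>\<^sub>! \<omega>\<close> on \<open>X\<^sub>0\<close> does not depend on the choice of the coordinate system.\<close>

definition assoc_coords :: "('m, 's) superspace \<Rightarrow> nat \<Rightarrow> ('m, 'm, 's, 'm \<Rightarrow> real) morph \<Rightarrow>
    ('m, 'p::finite, 's) chart" where
  "assoc_coords X q \<gamma> = (SOME x. coord_sys X q x \<and> associated X x \<gamma>)"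

text \<open>
  For \<open>u\<^sub>0\<close> with image \<open>W\<close> in \<open>\<real>\<^sup>p\<close>, the integral of \<open>\<phi> |du\<^sub>0|\<close> is that of \<open>\<phi>\<close> over \<open>W\<close> with respect to
  the Lebesgue measure; that of \<open>\<phi> du\<^sub>0\<close> is the integral of \<open>\<phi>\<close> times the sign of \<open>u\<^sub>0\<close> with respect to
  the orientation.  So the weight \<open>e\<close> is constantly \<open>1\<close> for densities, and an orientation for forms.
\<close>

definition integration_weight :: "kind \<Rightarrow> ('m, 's) superspace \<Rightarrow>
    (('m \<Rightarrow> real ^ 'p::finite) \<Rightarrow> 'm \<Rightarrow> real) \<Rightarrow> bool" where
  "integration_weight k X e \<longleftrightarrow>
    (case k of Density \<Rightarrow> e = (\<lambda>_ _. 1) | Form \<Rightarrow> orientation TYPE('p) X e)"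

definition fibre_integrand :: "(nat \<Rightarrow> nat \<Rightarrow> bool) \<Rightarrow> (('m \<Rightarrow> real ^ 'p::finite) \<Rightarrow> 'm \<Rightarrow> real) \<Rightarrow>
    ('m, 's) superspace \<Rightarrow> nat \<Rightarrow> ('m, 'p, 's) chart \<Rightarrow> ('m, 'p, 's) berezin \<Rightarrow> real ^ 'p \<Rightarrow> real" where
  "fibre_integrand s e X q x \<omega> w =
    e (fst x) (inv_into (topspace (base X)) (fst x) w) * fibre_coeff s X q x \<omega> w"

definition berezin_integrable :: "(nat \<Rightarrow> nat \<Rightarrow> bool) \<Rightarrow> (('m \<Rightarrow> real ^ 'p::finite) \<Rightarrow> 'm \<Rightarrow> real) \<Rightarrow>
    ('m, 's) superspace \<Rightarrow> nat \<Rightarrow> ('m, 'm, 's, 'm \<Rightarrow> real) morph \<Rightarrow> ('m, 'p, 's) berezin \<Rightarrow> bool" where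
  "berezin_integrable s e X q \<gamma> \<omega> \<longleftrightarrow> (let x = assoc_coords X q \<gamma> in
    set_integrable lborel (crange X x) (fibre_integrand s e X q x \<omega>))"

definition berezin_integral :: "(nat \<Rightarrow> nat \<Rightarrow> bool) \<Rightarrow> (('m \<Rightarrow> real ^ 'p::finite) \<Rightarrow> 'm \<Rightarrow> real) \<Rightarrow>
    ('m, 's) superspace \<Rightarrow> nat \<Rightarrow> ('m, 'm, 's, 'm \<Rightarrow> real) morph \<Rightarrow> ('m, 'p, 's) berezin \<Rightarrow> real" where
  "berezin_integral s e X q \<gamma> \<omega> = (let x = assoc_coords X q \<gamma> in
    set_lebesgue_integral lborel (crange X x) (fibre_integrand s e X q x \<omega>))"

end

theory Submission
  imports Defs "HOL-Library.Function_Algebras"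
begin

text \<open>
  Fix the coordinate system \<open>x = (u, \<xi>)\<close> belonging to \<open>\<gamma>\<close>, let \<open>n = \<gamma>'\<^sup>*(u\<^sub>0) - \<gamma>\<^sup>*(u\<^sub>0)\<close>, which is even
  and nilpotent, and let \<open>y = (\<gamma>'\<^sup>*(u\<^sub>0), \<xi>)\<close>.  If \<open>\<omega> = G |Dy|\<close>, then \<open>\<omega> = E(G) J |Dx|\<close>, where \<open>E\<close> is the
  substitution of \<open>u + n\<close> for \<open>u\<close> and \<open>J\<close> the Jacobian determinant of \<open>u + n\<close>, to which the
  Berezinian reduces because \<open>x\<close> and \<open>y\<close> share their odd coordinates.  Lagrange inversion, in the form
  \<open>g = \<Sum>\<^sub>i (-1)\<^bsup>|i|\<^esup> / i! \<partial>\<^sup>i (n\<^sup>i g(u + n) J)\<close>, recovers the coefficients of \<open>G\<close> as a finite sum of the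
  coefficients of the integrands \<open>(\<omega> n\<^sup>i).\<partial>\<^sup>i\<close>, so the two sides agree already before integration.
  The integral uses an arbitrary coordinate system associated with the retraction; two of them
  differ by a substitution \<open>\<psi>\<close> of the even coordinates and an odd substitution, whose Berezinian
  preserves the top coefficient up to \<open>det \<psi>'\<close>, and the classical change of variables applies.
\<close>

section \<open>Grassmann algebras\<close>

text \<open>A retraction is only a compatible family of algebra homomorphisms, so no Taylor formula
  for the pulled back functions is at hand. Hadamard's lemma at a point w0 replaces it: f(w) = f(w0)
  + \<Sum> (w_a - w0_a) R_a(w) near w0, and a homomorphism h that lifts the identity turns this into
  h f = f(w0) + \<Sum> (w_a + n_a - w0_a) h R_a. The operator L g = \<Sum> (-1)^|i| / i!
  \<partial>^i (n^i g) is the formal adjoint of the substitution of w + n for w. It satisfies L((w_a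
  + n_a) g) = w_a L g, so L((h f) J) equals f(w0) L(J) at w0, and everything rests on L(J) = 1. No
  coefficients are expanded for this: Jacobi's formula and Piola's identity show that L(J) is killed
  by every derivation that commutes with the \<partial>_a and kills constants. The Euler derivation
  in the odd variables is one of them, so L(J) is its own body, and n has none, which leaves 1. For
  two coordinate systems with one retraction the argument has an odd twin: a Piola identity for the
  inverse odd Jacobian makes all but the top monomial contribute divergences, and these have no top
  coefficient.\<close>

lemmas gcoeff_simps [simp] = zero_grass.rep_eq plus_grass.rep_eq minus_grass.rep_eq
  uminus_grass.rep_eq scaleR_grass.rep_eq

lemma gcoeff_one [simp]: "gcoeff 1 I = (if I = {} then 1 else 0)"
  by (simp add: one_grass.rep_eq)

lemma gcoeff_infinite [simp]: "infinite I \<Longrightarrow> gcoeff a I = 0"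
  using gcoeff[of a] by auto

lemma gcoeff_of_real [simp]: "gcoeff (of_real r) I = (if I = {} then r else 0)"
  by (simp add: of_real_def)

lemma gcoeff_ggen: "gcoeff (ggen j) I = (if I = {j} then 1 else 0)"
  by (simp add: ggen.rep_eq)

lemma gcoeff_gder: "gcoeff (gder j a) I =
    (if j \<in> I then 0 else (-1) ^ card {i \<in> I. i < j} * gcoeff a (insert j I))"
  by (simp add: gder.rep_eq)

lemma gcoeff_times:
  "gcoeff (a * b) K = (\<Sum>I\<in>Pow K. gsgn I (K - I) * gcoeff a I * gcoeff b (K - I))"
  by (simp add: times_grass.rep_eq)

lemma grass_eqI: "(\<And>I. gcoeff a I = gcoeff b I) \<Longrightarrow> a = b"
  by (simp add: gcoeff_inject[symmetric] ext)

lemma grass_eqI': "(\<And>I. finite I \<Longrightarrow> gcoeff a I = gcoeff b I) \<Longrightarrow> a = b"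
  by (rule grass_eqI) (metis gcoeff_infinite)

lemma gcoeff_Grass: "(\<And>I. infinite I \<Longrightarrow> a I = 0) \<Longrightarrow> gcoeff (Grass a) I = a I"
  by (subst Grass_inverse) auto

lemma gcoeff_sum [simp]: "gcoeff (sum f S) I = (\<Sum>x\<in>S. gcoeff (f x) I)"
  by (induction S rule: infinite_finite_induct) auto

lemma gcoeff_times_empty [simp]: "gcoeff (a * b) {} = gcoeff a {} * gcoeff b {}"
  by (simp add: gcoeff_times)

lemma gcoeff_of_real_times [simp]: "gcoeff (of_real r * a) I = r * gcoeff a I"
  by (simp add: of_real_def)

lemma gcoeff_times_of_real [simp]: "gcoeff (a * of_real r) I = r * gcoeff a I"
  by (simp add: of_real_def)

section \<open>Degree filtration, number of generators, parity, absence of a generator\<close>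

definition gdeg_ge :: "nat \<Rightarrow> grass \<Rightarrow> bool" where
  "gdeg_ge k a \<longleftrightarrow> (\<forall>I. card I < k \<longrightarrow> gcoeff a I = 0)"

definition gens :: "nat \<Rightarrow> grass \<Rightarrow> bool" where
  "gens q a \<longleftrightarrow> (\<forall>I. \<not> I \<subseteq> {..<q} \<longrightarrow> gcoeff a I = 0)"

definition gparity :: "bool \<Rightarrow> grass \<Rightarrow> bool" where
  "gparity d a \<longleftrightarrow> (\<forall>I. odd (card I) \<noteq> d \<longrightarrow> gcoeff a I = 0)"

definition gfree :: "nat \<Rightarrow> grass \<Rightarrow> bool" where
  "gfree j a \<longleftrightarrow> (\<forall>I. j \<in> I \<longrightarrow> gcoeff a I = 0)"

lemma gdeg_ge_times:
  assumes "gdeg_ge m a" "gdeg_ge n b"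
  shows "gdeg_ge (m + n) (a * b)"
  unfolding gdeg_ge_def
proof (intro allI impI)
  fix K :: "nat set" assume K: "card K < m + n"
  show "gcoeff (a * b) K = 0"
  proof (cases "finite K")
    case True
    have "gsgn I (K - I) * gcoeff a I * gcoeff b (K - I) = 0" if "I \<subseteq> K" for I
    proof -
      have "card K = card I + card (K - I)"
        using that True by (metis card_Diff_subset card_mono finite_subset le_add_diff_inverse)
      then have "card I < m \<or> card (K - I) < n" using K by linarith
      then show ?thesis using assms by (auto simp: gdeg_ge_def)
    qed
    then show ?thesis by (auto simp: gcoeff_times intro!: sum.neutral)
  qed simp
qed

lemma gens_times:
  assumes "gens q a" "gens q b"
  shows "gens q (a * b)"
  unfolding gens_def
proof (intro allI impI)
  fix K :: "nat set" assume K: "\<not> K \<subseteq> {..<q}"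
  have "gsgn I (K - I) * gcoeff a I * gcoeff b (K - I) = 0" if "I \<subseteq> K" for I
  proof -
    have "\<not> I \<subseteq> {..<q} \<or> \<not> (K - I) \<subseteq> {..<q}" using K that by auto
    then show ?thesis
    proof
      assume "\<not> I \<subseteq> {..<q}"
      then have "gcoeff a I = 0" using assms by (simp add: gens_def)
      then show ?thesis by simp
    next
      assume "\<not> (K - I) \<subseteq> {..<q}"
      then have "gcoeff b (K - I) = 0" using assms unfolding gens_def by (elim allE impE)
      then show ?thesis by simp
    qed
  qed
  then show "gcoeff (a * b) K = 0" by (auto simp: gcoeff_times intro!: sum.neutral)
qed

lemma gparity_times:
  assumes "gparity d a" "gparity e b"
  shows "gparity (d \<noteq> e) (a * b)"
  unfolding gparity_def
proof (intro allI impI)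
  fix K :: "nat set" assume K: "odd (card K) \<noteq> (d \<noteq> e)"
  show "gcoeff (a * b) K = 0"
  proof (cases "finite K")
    case True
    have "gsgn I (K - I) * gcoeff a I * gcoeff b (K - I) = 0" if "I \<subseteq> K" for I
    proof -
      have "card K = card I + card (K - I)"
        using that True by (metis card_Diff_subset card_mono finite_subset le_add_diff_inverse)
      then have "odd (card I) \<noteq> d \<or> odd (card (K - I)) \<noteq> e" using K by auto
      then show ?thesis using assms by (auto simp: gparity_def)
    qed
    then show ?thesis by (auto simp: gcoeff_times intro!: sum.neutral)
  qed simp
qed

lemma gfree_times:
  assumes "gfree j a" "gfree j b"
  shows "gfree j (a * b)"
  unfolding gfree_def
proof (intro allI impI)
  fix K :: "nat set" assume K: "j \<in> K"
  have "gsgn I (K - I) * gcoeff a I * gcoeff b (K - I) = 0" if "I \<subseteq> K" for I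
    using K assms by (cases "j \<in> I") (auto simp: gfree_def)
  then show "gcoeff (a * b) K = 0" by (auto simp: gcoeff_times intro!: sum.neutral)
qed

lemma gdeg_ge_add: "gdeg_ge m a \<Longrightarrow> gdeg_ge m b \<Longrightarrow> gdeg_ge m (a + b)"
  and gdeg_ge_diff: "gdeg_ge m a \<Longrightarrow> gdeg_ge m b \<Longrightarrow> gdeg_ge m (a - b)"
  and gdeg_ge_zero [simp]: "gdeg_ge m 0"
  and gdeg_ge_mono: "gdeg_ge m a \<Longrightarrow> n \<le> m \<Longrightarrow> gdeg_ge n a"
  and gdeg_ge_0 [simp]: "gdeg_ge 0 a"
  by (auto simp: gdeg_ge_def)

lemma gdeg_ge_sum: "(\<And>x. x \<in> S \<Longrightarrow> gdeg_ge m (f x)) \<Longrightarrow> gdeg_ge m (sum f S)"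
  by (auto simp: gdeg_ge_def)

lemma gens_add: "gens q a \<Longrightarrow> gens q b \<Longrightarrow> gens q (a + b)"
  and gens_diff: "gens q a \<Longrightarrow> gens q b \<Longrightarrow> gens q (a - b)"
  and gens_scaleR: "gens q a \<Longrightarrow> gens q (r *\<^sub>R a)"
  and gens_zero [simp]: "gens q 0"
  and gens_one [simp]: "gens q 1"
  and gens_of_real [simp]: "gens q (of_real r)"
  by (auto simp: gens_def)

lemma gens_sum: "(\<And>x. x \<in> S \<Longrightarrow> gens q (f x)) \<Longrightarrow> gens q (sum f S)"
  by (auto simp: gens_def)

lemma gens_ggen: "j < q \<Longrightarrow> gens q (ggen j)"
  by (auto simp: gens_def gcoeff_ggen)

lemma gens_gder: "gens q a \<Longrightarrow> gens q (gder j a)"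
  by (auto simp: gens_def gcoeff_gder)

lemma gparity_add: "gparity d a \<Longrightarrow> gparity d b \<Longrightarrow> gparity d (a + b)"
  and gparity_diff: "gparity d a \<Longrightarrow> gparity d b \<Longrightarrow> gparity d (a - b)"
  and gparity_minus: "gparity d a \<Longrightarrow> gparity d (- a)"
  and gparity_scaleR: "gparity d a \<Longrightarrow> gparity d (r *\<^sub>R a)"
  and gparity_zero [simp]: "gparity d 0"
  and gparity_one [simp]: "gparity False 1"
  and gparity_of_real [simp]: "gparity False (of_real r)"
  by (auto simp: gparity_def)

lemma gparity_sum: "(\<And>x. x \<in> S \<Longrightarrow> gparity d (f x)) \<Longrightarrow> gparity d (sum f S)"
  by (auto simp: gparity_def)

lemma gparity_ggen: "gparity True (ggen j)"
  by (auto simp: gparity_def gcoeff_ggen)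

lemma gparity_gder:
  assumes "gparity d a"
  shows "gparity (\<not> d) (gder j a)"
  unfolding gparity_def
proof (intro allI impI)
  fix I :: "nat set" assume I: "odd (card I) \<noteq> (\<not> d)"
  then show "gcoeff (gder j a) I = 0"
    using assms by (cases "finite I") (auto simp: gcoeff_gder gparity_def)
qed

text \<open>With q generators there is no monomial of degree above q. Nilpotency arguments below
  count degrees and then end with this lemma.\<close>

lemma gens_gdeg_ge_eq_0:
  assumes "gens q a" "gdeg_ge k a" "q < k"
  shows "a = 0"
proof (rule grass_eqI)
  fix I
  show "gcoeff a I = gcoeff 0 I"
  proof (cases "I \<subseteq> {..<q}")
    case True
    then have "card I \<le> q" using card_mono[of "{..<q}" I] by auto
    then show ?thesis using assms by (auto simp: gdeg_ge_def)
  qed (use assms in \<open>auto simp: gens_def\<close>)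
qed

section \<open>Supercommutativity and left derivatives\<close>

text \<open>Since I and J are disjoint, each pair in I \<times> J is an inversion for exactly one of
  the two orders, so the two counts add up to \<open>card I * card J\<close>.\<close>

lemma gsgn_commute:
  assumes "finite I" "finite J" "I \<inter> J = {}"
  shows "gsgn I J = (-1) ^ (card I * card J) * gsgn J I"
proof -
  let ?P = "{(i, j). i \<in> I \<and> j \<in> J \<and> j < i}" and ?Q = "{(j, i). j \<in> J \<and> i \<in> I \<and> i < j}"
  have "I \<times> J = ?P \<union> prod.swap ` ?Q"
  proof -
    have "i < j \<or> j < i" if "i \<in> I" "j \<in> J" for i j
      using that assms(3) by (metis disjoint_iff linorder_neqE_nat)
    then show ?thesis by (auto simp: image_def split_beta)
  qed
  moreover have "?P \<inter> prod.swap ` ?Q = {}" by auto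
  ultimately have "card (I \<times> J) = card ?P + card (prod.swap ` ?Q)"
    using assms by (simp add: card_Un_disjoint finite_inversions)
  also have "card (prod.swap ` ?Q) = card ?Q"
    by (rule card_image) auto
  finally have e: "card I * card J = card ?P + card ?Q" by (simp add: card_cartesian_product)
  have "(-1::real) ^ (m + n) * (-1) ^ n = (-1) ^ m" for m n :: nat
    by (simp add: power_add mult.assoc flip: power_mult_distrib)
  then show ?thesis unfolding gsgn_def e by simp
qed

lemma gparity_commute:
  assumes "gparity d a" "gparity e b"
  shows "a * b = (if d \<and> e then - (b * a) else b * a)"
proof (rule grass_eqI')
  fix K :: "nat set" assume K: "finite K"
  let ?s = "if d \<and> e then - 1 else 1 :: real"
  have "gcoeff (a * b) K = (\<Sum>I\<in>Pow K. ?s * (gsgn (K - I) I * gcoeff b (K - I) * gcoeff a I))"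
    unfolding gcoeff_times
  proof (rule sum.cong[OF refl])
    fix I assume "I \<in> Pow K"
    then have f: "finite I" "finite (K - I)" "I \<inter> (K - I) = {}" using K finite_subset by auto
    show "gsgn I (K - I) * gcoeff a I * gcoeff b (K - I) =
      ?s * (gsgn (K - I) I * gcoeff b (K - I) * gcoeff a I)"
    proof (cases "odd (card I) = d \<and> odd (card (K - I)) = e")
      case True
      then have "(-1::real) ^ (card I * card (K - I)) = ?s" by auto
      then show ?thesis by (subst gsgn_commute[OF f]) simp
    next
      case False
      then have "gcoeff a I = 0 \<or> gcoeff b (K - I) = 0" using assms by (auto simp: gparity_def)
      then show ?thesis by auto
    qed
  qed
  also have "\<dots> = ?s * (\<Sum>I\<in>Pow K. gsgn (K - I) I * gcoeff b (K - I) * gcoeff a I)"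
    by (simp add: sum_distrib_left)
  also have "(\<Sum>I\<in>Pow K. gsgn (K - I) I * gcoeff b (K - I) * gcoeff a I) = gcoeff (b * a) K"
    unfolding gcoeff_times
    by (rule sum.reindex_bij_witness[where i = "\<lambda>I. K - I" and j = "\<lambda>I. K - I"])
      (auto simp: double_diff)
  finally show "gcoeff (a * b) K = gcoeff (if d \<and> e then - (b * a) else b * a) K" by auto
qed

lemma gsgn_singleton_left: "gsgn {j} K = (-1) ^ card {i \<in> K. i < j}"
proof -
  have "{(i, k). i \<in> {j} \<and> k \<in> K \<and> k < i} = Pair j ` {i \<in> K. i < j}" by auto
  then show ?thesis unfolding gsgn_def by (simp add: card_image inj_on_def)
qed

lemma gcoeff_ggen_times: "gcoeff (ggen j * c) K =
    (if j \<in> K then (-1) ^ card {i \<in> K. i < j} * gcoeff c (K - {j}) else 0)"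
proof (cases "finite K")
  case True
  have "gcoeff (ggen j * c) K =
      (\<Sum>I\<in>Pow K. if I = {j} then gsgn {j} (K - {j}) * gcoeff c (K - {j}) else 0)"
    unfolding gcoeff_times by (intro sum.cong) (auto simp: gcoeff_ggen)
  also have "{i \<in> K - {j}. i < j} = {i \<in> K. i < j}" by auto
  ultimately show ?thesis using True by (simp add: gsgn_singleton_left)
qed auto

lemma ggen_square [simp]: "ggen j * ggen j = 0"
  by (rule grass_eqI) (auto simp: gcoeff_ggen_times gcoeff_ggen)

lemma gder_add: "gder j (a + b) = gder j a + gder j b"
  and gder_diff: "gder j (a - b) = gder j a - gder j b"
  and gder_scaleR: "gder j (r *\<^sub>R a) = r *\<^sub>R gder j a"
  and gder_zero [simp]: "gder j 0 = 0"
  and gder_one [simp]: "gder j 1 = 0"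
  and gder_of_real [simp]: "gder j (of_real r) = 0"
  by (rule grass_eqI; simp add: gcoeff_gder algebra_simps)+

lemma gder_sum: "gder j (sum f S) = (\<Sum>x\<in>S. gder j (f x))"
  by (induction S rule: infinite_finite_induct) (auto simp: gder_add)

lemma gder_ggen: "gder i (ggen j) = (if i = j then 1 else 0)"
proof (rule grass_eqI)
  fix I
  show "gcoeff (gder i (ggen j)) I = gcoeff (if i = j then 1 else 0) I"
    by (auto simp: gcoeff_gder gcoeff_ggen)
qed

lemma gfree_gder: "gfree j (gder j a)"
  by (auto simp: gfree_def gcoeff_gder)

text \<open>Division by \<xi>_j with remainder: neither the remainder nor \<partial>_j a contains
  \<xi>_j. Together with \<open>gder_split\<close>, which says that such a decomposition determines
  the derivative, it reduces the Leibniz rule to a computation with parts free of \<xi>_j.\<close>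

lemma gfree_remainder: "gfree j (a - ggen j * gder j a)"
  unfolding gfree_def
proof (intro allI impI)
  fix I :: "nat set" assume j: "j \<in> I"
  have "{i \<in> I - {j}. i < j} = {i \<in> I. i < j}" by auto
  then show "gcoeff (a - ggen j * gder j a) I = 0"
    using j by (simp add: gcoeff_ggen_times gcoeff_gder insert_absorb flip: mult.assoc power_add)
qed

lemma gder_split:
  assumes "gfree j c0" "gfree j c1"
  shows "gder j (c0 + ggen j * c1) = c1"
proof (rule grass_eqI)
  fix I :: "nat set"
  show "gcoeff (gder j (c0 + ggen j * c1)) I = gcoeff c1 I"
  proof (cases "j \<in> I")
    case False
    then have "{i \<in> insert j I. i < j} = {i \<in> I. i < j}" "insert j I - {j} = I" by auto
    then show ?thesis using False assms
      by (auto simp: gcoeff_ggen_times gcoeff_gder gfree_def simp flip: mult.assoc power_add)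
  qed (use assms in \<open>auto simp: gfree_def gcoeff_gder\<close>)
qed

text \<open>Write a = a0 + x a1 and b = b0 + x b1 with x = \<xi>_j and all four parts free of x. As
  x x = 0 and x passes each part at the cost of a sign, a b has the same shape again, and its
  derivative is the factor of x.\<close>

lemma gder_times:
  assumes a: "gparity d a"
  shows "gder j (a * b) = gder j a * b + (if d then - (a * gder j b) else a * gder j b)"
proof -
  define x where "x = ggen j"
  define a1 b1 where "a1 = gder j a" and "b1 = gder j b"
  define a0 b0 where "a0 = a - x * a1" and "b0 = b - x * b1"
  define s where "s = (if d then -1 else 1 :: real)"
  have f: "gfree j a0" "gfree j a1" "gfree j b0" "gfree j b1"
    unfolding a0_def b0_def a1_def b1_def x_def by (rule gfree_remainder gfree_gder)+
  have x: "gparity True x" unfolding x_def by (rule gparity_ggen)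
  have p1: "gparity (\<not> d) a1" unfolding a1_def by (rule gparity_gder[OF a])
  then have "gparity d (x * a1)" using gparity_times[OF x p1] by simp
  then have p0: "gparity d a0" unfolding a0_def using a by (rule gparity_diff[rotated])
  have c0: "a0 * x = s *\<^sub>R (x * a0)" using gparity_commute[OF p0 x] by (simp add: s_def)
  have c1: "a1 * x = - (s *\<^sub>R (x * a1))" using gparity_commute[OF p1 x] by (simp add: s_def)
  have ea: "a = a0 + x * a1" and eb: "b = b0 + x * b1" by (simp_all add: a0_def b0_def)
  have xx: "x * (x * c) = 0" for c using ggen_square[of j] by (simp add: x_def flip: mult.assoc)
  have c0': "a0 * (x * c) = s *\<^sub>R (x * (a0 * c))" for c
    by (simp add: c0 flip: mult.assoc)
  have c1': "a1 * (x * c) = - (s *\<^sub>R (x * (a1 * c)))" for c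
    by (simp add: c1 flip: mult.assoc)
  have "a * b = a0 * b0 + x * (a1 * b0 + s *\<^sub>R (a0 * b1))"
    unfolding ea eb by (simp add: algebra_simps c0' c1' xx)
  moreover have "gfree j (a1 * b0 + s *\<^sub>R (a0 * b1))" "gfree j (a0 * b0)"
    using gfree_times f by (auto simp: gfree_def)
  ultimately have "gder j (a * b) = a1 * b0 + s *\<^sub>R (a0 * b1)"
    using gder_split by (simp add: x_def)
  also have "\<dots> = a1 * b + s *\<^sub>R (a * b1)"
    unfolding ea eb by (simp add: algebra_simps c1')
  finally show ?thesis by (simp add: a1_def b1_def s_def)
qed

text \<open>For i < j, the sign for removing j counts i as well if i is still present, and no such
  effect exists the other way round; so the two orders of removal differ by one sign.\<close>

lemma gder_gder: "gder i (gder j a) = - gder j (gder i a)"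
proof (rule grass_eqI')
  fix I :: "nat set" assume I: "finite I"
  have *: "gcoeff (gder i (gder j a)) I = - gcoeff (gder j (gder i a)) I" if "i < j" for i j
  proof (cases "i \<in> I \<or> j \<in> I")
    case False
    have "{k. (k = i \<or> k \<in> I) \<and> k < j} = insert i {k \<in> I. k < j}"
      "{k. (k = j \<or> k \<in> I) \<and> k < i} = {k \<in> I. k < i}" using that False by auto
    then show ?thesis using False that I by (auto simp: gcoeff_gder insert_commute)
  qed (auto simp: gcoeff_gder)
  have "gcoeff (gder i (gder i a)) I = 0" by (auto simp: gcoeff_gder)
  then show "gcoeff (gder i (gder j a)) I = gcoeff (- gder j (gder i a)) I"
    using *[of i j] *[of j i] by (cases i j rule: linorder_cases) auto
qed

section \<open>Monomials and the Euler derivation\<close>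

lift_definition gmon :: "nat set \<Rightarrow> grass" is "\<lambda>I J. if J = I \<and> finite I then 1 else 0" by auto

lemma gcoeff_gmon: "gcoeff (gmon I) J = (if J = I \<and> finite I then 1 else 0)"
  by (simp add: gmon.rep_eq)

lemma gmon_empty [simp]: "gmon {} = 1"
  by (rule grass_eqI) (auto simp: gcoeff_gmon)

lemma gmon_insert:
  assumes "finite I" "\<And>i. i \<in> I \<Longrightarrow> m < i"
  shows "gmon (insert m I) = ggen m * gmon I"
proof (rule grass_eqI)
  fix K
  have "m \<notin> I" using assms(2) by blast
  have e: "{i \<in> insert m I. i < m} = {}"
    using assms(2) by (auto dest!: assms(2))
  show "gcoeff (gmon (insert m I)) K = gcoeff (ggen m * gmon I) K"
  proof (cases "K = insert m I")
    case True
    show ?thesis using assms(1) \<open>m \<notin> I\<close>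
      unfolding True gcoeff_ggen_times e by (simp add: gcoeff_gmon)
  next
    case False
    then have "\<not> (m \<in> K \<and> K - {m} = I)" by auto
    then show ?thesis using False by (auto simp: gcoeff_ggen_times gcoeff_gmon)
  qed
qed

lemma gens_gmon: "I \<subseteq> {..<q} \<Longrightarrow> gens q (gmon I)"
  by (auto simp: gens_def gcoeff_gmon)

lemma gdeg_ge_gmon: "gdeg_ge (card I) (gmon I)"
  by (auto simp: gdeg_ge_def gcoeff_gmon)

lemma gparity_gmon: "gparity (odd (card I)) (gmon I)"
  by (auto simp: gparity_def gcoeff_gmon)

lemma gens_expand:
  assumes "gens q a"
  shows "a = (\<Sum>I\<in>Pow {..<q}. gcoeff a I *\<^sub>R gmon I)"
proof (rule grass_eqI)
  fix K
  have "gcoeff (\<Sum>I\<in>Pow {..<q}. gcoeff a I *\<^sub>R gmon I) K =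
      (\<Sum>I\<in>Pow {..<q}. if I = K then gcoeff a K else 0)"
    unfolding gcoeff_sum by (intro sum.cong refl) (auto simp: gcoeff_gmon finite_subset)
  then show "gcoeff a K = gcoeff (\<Sum>I\<in>Pow {..<q}. gcoeff a I *\<^sub>R gmon I) K"
    using assms by (auto simp: gens_def)
qed

text \<open>The Euler derivation \<Sum> \<xi>_j \<partial>_j, given by its eigenvalues on monomials.
  Its kernel consists of the multiples of 1, so it can show that an element equals its body.\<close>

lift_definition geuler :: "grass \<Rightarrow> grass" is "\<lambda>a I. real (card I) * a I" by auto

lemma gcoeff_geuler: "gcoeff (geuler a) I = real (card I) * gcoeff a I"
  by (simp add: geuler.rep_eq)

lemma geuler_times: "geuler (a * b) = geuler a * b + a * geuler b"
proof (rule grass_eqI')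
  fix K :: "nat set" assume K: "finite K"
  have "real (card K) = real (card I) + real (card (K - I))" if "I \<subseteq> K" for I
    using that K by (metis card_Diff_subset card_mono finite_subset le_add_diff_inverse of_nat_add)
  then show "gcoeff (geuler (a * b)) K = gcoeff (geuler a * b + a * geuler b) K"
    by (simp add: gcoeff_geuler gcoeff_times sum_distrib_left flip: sum.distrib)
      (intro sum.cong, auto simp: algebra_simps)
qed

section \<open>The commutative algebra of even elements\<close>

text \<open>As a type of its own, the even part is a commutative ring, so products over sets,
  Leibniz determinants and cofactors make sense for it; in \<open>grass\<close> the order of factors
  matters.\<close>

typedef egrass = "{a. gparity False a}"
  morphisms eg Eg
  by (rule exI[of _ 0]) simp

setup_lifting type_definition_egrass

instantiation egrass :: "{comm_ring_1, real_algebra_1}"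
begin

lift_definition zero_egrass :: egrass is 0 by simp
lift_definition one_egrass :: egrass is 1 by simp
lift_definition plus_egrass :: "egrass \<Rightarrow> egrass \<Rightarrow> egrass" is "(+)" by (rule gparity_add)
lift_definition minus_egrass :: "egrass \<Rightarrow> egrass \<Rightarrow> egrass" is "(-)" by (rule gparity_diff)
lift_definition uminus_egrass :: "egrass \<Rightarrow> egrass" is uminus by (rule gparity_minus)
lift_definition scaleR_egrass :: "real \<Rightarrow> egrass \<Rightarrow> egrass" is scaleR by (rule gparity_scaleR)
lift_definition times_egrass :: "egrass \<Rightarrow> egrass \<Rightarrow> egrass" is "(*)"
  using gparity_times[of False _ False] by simp

instance
proof
  fix a b :: egrass
  show "a * b = b * a" by transfer (use gparity_commute[of False _ False] in simp)
qed (transfer; simp add: algebra_simps)+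

end

lemmas eg_simps [simp] = zero_egrass.rep_eq one_egrass.rep_eq plus_egrass.rep_eq
  minus_egrass.rep_eq uminus_egrass.rep_eq scaleR_egrass.rep_eq times_egrass.rep_eq

lemma gparity_eg [simp]: "gparity False (eg a)"
  using eg[of a] by simp

lemma eg_Eg: "gparity False a \<Longrightarrow> eg (Eg a) = a"
  by (simp add: Eg_inverse)

lemma eg_of_real [simp]: "eg (of_real r) = of_real r"
  by (simp add: of_real_def)

lemma eg_sum [simp]: "eg (sum f S) = (\<Sum>x\<in>S. eg (f x))"
  by (induction S rule: infinite_finite_induct) auto

lemma eg_of_int [simp]: "eg (of_int k) = of_int k"
  using eg_of_real[of "of_int k"] by simp

lemma eg_power [simp]: "eg (a ^ k) = eg a ^ k"
  by (induction k) auto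

text \<open>Even elements are central: split b into its even and its odd part and use graded
  commutativity for each.\<close>

lemma eg_commute: "eg a * b = b * eg a"
proof -
  define b0 where "b0 = Grass (\<lambda>I. if even (card I) then gcoeff b I else 0)"
  define b1 where "b1 = Grass (\<lambda>I. if odd (card I) then gcoeff b I else 0)"
  have c: "gcoeff b0 I = (if even (card I) then gcoeff b I else 0)"
    "gcoeff b1 I = (if odd (card I) then gcoeff b I else 0)" for I
    unfolding b0_def b1_def by (subst gcoeff_Grass; simp)+
  have "b = b0 + b1" by (rule grass_eqI) (simp add: c)
  moreover have "gparity False b0" "gparity True b1" by (auto simp: gparity_def c)
  ultimately show ?thesis
    using gparity_commute[OF gparity_eg, of False b0 a] gparity_commute[OF gparity_eg, of True b1 a]
    by (simp add: algebra_simps)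
qed

lemma gder_eg_times: "gder j (eg a * b) = gder j (eg a) * b + eg a * gder j b"
  using gder_times[OF gparity_eg] by simp

lift_definition eeuler :: "egrass \<Rightarrow> egrass" is geuler
  by (auto simp: gparity_def gcoeff_geuler)

lemma egrass_eqI: "eg a = eg b \<Longrightarrow> a = b"
  by (simp add: eg_inject)

section \<open>Determinants and Lagrange inversion in differential algebras\<close>

text \<open>The predicate \<open>r\<close> selects one element from each pair {x, f x}, and the two
  halves of the sum cancel. Concluding from "the sum is its own negative" would require division by
  2, which an arbitrary abelian group does not allow.\<close>

lemma sum_involution_eq_0:
  fixes g :: "'x \<Rightarrow> 'b::ab_group_add"
  assumes "finite P" "\<And>x. x \<in> P \<Longrightarrow> f x \<in> P" "\<And>x. x \<in> P \<Longrightarrow> f (f x) = x"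
    and "\<And>x. x \<in> P \<Longrightarrow> g (f x) = - g x" and "\<And>x. x \<in> P \<Longrightarrow> r (f x) \<longleftrightarrow> \<not> r x"
  shows "sum g P = 0"
proof -
  have "sum g {x \<in> P. \<not> r x} = (\<Sum>x\<in>{x \<in> P. r x}. g (f x))"
    by (rule sum.reindex_bij_witness[where i = f and j = f]) (use assms in auto)
  also have "\<dots> = - sum g {x \<in> P. r x}"
    by (subst sum_negf[symmetric]) (use assms in \<open>auto intro: sum.cong\<close>)
  finally have "sum g {x \<in> P. r x} + sum g {x \<in> P. \<not> r x} = 0" by simp
  moreover have "sum g P = sum g ({x \<in> P. r x} \<union> {x \<in> P. \<not> r x})"
    by (rule arg_cong[where f = "sum g"]) auto
  ultimately show ?thesis using assms(1) by (simp add: sum.union_disjoint disjoint_iff)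
qed

section \<open>Leibniz determinants and cofactors\<close>

definition ldet :: "'i set \<Rightarrow> ('i \<Rightarrow> 'i \<Rightarrow> 'a::comm_ring_1) \<Rightarrow> 'a" where
  "ldet I A = (\<Sum>\<pi> | \<pi> permutes I. of_int (sign \<pi>) * (\<Prod>i\<in>I. A i (\<pi> i)))"

text \<open>The cofactor of the entry (i, j), as a sum over the permutations that send i to j
  instead of a signed minor. Nothing has to be renumbered, the sign is that of the full permutation,
  and Jacobi's formula becomes a regrouping of the Leibniz sum.\<close>

definition lcof :: "'i set \<Rightarrow> ('i \<Rightarrow> 'i \<Rightarrow> 'a::comm_ring_1) \<Rightarrow> 'i \<Rightarrow> 'i \<Rightarrow> 'a" where
  "lcof I A i j = (\<Sum>\<pi> | \<pi> permutes I \<and> \<pi> i = j. of_int (sign \<pi>) * (\<Prod>k\<in>I - {i}. A k (\<pi> k)))"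

lemma permutes_transpose_comp:
  assumes "finite I" "\<pi> permutes I" "a \<in> I" "k \<in> I" "a \<noteq> k"
  shows "(\<pi> \<circ> Transposition.transpose a k) permutes I" "sign (\<pi> \<circ> Transposition.transpose a k) = - sign \<pi>"
proof -
  show "(\<pi> \<circ> Transposition.transpose a k) permutes I"
    using assms by (intro permutes_compose permutes_swap_id)
  have "permutation \<pi>" using assms permutation_permutes by blast
  then show "sign (\<pi> \<circ> Transposition.transpose a k) = - sign \<pi>"
    using assms by (simp add: sign_compose permutation_swap_id sign_swap_id)
qed

lemma prod_transpose_comp:
  fixes A :: "'i \<Rightarrow> 'i \<Rightarrow> 'a::comm_monoid_mult"
  shows "(\<Prod>l\<in>I - {k} - {a}. A l ((\<pi> \<circ> Transposition.transpose a k) l)) = (\<Prod>l\<in>I - {a} - {k}. A l (\<pi> l))"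
  by (rule prod.cong) (auto simp: Transposition.transpose_def)

text \<open>For b = c each permutation occurs exactly once, with a its preimage of c. For b \<noteq>
  c this is a determinant with two equal columns: exchanging row a with the row k that \<pi> sends
  to b keeps the product and reverses the sign, and comparing a with k tells the two partners
  apart.\<close>

lemma lcof_column:
  fixes A :: "'i::linorder \<Rightarrow> 'i \<Rightarrow> 'a::comm_ring_1"
  assumes I: "finite I" and b: "b \<in> I" and c: "c \<in> I"
  shows "(\<Sum>a\<in>I. A a b * lcof I A a c) = (if b = c then ldet I A else 0)"
proof -
  have fin: "finite {\<pi>. \<pi> permutes I}" "finite {\<pi>. \<pi> permutes I \<and> Q \<pi>}" for Q
    using finite_permutations[OF I] by auto
  define h where "h = (\<lambda>(a, \<pi>). of_int (sign \<pi>) * (A a b * (\<Prod>k\<in>I - {a}. A k (\<pi> k))))"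
  have "(\<Sum>a\<in>I. A a b * lcof I A a c) = (\<Sum>a\<in>I. \<Sum>\<pi> | \<pi> permutes I \<and> \<pi> a = c. h (a, \<pi>))"
    by (simp add: lcof_def h_def sum_distrib_left mult_ac)
  also have "\<dots> = sum h (SIGMA a:I. {\<pi>. \<pi> permutes I \<and> \<pi> a = c})"
    by (subst sum.Sigma) (use I fin in auto)
  also have "\<dots> = (if b = c then ldet I A else 0)"
  proof (cases "b = c")
    case True
    have "sum h (SIGMA a:I. {\<pi>. \<pi> permutes I \<and> \<pi> a = c}) = ldet I A"
      unfolding ldet_def
    proof (rule sum.reindex_bij_witness[where i = "\<lambda>\<pi>. (inv_into UNIV \<pi> c, \<pi>)" and j = snd])
      fix z assume "z \<in> (SIGMA a:I. {\<pi>. \<pi> permutes I \<and> \<pi> a = c})"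
      then obtain a \<pi> where z: "z = (a, \<pi>)" "a \<in> I" "\<pi> permutes I" "\<pi> a = c" by auto
      show "(inv_into UNIV (snd z) c, snd z) = z"
        using z permutes_inverses(2) by fastforce
      show "snd z \<in> {\<pi>. \<pi> permutes I}" using z by auto
      show "of_int (sign (snd z)) * (\<Prod>i\<in>I. A i ((snd z) i)) = h z"
        using z I True by (simp add: h_def prod.remove)
    next
      fix \<pi> assume "\<pi> \<in> {\<pi>. \<pi> permutes I}"
      then show "(inv_into UNIV \<pi> c, \<pi>) \<in> (SIGMA a:I. {\<pi>. \<pi> permutes I \<and> \<pi> a = c})"
        using c by (auto simp: permutes_inverses permutes_in_image permutes_inv)
    qed auto
    then show ?thesis using True by simp
  next
    case False
    let ?P = "SIGMA a:I. {\<pi>. \<pi> permutes I \<and> \<pi> a = c}"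
    have "sum h ?P = 0"
    proof (rule sum_involution_eq_0[where f = "\<lambda>(a, \<pi>). (inv_into UNIV \<pi> b, \<pi> \<circ> Transposition.transpose a (inv_into UNIV \<pi> b))"
          and r = "\<lambda>(a, \<pi>). a < inv_into UNIV \<pi> b"])
      show "finite ?P" using I fin by auto
    next
      fix z assume "z \<in> ?P"
      then obtain a \<pi> where z: "z = (a, \<pi>)" "a \<in> I" "\<pi> permutes I" "\<pi> a = c" by auto
      define k where "k = inv_into UNIV \<pi> b"
      have k: "\<pi> k = b" "k \<in> I" using z b
        by (auto simp: k_def permutes_inverses permutes_in_image permutes_inv)
      have ak: "a \<noteq> k" using k z False by auto
      define \<pi>' where "\<pi>' = \<pi> \<circ> Transposition.transpose a k"
      have p: "\<pi>' permutes I" "sign \<pi>' = - sign \<pi>"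
        unfolding \<pi>'_def using permutes_transpose_comp[OF I z(3,2) k(2) ak] by auto
      have v: "\<pi>' k = c" "\<pi>' a = b" using z k by (auto simp: \<pi>'_def)
      have k': "inv_into UNIV \<pi>' b = a" using v p by (metis permutes_inverses(2))
      have \<pi>'': "\<pi>' \<circ> Transposition.transpose k a = \<pi>"
        by (auto simp: \<pi>'_def fun_eq_iff Transposition.transpose_def)
      have fz: "(case z of (a, \<pi>) \<Rightarrow> (inv_into UNIV \<pi> b, \<pi> \<circ> Transposition.transpose a (inv_into UNIV \<pi> b))) = (k, \<pi>')"
        by (simp add: z k_def \<pi>'_def)
      show "(case z of (a, \<pi>) \<Rightarrow> (inv_into UNIV \<pi> b, \<pi> \<circ> Transposition.transpose a (inv_into UNIV \<pi> b))) \<in> ?P"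
        unfolding fz using k p v by auto
      show "(case (case z of (a, \<pi>) \<Rightarrow> (inv_into UNIV \<pi> b, \<pi> \<circ> Transposition.transpose a (inv_into UNIV \<pi> b))) of
          (a, \<pi>) \<Rightarrow> (inv_into UNIV \<pi> b, \<pi> \<circ> Transposition.transpose a (inv_into UNIV \<pi> b))) = z"
        unfolding fz using \<pi>'' k' z by simp
      have "(\<Prod>l\<in>I - {k}. A l (\<pi>' l)) = A a b * (\<Prod>l\<in>I - {k} - {a}. A l (\<pi>' l))"
        using I z ak v by (subst prod.remove[of _ a]) auto
      moreover have "(\<Prod>l\<in>I - {a}. A l (\<pi> l)) = A k b * (\<Prod>l\<in>I - {a} - {k}. A l (\<pi> l))"
        using I k ak by (subst prod.remove[of _ k]) auto
      ultimately show "h (case z of (a, \<pi>) \<Rightarrow> (inv_into UNIV \<pi> b, \<pi> \<circ> Transposition.transpose a (inv_into UNIV \<pi> b))) = - h z"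
        unfolding fz using p prod_transpose_comp[where A = A and I = I and k = k and a = a and \<pi> = \<pi>]
        by (simp add: z h_def \<pi>'_def mult_ac)
      show "(case (case z of (a, \<pi>) \<Rightarrow> (inv_into UNIV \<pi> b, \<pi> \<circ> Transposition.transpose a (inv_into UNIV \<pi> b))) of
          (a, \<pi>) \<Rightarrow> a < inv_into UNIV \<pi> b) \<longleftrightarrow> \<not> (case z of (a, \<pi>) \<Rightarrow> a < inv_into UNIV \<pi> b)"
        unfolding fz using k' ak by (auto simp: z k_def[symmetric])
    qed
    then show ?thesis using False by simp
  qed
  finally show ?thesis .
qed

section \<open>Derivations\<close>

text \<open>The domain is a subring, because only smooth functions can be differentiated. The values
  lie in a module with action \<open>act\<close>, because \<partial>/\<partial>\<xi>_j takes even
  elements to odd ones, so that even elements alone would not suffice.\<close>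

locale ring_derivation =
  fixes S :: "'a::comm_ring_1 set" and d :: "'a \<Rightarrow> 'm::ab_group_add" and act :: "'a \<Rightarrow> 'm \<Rightarrow> 'm"
  assumes one_closed: "1 \<in> S"
    and diff_closed: "a \<in> S \<Longrightarrow> b \<in> S \<Longrightarrow> a - b \<in> S"
    and mult_closed: "a \<in> S \<Longrightarrow> b \<in> S \<Longrightarrow> a * b \<in> S"
    and act_add: "act a (m + n) = act a m + act a n"
    and act_add_left: "act (a + b) m = act a m + act b m"
    and act_mult: "act (a * b) m = act a (act b m)"
    and act_one: "act 1 m = m"
    and d_diff: "a \<in> S \<Longrightarrow> b \<in> S \<Longrightarrow> d (a - b) = d a - d b"
    and d_mult: "a \<in> S \<Longrightarrow> b \<in> S \<Longrightarrow> d (a * b) = act a (d b) + act b (d a)"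
begin

lemma act_zero: "act a 0 = 0" using act_add[of a 0 0] by simp
lemma act_zero_left: "act 0 m = 0" using act_add_left[of 0 0 m] by simp
lemma act_minus_left: "act (- a) m = - act a m" using act_add_left[of a "- a" m]
  by (metis act_zero_left add.right_inverse minus_unique)
lemma act_sum: "act a (sum f X) = (\<Sum>x\<in>X. act a (f x))"
  by (induction X rule: infinite_finite_induct) (auto simp: act_add act_zero)
lemma act_sum_left: "act (sum f X) m = (\<Sum>x\<in>X. act (f x) m)"
  by (induction X rule: infinite_finite_induct) (auto simp: act_add_left act_zero_left)

lemma zero_closed: "0 \<in> S" using diff_closed[OF one_closed one_closed] by simp
lemma minus_closed: "a \<in> S \<Longrightarrow> - a \<in> S" using diff_closed[OF zero_closed, of a] by simp
lemma add_closed: "a \<in> S \<Longrightarrow> b \<in> S \<Longrightarrow> a + b \<in> S" using diff_closed[OF _ minus_closed, of a b] by simp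
lemma sum_closed: "(\<And>x. x \<in> X \<Longrightarrow> f x \<in> S) \<Longrightarrow> sum f X \<in> S"
  by (induction X rule: infinite_finite_induct) (auto simp: add_closed zero_closed)
lemma prod_closed: "(\<And>x. x \<in> X \<Longrightarrow> f x \<in> S) \<Longrightarrow> prod f X \<in> S"
  by (induction X rule: infinite_finite_induct) (auto simp: mult_closed one_closed)
lemma power_closed: "a \<in> S \<Longrightarrow> a ^ k \<in> S"
  by (induction k) (auto simp: mult_closed one_closed)
lemma of_nat_closed: "of_nat k \<in> S"
  by (induction k) (auto simp: zero_closed one_closed add_closed)
lemma sign_closed: "of_int (sign \<pi>) \<in> S"
  by (cases \<pi> rule: sign_cases) (auto simp: one_closed minus_closed)

lemma d_zero: "d 0 = 0" using d_diff[OF one_closed one_closed] by simp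
lemma d_one: "d 1 = 0" using d_mult[OF one_closed one_closed] by (simp add: act_one)
lemma d_minus: "a \<in> S \<Longrightarrow> d (- a) = - d a" using d_diff[OF zero_closed, of a] by (simp add: d_zero)
lemma d_add: "a \<in> S \<Longrightarrow> b \<in> S \<Longrightarrow> d (a + b) = d a + d b"
  using d_diff[OF _ minus_closed, of a b] by (simp add: d_minus)
lemma d_sum: "(\<And>x. x \<in> X \<Longrightarrow> f x \<in> S) \<Longrightarrow> d (sum f X) = (\<Sum>x\<in>X. d (f x))"
  by (induction X rule: infinite_finite_induct) (auto simp: d_add d_zero sum_closed)
lemma d_of_nat: "d (of_nat k) = 0"
  by (induction k) (auto simp: d_zero d_add d_one of_nat_closed one_closed)

lemma d_sign: "a \<in> S \<Longrightarrow> d (of_int (sign \<pi>) * a) = act (of_int (sign \<pi>)) (d a)"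
  by (cases \<pi> rule: sign_cases) (auto simp: d_minus act_one act_minus_left)

lemma d_prod:
  assumes "finite X" "\<And>x. x \<in> X \<Longrightarrow> f x \<in> S"
  shows "d (prod f X) = (\<Sum>x\<in>X. act (prod f (X - {x})) (d (f x)))"
  using assms
proof (induction X)
  case (insert y X)
  have "(\<Sum>x\<in>X. act (prod f (insert y X - {x})) (d (f x))) =
      (\<Sum>x\<in>X. act (f y) (act (prod f (X - {x})) (d (f x))))"
  proof (rule sum.cong[OF refl])
    fix x assume "x \<in> X"
    then have "insert y X - {x} = insert y (X - {x})" using insert by auto
    then show "act (prod f (insert y X - {x})) (d (f x)) = act (f y) (act (prod f (X - {x})) (d (f x)))"
      using insert by (simp add: act_mult)
  qed
  moreover have "insert y X - {y} = X" using insert by auto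
  ultimately show ?case using insert by (simp add: d_mult prod_closed act_sum add.commute)
qed (simp add: d_one)

lemma ldet_closed: "(\<And>i j. i \<in> I \<Longrightarrow> j \<in> I \<Longrightarrow> A i j \<in> S) \<Longrightarrow> ldet I A \<in> S"
  unfolding ldet_def
  by (intro sum_closed mult_closed prod_closed sign_closed) (auto simp: permutes_in_image)

lemma lcof_closed: "(\<And>i j. i \<in> I \<Longrightarrow> j \<in> I \<Longrightarrow> A i j \<in> S) \<Longrightarrow> lcof I A i j \<in> S"
  unfolding lcof_def
  by (intro sum_closed mult_closed prod_closed sign_closed) (auto simp: permutes_in_image)

text \<open>Jacobi's formula. The Leibniz rule differentiates one row i at a time; the permutations
  are then grouped by their value at i, and each group is a cofactor.\<close>

lemma d_ldet:
  assumes I: "finite I" and A: "\<And>i j. i \<in> I \<Longrightarrow> j \<in> I \<Longrightarrow> A i j \<in> S"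
  shows "d (ldet I A) = (\<Sum>i\<in>I. \<Sum>j\<in>I. act (lcof I A i j) (d (A i j)))"
proof -
  let ?P = "{\<pi>. \<pi> permutes I}"
  have fin: "finite ?P" using finite_permutations[OF I] .
  have cl: "A i (\<pi> i) \<in> S" if "\<pi> \<in> ?P" "i \<in> I" for \<pi> i
    using that A by (simp add: permutes_in_image)
  define h where "h = (\<lambda>i \<pi>. act (of_int (sign \<pi>) * (\<Prod>k\<in>I - {i}. A k (\<pi> k))) (d (A i (\<pi> i))))"
  have "d (ldet I A) = (\<Sum>\<pi>\<in>?P. d (of_int (sign \<pi>) * (\<Prod>i\<in>I. A i (\<pi> i))))"
    unfolding ldet_def by (rule d_sum) (intro mult_closed sign_closed prod_closed cl)
  also have "\<dots> = (\<Sum>\<pi>\<in>?P. \<Sum>i\<in>I. h i \<pi>)"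
  proof (rule sum.cong[OF refl])
    fix \<pi> assume \<pi>: "\<pi> \<in> ?P"
    have "d (of_int (sign \<pi>) * (\<Prod>i\<in>I. A i (\<pi> i))) = act (of_int (sign \<pi>)) (d (\<Prod>i\<in>I. A i (\<pi> i)))"
      by (rule d_sign) (intro prod_closed cl \<pi>)
    also have "\<dots> = (\<Sum>i\<in>I. h i \<pi>)"
      by (subst d_prod) (use I cl[OF \<pi>] in \<open>auto simp: act_sum h_def act_mult\<close>)
    finally show "d (of_int (sign \<pi>) * (\<Prod>i\<in>I. A i (\<pi> i))) = (\<Sum>i\<in>I. h i \<pi>)" .
  qed
  also have "\<dots> = (\<Sum>i\<in>I. sum (h i) ?P)" by (rule sum.swap)
  also have "\<dots> = (\<Sum>i\<in>I. \<Sum>j\<in>I. act (lcof I A i j) (d (A i j)))"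
  proof (rule sum.cong[OF refl])
    fix i assume i: "i \<in> I"
    have "sum (h i) ?P = (\<Sum>j\<in>I. sum (h i) {\<pi> \<in> ?P. \<pi> i = j})"
      by (rule sum.group[symmetric]) (use fin I i in \<open>auto simp: permutes_in_image\<close>)
    also have "\<dots> = (\<Sum>j\<in>I. act (lcof I A i j) (d (A i j)))"
      by (rule sum.cong[OF refl]) (simp add: lcof_def act_sum_left h_def)
    finally show "sum (h i) ?P = (\<Sum>j\<in>I. act (lcof I A i j) (d (A i j)))" .
  qed
  finally show ?thesis .
qed

end

section \<open>Multi-indices and algebras with commuting derivations\<close>

definition multi_idx :: "nat \<Rightarrow> ('p::finite \<Rightarrow> nat) set" where
  "multi_idx k = {i. sum i UNIV = k}"

lemma finite_multi_idx [simp]: "finite (multi_idx k)"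
proof (rule finite_subset)
  show "multi_idx k \<subseteq> {i. \<forall>a. (a \<in> UNIV \<longrightarrow> i a \<in> {..k}) \<and> (a \<notin> UNIV \<longrightarrow> i a = 0)}"
    by (auto simp: multi_idx_def intro: member_le_sum)
qed (rule finite_set_of_finite_funs, auto)

lemma multi_idx_0: "multi_idx 0 = {\<lambda>_. 0}"
  by (auto simp: multi_idx_def)

text \<open>\<open>K\<close> supplies the real scalars, since the type is only assumed to be a
  commutative ring.\<close>

locale diff_algebra =
  fixes S :: "'a::comm_ring_1 set" and d :: "'p::{finite,linorder} \<Rightarrow> 'a \<Rightarrow> 'a" and K :: "real \<Rightarrow> 'a"
  assumes derivation: "ring_derivation S (d a) (*)"
    and d_closed: "f \<in> S \<Longrightarrow> d a f \<in> S"
    and d_commute: "f \<in> S \<Longrightarrow> d a (d b f) = d b (d a f)"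
    and K_closed: "K r \<in> S" and K_add: "K (r + t) = K r + K t" and K_mult: "K (r * t) = K r * K t"
    and K_one: "K 1 = 1" and d_K: "d a (K r) = 0"
begin

interpretation d: ring_derivation S "d a" "(*)" for a by (rule derivation)

lemmas closed = d.one_closed d.zero_closed d.diff_closed d.minus_closed d.mult_closed d.add_closed
  d.sum_closed d.prod_closed d.power_closed d.of_nat_closed d_closed K_closed

lemma K_of_nat: "K (of_nat k) = of_nat k"
proof (induction k)
  case 0
  show ?case using K_add[of 0 0] by simp
qed (simp add: K_add K_one)

lemma d_K_mult: "f \<in> S \<Longrightarrow> d a (K r * f) = K r * d a f"
  by (simp add: d.d_mult closed d_K)

text \<open>T_k f is the sum of \<partial>_{a1} ... \<partial>_{ak} (n_{a1} ... n_{ak} f) over all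
  k-tuples of directions. In contrast to multi-indices, tuples allow a recursion that adds one
  direction at a time; \<open>T_multi_idx\<close> translates.\<close>

primrec T :: "('p \<Rightarrow> 'a) \<Rightarrow> nat \<Rightarrow> 'a \<Rightarrow> 'a" where
  "T n 0 f = f"
| "T n (Suc k) f = (\<Sum>a\<in>UNIV. d a (T n k (n a * f)))"

text \<open>The factors come in the order of \<open>ract_du\<close>, so that the two folds can be
  compared step by step.\<close>

definition dm :: "('p \<Rightarrow> nat) \<Rightarrow> 'a \<Rightarrow> 'a" where
  "dm i f = fold (\<lambda>a. d a ^^ i a) (rev (sorted_list_of_set UNIV)) f"

lemma funpow_closed: "f \<in> S \<Longrightarrow> (d a ^^ k) f \<in> S"
  by (induction k) (auto simp: closed)

lemma fold_closed: "f \<in> S \<Longrightarrow> fold (\<lambda>a. d a ^^ i a) xs f \<in> S"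
  by (induction xs arbitrary: f) (auto simp: funpow_closed)

lemma d_funpow_commute: "f \<in> S \<Longrightarrow> d a ((d b ^^ k) f) = (d b ^^ k) (d a f)"
  by (induction k) (auto simp: d_commute[of _ a b] funpow_closed)

lemma d_fold_commute: "f \<in> S \<Longrightarrow> d a (fold (\<lambda>a. d a ^^ i a) xs f) = fold (\<lambda>a. d a ^^ i a) xs (d a f)"
  by (induction xs arbitrary: f) (auto simp: d_funpow_commute funpow_closed)

lemma fold_Suc:
  assumes "distinct xs" "a \<in> set xs" "f \<in> S"
  shows "fold (\<lambda>b. d b ^^ (i(a := Suc (i a))) b) xs f = d a (fold (\<lambda>b. d b ^^ i b) xs f)"
  using assms
proof (induction xs arbitrary: f)
  case (Cons b xs)
  show ?case
  proof (cases "b = a")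
    case True
    then have "fold (\<lambda>b. d b ^^ (i(a := Suc (i a))) b) xs g = fold (\<lambda>b. d b ^^ i b) xs g" for g
      using Cons.prems by (intro fold_cong) auto
    then show ?thesis using True Cons.prems by (simp add: d_fold_commute funpow_closed)
  next
    case False
    then show ?thesis using Cons by (auto simp: funpow_closed)
  qed
qed simp

lemma dm_Suc: "f \<in> S \<Longrightarrow> dm (i(a := Suc (i a))) f = d a (dm i f)"
  unfolding dm_def by (rule fold_Suc) auto

lemma dm_closed: "f \<in> S \<Longrightarrow> dm i f \<in> S"
  unfolding dm_def by (rule fold_closed)

lemma dm_zero: "dm (\<lambda>_. 0) f = f"
proof -
  have "fold (\<lambda>a. d a ^^ 0) xs f = f" for xs by (induction xs) auto
  then show ?thesis by (simp add: dm_def)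
qed

context
  fixes n :: "'p \<Rightarrow> 'a"
  assumes n: "n a \<in> S"
begin

lemma T_closed: "f \<in> S \<Longrightarrow> T n k f \<in> S"
  by (induction k arbitrary: f) (auto simp: closed n)

lemma T_add: "f \<in> S \<Longrightarrow> g \<in> S \<Longrightarrow> T n k (f + g) = T n k f + T n k g"
  by (induction k arbitrary: f g)
    (simp_all add: distrib_left closed n d.d_add T_closed sum.distrib)

lemma T_zero: "T n k 0 = 0"
  by (induction k) (auto simp: d.d_zero)

text \<open>D passes the \<partial>_a and hits either f or one of the k factors n_a. The k
  contributions of the second kind are equal, because the directions of a tuple may be reordered.
  For k = 0 the factor k removes the term in which \<open>k - 1\<close> is truncated.\<close>

lemma T_derivation:
  assumes D: "ring_derivation S D (*)" and DS: "\<And>f. f \<in> S \<Longrightarrow> D f \<in> S"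
    and Dd: "\<And>f a. f \<in> S \<Longrightarrow> D (d a f) = d a (D f)" and f: "f \<in> S"
  shows "D (T n k f) = T n k (D f) + of_nat k * (\<Sum>a\<in>UNIV. d a (T n (k - 1) (D (n a) * f)))"
  using f
proof (induction k arbitrary: f)
  case (Suc k)
  interpret D: ring_derivation S D "(*)" by (rule D)
  have e: "D (d a (T n k (n a * f))) = d a (T n k (n a * D f)) + d a (T n k (D (n a) * f)) +
      of_nat k * d a (\<Sum>b\<in>UNIV. d b (T n (k - 1) (n a * (D (n b) * f))))" for a
  proof -
    have "D (d a (T n k (n a * f))) = d a (D (T n k (n a * f)))"
      by (intro Dd T_closed closed n Suc.prems)
    also have "D (T n k (n a * f)) = T n k (D (n a * f)) +
        of_nat k * (\<Sum>b\<in>UNIV. d b (T n (k - 1) (D (n b) * (n a * f))))"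
      by (intro Suc.IH closed n Suc.prems)
    also have "D (n a * f) = n a * D f + D (n a) * f"
      by (simp add: D.d_mult n Suc.prems mult.commute)
    also have "T n k (n a * D f + D (n a) * f) = T n k (n a * D f) + T n k (D (n a) * f)"
      by (intro T_add closed n Suc.prems DS)
    finally show ?thesis
      by (simp add: d.d_add d.d_mult d.d_of_nat closed T_closed n Suc.prems DS mult.left_commute)
  qed
  \<comment> \<open>Exchanging \<partial>_a with \<partial>_b turns the sum over a into one more
    step of T. The contributions of the k older factors thus take the form of the contribution of
    the newest one, which makes k + 1 equal terms.\<close>
  have "of_nat k * (\<Sum>a\<in>UNIV. d a (\<Sum>b\<in>UNIV. d b (T n (k - 1) (n a * (D (n b) * f))))) =
      of_nat k * (\<Sum>b\<in>UNIV. d b (T n k (D (n b) * f)))"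
  proof (cases k)
    case (Suc j)
    have "(\<Sum>a\<in>UNIV. d a (\<Sum>b\<in>UNIV. d b (T n j (n a * (D (n b) * f))))) =
       (\<Sum>a\<in>UNIV. \<Sum>b\<in>UNIV. d b (d a (T n j (n a * (D (n b) * f)))))"
      by (subst d.d_sum)
        (auto intro!: sum.cong d_commute closed T_closed n Suc.prems DS \<open>f \<in> S\<close>)
    also have "\<dots> = (\<Sum>b\<in>UNIV. \<Sum>a\<in>UNIV. d b (d a (T n j (n a * (D (n b) * f)))))"
      by (rule sum.swap)
    also have "\<dots> = (\<Sum>b\<in>UNIV. d b (T n (Suc j) (D (n b) * f)))"
      by (simp, subst d.d_sum) (auto intro!: closed T_closed n DS \<open>f \<in> S\<close>)
    finally show ?thesis using Suc by simp
  qed simp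
  moreover have "D (T n (Suc k) f) = (\<Sum>a\<in>UNIV. D (d a (T n k (n a * f))))"
    by (simp, rule D.d_sum) (intro closed T_closed n Suc.prems)
  ultimately have "D (T n (Suc k) f) = (\<Sum>a\<in>UNIV. d a (T n k (n a * D f))) +
      (\<Sum>a\<in>UNIV. d a (T n k (D (n a) * f))) + of_nat k * (\<Sum>b\<in>UNIV. d b (T n k (D (n b) * f)))"
    by (simp only: e sum.distrib sum_distrib_left[symmetric])
  then show ?case by (simp add: distrib_right add.assoc)
qed simp

lemma T_K_mult: "f \<in> S \<Longrightarrow> T n k (K r * f) = K r * T n k f"
proof (induction k arbitrary: f)
  case (Suc k)
  have "T n k (n a * (K r * f)) = K r * T n k (n a * f)" for a
    using Suc by (subst mult.left_commute) (simp add: closed n)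
  then show ?case using Suc.prems by (simp add: d_K_mult T_closed closed n sum_distrib_left)
qed simp

text \<open>The commutator of T_k with multiplication by a coordinate w. The derivative u is kept
  general because partial derivatives will be set to 0 outside of a domain W, which makes u the
  indicator function of W and not 1.\<close>

lemma T_coordinate:
  assumes w: "w \<in> S" "\<And>b. d b w = (if b = c then u else 0)"
    and u: "u \<in> S" "\<And>a. d a u = 0" and f: "f \<in> S"
  shows "T n k (w * f) = w * T n k f + of_nat k * (u * T n (k - 1) (n c * f))"
  using f
proof (induction k arbitrary: f)
  case (Suc k)
  have e: "d a (T n k (n a * (w * f))) = w * d a (T n k (n a * f)) +
      (if a = c then u * T n k (n a * f) else 0) +
      of_nat k * (u * d a (T n (k - 1) (n a * (n c * f))))" for a
  proof -
    have "T n k (n a * (w * f)) = T n k (w * (n a * f))" by (simp add: mult_ac)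
    also have "\<dots> = w * T n k (n a * f) + of_nat k * (u * T n (k - 1) (n c * (n a * f)))"
      by (intro Suc.IH closed n Suc.prems)
    finally show ?thesis
      by (simp add: d.d_add d.d_mult d.d_of_nat closed T_closed n Suc.prems w u mult_ac)
  qed
  have "of_nat k * (u * (\<Sum>a\<in>UNIV. d a (T n (k - 1) (n a * (n c * f))))) = of_nat k * (u * T n k (n c * f))"
    by (cases k) auto
  moreover have "T n (Suc k) (w * f) = (\<Sum>a\<in>UNIV. d a (T n k (n a * (w * f))))" by simp
  ultimately have "T n (Suc k) (w * f) = w * (\<Sum>a\<in>UNIV. d a (T n k (n a * f))) +
      u * T n k (n c * f) + of_nat k * (u * T n k (n c * f))"
    by (simp only: e sum.distrib sum_distrib_left[symmetric]) simp
  then show ?case by (simp add: distrib_right add.assoc)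
qed simp

text \<open>A multi-index i comes from |i|! / i! tuples. In the induction the factor k + 1 = \<Sum>
  i_a is distributed over the directions, and i_a / i! = 1 / (i - e_a)! leads back to multi-indices
  of size k.\<close>

lemma T_multi_idx:
  assumes f: "f \<in> S"
  shows "K (1 / fact k) * T n k f =
    (\<Sum>i\<in>multi_idx k. K (1 / (\<Prod>a\<in>UNIV. fact (i a))) * dm i ((\<Prod>a\<in>UNIV. n a ^ i a) * f))"
  using f
proof (induction k arbitrary: f)
  case 0
  then show ?case by (simp add: multi_idx_0 K_one dm_zero)
next
  case (Suc k)
  define c :: "('p \<Rightarrow> nat) \<Rightarrow> real" where "c i = 1 / (\<Prod>a\<in>UNIV. fact (i a))" for i :: "'p \<Rightarrow> nat"
  define P where "P i = (\<Prod>a\<in>UNIV. n a ^ i a)" for i :: "'p \<Rightarrow> nat"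
  define X where "X i = dm i (P i * f)" for i
  have P: "P i \<in> S" for i unfolding P_def by (intro closed n)
  have PS: "P (i(a := Suc (i a))) = P i * n a" for i a
    unfolding P_def by (subst (1 2) prod.remove[of _ a]) (auto intro!: prod.cong simp: mult_ac)
  have cS: "real (Suc (i a)) * c (i(a := Suc (i a))) = c i" for i a
    unfolding c_def by (subst (1 2) prod.remove[of _ a]) (auto simp: divide_simps intro!: prod.cong)
  have XS: "X (i(a := Suc (i a))) = d a (dm i (P i * (n a * f)))" for i a
    unfolding X_def PS using Suc.prems by (subst dm_Suc) (auto intro: closed P n simp: mult.assoc)
  have "K (real (Suc k)) * (\<Sum>i\<in>multi_idx (Suc k). K (c i) * X i) =
      (\<Sum>i\<in>multi_idx (Suc k). \<Sum>a\<in>UNIV. K (real (i a) * c i) * X i)"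
    unfolding sum_distrib_left
  proof (rule sum.cong[OF refl])
    fix i :: "'p \<Rightarrow> nat" assume "i \<in> multi_idx (Suc k)"
    then have "Suc k = (\<Sum>a\<in>UNIV. i a)" by (simp add: multi_idx_def)
    then have "K (real (Suc k)) = of_nat (\<Sum>a\<in>UNIV. i a)" by (metis K_of_nat)
    then have "K (real (Suc k)) = (\<Sum>a\<in>UNIV. K (real (i a)))" by (simp add: K_of_nat)
    then show "K (real (Suc k)) * (K (c i) * X i) = (\<Sum>a\<in>UNIV. K (real (i a) * c i) * X i)"
      by (simp add: K_mult sum_distrib_right mult.assoc)
  qed
  also have "\<dots> = (\<Sum>a\<in>UNIV. \<Sum>i\<in>multi_idx (Suc k). K (real (i a) * c i) * X i)"
    by (rule sum.swap)
  also have "\<dots> = (\<Sum>a\<in>UNIV. \<Sum>i\<in>multi_idx k. K (c i) * d a (dm i (P i * (n a * f))))"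
  proof (rule sum.cong[OF refl])
    fix a :: 'p
    have "(\<Sum>i\<in>multi_idx (Suc k). K (real (i a) * c i) * X i) =
        (\<Sum>i\<in>{i \<in> multi_idx (Suc k). i a \<noteq> 0}. K (real (i a) * c i) * X i)"
      using K_of_nat[of 0] by (intro sum.mono_neutral_right) auto
    also have "\<dots> = (\<Sum>i\<in>multi_idx k. K (c i) * d a (dm i (P i * (n a * f))))"
    proof (rule sum.reindex_bij_witness
        [where i = "\<lambda>i. i(a := Suc (i a))" and j = "\<lambda>i. i(a := i a - 1)"])
      fix i :: "'p \<Rightarrow> nat" assume i: "i \<in> {i \<in> multi_idx (Suc k). i a \<noteq> 0}"
      show "i(a := i a - 1) \<in> multi_idx k"
        using i by (simp add: multi_idx_def sum.remove[of UNIV a])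
      define j where "j = i(a := i a - 1)"
      have "i = j(a := Suc (j a))" using i by (auto simp: j_def)
      then show "K (c (i(a := i a - 1))) * d a (dm (i(a := i a - 1)) (P (i(a := i a - 1)) * (n a * f))) =
        K (real (i a) * c i) * X i"
        using XS[of j a] cS[of j a] by (metis fun_upd_same j_def)
    qed (auto simp: multi_idx_def sum.remove[of UNIV a])
    finally show "(\<Sum>i\<in>multi_idx (Suc k). K (real (i a) * c i) * X i) = 
        (\<Sum>i\<in>multi_idx k. K (c i) * d a (dm i (P i * (n a * f))))" .
  qed
  also have "\<dots> = (\<Sum>a\<in>UNIV. d a (K (1 / fact k) * T n k (n a * f)))"
  proof (rule sum.cong[OF refl])
    fix a :: 'p
    have "d a (K (1 / fact k) * T n k (n a * f)) =
        d a (\<Sum>i\<in>multi_idx k. K (c i) * dm i (P i * (n a * f)))"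
      unfolding c_def P_def by (subst Suc.IH) (auto intro: closed n Suc.prems)
    also have "\<dots> = (\<Sum>i\<in>multi_idx k. K (c i) * d a (dm i (P i * (n a * f))))"
      using Suc.prems by (subst d.d_sum) (auto simp: d_K_mult dm_closed closed n P)
    finally show "(\<Sum>i\<in>multi_idx k. K (c i) * d a (dm i (P i * (n a * f)))) =
      d a (K (1 / fact k) * T n k (n a * f))" ..
  qed
  also have "\<dots> = K (1 / fact k) * T n (Suc k) f"
    using Suc.prems by (simp add: d_K_mult T_closed closed n sum_distrib_left)
  finally have e: "K (1 / fact k) * T n (Suc k) f =
    K (real (Suc k)) * (\<Sum>i\<in>multi_idx (Suc k). K (c i) * X i)" ..
  have "K (1 / fact (Suc k)) * T n (Suc k) f = K (1 / real (Suc k)) * (K (1 / fact k) * T n (Suc k) f)"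
    by (simp add: mult.assoc[symmetric] flip: K_mult)
  also have "\<dots> = K (1 / real (Suc k) * real (Suc k)) * (\<Sum>i\<in>multi_idx (Suc k). K (c i) * X i)"
    unfolding e K_mult by (simp only: mult.assoc)
  also have "1 / real (Suc k) * real (Suc k) = 1" by simp
  finally show ?case by (simp add: K_one c_def X_def P_def)
qed

section \<open>The Lagrange operator\<close>

context
  fixes N :: nat
  assumes nil: "f \<in> S \<Longrightarrow> T n N f = 0"
begin

text \<open>The formal adjoint of the substitution g \<mapsto> g(w + n) = \<Sum> n^i \<partial>^i g
  / i!, obtained by integrating by parts. The change of variables formula, read formally, says that
  L inverts g \<mapsto> g(w + n) J; this is what is proved for smooth functions further
  below.\<close>

definition L :: "'a \<Rightarrow> 'a" where
  "L f = (\<Sum>k\<le>N. K ((-1) ^ k / fact k) * T n k f)"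

lemma L_closed: "f \<in> S \<Longrightarrow> L f \<in> S"
  unfolding L_def by (intro closed T_closed)

lemma L_add: "f \<in> S \<Longrightarrow> g \<in> S \<Longrightarrow> L (f + g) = L f + L g"
  unfolding L_def by (simp add: T_add distrib_left sum.distrib)

lemma L_zero: "L 0 = 0"
  by (simp add: L_def T_zero)

lemma L_sum: "(\<And>x. x \<in> X \<Longrightarrow> f x \<in> S) \<Longrightarrow> L (sum f X) = (\<Sum>x\<in>X. L (f x))"
  by (induction X rule: infinite_finite_induct) (auto simp: L_add closed L_zero)

text \<open>Since k / k! = 1 / (k - 1)!, moving the index by one gives back the terms of L with the
  opposite sign. The last term of L, which the shifted sum does not reach, is T_N g = 0.\<close>

lemma L_shift:
  assumes g: "g \<in> S" and "\<And>k. h (Suc k) = T n k g"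
  shows "(\<Sum>k\<le>N. K ((-1) ^ k / fact k) * (of_nat k * h k)) = - L g"
proof -
  have "K ((-1) ^ Suc k / fact (Suc k)) * (of_nat (Suc k) * h (Suc k)) =
      - (K ((-1) ^ k / fact k) * T n k g)" for k
  proof -
    have "K ((-1) ^ Suc k / fact (Suc k)) * of_nat (Suc k) = K (-1 * ((-1) ^ k / fact k))"
      by (subst K_of_nat[symmetric], subst K_mult[symmetric]) (simp add: divide_simps)
    also have "\<dots> = - K ((-1) ^ k / fact k)"
      using K_add[of "-1" 1] K_of_nat[of 0] by (subst K_mult) (simp add: K_one add_eq_0_iff2)
    finally show ?thesis by (simp add: assms(2) mult.assoc[symmetric])
  qed
  then have "(\<Sum>k\<le>N. K ((-1) ^ k / fact k) * (of_nat k * h k)) =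
      - (\<Sum>k<N. K ((-1) ^ k / fact k) * T n k g)"
    by (subst sum.atMost_shift) (simp add: sum_negf)
  also have "(\<Sum>k<N. K ((-1) ^ k / fact k) * T n k g) = L g"
    unfolding L_def lessThan_Suc_atMost[symmetric] using nil[OF g] by simp
  finally show ?thesis .
qed

lemma L_derivation:
  assumes D: "ring_derivation S D (*)" and DS: "\<And>f. f \<in> S \<Longrightarrow> D f \<in> S"
    and Dd: "\<And>f a. f \<in> S \<Longrightarrow> D (d a f) = d a (D f)" and DK: "\<And>r. D (K r) = 0" and f: "f \<in> S"
  shows "D (L f) = L (D f) - (\<Sum>a\<in>UNIV. d a (L (D (n a) * f)))"
proof -
  interpret D: ring_derivation S D "(*)" by (rule D)
  have "D (L f) = (\<Sum>k\<le>N. K ((-1) ^ k / fact k) * D (T n k f))"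
    unfolding L_def
    by (subst D.d_sum) (auto simp: D.d_mult DK closed T_closed f)
  also have "\<dots> = L (D f) + (\<Sum>k\<le>N. \<Sum>a\<in>UNIV. K ((-1) ^ k / fact k) *
      (of_nat k * d a (T n (k - 1) (D (n a) * f))))"
    by (subst T_derivation[OF D DS Dd f])
      (auto simp: distrib_left sum.distrib L_def sum_distrib_left)
  also have "(\<Sum>k\<le>N. \<Sum>a\<in>UNIV. K ((-1) ^ k / fact k) * (of_nat k * d a (T n (k - 1) (D (n a) * f)))) =
      (\<Sum>a\<in>UNIV. d a (\<Sum>k\<le>N. K ((-1) ^ k / fact k) * (of_nat k * T n (k - 1) (D (n a) * f))))"
    by (subst sum.swap, rule sum.cong[OF refl], subst d.d_sum)
      (auto simp: d.d_mult d_K d.d_of_nat closed T_closed f n DS)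
  also have "\<dots> = (\<Sum>a\<in>UNIV. d a (- L (D (n a) * f)))"
    by (intro sum.cong refl arg_cong[where f = "d _"] L_shift) (auto intro: closed f n DS)
  also have "\<dots> = - (\<Sum>a\<in>UNIV. d a (L (D (n a) * f)))"
    by (subst d.d_minus) (auto simp: sum_negf intro: L_closed closed f n DS)
  finally show ?thesis by simp
qed

text \<open>Where u = 1, the operator L turns multiplication by w + n_c into multiplication by w, as
  the inverse of a substitution must do.\<close>

lemma L_coordinate:
  assumes w: "w \<in> S" "\<And>b. d b w = (if b = c then u else 0)"
    and u: "u \<in> S" "\<And>a. d a u = 0" and f: "f \<in> S"
  shows "L ((w + n c) * f) = w * L f + (1 - u) * L (n c * f)"
proof -
  have "L (w * f) = w * L f +
      u * (\<Sum>k\<le>N. K ((-1) ^ k / fact k) * (of_nat k * T n (k - 1) (n c * f)))"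
    unfolding L_def T_coordinate[OF w u f]
    by (simp add: distrib_left sum.distrib sum_distrib_left mult_ac)
  also have "\<dots> = w * L f - u * L (n c * f)"
    by (subst L_shift) (auto intro: closed f n)
  finally show ?thesis using w(1) f by (simp add: distrib_right left_diff_distrib L_add closed n)
qed

lemma L_K_mult: "f \<in> S \<Longrightarrow> L (K r * f) = K r * L f"
  by (simp add: L_def T_K_mult sum_distrib_left mult.left_commute)

lemma L_multi_idx:
  assumes "f \<in> S"
  shows "L f = (\<Sum>k\<le>N. \<Sum>i\<in>multi_idx k.
    K ((-1) ^ k / (\<Prod>a\<in>UNIV. fact (i a))) * dm i ((\<Prod>a\<in>UNIV. n a ^ i a) * f))"
  unfolding L_def
proof (rule sum.cong[OF refl])
  fix k
  have "K ((-1) ^ k / fact k) * T n k f = K ((-1) ^ k) * (K (1 / fact k) * T n k f)"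
    by (simp add: mult.assoc[symmetric] flip: K_mult)
  also have "\<dots> = (\<Sum>i\<in>multi_idx k. K ((-1) ^ k / (\<Prod>a\<in>UNIV. fact (i a))) * dm i ((\<Prod>a\<in>UNIV. n a ^ i a) * f))"
    unfolding T_multi_idx[OF assms] sum_distrib_left
    by (rule sum.cong[OF refl]) (simp add: mult.assoc[symmetric] flip: K_mult)
  finally show "K ((-1) ^ k / fact k) * T n k f = (\<Sum>i\<in>multi_idx k.
      K ((-1) ^ k / (\<Prod>a\<in>UNIV. fact (i a))) * dm i ((\<Prod>a\<in>UNIV. n a ^ i a) * f))" .
qed

abbreviation "Mat \<equiv> \<lambda>a b. (if a = b then 1 else 0) + d a (n b)"
abbreviation "Jac \<equiv> ldet UNIV Mat"

lemma Mat_closed: "Mat a b \<in> S"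
  by (auto intro: closed n)

text \<open>Piola's identity: the columns of the cofactor matrix are free of divergence.
  Differentiating the entry in row k produces \<partial>_a \<partial>_k n, which is symmetric in a
  and k, whereas exchanging the rows a and k changes the sign of the permutation.\<close>

lemma piola: "(\<Sum>a\<in>UNIV. d a (lcof UNIV Mat a c)) = 0"
proof -
  define h where "h = (\<lambda>(a, k, \<pi>). of_int (sign \<pi>) *
    ((\<Prod>l\<in>UNIV - {a} - {k}. Mat l (\<pi> l)) * d a (d k (n (\<pi> k)))))"
  let ?Q = "\<lambda>a. {\<pi>. \<pi> permutes (UNIV :: 'p set) \<and> \<pi> a = c}"
  let ?P = "{(a, k, \<pi>). a \<noteq> k \<and> \<pi> permutes (UNIV :: 'p set) \<and> \<pi> a = c}"
  have fin: "finite ?P"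
    by (rule finite_subset[of _ "UNIV \<times> UNIV \<times> {\<pi>. \<pi> permutes UNIV}"])
      (auto intro: finite_permutations)
  have "d a (lcof UNIV Mat a c) = (\<Sum>\<pi>\<in>?Q a. \<Sum>k\<in>UNIV - {a}. h (a, k, \<pi>))" for a
  proof -
    have "d a (lcof UNIV Mat a c) =
       (\<Sum>\<pi>\<in>?Q a. d a (of_int (sign \<pi>) * (\<Prod>k\<in>UNIV - {a}. Mat k (\<pi> k))))"
      unfolding lcof_def by (rule d.d_sum) (intro closed d.sign_closed Mat_closed)
    also have "\<dots> = (\<Sum>\<pi>\<in>?Q a. \<Sum>k\<in>UNIV - {a}. h (a, k, \<pi>))"
    proof (rule sum.cong[OF refl])
      fix \<pi>
      have "d a (of_int (sign \<pi>) * (\<Prod>k\<in>UNIV - {a}. Mat k (\<pi> k))) =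
          of_int (sign \<pi>) * d a (\<Prod>k\<in>UNIV - {a}. Mat k (\<pi> k))"
        by (intro d.d_sign closed Mat_closed)
      moreover have "d a (\<Prod>k\<in>UNIV - {a}. Mat k (\<pi> k)) = (\<Sum>k\<in>UNIV - {a}.
          (\<Prod>l\<in>UNIV - {a} - {k}. Mat l (\<pi> l)) * d a (Mat k (\<pi> k)))"
        by (rule d.d_prod) (simp, rule Mat_closed)
      moreover have "d a (Mat k b) = d a (d k (n b))" for k b
        by (simp add: d.d_add closed n d.d_one d.d_zero if_distrib[of "d a"])
      ultimately show "d a (of_int (sign \<pi>) * (\<Prod>k\<in>UNIV - {a}. Mat k (\<pi> k))) =
          (\<Sum>k\<in>UNIV - {a}. h (a, k, \<pi>))"
        by (simp add: h_def sum_distrib_left)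
    qed
    finally show ?thesis .
  qed
  then have "(\<Sum>a\<in>UNIV. d a (lcof UNIV Mat a c)) =
      (\<Sum>a\<in>UNIV. \<Sum>k\<in>UNIV - {a}. \<Sum>\<pi>\<in>?Q a. h (a, k, \<pi>))"
    by (simp, subst sum.swap) auto
  also have "\<dots> = (\<Sum>a\<in>UNIV. sum (\<lambda>z. h (a, z)) ((UNIV - {a}) \<times> ?Q a))"
    by (subst sum.cartesian_product) (auto intro!: sum.cong)
  also have "\<dots> = sum h (SIGMA a:UNIV. ((UNIV - {a}) \<times> ?Q a))"
    by (subst sum.Sigma) (auto intro: finite_permutations finite_subset[OF _ finite_permutations])
  also have "(SIGMA a:UNIV. ((UNIV - {a}) \<times> ?Q a)) = ?P" by auto
  also have "sum h ?P = 0"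
  proof (rule sum_involution_eq_0[where f = "\<lambda>(a, k, \<pi>). (k, a, \<pi> \<circ> Transposition.transpose a k)"
        and r = "\<lambda>(a, k, \<pi>). a < k"])
    fix z assume "z \<in> ?P"
    then obtain a k \<pi> where z: "z = (a, k, \<pi>)" "a \<noteq> k" "\<pi> permutes UNIV" "\<pi> a = c" by auto
    note p = permutes_transpose_comp[of UNIV \<pi> a k]
    show "h (case z of (a, k, \<pi>) \<Rightarrow> (k, a, \<pi> \<circ> Transposition.transpose a k)) = - h z"
      using z p prod_transpose_comp[where A = Mat and I = UNIV and k = k and a = a and \<pi> = \<pi>] d_commute[OF n, of a k]
      by (simp add: h_def)
    show "(case z of (a, k, \<pi>) \<Rightarrow> (k, a, \<pi> \<circ> Transposition.transpose a k)) \<in> ?P"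
      using z p by auto
  qed (use fin in \<open>auto simp: fun_eq_iff Transposition.transpose_def\<close>)
  finally show ?thesis .
qed

text \<open>Let M be the matrix \<open>Mat\<close>, C its cofactors and J its determinant. Jacobi
  and Piola give D J = \<Sum> \<partial>_a (C_ac D n_c). From L \<partial>_a g = \<Sum>_b
  \<partial>_b L(M_ab g) and \<Sum>_a M_ab C_ac = \<delta>_bc J it follows that L(D J) = \<Sum>_b
  \<partial>_b L(D(n_b) J). This is exactly the term that \<open>L_derivation\<close>
  subtracts.\<close>

lemma L_Jac_derivation:
  assumes D: "ring_derivation S D (*)" and DS: "\<And>f. f \<in> S \<Longrightarrow> D f \<in> S"
    and Dd: "\<And>f a. f \<in> S \<Longrightarrow> D (d a f) = d a (D f)" and DK: "\<And>r. D (K r) = 0"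
  shows "D (L Jac) = 0"
proof -
  interpret D: ring_derivation S D "(*)" by (rule D)
  let ?C = "lcof UNIV Mat"
  have C: "?C a c \<in> S" for a c by (intro d.lcof_closed Mat_closed)
  have Jac: "Jac \<in> S" by (intro d.ldet_closed Mat_closed)
  \<comment> \<open>\<open>L_derivation\<close> for D = \<partial>_a, solved for L(\<partial>_a f);
    the unit matrix inside \<open>Mat\<close> accounts for \<partial>_a L(f).\<close>
  have Ld: "L (d a f) = (\<Sum>b\<in>UNIV. d b (L (Mat a b * f)))" if f: "f \<in> S" for a f
  proof -
    have "d a (L f) = L (d a f) - (\<Sum>b\<in>UNIV. d b (L (d a (n b) * f)))"
      by (rule L_derivation) (auto intro: derivation d_closed d_commute d_K f)
    moreover have "d b (L (Mat a b * f)) = (if b = a then d a (L f) else 0) + d b (L (d a (n b) * f))" for b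
      using f by (auto simp: distrib_right L_add closed n d.d_add L_closed L_zero d.d_zero)
    ultimately show ?thesis by (simp add: sum.distrib)
  qed
  have "D Jac = (\<Sum>a\<in>UNIV. \<Sum>c\<in>UNIV. ?C a c * d a (D (n c)))"
    by (subst D.d_ldet) (auto simp: Mat_closed D.d_add closed n D.d_one D.d_zero Dd if_distrib[of D]
        intro!: sum.cong)
  also have "\<dots> = (\<Sum>a\<in>UNIV. \<Sum>c\<in>UNIV. d a (?C a c * D (n c)))" (is "?l = ?r")
  proof -
    have "?r = ?l + (\<Sum>a\<in>UNIV. \<Sum>c\<in>UNIV. D (n c) * d a (?C a c))"
      by (simp add: d.d_mult C DS n sum.distrib)
    also have "(\<Sum>a\<in>UNIV. \<Sum>c\<in>UNIV. D (n c) * d a (?C a c)) = 0"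
      by (subst sum.swap) (simp add: piola flip: sum_distrib_left)
    finally show ?thesis by simp
  qed
  finally have "L (D Jac) = (\<Sum>a\<in>UNIV. \<Sum>c\<in>UNIV. \<Sum>b\<in>UNIV. d b (L (Mat a b * (?C a c * D (n c)))))"
    by (simp add: L_sum closed C DS n Ld)
  also have "\<dots> = (\<Sum>b\<in>UNIV. d b (L (\<Sum>c\<in>UNIV. \<Sum>a\<in>UNIV. Mat a b * ?C a c * D (n c))))"
  proof -
    have "d b (L (\<Sum>c\<in>UNIV. \<Sum>a\<in>UNIV. Mat a b * ?C a c * D (n c))) =
      (\<Sum>c\<in>UNIV. \<Sum>a\<in>UNIV. d b (L (Mat a b * (?C a c * D (n c)))))" for b
      by (simp add: L_sum d.d_sum closed C DS n Mat_closed L_closed mult.assoc del: distrib_left)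
    then show ?thesis by (simp, subst sum.swap, subst (2) sum.swap, subst sum.swap) simp
  qed
  also have "\<dots> = (\<Sum>b\<in>UNIV. d b (L (D (n b) * Jac)))"
  proof -
    have "(\<Sum>c\<in>UNIV. \<Sum>a\<in>UNIV. Mat a b * ?C a c * D (n c)) = D (n b) * Jac" for b
    proof -
      have "(\<Sum>c\<in>UNIV. \<Sum>a\<in>UNIV. Mat a b * ?C a c * D (n c)) =
          (\<Sum>c\<in>UNIV. (\<Sum>a\<in>UNIV. Mat a b * ?C a c) * D (n c))"
        by (simp add: sum_distrib_right)
      also have "\<dots> = (\<Sum>c\<in>UNIV. (if b = c then Jac * D (n b) else 0))"
      proof (rule sum.cong[OF refl])
        fix c
        have "(\<Sum>a\<in>UNIV. Mat a b * ?C a c) = (if b = c then Jac else 0)"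
          by (rule lcof_column) auto
        then show "(\<Sum>a\<in>UNIV. Mat a b * ?C a c) * D (n c) = (if b = c then Jac * D (n b) else 0)"
          by auto
      qed
      finally show ?thesis by (simp add: mult.commute)
    qed
    then show ?thesis by simp
  qed
  finally show ?thesis by (subst L_derivation[OF D DS Dd DK Jac]) auto
qed

end

end

end

section \<open>Determinants over the even part of a Grassmann algebra\<close>

lemma ldet_transpose:
  assumes I: "finite I"
  shows "ldet I (\<lambda>i j. A j i) = ldet I A"
  unfolding ldet_def
proof (rule sum.reindex_bij_witness[where i = "inv_into UNIV" and j = "inv_into UNIV"])
  fix \<pi> assume "\<pi> \<in> {\<pi>. \<pi> permutes I}"
  then have \<pi>: "\<pi> permutes I" by simp
  show "inv_into UNIV (inv_into UNIV \<pi>) = \<pi>" using \<pi> by (metis permutes_inv_inv)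
  show "inv_into UNIV \<pi> \<in> {\<pi>. \<pi> permutes I}" using \<pi> by (simp add: permutes_inv)
  have "(\<Prod>i\<in>I. A i (inv_into UNIV \<pi> i)) = (\<Prod>i\<in>I. A (\<pi> i) (inv_into UNIV \<pi> (\<pi> i)))"
    by (rule prod.permute[OF \<pi>, unfolded o_def])
  also have "\<dots> = (\<Prod>i\<in>I. A (\<pi> i) i)" using \<pi> by (simp add: permutes_inverses)
  finally show "of_int (sign (inv_into UNIV \<pi>)) * (\<Prod>i\<in>I. A i (inv_into UNIV \<pi> i)) =
      of_int (sign \<pi>) * (\<Prod>i\<in>I. A (\<pi> i) i)"
    using sign_inverse[OF permutes_imp_permutation[OF I \<pi>]] by simp
qed (metis mem_Collect_eq permutes_inv_inv, simp add: permutes_inv)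

lemma ldet_cong:
  assumes "\<And>i j. i \<in> I \<Longrightarrow> j \<in> I \<Longrightarrow> A i j = B i j"
  shows "ldet I A = ldet I B"
  unfolding ldet_def
  by (intro sum.cong refl arg_cong2[where f = "(*)"] prod.cong) (auto intro!: assms simp: permutes_in_image)

lemma ldet_identity:
  assumes "finite I" "\<And>i j. i \<in> I \<Longrightarrow> j \<in> I \<Longrightarrow> A i j = (if i = j then 1 else 0)"
  shows "ldet I A = 1"
proof -
  have "of_int (sign \<pi>) * (\<Prod>i\<in>I. A i (\<pi> i)) = (if \<pi> = id then 1 else 0)" if \<pi>: "\<pi> permutes I" for \<pi>
  proof (cases "\<pi> = id")
    case False
    then obtain i where "\<pi> i \<noteq> i" by (auto simp: fun_eq_iff)
    then have "i \<in> I" "\<pi> i \<in> I" "\<pi> i \<noteq> i" using \<pi> by (auto simp: permutes_def permutes_in_image)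
    then have "(\<Prod>i\<in>I. A i (\<pi> i)) = 0" using assms by (intro prod_zero) (auto intro!: bexI[of _ i])
    then show ?thesis using False by simp
  qed (use assms in auto)
  then have "ldet I A = (\<Sum>\<pi> | \<pi> permutes I. if \<pi> = id then 1 else 0)"
    unfolding ldet_def by (intro sum.cong) auto
  then show ?thesis using assms(1) by (simp add: finite_permutations permutes_id)
qed

lemma eg_prod_list: "eg (\<Prod>i\<in>set xs. f i) = prod_list (map (\<lambda>i. eg (f i)) xs)" if "distinct xs"
  using that by (induction xs) auto

text \<open>Even entries commute, so the ordered products in \<open>gdet\<close> are products over a
  set.\<close>

lemma gdet_eg:
  assumes "finite I" "\<And>i j. i \<in> I \<Longrightarrow> j \<in> I \<Longrightarrow> A i j = eg (B i j)"
  shows "gdet I A = eg (ldet I B)"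
proof -
  have "prod_list (map (\<lambda>i. A i (\<pi> i)) (sorted_list_of_set I)) = eg (\<Prod>i\<in>I. B i (\<pi> i))"
    if "\<pi> permutes I" for \<pi>
  proof -
    have "prod_list (map (\<lambda>i. A i (\<pi> i)) (sorted_list_of_set I)) =
        prod_list (map (\<lambda>i. eg (B i (\<pi> i))) (sorted_list_of_set I))"
      using assms that by (intro arg_cong[where f = prod_list] map_cong) (auto simp: permutes_in_image)
    also have "\<dots> = eg (\<Prod>i\<in>set (sorted_list_of_set I). B i (\<pi> i))"
      by (simp add: eg_prod_list)
    finally show ?thesis using assms(1) by simp
  qed
  then show ?thesis unfolding gdet_def ldet_def by simp
qed

lemma gcoeff_prod_empty: "gcoeff (eg (prod f X)) {} = (\<Prod>x\<in>X. gcoeff (eg (f x)) {})"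
  by (induction X rule: infinite_finite_induct) auto

lemma gcoeff_ldet_empty: "gcoeff (eg (ldet I A)) {} = ldet I (\<lambda>i j. gcoeff (eg (A i j)) {})"
proof -
  have "gcoeff (of_int k) {} = of_int k" for k
    using gcoeff_of_real[of "of_int k" "{}"] by simp
  then show ?thesis by (simp add: ldet_def gcoeff_prod_empty)
qed

section \<open>Products of odd elements and determinants\<close>

text \<open>Both x and y pass m with the same sign, so these two signs cancel and only that of x y =
  - y x remains.\<close>

lemma odd_swap:
  assumes x: "gparity True x" and y: "gparity True y" and m: "gparity d m"
  shows "x * m * y = - (y * m * x)"
proof -
  define s where "s = (if d then -1 else 1 :: real)"
  have a: "m * y = s *\<^sub>R (y * m)" using gparity_commute[OF m y] by (simp add: s_def)
  have b: "x * m = s *\<^sub>R (m * x)" using gparity_commute[OF x m] by (simp add: s_def)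
  have c: "x * y = - (y * x)" using gparity_commute[OF x y] by simp
  have "x * m * y = s *\<^sub>R ((x * y) * m)" by (simp add: mult.assoc a)
  also have "\<dots> = - (s *\<^sub>R (y * (x * m)))" by (simp add: c mult.assoc)
  also have "\<dots> = - (y * m * x)" by (simp add: b mult.assoc s_def)
  finally show ?thesis .
qed

lemma gparity_prod_list:
  "(\<And>x. x \<in> set xs \<Longrightarrow> gparity True x) \<Longrightarrow> gparity (odd (length xs)) (prod_list xs)"
proof (induction xs)
  case (Cons x xs)
  then show ?case using gparity_times[of True x "odd (length xs)" "prod_list xs"] by auto
qed simp

lemma prod_list_expand:
  assumes "distinct js"
  shows "prod_list (map (\<lambda>j. \<Sum>i\<in>X. eg (C i j) * y i) js) =
    (\<Sum>f\<in>PiE (set js) (\<lambda>_. X). eg (\<Prod>j\<in>set js. C (f j) j) * prod_list (map (\<lambda>j. y (f j)) js))"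
  using assms
proof (induction js)
  case (Cons j js)
  define h where "h f js = eg (\<Prod>j\<in>set js. C (f j) j) * prod_list (map (\<lambda>j. y (f j)) js)" for f js
  have e: "h (f(j := i)) (j # js) = eg (C i j) * y i * h f js" for i f
  proof -
    have "(\<Prod>k\<in>set js. C ((f(j := i)) k) k) = (\<Prod>k\<in>set js. C (f k) k)"
      and m: "map (\<lambda>k. y ((f(j := i)) k)) js = map (\<lambda>k. y (f k)) js"
      using Cons.prems by (auto intro!: prod.cong)
    then have p: "(\<Prod>k\<in>set (j # js). C ((f(j := i)) k) k) = C i j * (\<Prod>k\<in>set js. C (f k) k)"
      using Cons.prems by simp
    have "eg P * (y i * R) = y i * (eg P * R)" for P R
      by (simp only: mult.assoc[symmetric] eg_commute[of P "y i"])
    then show ?thesis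
      unfolding h_def p list.map prod_list.Cons m by (simp add: mult.assoc)
  qed
  have "(\<Sum>f\<in>PiE (set (j # js)) (\<lambda>_. X). h f (j # js)) =
      (\<Sum>(i, f)\<in>X \<times> PiE (set js) (\<lambda>_. X). h (f(j := i)) (j # js))"
    unfolding list.set PiE_insert_eq
    by (subst sum.reindex) (use Cons.prems inj_combinator[of j "set js" "\<lambda>_. X"] in \<open>auto simp: split_beta\<close>)
  also have "\<dots> = (\<Sum>i\<in>X. \<Sum>f\<in>PiE (set js) (\<lambda>_. X). eg (C i j) * y i * h f js)"
    by (simp only: e sum.cartesian_product)
  also have "\<dots> = (\<Sum>i\<in>X. eg (C i j) * y i) * (\<Sum>f\<in>PiE (set js) (\<lambda>_. X). h f js)"
    by (rule sum_product[symmetric])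
  finally show ?case using Cons by (simp add: h_def)
qed (simp add: PiE_empty_domain)

context
  fixes q :: nat and y :: "nat \<Rightarrow> grass"
  assumes y: "j < q \<Longrightarrow> gparity True (y j)"
begin

abbreviation "odd_prod f \<equiv> prod_list (map (\<lambda>j. y (f j)) [0..<q])"

lemma odd_prod_swap:
  assumes f: "\<And>j. j < q \<Longrightarrow> f j < q" and ab: "a < b" "b < q"
  shows "odd_prod (f \<circ> Transposition.transpose a b) = - odd_prod f"
proof -
  have "[0..<q] = [0..<a] @ [a..<q]"
    using ab upt_add_eq_append[of 0 a "q - a"] by simp
  also have "[a..<q] = [a..<b] @ [b..<q]"
    using ab upt_add_eq_append[of a b "q - b"] by simp
  finally have s: "[0..<q] = [0..<a] @ (a # [Suc a..<b]) @ (b # [Suc b..<q])"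
    using ab by (simp add: upt_conv_Cons)
  let ?g = "f \<circ> Transposition.transpose a b"
  define P where "P xs = prod_list (map (\<lambda>j. y (f j)) xs)" for xs
  have "gparity (odd (length (map (\<lambda>j. y (f j)) [Suc a..<b]))) (P [Suc a..<b])"
    unfolding P_def by (rule gparity_prod_list) (use ab f y in auto)
  then obtain d where d: "gparity d (P [Suc a..<b])" by blast
  have u: "map (\<lambda>j. y (?g j)) xs = map (\<lambda>j. y (f j)) xs" if "a \<notin> set xs" "b \<notin> set xs" for xs
    using that by (intro map_cong) (auto simp: Transposition.transpose_def)
  have "odd_prod ?g = P [0..<a] * (y (f b) * P [Suc a..<b] * y (f a)) * P [Suc b..<q]"
    unfolding s map_append list.map prod_list.append prod_list.Cons P_def
    using ab by (subst (1 2 3) u) (auto simp: mult.assoc)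
  also have "y (f b) * P [Suc a..<b] * y (f a) = - (y (f a) * P [Suc a..<b] * y (f b))"
    by (rule odd_swap[OF _ _ d]) (use f y ab in auto)
  also have "P [0..<a] * (- (y (f a) * P [Suc a..<b] * y (f b))) * P [Suc b..<q] = - odd_prod f"
    unfolding s by (simp add: P_def mult.assoc)
  finally show ?thesis .
qed

lemma odd_prod_not_inj:
  assumes f: "\<And>j. j < q \<Longrightarrow> f j < q" and ni: "\<not> inj_on f {..<q}"
  shows "odd_prod f = 0"
proof -
  obtain a b where ab: "a < b" "b < q" "f a = f b"
    using ni unfolding inj_on_def by (metis lessThan_iff linorder_neqE_nat)
  have "f \<circ> Transposition.transpose a b = f"
    using ab by (auto simp: fun_eq_iff Transposition.transpose_def)
  then have "odd_prod f = - odd_prod f" using odd_prod_swap[of f, OF f ab(1,2)] by metis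
  then have "2 *\<^sub>R odd_prod f = 0" by (metis add.right_inverse scaleR_2)
  then show ?thesis by simp
qed

lemma odd_prod_permutes:
  assumes "\<pi> permutes {..<q}"
  shows "odd_prod \<pi> = of_int (sign \<pi>) * odd_prod id"
  using finite_lessThan[of q] assms
proof (induction rule: permutes_rev_induct)
  case (swap a b p)
  have f: "p j < q" if "j < q" for j using permutes_in_image[OF swap(4), of j] that by simp
  have "odd_prod (p \<circ> Transposition.transpose a b) = - odd_prod p"
  proof (cases "a < b")
    case True
    then show ?thesis using swap(2) by (intro odd_prod_swap f) auto
  next
    case False
    then have "b < a" using swap(3) by simp
    then have "odd_prod (p \<circ> Transposition.transpose b a) = - odd_prod p"
      using swap(1) by (intro odd_prod_swap f) auto
    then show ?thesis by (simp only: transpose_commute[of a b])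
  qed
  moreover have "sign (p \<circ> Transposition.transpose a b) = - sign p"
    using permutes_transpose_comp[of "{..<q}" p a b] swap by auto
  ultimately show ?case by (simp only: swap(5) of_int_minus mult_minus_left)
qed auto

text \<open>The determinant as the factor by which a linear map acts on the top exterior power:
  after expansion, a repeated factor kills the product, and the remaining choices are the
  permutations. The y_j may be any odd elements, so that two linear maps can be applied one after
  the other.\<close>

lemma odd_prod_linear:
  "prod_list (map (\<lambda>j. \<Sum>i<q. eg (C i j) * y i) [0..<q]) =
    eg (ldet {..<q} (\<lambda>j i. C i j)) * prod_list (map y [0..<q])"
proof -
  define h where "h f = eg (\<Prod>j<q. C (f j) j) * odd_prod f" for f
  have u: "set [0..<q] = {..<q}" by auto
  have "prod_list (map (\<lambda>j. \<Sum>i<q. eg (C i j) * y i) [0..<q]) = (\<Sum>f\<in>PiE {..<q} (\<lambda>_. {..<q}). h f)"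
    by (subst prod_list_expand) (auto simp: h_def u simp del: set_upt)
  also have "\<dots> = (\<Sum>f\<in>{f \<in> PiE {..<q} (\<lambda>_. {..<q}). inj_on f {..<q}}. h f)"
  proof (rule sum.mono_neutral_right)
    show "\<forall>f\<in>PiE {..<q} (\<lambda>_. {..<q}) - {f \<in> PiE {..<q} (\<lambda>_. {..<q}). inj_on f {..<q}}. h f = 0"
    proof
      fix f assume f: "f \<in> PiE {..<q} (\<lambda>_. {..<q}) - {f \<in> PiE {..<q} (\<lambda>_. {..<q}). inj_on f {..<q}}"
      then have "odd_prod f = 0" by (intro odd_prod_not_inj) (auto simp: PiE_iff)
      then show "h f = 0" by (simp add: h_def)
    qed
  qed (auto intro: finite_PiE)
  also have "\<dots> = (\<Sum>\<pi> | \<pi> permutes {..<q}. h \<pi>)"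
  proof (rule sum.reindex_bij_witness[where i = "\<lambda>\<pi>. restrict \<pi> {..<q}"
        and j = "\<lambda>f i. if i < q then f i else i"])
    fix f assume "f \<in> {f \<in> PiE {..<q} (\<lambda>_. {..<q}). inj_on f {..<q}}"
    then have f: "f \<in> PiE {..<q} (\<lambda>_. {..<q})" "inj_on f {..<q}" by auto
    show "restrict (\<lambda>i. if i < q then f i else i) {..<q} = f"
      using f by (auto simp: fun_eq_iff PiE_iff extensional_def)
    have "f ` {..<q} = {..<q}" using f by (intro endo_inj_surj) auto
    then have "bij_betw (\<lambda>i. if i < q then f i else i) {..<q} {..<q}"
      using f by (auto simp: bij_betw_def inj_on_def image_def)
    then show "(\<lambda>i. if i < q then f i else i) \<in> {\<pi>. \<pi> permutes {..<q}}"
      using bij_imp_permutes[of "\<lambda>i. if i < q then f i else i" "{..<q}"] by auto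
    show "h (\<lambda>i. if i < q then f i else i) = h f"
      unfolding h_def by (intro arg_cong2[where f = "(*)"] arg_cong[where f = eg]
          arg_cong[where f = prod_list] prod.cong map_cong) auto
  next
    fix \<pi> assume "\<pi> \<in> {\<pi>. \<pi> permutes {..<q}}"
    then have \<pi>: "\<pi> permutes {..<q}" by simp
    show "(\<lambda>i. if i < q then restrict \<pi> {..<q} i else i) = \<pi>"
      using \<pi> by (auto simp: fun_eq_iff permutes_def)
    have "\<pi> i < q" if "i < q" for i using \<pi> that by (metis lessThan_iff permutes_in_image)
    then show "restrict \<pi> {..<q} \<in> {f \<in> PiE {..<q} (\<lambda>_. {..<q}). inj_on f {..<q}}"
      using permutes_inj_on[OF \<pi>] by (auto simp: inj_on_restrict_eq)
  qed
  also have "\<dots> = (\<Sum>\<pi> | \<pi> permutes {..<q}. eg (of_int (sign \<pi>) * (\<Prod>j<q. C (\<pi> j) j)) * odd_prod id)"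
  proof (rule sum.cong[OF refl])
    fix \<pi> assume "\<pi> \<in> {\<pi>. \<pi> permutes {..<q}}"
    then have \<pi>: "\<pi> permutes {..<q}" by simp
    have "of_int (sign \<pi>) * eg z = eg z * of_int (sign \<pi>)" for z
      by (cases \<pi> rule: sign_cases) auto
    then show "h \<pi> = eg (of_int (sign \<pi>) * (\<Prod>j<q. C (\<pi> j) j)) * odd_prod id"
      unfolding h_def odd_prod_permutes[OF \<pi>] by (simp add: mult.assoc)
  qed
  finally show ?thesis by (simp add: ldet_def sum_distrib_right)
qed

end

lemma gcoeff_times_gmon: "gcoeff (a * gmon {..<q}) {..<q} = gcoeff a {}"
proof -
  have "gsgn I ({..<q} - I) * gcoeff a I * gcoeff (gmon {..<q}) ({..<q} - I) =
      (if I = {} then gcoeff a {} else 0)" if "I \<subseteq> {..<q}" for I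
    using that by (auto simp: gcoeff_gmon)
  then have "gcoeff (a * gmon {..<q}) {..<q} = (\<Sum>I\<in>Pow {..<q}. if I = {} then gcoeff a {} else 0)"
    unfolding gcoeff_times by (intro sum.cong) auto
  then show ?thesis by simp
qed

text \<open>The image of the monomial \<xi>^I under the substitution of \<theta>_j for \<xi>_j, with
  the factors in increasing order as in \<xi>^I.\<close>

definition thmon :: "(nat \<Rightarrow> grass) \<Rightarrow> nat set \<Rightarrow> grass" where
  "thmon \<theta> I = prod_list (map \<theta> (sorted_list_of_set I))"

lemma sorted_list_of_set_insert_min:
  fixes m :: nat
  assumes "finite I" "\<forall>i\<in>I. m < i"
  shows "sorted_list_of_set (insert m I) = m # sorted_list_of_set I"
proof -
  have "m \<notin> I" using assms(2) by blast
  then have "sorted_list_of_set (insert m I) = insort m (sorted_list_of_set I)"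
    using assms(1) by (simp add: sorted_list_of_set_insert)
  also have "\<dots> = m # sorted_list_of_set I"
    using assms by (intro insort_is_Cons) (auto intro: less_imp_le)
  finally show ?thesis .
qed

lemma thmon_insert:
  assumes "finite I" "\<forall>i\<in>I. m < i"
  shows "thmon \<theta> (insert m I) = \<theta> m * thmon \<theta> I"
  by (simp add: thmon_def sorted_list_of_set_insert_min[OF assms])

lemma thmon_empty [simp]: "thmon \<theta> {} = 1"
  by (simp add: thmon_def)

lemma thmon_ggen: "finite I \<Longrightarrow> thmon ggen I = gmon I"
proof (induction I rule: finite_linorder_min_induct)
  case (insert m I)
  then show ?case using gmon_insert[of I m] by (simp add: thmon_insert)
qed simp

lemma thmon_full: "thmon \<theta> {..<q} = prod_list (map \<theta> [0..<q])"
  by (simp add: thmon_def lessThan_atLeast0)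

text \<open>Put y = B \<xi>, so that A y = \<xi>. Two applications of \<open>odd_prod_linear\<close>
  give det A det B \<mu> = \<mu> for the top monomial \<mu>. The top coefficient of c \<mu> is the
  body of c, which is all that is claimed and enough to make det A invertible.\<close>

lemma ldet_inverse_body:
  fixes A B :: "nat \<Rightarrow> nat \<Rightarrow> egrass"
  assumes AB: "\<And>i j. i < q \<Longrightarrow> j < q \<Longrightarrow> (\<Sum>k<q. A i k * B k j) = (if i = j then 1 else 0)"
  shows "gcoeff (eg (ldet {..<q} A)) {} * gcoeff (eg (ldet {..<q} B)) {} = 1"
proof -
  define y where "y k = (\<Sum>m<q. eg (B k m) * ggen m)" for k
  have y: "gparity True (y k)" for k
    unfolding y_def using gparity_times[OF gparity_eg gparity_ggen] by (intro gparity_sum) simp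
  have Y: "prod_list (map y [0..<q]) = eg (ldet {..<q} B) * gmon {..<q}"
    using odd_prod_linear[of q ggen "\<lambda>m k. B k m"]
    by (simp add: y_def[abs_def] gparity_ggen thmon_full[symmetric] thmon_ggen)
  have *: "(\<Sum>k<q. eg (A i k) * y k) = ggen i" if "i < q" for i
  proof -
    have "(\<Sum>k<q. eg (A i k) * y k) = (\<Sum>k<q. \<Sum>m<q. eg (A i k * B k m) * ggen m)"
      by (simp add: y_def sum_distrib_left mult.assoc)
    also have "\<dots> = (\<Sum>m<q. eg (\<Sum>k<q. A i k * B k m) * ggen m)"
      by (subst sum.swap) (simp add: sum_distrib_right)
    also have "\<dots> = (\<Sum>m<q. if i = m then ggen i else 0)"
      by (intro sum.cong refl) (use AB[OF that] in auto)
    finally show ?thesis using that by simp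
  qed
  have "map (\<lambda>i. \<Sum>k<q. eg (A i k) * y k) [0..<q] = map ggen [0..<q]"
    using * by (intro map_cong) auto
  then have "gmon {..<q} = prod_list (map (\<lambda>i. \<Sum>k<q. eg (A i k) * y k) [0..<q])"
    by (simp only: thmon_full[symmetric] thmon_ggen[OF finite_lessThan])
  also have "\<dots> = eg (ldet {..<q} A) * (eg (ldet {..<q} B) * gmon {..<q})"
    using odd_prod_linear[of q y "\<lambda>k i. A i k"] y by (simp add: Y)
  finally have "gcoeff (eg (ldet {..<q} A) * eg (ldet {..<q} B) * gmon {..<q}) {..<q} =
      gcoeff (gmon {..<q}) {..<q}" by (simp add: mult.assoc)
  then show ?thesis by (simp add: gcoeff_times_gmon) (simp add: gcoeff_gmon)
qed

text \<open>A Neumann series; \<open>1 - a / r\<close> is nilpotent when \<open>r\<close> is the body of \<open>a\<close>.\<close>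

definition grecip :: "nat \<Rightarrow> grass \<Rightarrow> grass" where
  "grecip q a = (1 / gcoeff a {}) *\<^sub>R (\<Sum>k\<le>q. (1 - (1 / gcoeff a {}) *\<^sub>R a) ^ k)"

lemma gdeg_ge_power: "gdeg_ge 1 a \<Longrightarrow> gdeg_ge k (a ^ k)"
  by (induction k) (use gdeg_ge_times[of 1] in auto)

lemma gens_power: "gens q a \<Longrightarrow> gens q (a ^ k)"
  by (induction k) (auto intro: gens_times)

lemma gparity_power: "gparity False a \<Longrightarrow> gparity False (a ^ k)"
  by (induction k) (use gparity_times[of False _ False] in auto)

lemma grecip:
  assumes a: "gens q a" and b: "gcoeff a {} \<noteq> 0"
  shows "a * grecip q a = 1" "grecip q a * a = 1"
proof -
  define r N where "r = gcoeff a {}" and "N = 1 - (1 / r) *\<^sub>R a"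
  have "gdeg_ge 1 N"
    unfolding gdeg_ge_def
  proof (intro allI impI)
    fix I :: "nat set" assume "card I < 1"
    then have "I = {} \<or> infinite I" by auto
    then show "gcoeff N I = 0" using b by (auto simp: N_def r_def)
  qed
  then have "gdeg_ge (Suc q) (N ^ Suc q)" by (rule gdeg_ge_power)
  moreover have "gens q (N ^ Suc q)"
    unfolding N_def by (intro gens_power gens_diff gens_one gens_scaleR a)
  ultimately have N0: "N ^ Suc q = 0" by (intro gens_gdeg_ge_eq_0) auto
  have ae: "a = r *\<^sub>R (1 - N)" using b by (simp add: N_def r_def)
  have "(1 - N) * (\<Sum>k\<le>m. N ^ k) = 1 - N ^ Suc m \<and> (\<Sum>k\<le>m. N ^ k) * (1 - N) = 1 - N ^ Suc m" for m
  proof (induction m)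
    case (Suc m)
    have "(1 - N) * N ^ Suc m = N ^ Suc m - N ^ Suc (Suc m)"
      by (simp add: left_diff_distrib)
    moreover have "N ^ Suc m * (1 - N) = N ^ Suc m - N ^ Suc (Suc m)"
      by (simp only: right_diff_distrib mult_1_right power_Suc2)
    ultimately show ?case using Suc by (simp only: sum.atMost_Suc distrib_left distrib_right) simp
  qed auto
  from this[of q] N0
  have "(1 - N) * (\<Sum>k\<le>q. N ^ k) = 1" "(\<Sum>k\<le>q. N ^ k) * (1 - N) = 1" by auto
  moreover have g: "grecip q a = (1 / r) *\<^sub>R (\<Sum>k\<le>q. N ^ k)" by (simp add: grecip_def N_def r_def)
  moreover have "r \<noteq> 0" using b by (simp add: r_def)
  ultimately show "a * grecip q a = 1" "grecip q a * a = 1"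
    unfolding g by (subst ae; simp)+
qed

lemma gparity_grecip: "gparity False a \<Longrightarrow> gparity False (grecip q a)"
  unfolding grecip_def by (intro gparity_scaleR gparity_sum gparity_power gparity_diff gparity_one)

lemma gens_grecip: "gens q a \<Longrightarrow> gens q (grecip q a)"
  unfolding grecip_def by (intro gens_scaleR gens_sum gens_power gens_diff gens_one)

section \<open>Inverse matrices\<close>

text \<open>The body of det V is not 0 by \<open>ldet_inverse_body\<close>, so det V is a unit.
  Multiplying V C = 1 by the adjugate shows that the adjugate is det V times C, and the adjugate
  commutes with V up to the same unit.\<close>

lemma egrass_right_inverse_left:
  fixes V C :: "nat \<Rightarrow> nat \<Rightarrow> egrass"
  assumes VC: "\<And>i j. i < q \<Longrightarrow> j < q \<Longrightarrow> (\<Sum>k<q. V i k * C k j) = (if i = j then 1 else 0)"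
    and g: "\<And>i j. i < q \<Longrightarrow> j < q \<Longrightarrow> gens q (eg (V i j))"
    and ij: "i < q" "j < q"
  shows "(\<Sum>k<q. C i k * V k j) = (if i = j then 1 else 0)"
proof -
  define D where "D = ldet {..<q} V"
  \<comment> \<open>The zero derivation is interpreted here for the sake of
    \<open>ldet_closed\<close>: determinants involve no generators other than those of the
    entries.\<close>
  interpret G: ring_derivation "{a. gens q (eg a)}" "\<lambda>_. 0 :: egrass" "(*)"
    by unfold_locales (auto intro: gens_diff gens_times simp: algebra_simps)
  have "D \<in> {a. gens q (eg a)}" unfolding D_def by (rule G.ldet_closed) (use g in auto)
  then have gD: "gens q (eg D)" by simp
  have bD: "gcoeff (eg D) {} \<noteq> 0" using ldet_inverse_body[of q V C] VC by (auto simp: D_def)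
  define D' where "D' = Eg (grecip q (eg D))"
  have D': "D * D' = 1" by (rule egrass_eqI)
    (simp add: D'_def eg_Eg gparity_grecip grecip(1)[OF gD bD])
  have adj: "(\<Sum>a<q. lcof {..<q} V a c * V a b) = (if b = c then D else 0)" if "b < q" "c < q" for b c
    using lcof_column[of "{..<q}" b c V] that by (simp add: D_def mult.commute)
  have "lcof {..<q} V k i = D * C i k" if "k < q" for k
  proof -
    have "lcof {..<q} V k i = (\<Sum>a<q. lcof {..<q} V a i * (\<Sum>b<q. V a b * C b k))"
      using that VC by (simp add: if_distrib[of "\<lambda>x. _ * x"] cong: if_cong)
    also have "\<dots> = (\<Sum>b<q. (\<Sum>a<q. lcof {..<q} V a i * V a b) * C b k)"
      by (simp add: sum_distrib_left sum_distrib_right mult.assoc) (rule sum.swap)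
    also have "\<dots> = (\<Sum>b<q. if b = i then D * C i k else 0)"
      using adj ij by (intro sum.cong) auto
    finally show ?thesis using ij by simp
  qed
  then have "D * (\<Sum>k<q. C i k * V k j) = (if j = i then D else 0)"
    using adj[OF ij(2,1)] by (simp add: sum_distrib_left mult.assoc)
  then have "D' * (D * (\<Sum>k<q. C i k * V k j)) = D' * (if j = i then D else 0)" by simp
  then show ?thesis using D' by (auto simp: mult.assoc[symmetric] mult.commute[of D' D])
qed

lemma ginv_eq:
  assumes "\<And>i j. i < q \<Longrightarrow> j < q \<Longrightarrow> (\<Sum>k<q. A i k * B k j) = (if i = j then 1 else 0)"
    and "\<And>i j. i < q \<Longrightarrow> j < q \<Longrightarrow> (\<Sum>k<q. B i k * A k j) = (if i = j then 1 else 0)"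
  shows "ginv q A = (\<lambda>i j. if i < q \<and> j < q then B i j else 0)"
  unfolding ginv_def
proof (rule the_equality)
  fix C assume C: "(\<forall>i j. \<not> (i < q \<and> j < q) \<longrightarrow> C i j = 0) \<and>
      (\<forall>i<q. \<forall>j<q. (\<Sum>k<q. A i k * C k j) = (if i = j then 1 else 0) \<and>
                   (\<Sum>k<q. C i k * A k j) = (if i = j then 1 else 0))"
  show "C = (\<lambda>i j. if i < q \<and> j < q then B i j else 0)"
  proof (intro ext)
    fix i j
    show "C i j = (if i < q \<and> j < q then B i j else 0)"
    proof (cases "i < q \<and> j < q")
      case True
      have "C i j = (\<Sum>k<q. C i k * (\<Sum>l<q. A k l * B l j))"
        using True assms(1) by (simp add: if_distrib[of "\<lambda>x. _ * x"] cong: if_cong)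
      also have "\<dots> = (\<Sum>l<q. (\<Sum>k<q. C i k * A k l) * B l j)"
        by (simp add: sum_distrib_left sum_distrib_right mult.assoc) (rule sum.swap)
      also have "\<dots> = (\<Sum>l<q. if i = l then B i j else 0)"
        using True C by (intro sum.cong) auto
      finally show ?thesis using True by simp
    qed (use C in auto)
  qed
next
  have "(\<Sum>k<q. A i k * (if k < q \<and> j < q then B k j else 0)) = (\<Sum>k<q. A i k * B k j)"
    "(\<Sum>k<q. (if i < q \<and> k < q then B i k else 0) * A k j) = (\<Sum>k<q. B i k * A k j)"
    if "i < q" "j < q" for i j
    using that by (auto intro: sum.cong)
  then show "(\<forall>i j. \<not> (i < q \<and> j < q) \<longrightarrow> (if i < q \<and> j < q then B i j else 0) = 0) \<and>
      (\<forall>i<q. \<forall>j<q. (\<Sum>k<q. A i k * (if k < q \<and> j < q then B k j else 0)) = (if i = j then 1 else 0) \<and>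
        (\<Sum>k<q. (if i < q \<and> k < q then B i k else 0) * A k j) = (if i = j then 1 else 0))"
    using assms by auto
qed

section \<open>Substitution of odd elements\<close>

text \<open>\<partial>_i takes one sign from every factor in front of \<theta>_j; the derivative
  \<partial>_i \<theta>_j itself is even and moves to the front freely.\<close>

lemma gder_thmon:
  assumes "finite I" "\<And>j. j \<in> I \<Longrightarrow> gparity True (\<theta> j)"
  shows "gder i (thmon \<theta> I) =
    (\<Sum>j\<in>I. (-1) ^ card {k \<in> I. k < j} *\<^sub>R (gder i (\<theta> j) * thmon \<theta> (I - {j})))"
  using assms
proof (induction I rule: finite_linorder_min_induct)
  case (insert m I)
  have mI: "m \<notin> I" using insert by blast
  have "gder i (thmon \<theta> (insert m I)) = gder i (\<theta> m) * thmon \<theta> I - \<theta> m * gder i (thmon \<theta> I)"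
    using insert by (simp add: thmon_insert gder_times[of True])
  also have "\<theta> m * gder i (thmon \<theta> I) =
      (\<Sum>j\<in>I. (-1) ^ card {k \<in> I. k < j} *\<^sub>R (\<theta> m * (gder i (\<theta> j) * thmon \<theta> (I - {j}))))"
    using insert by (simp add: sum_distrib_left)
  also have "\<dots> = (\<Sum>j\<in>I. - ((-1) ^ card {k \<in> insert m I. k < j} *\<^sub>R
      (gder i (\<theta> j) * thmon \<theta> (insert m I - {j}))))"
  proof (rule sum.cong[OF refl])
    fix j assume j: "j \<in> I"
    have "{k \<in> insert m I. k < j} = insert m {k \<in> I. k < j}" using j insert by auto
    then have c: "card {k \<in> insert m I. k < j} = Suc (card {k \<in> I. k < j})"
      using insert mI by simp
    have "insert m I - {j} = insert m (I - {j})" using j mI by auto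
    then have t: "thmon \<theta> (insert m I - {j}) = \<theta> m * thmon \<theta> (I - {j})"
      using insert by (simp add: thmon_insert)
    have "gparity False (gder i (\<theta> j))" using gparity_gder[of True] insert.prems j by auto
    then have "\<theta> m * gder i (\<theta> j) = gder i (\<theta> j) * \<theta> m"
      using gparity_commute insert.prems by force
    then show "(-1) ^ card {k \<in> I. k < j} *\<^sub>R (\<theta> m * (gder i (\<theta> j) * thmon \<theta> (I - {j}))) =
        - ((-1) ^ card {k \<in> insert m I. k < j} *\<^sub>R (gder i (\<theta> j) * thmon \<theta> (insert m I - {j})))"
      unfolding c t by (simp add: mult.assoc[symmetric])
  qed
  finally show ?case using insert mI
  proof -
    have "{k. (k = m \<or> k \<in> I) \<and> k < m} = {}" using insert by auto
    then have c0: "card {k. (k = m \<or> k \<in> I) \<and> k < m} = 0" by (simp only: card.empty)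
    moreover have "insert m I - {m} = I" using mI by auto
    moreover assume "gder i (thmon \<theta> (insert m I)) = gder i (\<theta> m) * thmon \<theta> I -
      (\<Sum>j\<in>I. - ((-1) ^ card {k \<in> insert m I. k < j} *\<^sub>R (gder i (\<theta> j) * thmon \<theta> (insert m I - {j}))))"
    ultimately show ?thesis using insert(1) mI by (simp add: sum_negf c0)
  qed
qed simp

text \<open>Substitution at a fixed point of the base, where the coefficients of F are just real
  numbers.\<close>

definition gsubst :: "nat \<Rightarrow> (nat \<Rightarrow> grass) \<Rightarrow> grass \<Rightarrow> grass" where
  "gsubst q \<theta> F = (\<Sum>I\<in>Pow {..<q}. gcoeff F I *\<^sub>R thmon \<theta> I)"

text \<open>The chain rule. Pairs (I, j) with j in I correspond to pairs (j, J) with J = I - {j},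
  and the sign in \<open>gder_thmon\<close> is the one in the coefficient of \<partial>_j F at
  J.\<close>

lemma gder_gsubst:
  assumes \<theta>: "\<And>j. j < q \<Longrightarrow> gparity True (\<theta> j)"
  shows "gder i (gsubst q \<theta> F) = (\<Sum>j<q. gder i (\<theta> j) * gsubst q \<theta> (gder j F))"
proof -
  define s where "s j I = (-1 :: real) ^ card {k \<in> I. k < j}" for j :: nat and I
  have "gder i (gsubst q \<theta> F) = (\<Sum>I\<in>Pow {..<q}. \<Sum>j\<in>I.
      (gcoeff F I * s j I) *\<^sub>R (gder i (\<theta> j) * thmon \<theta> (I - {j})))"
    unfolding gsubst_def gder_sum gder_scaleR
  proof (rule sum.cong[OF refl])
    fix I assume "I \<in> Pow {..<q}"
    then have "finite I" "\<And>j. j \<in> I \<Longrightarrow> j < q" by (auto intro: finite_subset)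
    then show "gcoeff F I *\<^sub>R gder i (thmon \<theta> I) =
        (\<Sum>j\<in>I. (gcoeff F I * s j I) *\<^sub>R (gder i (\<theta> j) * thmon \<theta> (I - {j})))"
      using \<theta> by (simp add: gder_thmon scaleR_sum_right s_def)
  qed
  also have "\<dots> = (\<Sum>(I, j)\<in>Sigma (Pow {..<q}) (\<lambda>I. I).
      (gcoeff F I * s j I) *\<^sub>R (gder i (\<theta> j) * thmon \<theta> (I - {j})))"
    by (subst sum.Sigma) (auto intro: finite_subset)
  also have "\<dots> = (\<Sum>(j, J)\<in>(SIGMA j:{..<q}. Pow ({..<q} - {j})).
      gcoeff (gder j F) J *\<^sub>R (gder i (\<theta> j) * thmon \<theta> J))"
  proof (rule sum.reindex_bij_witness[where i = "\<lambda>(j, J). (insert j J, j)" and j = "\<lambda>(I, j). (j, I - {j})"])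
    fix z assume "z \<in> Sigma (Pow {..<q}) (\<lambda>I. I)"
    then obtain I j where z: "z = (I, j)" "I \<subseteq> {..<q}" "j \<in> I" by auto
    have "{k \<in> I - {j}. k < j} = {k \<in> I. k < j}" "insert j (I - {j}) = I" using z by auto
    then show "(case (case z of (I, j) \<Rightarrow> (j, I - {j})) of
        (j, J) \<Rightarrow> gcoeff (gder j F) J *\<^sub>R (gder i (\<theta> j) * thmon \<theta> J)) =
      (case z of (I, j) \<Rightarrow> (gcoeff F I * s j I) *\<^sub>R (gder i (\<theta> j) * thmon \<theta> (I - {j})))"
      by (simp add: z(1) gcoeff_gder s_def mult.commute)
  qed auto
  also have "\<dots> = (\<Sum>j<q. \<Sum>J\<in>Pow ({..<q} - {j}). gcoeff (gder j F) J *\<^sub>R (gder i (\<theta> j) * thmon \<theta> J))"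
    by (subst sum.Sigma) auto
  also have "\<dots> = (\<Sum>j<q. gder i (\<theta> j) * gsubst q \<theta> (gder j F))"
  proof (rule sum.cong[OF refl])
    fix j
    have "gder i (\<theta> j) * gsubst q \<theta> (gder j F) =
        (\<Sum>J\<in>Pow {..<q}. gcoeff (gder j F) J *\<^sub>R (gder i (\<theta> j) * thmon \<theta> J))"
      by (simp add: gsubst_def sum_distrib_left)
    also have "\<dots> = (\<Sum>J\<in>Pow ({..<q} - {j}). gcoeff (gder j F) J *\<^sub>R (gder i (\<theta> j) * thmon \<theta> J))"
      by (rule sum.mono_neutral_right) (auto simp: gcoeff_gder)
    finally show "(\<Sum>J\<in>Pow ({..<q} - {j}). gcoeff (gder j F) J *\<^sub>R (gder i (\<theta> j) * thmon \<theta> J)) =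
      gder i (\<theta> j) * gsubst q \<theta> (gder j F)" ..
  qed
  finally show ?thesis .
qed

section \<open>The Berezinian of a purely odd substitution\<close>

context
  fixes q :: nat and \<theta> :: "nat \<Rightarrow> grass" and V B :: "nat \<Rightarrow> nat \<Rightarrow> egrass"
  assumes \<theta>: "\<And>j. j < q \<Longrightarrow> gparity True (\<theta> j)" "\<And>j. j < q \<Longrightarrow> gens q (\<theta> j)"
    and V: "\<And>i j. j < q \<Longrightarrow> eg (V i j) = gder i (\<theta> j)"
    and VB: "\<And>i j. i < q \<Longrightarrow> j < q \<Longrightarrow> (\<Sum>k<q. V i k * B k j) = (if i = j then 1 else 0)"
    and BV: "\<And>i j. i < q \<Longrightarrow> j < q \<Longrightarrow> (\<Sum>k<q. B i k * V k j) = (if i = j then 1 else 0)"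
begin

lemma gder_derivation: "ring_derivation UNIV (\<lambda>a. gder i (eg a)) (\<lambda>a m. eg a * m)"
  by unfold_locales
    (simp_all add: algebra_simps gder_diff gder_eg_times, metis eg_commute)

text \<open>Piola's identity for odd variables, with the Berezinian det B of the substitution in the
  place of the Jacobian determinant. The derivatives of B and of det B are expressed by \<partial>_i
  V_km = \<partial>_i \<partial>_k \<theta>_m. This is antisymmetric in i and k, so the two double
  sums cancel after summation over i.\<close>

lemma odd_piola:
  assumes l: "l < q"
  shows "(\<Sum>i<q. gder i (eg (ldet {..<q} B * B l i))) = 0"
proof -
  interpret D: ring_derivation UNIV "\<lambda>a. gder i (eg a)" "\<lambda>a m. eg a * m" for i
    by (rule gder_derivation)
  define Q where "Q = ldet {..<q} B"
  define dV where "dV i k m = gder i (eg (V k m))" for i k m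
  have assoc: "eg x * (eg y * z) = eg (x * y) * z" for x y z
    by (simp add: mult.assoc)
  \<comment> \<open>Differentiate B V = 1 and multiply by B from the right.\<close>
  have dB: "gder i (eg (B l j)) = - (\<Sum>m<q. \<Sum>k<q. eg (B m j * B l k) * dV i k m)"
    if l: "l < q" and j: "j < q" for i l j
  proof -
    define g where "g k = gder i (eg (B l k))" for k
    have z: "(\<Sum>k<q. eg (B l k) * dV i k m) + (\<Sum>k<q. eg (V k m) * g k) = 0"
      if m: "m < q" for m
    proof -
      have "gder i (eg (\<Sum>k<q. B l k * V k m)) = (\<Sum>k<q. gder i (eg (B l k * V k m)))"
        by (rule D.d_sum) simp
      also have "\<dots> = (\<Sum>k<q. eg (B l k) * dV i k m + eg (V k m) * g k)"
        by (simp only: D.d_mult UNIV_I dV_def g_def)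
      also have "gder i (eg (\<Sum>k<q. B l k * V k m)) = 0"
        unfolding BV[OF l m] by simp
      finally show ?thesis by (simp add: sum.distrib)
    qed
    have "0 = (\<Sum>m<q. eg (B m j) * ((\<Sum>k<q. eg (B l k) * dV i k m) + (\<Sum>k<q. eg (V k m) * g k)))"
      by (rule sym, rule sum.neutral) (simp add: z del: sum.lessThan_Suc)
    also have "\<dots> = (\<Sum>m<q. \<Sum>k<q. eg (B m j * B l k) * dV i k m) +
        (\<Sum>m<q. \<Sum>k<q. eg (B m j * V k m) * g k)"
      by (simp only: distrib_left sum.distrib sum_distrib_left assoc)
    also have "(\<Sum>m<q. \<Sum>k<q. eg (B m j * V k m) * g k) = (\<Sum>k<q. \<Sum>m<q. eg (V k m * B m j) * g k)"
      by (subst sum.swap) (simp only: mult.commute[of "B _ j"])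
    also have "\<dots> = (\<Sum>k<q. eg (\<Sum>m<q. V k m * B m j) * g k)"
      by (simp only: sum_distrib_right eg_sum)
    also have "\<dots> = (\<Sum>k<q. if k = j then g j else 0)"
      by (rule sum.cong[OF refl]) (subst VB, use j in auto)
    finally show ?thesis using j by (simp add: g_def eq_neg_iff_add_eq_0 add.commute)
  qed
  \<comment> \<open>As V inverts B, the cofactors of B are the entries of V times det B.\<close>
  have cof: "lcof {..<q} B a c = V c a * Q" if "a < q" "c < q" for a c
  proof -
    have "lcof {..<q} B a c = (\<Sum>k<q. (if k = a then 1 else 0) * lcof {..<q} B k c)"
      using that by (simp add: if_distrib[of "\<lambda>x. x * _"] cong: if_cong)
    also have "\<dots> = (\<Sum>k<q. (\<Sum>b<q. B k b * V b a) * lcof {..<q} B k c)"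
      by (rule sum.cong[OF refl]) (subst BV, use that in auto)
    also have "\<dots> = (\<Sum>k<q. \<Sum>b<q. V b a * (B k b * lcof {..<q} B k c))"
      by (simp only: sum_distrib_left sum_distrib_right mult.assoc mult.left_commute)
    also have "\<dots> = (\<Sum>b<q. V b a * (\<Sum>k<q. B k b * lcof {..<q} B k c))"
      by (subst sum.swap) (simp only: sum_distrib_left)
    also have "\<dots> = (\<Sum>b<q. if b = c then V c a * Q else 0)"
      by (rule sum.cong[OF refl], subst lcof_column) (use that in \<open>auto simp: Q_def\<close>)
    finally show ?thesis using that by simp
  qed
  \<comment> \<open>Jacobi's formula for det B, with \<open>cof\<close> and \<open>dB\<close>
    inserted; the sum over c collapses by B V = 1.\<close>
  have dQ: "gder i (eg Q) = - (\<Sum>m<q. \<Sum>k<q. eg (Q * B m k) * dV i k m)" for i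
  proof -
    have "gder i (eg Q) = (\<Sum>a<q. \<Sum>c<q. eg (lcof {..<q} B a c) * gder i (eg (B a c)))"
      unfolding Q_def by (rule D.d_ldet) auto
    also have "\<dots> = (\<Sum>a<q. \<Sum>c<q. - (\<Sum>m<q. \<Sum>k<q. eg (Q * (B a k * (B m c * V c a))) * dV i k m))"
    proof (intro sum.cong refl)
      fix a c assume ac: "a \<in> {..<q}" "c \<in> {..<q}"
      have "V c a * Q * (B m c * B a k) = Q * (B a k * (B m c * V c a))" for m k
        by (simp add: mult_ac)
      then show "eg (lcof {..<q} B a c) * gder i (eg (B a c)) =
          - (\<Sum>m<q. \<Sum>k<q. eg (Q * (B a k * (B m c * V c a))) * dV i k m)"
        using ac by (simp only: lessThan_iff cof dB mult_minus_right sum_distrib_left assoc)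
    qed
    also have "\<dots> = - (\<Sum>a<q. \<Sum>c<q. \<Sum>m<q. \<Sum>k<q. eg (Q * (B a k * (B m c * V c a))) * dV i k m)"
      by (simp only: sum_negf)
    also have "(\<Sum>a<q. \<Sum>c<q. \<Sum>m<q. \<Sum>k<q. eg (Q * (B a k * (B m c * V c a))) * dV i k m) =
        (\<Sum>a<q. \<Sum>m<q. \<Sum>k<q. \<Sum>c<q. eg (Q * (B a k * (B m c * V c a))) * dV i k m)"
      by (rule sum.cong[OF refl], subst sum.swap, rule sum.cong[OF refl], rule sum.swap)
    also have "\<dots> = (\<Sum>a<q. \<Sum>m<q. \<Sum>k<q. eg (Q * (B a k * (\<Sum>c<q. B m c * V c a))) * dV i k m)"
      by (simp only: sum_distrib_left sum_distrib_right eg_sum)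
    also have "\<dots> = (\<Sum>a<q. \<Sum>m<q. if m = a then (\<Sum>k<q. eg (Q * B a k) * dV i k a) else 0)"
      by (intro sum.cong refl, subst BV) auto
    finally show ?thesis by simp
  qed
  define W where "W i m k = eg (Q * (B m i * B l k)) * dV i k m" for i m k
  have swap: "(\<Sum>i<q. \<Sum>m<q. \<Sum>k<q. W k m i) = (\<Sum>i<q. \<Sum>m<q. \<Sum>k<q. W i m k)"
  proof -
    have "(\<Sum>i<q. \<Sum>m<q. \<Sum>k<q. W k m i) = (\<Sum>m<q. \<Sum>i<q. \<Sum>k<q. W k m i)" by (rule sum.swap)
    also have "\<dots> = (\<Sum>m<q. \<Sum>k<q. \<Sum>i<q. W k m i)"
      by (rule sum.cong[OF refl]) (rule sum.swap)
    also have "\<dots> = (\<Sum>k<q. \<Sum>m<q. \<Sum>i<q. W k m i)" by (rule sum.swap)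
    finally show ?thesis .
  qed
  have "gder i (eg (Q * B l i)) = (\<Sum>m<q. \<Sum>k<q. W k m i) - (\<Sum>m<q. \<Sum>k<q. W i m k)"
    if i: "i < q" for i
  proof -
    have 1: "eg Q * gder i (eg (B l i)) = - (\<Sum>m<q. \<Sum>k<q. W i m k)"
      by (simp only: dB[OF l i] W_def mult_minus_right sum_distrib_left assoc)
    have "eg (B l i) * gder i (eg Q) = - (\<Sum>m<q. \<Sum>k<q. eg (B l i * (Q * B m k)) * dV i k m)"
      by (simp only: dQ mult_minus_right sum_distrib_left assoc)
    also have "\<dots> = - (\<Sum>m<q. \<Sum>k<q. - W k m i)"
    proof (intro arg_cong[where f = uminus] sum.cong refl)
      fix m k assume "m \<in> {..<q}"
      then have "dV i k m = - dV k i m" by (simp add: dV_def V gder_gder[of i k])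
      moreover have "B l i * (Q * B m k) = Q * (B m k * B l i)" by (simp add: mult_ac)
      ultimately show "eg (B l i * (Q * B m k)) * dV i k m = - W k m i"
        by (simp only: W_def mult_minus_right)
    qed
    finally have 2: "eg (B l i) * gder i (eg Q) = (\<Sum>m<q. \<Sum>k<q. W k m i)"
      by (simp only: sum_negf minus_minus)
    have "gder i (eg (Q * B l i)) = eg Q * gder i (eg (B l i)) + eg (B l i) * gder i (eg Q)"
      by (rule D.d_mult) auto
    then show ?thesis unfolding 1 2 by simp
  qed
  then have "(\<Sum>i<q. gder i (eg (Q * B l i))) =
      (\<Sum>i<q. (\<Sum>m<q. \<Sum>k<q. W k m i) - (\<Sum>m<q. \<Sum>k<q. W i m k))"
    by (intro sum.cong refl) auto
  also have "\<dots> = 0" using swap by (simp only: sum_subtractf) simp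
  finally show ?thesis by (simp add: Q_def)
qed

lemma top_gder: "i < q \<Longrightarrow> gcoeff (gder i h) {..<q} = 0"
  by (simp add: gcoeff_gder)

text \<open>The derivation \<Sum>_i B_li \<partial>_i is \<partial>/\<partial>\<theta>_l, so for l
  not in I it takes the monomial of I \<union> {l} to that of I, up to sign. By
  \<open>odd_piola\<close> the product of this with det B is a sum of derivatives \<partial>_i, and
  no such derivative contains \<xi>_i.\<close>

lemma top_thmon:
  assumes I: "I \<subseteq> {..<q}" "I \<noteq> {..<q}"
  shows "gcoeff (thmon \<theta> I * eg (ldet {..<q} B)) {..<q} = 0"
proof -
  obtain l where l: "l < q" "l \<notin> I" using I by auto
  define J where "J = insert l I"
  define s where "s j = (-1 :: real) ^ card {k \<in> J. k < j}" for j
  define Q where "Q = ldet {..<q} B"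
  have J: "finite J" "J \<subseteq> {..<q}" "J - {l} = I" using I l by (auto simp: J_def intro: finite_subset)
  have "(\<Sum>i<q. eg (B l i) * gder i (thmon \<theta> J)) =
      (\<Sum>i<q. \<Sum>j\<in>J. s j *\<^sub>R (eg (B l i * V i j) * thmon \<theta> (J - {j})))"
  proof (rule sum.cong[OF refl])
    fix i
    have "eg (B l i) * gder i (thmon \<theta> J) =
        (\<Sum>j\<in>J. s j *\<^sub>R (eg (B l i) * (gder i (\<theta> j) * thmon \<theta> (J - {j}))))"
      by (subst gder_thmon) (use J \<theta> in \<open>auto simp: s_def sum_distrib_left\<close>)
    also have "\<dots> = (\<Sum>j\<in>J. s j *\<^sub>R (eg (B l i * V i j) * thmon \<theta> (J - {j})))"
      by (rule sum.cong[OF refl]) (use J V in \<open>auto simp: mult.assoc\<close>)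
    finally show "eg (B l i) * gder i (thmon \<theta> J) =
      (\<Sum>j\<in>J. s j *\<^sub>R (eg (B l i * V i j) * thmon \<theta> (J - {j})))" .
  qed
  also have "\<dots> = (\<Sum>j\<in>J. s j *\<^sub>R (eg (\<Sum>i<q. B l i * V i j) * thmon \<theta> (J - {j})))"
    by (subst sum.swap) (simp add: sum_distrib_right scaleR_sum_right)
  also have "\<dots> = (\<Sum>j\<in>J. if j = l then s l *\<^sub>R thmon \<theta> I else 0)"
    by (rule sum.cong[OF refl]) (subst BV, use J l in auto)
  also have "\<dots> = s l *\<^sub>R thmon \<theta> I" using J(1) by (simp add: J_def)
  finally have e: "(\<Sum>i<q. eg (B l i) * gder i (thmon \<theta> J)) = s l *\<^sub>R thmon \<theta> I" .
  have "s l *\<^sub>R (eg Q * thmon \<theta> I) = eg Q * (\<Sum>i<q. eg (B l i) * gder i (thmon \<theta> J))"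
    by (simp add: e)
  also have "\<dots> = (\<Sum>i<q. eg (Q * B l i) * gder i (thmon \<theta> J))"
    by (simp add: sum_distrib_left mult.assoc)
  also have "\<dots> = (\<Sum>i<q. gder i (eg (Q * B l i) * thmon \<theta> J)) -
      (\<Sum>i<q. gder i (eg (Q * B l i))) * thmon \<theta> J"
    by (simp only: gder_eg_times sum.distrib sum_distrib_right) simp
  also have "\<dots> = (\<Sum>i<q. gder i (eg (Q * B l i) * thmon \<theta> J))"
    using odd_piola[OF l(1)] by (simp add: Q_def)
  finally have "gcoeff (s l *\<^sub>R (eg Q * thmon \<theta> I)) {..<q} = 0"
    by (simp add: top_gder)
  then show ?thesis by (simp add: s_def Q_def eg_commute[of _ "thmon \<theta> I"])
qed

text \<open>The \<theta>_j are odd and so start in degree 1; in a product of q of them any part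
  beyond the linear one exceeds degree q. The linear parts \<open>lin\<close> contribute the
  determinant of the body of V, and the body of det B is its inverse.\<close>

lemma top_thmon_full: "gcoeff (thmon \<theta> {..<q} * eg (ldet {..<q} B)) {..<q} = 1"
proof -
  define C where "C i j = (of_real (gcoeff (\<theta> j) {i}) :: egrass)" for i j
  define lin where "lin j = (\<Sum>i<q. eg (C i j) * ggen i)" for j
  have C: "gcoeff (eg (V i j)) {} = gcoeff (\<theta> j) {i}" if "j < q" for i j
    by (simp add: V that gcoeff_gder)
  have lc: "gcoeff (lin j) I = (if \<exists>i<q. I = {i} then gcoeff (\<theta> j) I else 0)" for j I
  proof -
    have "gcoeff (lin j) I = (\<Sum>i<q. if I = {i} then gcoeff (\<theta> j) {i} else 0)"
      by (simp add: lin_def C_def) (intro sum.cong refl, auto simp: gcoeff_ggen)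
    also have "\<dots> = (if \<exists>i<q. I = {i} then gcoeff (\<theta> j) I else 0)"
    proof (cases "\<exists>i<q. I = {i}")
      case True
      then obtain i where "i < q" "I = {i}" by auto
      then show ?thesis by auto
    qed auto
    finally show ?thesis .
  qed
  have d1: "gdeg_ge 1 (\<theta> j)" "gdeg_ge 1 (lin j)" "gdeg_ge 2 (\<theta> j - lin j)" if j: "j < q" for j
  proof -
    have z: "gcoeff (\<theta> j) {} = 0" using \<theta>(1)[OF j] by (simp add: gparity_def)
    have e: "I = {}" if "card I < 1" "finite I" for I :: "nat set" using that by simp
    show "gdeg_ge 1 (\<theta> j)" unfolding gdeg_ge_def using z e by (metis gcoeff_infinite)
    show "gdeg_ge 1 (lin j)" unfolding gdeg_ge_def lc using z e by auto
    show "gdeg_ge 2 (\<theta> j - lin j)" unfolding gdeg_ge_def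
    proof (intro allI impI)
      fix I :: "nat set" assume I: "card I < 2"
      show "gcoeff (\<theta> j - lin j) I = 0"
      proof (cases "finite I \<and> I \<noteq> {}")
        case True
        then have "card I \<noteq> 0" by auto
        then have "card I = 1" using I by linarith
        then obtain i where i: "I = {i}" by (auto simp: card_1_singleton_iff)
        then show ?thesis using \<theta>(2)[OF j] by (auto simp: lc gens_def)
      qed (use z lc[of j "{}"] in auto)
    qed
  qed
  have deg: "gdeg_ge (length xs) (prod_list (map \<theta> xs)) \<and>
      gdeg_ge (Suc (length xs)) (prod_list (map \<theta> xs) - prod_list (map lin xs))"
    (is "?P xs") if "set xs \<subseteq> {..<q}" for xs
    using that
  proof (induction xs)
    case (Cons j xs)
    have j: "j < q" using Cons by simp
    have IH: "gdeg_ge (length xs) (prod_list (map \<theta> xs))"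
      "gdeg_ge (Suc (length xs)) (prod_list (map \<theta> xs) - prod_list (map lin xs))"
      using Cons by auto
    have "prod_list (map \<theta> (j # xs)) - prod_list (map lin (j # xs)) =
        (\<theta> j - lin j) * prod_list (map \<theta> xs) + lin j * (prod_list (map \<theta> xs) - prod_list (map lin xs))"
      by (simp add: algebra_simps)
    then show ?case
      using gdeg_ge_times[OF d1(1)[OF j] IH(1)] gdeg_ge_times[OF d1(3)[OF j] IH(1)]
        gdeg_ge_times[OF d1(2)[OF j] IH(2)] by (auto intro: gdeg_ge_add)
  qed simp
  have "?P [0..<q]" by (rule deg) auto
  then have "gdeg_ge (Suc q) (thmon \<theta> {..<q} - prod_list (map lin [0..<q]))"
    by (auto simp: thmon_full)
  then have "gdeg_ge (Suc q) ((thmon \<theta> {..<q} - prod_list (map lin [0..<q])) * eg (ldet {..<q} B))"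
    using gdeg_ge_times[of "Suc q" _ 0] by simp
  then have "gcoeff ((thmon \<theta> {..<q} - prod_list (map lin [0..<q])) * eg (ldet {..<q} B)) {..<q} = 0"
    by (simp add: gdeg_ge_def)
  then have "gcoeff (thmon \<theta> {..<q} * eg (ldet {..<q} B)) {..<q} =
      gcoeff (prod_list (map lin [0..<q]) * eg (ldet {..<q} B)) {..<q}"
    by (simp add: left_diff_distrib)
  also have "prod_list (map lin [0..<q]) = eg (ldet {..<q} (\<lambda>j i. C i j)) * gmon {..<q}"
    using odd_prod_linear[of q ggen C]
    by (simp add: lin_def[abs_def] gparity_ggen thmon_full[symmetric] thmon_ggen)
  also have "ldet {..<q} (\<lambda>j i. C i j) = ldet {..<q} C" by (rule ldet_transpose) simp
  also have "eg (ldet {..<q} C) * gmon {..<q} * eg (ldet {..<q} B) =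
      eg (ldet {..<q} C) * eg (ldet {..<q} B) * gmon {..<q}"
    using eg_commute[of "ldet {..<q} B" "gmon {..<q}"] by (simp only: mult.assoc)
  also have "gcoeff \<dots> {..<q} = gcoeff (eg (ldet {..<q} C)) {} * gcoeff (eg (ldet {..<q} B)) {}"
    by (simp add: gcoeff_times_gmon)
  also have "gcoeff (eg (ldet {..<q} C)) {} = gcoeff (eg (ldet {..<q} V)) {}"
    unfolding gcoeff_ldet_empty by (rule ldet_cong) (simp add: C_def C)
  finally show ?thesis using ldet_inverse_body[of q V B] VB by simp
qed

text \<open>Monomial by monomial, only the top one survives: odd integration is invariant under odd
  substitutions when det B serves as the density factor.\<close>

theorem top_gsubst: "gcoeff (gsubst q \<theta> F * eg (ldet {..<q} B)) {..<q} = gcoeff F {..<q}"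
proof -
  have "gcoeff (gsubst q \<theta> F * eg (ldet {..<q} B)) {..<q} =
      (\<Sum>I\<in>Pow {..<q}. gcoeff F I * gcoeff (thmon \<theta> I * eg (ldet {..<q} B)) {..<q})"
    by (simp add: gsubst_def sum_distrib_right)
  also have "\<dots> = (\<Sum>I\<in>Pow {..<q}. if I = {..<q} then gcoeff F {..<q} else 0)"
    by (rule sum.cong[OF refl]) (auto simp: top_thmon top_thmon_full)
  finally show ?thesis by simp
qed

end

section \<open>Smooth functions\<close>

lemma has_derivative_cong_open:
  assumes "open W" "w \<in> W" "\<And>z. z \<in> W \<Longrightarrow> f z = g z"
  shows "(f has_derivative D) (at w) \<longleftrightarrow> (g has_derivative D) (at w)"
  using assms by (metis has_derivative_transform_within_open)

lemma pd_cong: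
  assumes "open W" "w \<in> W" "\<And>z. z \<in> W \<Longrightarrow> f z = g z"
  shows "pd a f w = pd a g w"
  unfolding pd_def frechet_derivative_def using has_derivative_cong_open[OF assms] by simp

lemma pd_eq: "(f has_derivative D) (at w) \<Longrightarrow> pd a f w = D (axis a 1)"
  unfolding pd_def by (metis frechet_derivative_at)

lemma axis_sum: "(\<Sum>b\<in>UNIV. axis a 1 $ b * c b) = (c a :: real)"
  by (simp add: axis_def if_distrib[of "\<lambda>x. x * _"] cong: if_cong)

lemma has_derivative_pd:
  assumes "f differentiable (at w)"
  shows "(f has_derivative (\<lambda>h. \<Sum>a\<in>UNIV. h $ a * pd a f w)) (at w)"
proof -
  obtain D where D: "(f has_derivative D) (at w)" using assms by (auto simp: differentiable_def)
  have "D = (\<lambda>h. \<Sum>a\<in>UNIV. h $ a * pd a f w)"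
  proof
    fix h :: "real ^ 'a"
    interpret bounded_linear D by (rule has_derivative_bounded_linear[OF D])
    have "h = (\<Sum>a\<in>UNIV. (h $ a) *\<^sub>R axis a 1)"
      by (subst basis_expansion[symmetric]) (simp add: scalar_mult_eq_scaleR)
    then have "D h = (\<Sum>a\<in>UNIV. (h $ a) *\<^sub>R D (axis a 1))" by (metis (no_types, lifting) sum scaleR sum.cong)
    then show "D h = (\<Sum>a\<in>UNIV. h $ a * pd a f w)" by (simp add: pd_eq[OF D])
  qed
  then show ?thesis using D by simp
qed

lemma Ck_on_cong:
  assumes "open W" "\<And>z. z \<in> W \<Longrightarrow> f z = g z" "Ck_on k W f"
  shows "Ck_on k W g"
  using assms(2,3)
proof (induction k arbitrary: f g)
  case 0
  then show ?case by (simp cong: continuous_on_cong)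
next
  case (Suc k)
  have "Ck_on k W (pd a g)" for a
  proof (rule Suc.IH[of "pd a f"])
    show "pd a f z = pd a g z" if "z \<in> W" for z
      by (rule pd_cong[OF assms(1) that]) (rule Suc.prems(1))
  qed (use Suc.prems in simp)
  moreover have "g differentiable_on W"
    using Suc.prems has_derivative_cong_open[OF assms(1), of _ f g]
    by (simp add: differentiable_on_eq_differentiable_at[OF assms(1)] differentiable_def)
  ultimately show ?case by simp
qed

lemma Ck_on_differentiable: "open W \<Longrightarrow> Ck_on (Suc k) W f \<Longrightarrow> w \<in> W \<Longrightarrow> f differentiable (at w)"
  by (simp add: differentiable_on_eq_differentiable_at)

lemma Ck_on_Suc: "Ck_on (Suc k) W f \<Longrightarrow> Ck_on k W f"
  by (induction k arbitrary: f) (auto intro: differentiable_imp_continuous_on)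

lemma Ck_on_subset:
  assumes "Ck_on k W f" "V \<subseteq> W"
  shows "Ck_on k V f"
  using assms by (induction k arbitrary: f)
    (auto intro: continuous_on_subset differentiable_on_subset)

lemma pd_const [simp]: "pd a (\<lambda>_. c) w = 0"
  using pd_eq[of "\<lambda>_. c" "\<lambda>_. 0"] by simp

lemma pd_add: "f differentiable (at w) \<Longrightarrow> g differentiable (at w) \<Longrightarrow>
    pd a (\<lambda>z. f z + g z) w = pd a f w + pd a g w"
  by (rule trans[OF pd_eq[OF has_derivative_add[OF has_derivative_pd has_derivative_pd]]])
    (auto simp: axis_sum)

lemma pd_mult: "f differentiable (at w) \<Longrightarrow> g differentiable (at w) \<Longrightarrow>
    pd a (\<lambda>z. f z * g z) w = f w * pd a g w + pd a f w * g w"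
  by (rule trans[OF pd_eq[OF has_derivative_mult[OF has_derivative_pd has_derivative_pd]]])
    (auto simp: axis_sum)

lemma has_derivative_coord: "((\<lambda>z :: real ^ 'p::finite. z $ b) has_derivative (\<lambda>h. h $ b)) (at w)"
  by (rule bounded_linear_imp_has_derivative) (rule bounded_linear_vec_nth)

lemma pd_coord: "pd a (\<lambda>z. z $ b) w = (if a = b then 1 else 0)"
  by (subst pd_eq[OF has_derivative_coord]) (auto simp: axis_def)

lemma Ck_on_const: "Ck_on k W (\<lambda>_. c)"
proof (induction k arbitrary: c)
  case (Suc k)
  have "pd a (\<lambda>_. c) = (\<lambda>_. 0)" for a :: 'a by (simp add: fun_eq_iff)
  then show ?case using Suc by simp
qed simp

lemma Ck_on_coord: "Ck_on k W (\<lambda>z. z $ b)"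
proof (cases k)
  case 0
  then show ?thesis by (simp add: continuous_on_component)
next
  case (Suc j)
  have "pd a (\<lambda>z. z $ b) = (\<lambda>_. if a = b then 1 else 0)" for a :: 'a
    by (simp add: fun_eq_iff pd_coord)
  moreover have "(\<lambda>z. z $ b) differentiable_on W"
    by (rule bounded_linear_imp_differentiable_on) (rule bounded_linear_vec_nth)
  ultimately show ?thesis using Suc by (simp add: Ck_on_const)
qed

lemma Ck_on_add:
  assumes "open W" "Ck_on k W f" "Ck_on k W g"
  shows "Ck_on k W (\<lambda>z. f z + g z)"
  using assms(2,3)
proof (induction k arbitrary: f g)
  case (Suc k)
  show ?case unfolding Ck_on.simps
  proof (intro conjI allI)
    show "(\<lambda>z. f z + g z) differentiable_on W" using Suc.prems by (simp add: differentiable_on_add)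
    fix a
    show "Ck_on k W (pd a (\<lambda>z. f z + g z))"
    proof (rule Ck_on_cong[OF assms(1)])
      show "Ck_on k W (\<lambda>z. pd a f z + pd a g z)" using Suc.prems by (intro Suc.IH) auto
      show "pd a f z + pd a g z = pd a (\<lambda>z. f z + g z) z" if "z \<in> W" for z
        using Ck_on_differentiable[OF assms(1)] Suc.prems that by (intro pd_add[symmetric]) blast+
    qed
  qed
qed (simp add: continuous_on_add)

lemma Ck_on_mult:
  assumes "open W" "Ck_on k W f" "Ck_on k W g"
  shows "Ck_on k W (\<lambda>z. f z * g z)"
  using assms(2,3)
proof (induction k arbitrary: f g)
  case (Suc k)
  show ?case unfolding Ck_on.simps
  proof (intro conjI allI)
    show "(\<lambda>z. f z * g z) differentiable_on W" using Suc.prems by (simp add: differentiable_on_mult)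
    fix a
    have "Ck_on k W (\<lambda>z. f z * pd a g z + pd a f z * g z)"
      by (intro Ck_on_add[OF assms(1)] Suc.IH Ck_on_Suc[OF Suc.prems(1)] Ck_on_Suc[OF Suc.prems(2)])
        (use Suc.prems in simp_all)
    then show "Ck_on k W (pd a (\<lambda>z. f z * g z))"
    proof (rule Ck_on_cong[OF assms(1), rotated])
      show "f z * pd a g z + pd a f z * g z = pd a (\<lambda>z. f z * g z) z" if "z \<in> W" for z
        using Ck_on_differentiable[OF assms(1)] Suc.prems that by (intro pd_mult[symmetric]) blast+
    qed
  qed
qed (simp add: continuous_on_mult)

lemma Ck_on_inverse:
  assumes W: "open W" and "Ck_on k W f" and nz: "\<And>z. z \<in> W \<Longrightarrow> f z \<noteq> 0"
  shows "Ck_on k W (\<lambda>z. inverse (f z))"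
  using assms(2)
proof (induction k)
  case (Suc k)
  show ?case unfolding Ck_on.simps
  proof (intro conjI allI)
    show "(\<lambda>z. inverse (f z)) differentiable_on W"
      using Suc.prems nz by (auto simp: differentiable_on_def intro!: differentiable_inverse)
    fix a
    have "Ck_on k W (\<lambda>z. - 1 * ((inverse (f z) * inverse (f z)) * pd a f z))"
      by (intro Ck_on_mult[OF W] Ck_on_const Suc.IH Ck_on_Suc[OF Suc.prems])
        (use Suc.prems in simp_all)
    then show "Ck_on k W (pd a (\<lambda>z. inverse (f z)))"
    proof (rule Ck_on_cong[OF W, rotated])
      fix w assume w: "w \<in> W"
      have "f differentiable (at w)" by (rule Ck_on_differentiable[OF W Suc.prems w])
      from pd_eq[OF Deriv.has_derivative_inverse[OF nz[OF w] has_derivative_pd[OF this]]]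
      show "- 1 * ((inverse (f w) * inverse (f w)) * pd a f w) = pd a (\<lambda>z. inverse (f z)) w"
        by (simp only: axis_sum) (simp add: mult_ac)
    qed
  qed
qed (use nz in \<open>auto intro: continuous_on_inverse\<close>)

lemma Ck_on_local:
  assumes "\<And>w. w \<in> W \<Longrightarrow> \<exists>V. open V \<and> w \<in> V \<and> V \<subseteq> W \<and> Ck_on k V f"
  shows "Ck_on k W f"
  using assms
proof (induction k arbitrary: f)
  case 0
  then show ?case
    by (metis Ck_on.simps(1) continuous_at_imp_continuous_on continuous_on_eq_continuous_at)
next
  case (Suc k)
  have "f differentiable_on W"
    unfolding differentiable_on_def
  proof
    fix w assume "w \<in> W"
    then obtain V where "open V" "w \<in> V" "V \<subseteq> W" "Ck_on (Suc k) V f" using Suc.prems by blast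
    then show "f differentiable at w within W"
      by (meson Ck_on_differentiable differentiable_at_withinI)
  qed
  moreover have "Ck_on k W (pd a f)" for a
    by (rule Suc.IH) (use Suc.prems in fastforce)
  ultimately show ?case by simp
qed

lemma smooth_on_subset: "smooth_on W f \<Longrightarrow> V \<subseteq> W \<Longrightarrow> smooth_on V f"
  and smooth_on_cong: "open W \<Longrightarrow> (\<And>z. z \<in> W \<Longrightarrow> f z = g z) \<Longrightarrow> smooth_on W f \<Longrightarrow> smooth_on W g"
  and smooth_on_const [simp]: "smooth_on W (\<lambda>_. c)"
  and smooth_on_coord [simp]: "smooth_on W (\<lambda>z. z $ b)"
  and smooth_on_add: "open W \<Longrightarrow> smooth_on W f \<Longrightarrow> smooth_on W g \<Longrightarrow> smooth_on W (\<lambda>z. f z + g z)"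
  and smooth_on_mult: "open W \<Longrightarrow> smooth_on W f \<Longrightarrow> smooth_on W g \<Longrightarrow> smooth_on W (\<lambda>z. f z * g z)"
  and smooth_on_inverse: "open W \<Longrightarrow> smooth_on W f \<Longrightarrow> (\<And>z. z \<in> W \<Longrightarrow> f z \<noteq> 0) \<Longrightarrow>
    smooth_on W (\<lambda>z. inverse (f z))"
  and smooth_on_local: "(\<And>w. w \<in> W \<Longrightarrow> \<exists>V. open V \<and> w \<in> V \<and> V \<subseteq> W \<and> smooth_on V f) \<Longrightarrow> smooth_on W f"
  unfolding smooth_on_def
  by (auto intro: Ck_on_subset Ck_on_const Ck_on_coord Ck_on_add Ck_on_mult Ck_on_inverse
      Ck_on_cong[of W f g] Ck_on_local) (meson Ck_on_local)

lemma smooth_on_minus: "open W \<Longrightarrow> smooth_on W f \<Longrightarrow> smooth_on W (\<lambda>z. - f z)"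
  using smooth_on_mult[of W "\<lambda>_. -1" f] by simp

lemma smooth_on_diff: "open W \<Longrightarrow> smooth_on W f \<Longrightarrow> smooth_on W g \<Longrightarrow> smooth_on W (\<lambda>z. f z - g z)"
  using smooth_on_add[OF _ _ smooth_on_minus, of W f g] by simp

lemma smooth_on_sum:
  "open W \<Longrightarrow> (\<And>x. x \<in> X \<Longrightarrow> smooth_on W (f x)) \<Longrightarrow> smooth_on W (\<lambda>z. \<Sum>x\<in>X. f x z)"
  by (induction X rule: infinite_finite_induct) (auto intro: smooth_on_add)

lemma smooth_on_pd: "smooth_on W f \<Longrightarrow> smooth_on W (pd a f)"
  unfolding smooth_on_def by (metis Ck_on.simps(2))

lemma smooth_on_differentiable: "open W \<Longrightarrow> smooth_on W f \<Longrightarrow> w \<in> W \<Longrightarrow> f differentiable (at w)"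
  unfolding smooth_on_def using Ck_on_differentiable by blast

lemma smooth_on_continuous: "smooth_on W f \<Longrightarrow> continuous_on W f"
  unfolding smooth_on_def by (metis Ck_on.simps(1))

lemma pd_sum:
  "finite X \<Longrightarrow> (\<And>x. x \<in> X \<Longrightarrow> f x differentiable (at w)) \<Longrightarrow> pd a (\<lambda>z. \<Sum>x\<in>X. f x z) w = (\<Sum>x\<in>X. pd a (f x) w)"
proof (induction X rule: finite_induct)
  case (insert x X)
  then show ?case by (simp add: pd_add differentiable_sum)
qed simp

lemma pd_cmult: "f differentiable (at w) \<Longrightarrow> pd a (\<lambda>z. c * f z) w = c * pd a f w"
  using pd_mult[of "\<lambda>_. c" w f a] by simp

section \<open>Hadamard's lemma\<close>

text \<open>Differentiation under the integral sign brings out one more factor t by the chain rule,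
  so the induction over the order of differentiability has to allow every power t^m.
  \<open>hadamard\<close> uses m = 0.\<close>

lemma Ck_on_integral_segment:
  fixes g :: "real ^ 'p::finite \<Rightarrow> real"
  assumes "smooth_on (ball w0 r) g"
  shows "Ck_on k (ball w0 r) (\<lambda>w. integral (cbox 0 1) (\<lambda>t. t ^ m * g (w0 + t *\<^sub>R (w - w0))))"
  using assms
proof (induction k arbitrary: g m)
  case IH: (0 g m)
  have mem: "w0 + t *\<^sub>R (w - w0) \<in> ball w0 r" if "w \<in> ball w0 r" "t \<in> cbox 0 1" for w t
  proof -
    have "dist w0 (w0 + t *\<^sub>R (w - w0)) = t * dist w0 w"
      using that by (simp add: dist_norm norm_minus_commute)
    also have "\<dots> \<le> dist w0 w" using that by (simp add: mult_left_le_one_le)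
    finally show ?thesis using that by simp
  qed
  show ?case
    unfolding Ck_on.simps
    by (rule integral_continuous_on_param)
      (auto simp: split_beta intro!: continuous_intros mem
        continuous_on_compose2[OF smooth_on_continuous[OF IH.prems]])
next
  case (Suc k g m)
  let ?B = "ball w0 r"
  have mem: "w0 + t *\<^sub>R (w - w0) \<in> ?B" if "w \<in> ?B" "t \<in> cbox 0 1" for w t
  proof -
    have "dist w0 (w0 + t *\<^sub>R (w - w0)) = t * dist w0 w"
      using that by (simp add: dist_norm norm_minus_commute)
    also have "\<dots> \<le> dist w0 w" using that by (simp add: mult_left_le_one_le)
    finally show ?thesis using that by simp
  qed
  define G where "G a w t = t ^ Suc m * pd a g (w0 + t *\<^sub>R (w - w0))" for a w t
  \<comment> \<open>The rule for parametric integrals asks for the derivative as a bounded linear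
    function that is jointly continuous; it is assembled from the partial derivatives.\<close>
  define F where "F w t = (\<Sum>a\<in>UNIV. G a w t *\<^sub>R blinfun_inner_left (axis a 1 :: real ^ 'p))" for w t
  have contG: "continuous_on (?B \<times> cbox 0 1) (\<lambda>(w, t). G a w t)" for a
    unfolding G_def split_beta
    by (auto intro!: continuous_intros mem
        continuous_on_compose2[OF smooth_on_continuous[OF smooth_on_pd[OF Suc.prems]]])
  have intG: "(G a w) integrable_on cbox 0 1" if "w \<in> ?B" for a w
  proof -
    have "continuous_on (cbox 0 1) (\<lambda>t. (\<lambda>(w, t). G a w t) (w, t))"
      by (rule continuous_on_compose2[OF contG]) (use that in \<open>auto intro!: continuous_intros\<close>)
    then show ?thesis by (simp add: integrable_continuous_real)
  qed
  have der: "((\<lambda>w. integral (cbox 0 1) (\<lambda>t. t ^ m * g (w0 + t *\<^sub>R (w - w0)))) has_derivative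
      integral (cbox 0 1) (F w)) (at w)" if w: "w \<in> ?B" for w
  proof -
    have "((\<lambda>w. integral (cbox 0 1) (\<lambda>t. t ^ m * g (w0 + t *\<^sub>R (w - w0)))) has_derivative
      integral (cbox 0 1) (F w)) (at w within ?B)"
    proof (rule leibniz_rule[OF _ _ _ w convex_ball])
      fix z t assume z: "z \<in> ?B" and t: "t \<in> cbox 0 (1::real)"
      have "g differentiable (at (w0 + t *\<^sub>R (z - w0)))"
        by (rule smooth_on_differentiable[OF open_ball Suc.prems mem[OF z t]])
      note 1 = has_derivative_pd[OF this]
      have 2: "((\<lambda>z. w0 + t *\<^sub>R (z - w0)) has_derivative (\<lambda>h. t *\<^sub>R h)) (at z)"
        by (auto intro!: derivative_eq_intros)
      have "((\<lambda>z. t ^ m * g (w0 + t *\<^sub>R (z - w0))) has_derivative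
          (\<lambda>h. t ^ m * (\<Sum>a\<in>UNIV. (t *\<^sub>R h) $ a * pd a g (w0 + t *\<^sub>R (z - w0))))) (at z)"
        by (intro has_derivative_mult_right has_derivative_compose[OF 2 1])
      also have "(\<lambda>h. t ^ m * (\<Sum>a\<in>UNIV. (t *\<^sub>R h) $ a * pd a g (w0 + t *\<^sub>R (z - w0)))) = blinfun_apply (F z t)"
        by (auto simp: F_def G_def fun_eq_iff blinfun.sum_left blinfun.scaleR_left inner_axis
            sum_distrib_left mult_ac intro!: sum.cong)
      finally show "((\<lambda>z. t ^ m * g (w0 + t *\<^sub>R (z - w0))) has_derivative blinfun_apply (F z t)) (at z within ?B)"
        by (rule has_derivative_at_withinI)
    next
      fix z assume z: "z \<in> ?B"
      show "(\<lambda>t. t ^ m * g (w0 + t *\<^sub>R (z - w0))) integrable_on cbox 0 1"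
        by (rule integrable_continuous)
          (auto intro!: continuous_intros mem z continuous_on_compose2[OF smooth_on_continuous[OF Suc.prems]])
    next
      have "continuous_on (?B \<times> cbox 0 1) (\<lambda>z. \<Sum>a\<in>UNIV. (\<lambda>(w, t). G a w t) z *\<^sub>R blinfun_inner_left (axis a 1 :: real ^ 'p))"
        by (intro continuous_intros contG)
      then show "continuous_on (?B \<times> cbox 0 1) (\<lambda>(w, t). F w t)"
        by (simp add: F_def split_beta)
    qed
    then show ?thesis by (simp only: at_within_open[OF w open_ball])
  qed
  have pd: "pd a (\<lambda>w. integral (cbox 0 1) (\<lambda>t. t ^ m * g (w0 + t *\<^sub>R (w - w0)))) w =
      integral (cbox 0 1) (G a w)" if w: "w \<in> ?B" for a w
  proof -
    have "(F w) integrable_on cbox 0 1"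
      unfolding F_def by (intro integrable_sum integrable_on_scaleR_left intG w) auto
    then have "blinfun_apply (integral (cbox 0 1) (F w)) (axis a 1) =
        integral (cbox 0 1) (\<lambda>t. blinfun_apply (F w t) (axis a 1))"
      using integral_linear[of "F w" "cbox 0 1" "\<lambda>L. blinfun_apply L (axis a 1)"]
      by (simp add: o_def bounded_linear_intros blinfun.bounded_linear_left)
    also have "(\<lambda>t. blinfun_apply (F w t) (axis a 1)) = G a w"
      by (auto simp: F_def fun_eq_iff blinfun.sum_left blinfun.scaleR_left inner_axis_axis
          if_distrib[of "\<lambda>x. _ * x"] cong: if_cong)
    finally show ?thesis using pd_eq[OF der[OF w]] by simp
  qed
  have Ckk: "Ck_on k ?B (\<lambda>w. integral (cbox 0 1) (G a w))" for a
    unfolding G_def[abs_def] by (rule Suc.IH) (rule smooth_on_pd[OF Suc.prems])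
  have "Ck_on k ?B (pd a (\<lambda>w. integral (cbox 0 1) (\<lambda>t. t ^ m * g (w0 + t *\<^sub>R (w - w0)))))" for a
    by (rule Ck_on_cong[OF open_ball _ Ckk[of a]]) (rule pd[symmetric])
  moreover have "(\<lambda>w. integral (cbox 0 1) (\<lambda>t. t ^ m * g (w0 + t *\<^sub>R (w - w0)))) differentiable_on ?B"
    unfolding differentiable_on_eq_differentiable_at[OF open_ball] using der by (blast intro: differentiableI)
  ultimately show ?case by simp
qed

text \<open>The difference f(w) - f(w0) is the integral of the derivative along the segment from w0
  to w, and R_a is the mean of \<partial>_a f over this segment.\<close>

lemma hadamard:
  fixes f :: "real ^ 'p::finite \<Rightarrow> real"
  assumes "smooth_on (ball w0 r) f"
  obtains R where "\<And>a. smooth_on (ball w0 r) (R a)"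
    and "\<And>w. w \<in> ball w0 r \<Longrightarrow> f w = f w0 + (\<Sum>a\<in>UNIV. (w $ a - w0 $ a) * R a w)"
proof
  let ?B = "ball w0 r"
  let ?R = "\<lambda>a w. integral (cbox 0 1) (\<lambda>t. t ^ 0 * pd a f (w0 + t *\<^sub>R (w - w0)))"
  show "smooth_on ?B (?R a)" for a
    unfolding smooth_on_def using Ck_on_integral_segment[OF smooth_on_pd[OF assms]] by blast
  fix w assume w: "w \<in> ?B"
  have mem: "w0 + t *\<^sub>R (w - w0) \<in> ?B" if "t \<in> {0..1}" for t
  proof -
    have "dist w0 (w0 + t *\<^sub>R (w - w0)) = t * dist w0 w"
      using that by (simp add: dist_norm norm_minus_commute)
    also have "\<dots> \<le> dist w0 w" using that by (simp add: mult_left_le_one_le)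
    finally show ?thesis using w by simp
  qed
  let ?g = "\<lambda>a t. pd a f (w0 + t *\<^sub>R (w - w0))"
  have I1: "((\<lambda>t. \<Sum>a\<in>UNIV. (w $ a - w0 $ a) * ?g a t) has_integral
      (f (w0 + 1 *\<^sub>R (w - w0)) - f (w0 + 0 *\<^sub>R (w - w0)))) {0..1}"
  proof (rule fundamental_theorem_of_calculus)
    fix t :: real assume t: "t \<in> {0..1}"
    have "f differentiable (at (w0 + t *\<^sub>R (w - w0)))"
      by (rule smooth_on_differentiable[OF open_ball assms mem[OF t]])
    note 1 = has_derivative_pd[OF this]
    have 2: "((\<lambda>t. w0 + t *\<^sub>R (w - w0)) has_derivative (\<lambda>h. h *\<^sub>R (w - w0))) (at t within {0..1})"
      by (auto intro!: derivative_eq_intros)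
    have "((\<lambda>t. f (w0 + t *\<^sub>R (w - w0))) has_derivative
        (\<lambda>h. \<Sum>a\<in>UNIV. (h *\<^sub>R (w - w0)) $ a * ?g a t)) (at t within {0..1})"
      by (rule has_derivative_compose[OF 2 1])
    then show "((\<lambda>t. f (w0 + t *\<^sub>R (w - w0))) has_vector_derivative
        (\<Sum>a\<in>UNIV. (w $ a - w0 $ a) * ?g a t)) (at t within {0..1})"
      by (simp add: has_vector_derivative_def sum_distrib_left mult.assoc)
  qed simp
  have I2: "((\<lambda>t. \<Sum>a\<in>UNIV. (w $ a - w0 $ a) * ?g a t) has_integral
      (\<Sum>a\<in>UNIV. (w $ a - w0 $ a) * ?R a w)) {0..1}"
  proof (intro has_integral_sum has_integral_mult_right)
    fix a
    have "continuous_on {0..1} (?g a)"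
      by (intro continuous_on_compose2[OF smooth_on_continuous[OF smooth_on_pd[OF assms]]])
        (auto intro!: continuous_intros mem)
    then show "(?g a has_integral ?R a w) {0..1}"
      by (simp add: cbox_interval has_integral_integral[symmetric] integrable_continuous_real)
  qed simp
  show "f w = f w0 + (\<Sum>a\<in>UNIV. (w $ a - w0 $ a) * ?R a w)"
    using has_integral_unique[OF I1 I2] by simp
qed

text \<open>Applying Hadamard's lemma twice exhibits the second derivatives at \<open>w0\<close> symmetrically.\<close>

lemma pd_commute:
  fixes f :: "real ^ 'p::finite \<Rightarrow> real"
  assumes "open W" "smooth_on W f" "w0 \<in> W"
  shows "pd a (pd b f) w0 = pd b (pd a f) w0"
proof -
  obtain r where r: "r > 0" "ball w0 r \<subseteq> W" using assms openE by blast
  let ?B = "ball w0 r"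
  have w0: "w0 \<in> ?B" using r by simp
  have f: "smooth_on ?B f" using assms r smooth_on_subset by blast
  obtain R where R: "\<And>a. smooth_on ?B (R a)"
    "\<And>w. w \<in> ?B \<Longrightarrow> f w = f w0 + (\<Sum>a\<in>UNIV. (w $ a - w0 $ a) * R a w)"
    using hadamard[OF f] by metis
  have "\<exists>S. (\<forall>d. smooth_on ?B (S d)) \<and> (\<forall>w\<in>?B. R c w = R c w0 + (\<Sum>d\<in>UNIV. (w $ d - w0 $ d) * S d w))" for c
    using hadamard[OF R(1)[of c]] by metis
  then obtain S where S: "\<And>c d. smooth_on ?B (S c d)"
    "\<And>c w. w \<in> ?B \<Longrightarrow> R c w = R c w0 + (\<Sum>d\<in>UNIV. (w $ d - w0 $ d) * S c d w)"
    by metis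
  define x where "x c w = w $ c - w0 $ c" for c and w :: "real ^ 'p"
  have xs: "smooth_on ?B (x c)" for c unfolding x_def by (intro smooth_on_diff) auto
  have px: "pd a (x c) w = (if a = c then 1 else 0)" if "w \<in> ?B" for a c w
    using pd_add[of "\<lambda>w. w $ c" w "\<lambda>_. - w0 $ c" a] has_derivative_coord[of c w]
    by (simp add: x_def[abs_def] pd_coord differentiableI)
  note sm = smooth_on_add smooth_on_sum smooth_on_mult xs S(1) smooth_on_const smooth_on_pd open_ball
  note di = smooth_on_differentiable[OF open_ball, of w0 r]
  have pdb: "pd b f w = R b w0 + (\<Sum>c\<in>UNIV. x c w * S b c w) + (\<Sum>c\<in>UNIV. x c w * S c b w) +
      (\<Sum>c\<in>UNIV. \<Sum>d\<in>UNIV. x c w * (x d w * pd b (S c d) w))" if w: "w \<in> ?B" for b w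
  proof -
    have "pd b f w = pd b (\<lambda>w. f w0 + (\<Sum>c\<in>UNIV. x c w * (R c w0 + (\<Sum>d\<in>UNIV. x d w * S c d w)))) w"
      by (rule pd_cong[OF open_ball w]) (simp add: R(2) x_def flip: S(2))
    also have "\<dots> = (\<Sum>c\<in>UNIV. x c w * (\<Sum>d\<in>UNIV. x d w * pd b (S c d) w + (if b = d then 1 else 0) * S c d w) +
        (if b = c then 1 else 0) * (R c w0 + (\<Sum>d\<in>UNIV. x d w * S c d w)))"
      using w by (simp add: pd_add pd_sum pd_mult px di sm differentiable_sum)
    also have "\<dots> = R b w0 + (\<Sum>c\<in>UNIV. x c w * S b c w) + (\<Sum>c\<in>UNIV. x c w * S c b w) +
      (\<Sum>c\<in>UNIV. \<Sum>d\<in>UNIV. x c w * (x d w * pd b (S c d) w))"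
    proof -
      have "(\<Sum>c\<in>UNIV. (if b = c then 1 else 0) * F c) = F b" for F :: "'p \<Rightarrow> real"
        by (simp add: if_distrib[of "\<lambda>x. x * _"] cong: if_cong)
      then show ?thesis by (simp only: sum.distrib distrib_left) (simp add: sum_distrib_left)
    qed
    finally show ?thesis .
  qed
  have x0: "x c w0 = 0" for c by (simp add: x_def)
  have "pd a (pd b f) w0 = S b a w0 + S a b w0" for a b
  proof -
    have "pd a (pd b f) w0 = pd a (\<lambda>w. R b w0 + (\<Sum>c\<in>UNIV. x c w * S b c w) + (\<Sum>c\<in>UNIV. x c w * S c b w) +
      (\<Sum>c\<in>UNIV. \<Sum>d\<in>UNIV. x c w * (x d w * pd b (S c d) w))) w0"
      by (rule pd_cong[OF open_ball w0]) (rule pdb)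
    also have "\<dots> = S b a w0 + S a b w0"
      using w0 by (simp add: pd_add pd_sum pd_mult px di sm x0 if_distrib[of "\<lambda>x. x * _"] cong: if_cong)
    finally show ?thesis .
  qed
  from this[of a b] this[of b a] show ?thesis by simp
qed

section \<open>Lagrange inversion for even superfunctions\<close>

definition gsmooth :: "(real ^ 'p::finite) set \<Rightarrow> (real ^ 'p \<Rightarrow> grass) \<Rightarrow> bool" where
  "gsmooth W F \<longleftrightarrow> (\<forall>I. smooth_on W (\<lambda>w. gcoeff (F w) I))"

lemma gcoeff_gpd: "gcoeff (gpd a F w) I = pd a (\<lambda>z. gcoeff (F z) I) w"
  unfolding gpd_def by (cases "finite I") (simp_all add: gcoeff_Grass)

lemma gpd_cong:
  assumes "open W" "w \<in> W" "\<And>z. z \<in> W \<Longrightarrow> F z = G z"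
  shows "gpd a F w = gpd a G w"
  by (rule grass_eqI) (unfold gcoeff_gpd, rule pd_cong[OF assms(1,2)], simp add: assms(3))

lemma gpd_const [simp]: "gpd a (\<lambda>_. c) w = 0"
  by (rule grass_eqI) (simp add: gcoeff_gpd)

lemma gsmooth_cong:
  assumes "open W" "\<And>z. z \<in> W \<Longrightarrow> F z = G z" "gsmooth W F"
  shows "gsmooth W G"
  unfolding gsmooth_def
proof
  fix I
  show "smooth_on W (\<lambda>w. gcoeff (G w) I)"
    by (rule smooth_on_cong[OF assms(1), of "\<lambda>w. gcoeff (F w) I"]) (use assms in \<open>auto simp: gsmooth_def\<close>)
qed

lemma gsmooth_subset: "gsmooth W F \<Longrightarrow> V \<subseteq> W \<Longrightarrow> gsmooth V F"
  unfolding gsmooth_def using smooth_on_subset by blast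

lemma gsmooth_const [simp]: "gsmooth W (\<lambda>_. c)"
  by (simp add: gsmooth_def)

lemma gsmooth_add: "open W \<Longrightarrow> gsmooth W F \<Longrightarrow> gsmooth W G \<Longrightarrow> gsmooth W (\<lambda>z. F z + G z)"
  and gsmooth_diff: "open W \<Longrightarrow> gsmooth W F \<Longrightarrow> gsmooth W G \<Longrightarrow> gsmooth W (\<lambda>z. F z - G z)"
  by (simp_all add: gsmooth_def smooth_on_add smooth_on_diff smooth_on_minus)

lemma gsmooth_sum: "open W \<Longrightarrow> (\<And>x. x \<in> X \<Longrightarrow> gsmooth W (F x)) \<Longrightarrow> gsmooth W (\<lambda>z. \<Sum>x\<in>X. F x z)"
  by (simp add: gsmooth_def smooth_on_sum)

lemma gsmooth_times: "open W \<Longrightarrow> gsmooth W F \<Longrightarrow> gsmooth W G \<Longrightarrow> gsmooth W (\<lambda>z. F z * G z)"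
  unfolding gsmooth_def gcoeff_times
  by (intro allI smooth_on_sum smooth_on_mult) auto

lemma gsmooth_scaleR: "open W \<Longrightarrow> smooth_on W f \<Longrightarrow> gsmooth W F \<Longrightarrow> gsmooth W (\<lambda>z. f z *\<^sub>R F z)"
  by (simp add: gsmooth_def smooth_on_mult)

lemma gsmooth_of_real: "smooth_on W f \<Longrightarrow> gsmooth W (\<lambda>z. of_real (f z))"
  unfolding gsmooth_def gcoeff_of_real
proof
  fix I assume "smooth_on W f"
  then show "smooth_on W (\<lambda>w. if I = {} then f w else 0)" by (cases "I = {}") auto
qed

lemma gsmooth_power: "open W \<Longrightarrow> gsmooth W F \<Longrightarrow> gsmooth W (\<lambda>z. F z ^ k)"
  by (induction k) (auto intro: gsmooth_times)

lemma gsmooth_gpd: "gsmooth W F \<Longrightarrow> gsmooth W (gpd a F)"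
  by (simp add: gsmooth_def gcoeff_gpd smooth_on_pd)

lemma gsmooth_gder: "open W \<Longrightarrow> gsmooth W F \<Longrightarrow> gsmooth W (\<lambda>z. gder j (F z))"
  unfolding gsmooth_def gcoeff_gder
proof
  fix I assume "open W" "\<forall>I. smooth_on W (\<lambda>w. gcoeff (F w) I)"
  then show "smooth_on W (\<lambda>w. if j \<in> I then 0
      else (-1) ^ card {i \<in> I. i < j} * gcoeff (F w) (insert j I))"
    by (cases "j \<in> I") (auto intro: smooth_on_mult)
qed

lemma gsmooth_differentiable:
  "open W \<Longrightarrow> gsmooth W F \<Longrightarrow> w \<in> W \<Longrightarrow> (\<lambda>z. gcoeff (F z) I) differentiable (at w)"
  unfolding gsmooth_def using smooth_on_differentiable by blast

lemma gpd_add: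
  assumes "open W" "gsmooth W F" "gsmooth W G" "w \<in> W"
  shows "gpd a (\<lambda>z. F z + G z) w = gpd a F w + gpd a G w"
  by (rule grass_eqI) (simp add: gcoeff_gpd pd_add gsmooth_differentiable[OF assms(1)] assms)

lemma gpd_diff:
  assumes "open W" "gsmooth W F" "gsmooth W G" "w \<in> W"
  shows "gpd a (\<lambda>z. F z - G z) w = gpd a F w - gpd a G w"
proof (rule grass_eqI)
  fix I
  have "pd a (\<lambda>z. gcoeff (F z) I + -1 * gcoeff (G z) I) w =
      pd a (\<lambda>z. gcoeff (F z) I) w + pd a (\<lambda>z. -1 * gcoeff (G z) I) w"
    by (intro pd_add differentiable_mult differentiable_const gsmooth_differentiable[OF assms(1)] assms)
  also have "pd a (\<lambda>z. -1 * gcoeff (G z) I) w = -1 * pd a (\<lambda>z. gcoeff (G z) I) w"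
    by (intro pd_cmult gsmooth_differentiable[OF assms(1)] assms)
  finally show "gcoeff (gpd a (\<lambda>z. F z - G z) w) I = gcoeff (gpd a F w - gpd a G w) I"
    by (simp add: gcoeff_gpd)
qed

lemma gpd_sum:
  assumes "open W" "finite X" "\<And>x. x \<in> X \<Longrightarrow> gsmooth W (F x)" "w \<in> W"
  shows "gpd a (\<lambda>z. \<Sum>x\<in>X. F x z) w = (\<Sum>x\<in>X. gpd a (F x) w)"
  by (rule grass_eqI) (simp add: gcoeff_gpd pd_sum gsmooth_differentiable[OF assms(1)] assms)

lemma gpd_times:
  assumes "open W" "gsmooth W F" "gsmooth W G" "w \<in> W"
  shows "gpd a (\<lambda>z. F z * G z) w = F w * gpd a G w + gpd a F w * G w"
proof (rule grass_eqI')
  fix K :: "nat set" assume K: "finite K"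
  note di = gsmooth_differentiable[OF assms(1) _ assms(4)]
  have "pd a (\<lambda>z. \<Sum>I\<in>Pow K. gsgn I (K - I) * gcoeff (F z) I * gcoeff (G z) (K - I)) w =
      (\<Sum>I\<in>Pow K. pd a (\<lambda>z. gsgn I (K - I) * gcoeff (F z) I * gcoeff (G z) (K - I)) w)"
    using K by (intro pd_sum) (auto intro!: differentiable_mult di assms)
  also have "\<dots> = (\<Sum>I\<in>Pow K. gsgn I (K - I) * gcoeff (F w) I * pd a (\<lambda>z. gcoeff (G z) (K - I)) w +
      gsgn I (K - I) * pd a (\<lambda>z. gcoeff (F z) I) w * gcoeff (G w) (K - I))"
    by (intro sum.cong refl, subst pd_mult) (auto intro!: differentiable_mult di assms simp: pd_cmult[OF di[OF assms(2)]])
  finally show "gcoeff (gpd a (\<lambda>z. F z * G z) w) K = gcoeff (F w * gpd a G w + gpd a F w * G w) K"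
    by (simp add: gcoeff_gpd gcoeff_times sum.distrib)
qed

lemma gpd_coord: "gpd a (\<lambda>z. of_real (z $ b)) w = (if a = b then 1 else 0)"
proof (rule grass_eqI)
  fix I
  have "(\<lambda>z. gcoeff (of_real (z $ b)) I) = (\<lambda>z :: real ^ 'a. if I = {} then z $ b else 0)"
    by (auto simp: fun_eq_iff)
  then show "gcoeff (gpd a (\<lambda>z. of_real (z $ b)) w) I = gcoeff (if a = b then 1 else 0) I"
    by (cases "I = {}") (simp_all add: gcoeff_gpd pd_coord)
qed

lemma gpd_commute:
  assumes "open W" "gsmooth W F" "w \<in> W"
  shows "gpd a (gpd b F) w = gpd b (gpd a F) w"
proof (rule grass_eqI)
  fix I
  have "(\<lambda>z. gcoeff (gpd b F z) I) = pd b (\<lambda>z. gcoeff (F z) I)" for b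
    by (simp add: fun_eq_iff gcoeff_gpd)
  then show "gcoeff (gpd a (gpd b F) w) I = gcoeff (gpd b (gpd a F) w) I"
    using assms by (simp add: gcoeff_gpd pd_commute[of W] gsmooth_def)
qed

lemma pd_zero_fun:
  assumes "\<And>z. f z = 0"
  shows "pd a f w = 0"
proof -
  have "f = (\<lambda>_. 0)" using assms by (simp add: fun_eq_iff)
  then show ?thesis by simp
qed

lemma gens_gpd: "(\<And>z. gens q (F z)) \<Longrightarrow> gens q (gpd a F w)"
  by (auto simp: gens_def gcoeff_gpd intro: pd_zero_fun)

lemma gparity_gpd: "(\<And>z. gparity e (F z)) \<Longrightarrow> gparity e (gpd a F w)"
  by (auto simp: gparity_def gcoeff_gpd intro: pd_zero_fun)

lemma gdeg_ge_gpd: "(\<And>z. gdeg_ge k (F z)) \<Longrightarrow> gdeg_ge k (gpd a F w)"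
  by (auto simp: gdeg_ge_def gcoeff_gpd intro: pd_zero_fun)

section \<open>Even superfunctions as an algebra with commuting derivations\<close>

definition even_smooth :: "nat \<Rightarrow> (real ^ 'p::finite) set \<Rightarrow> (real ^ 'p \<Rightarrow> egrass) set" where
  "even_smooth q W = {f. gsmooth W (\<lambda>w. eg (f w)) \<and> (\<forall>w. gens q (eg (f w)))}"

text \<open>Set to 0 outside of W, where differentiability is not known; the laws of commuting
  derivations then hold as equations between functions, at every point.\<close>

definition epd :: "(real ^ 'p::finite) set \<Rightarrow> 'p \<Rightarrow> (real ^ 'p \<Rightarrow> egrass) \<Rightarrow> real ^ 'p \<Rightarrow> egrass" where
  "epd W a f w = (if w \<in> W then Eg (gpd a (\<lambda>z. eg (f z)) w) else 0)"

lemma eg_epd: "eg (epd W a f w) = (if w \<in> W then gpd a (\<lambda>z. eg (f z)) w else 0)"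
  by (simp add: epd_def eg_Eg gparity_gpd)

lemma sum_fun_apply [simp]: "(\<Sum>x\<in>X. f x) w = (\<Sum>x\<in>X. f x w)"
  by (induction X rule: infinite_finite_induct) auto

lemma prod_fun_apply [simp]: "(\<Prod>x\<in>X. f x) w = (\<Prod>x\<in>X. f x w)"
  by (induction X rule: infinite_finite_induct) auto

lemma power_fun_apply [simp]: "(f ^ k) w = f w ^ k"
  by (induction k) auto

lemma even_smooth_closed:
  assumes "open W" "f \<in> even_smooth q W" "g \<in> even_smooth q W"
  shows "f - g \<in> even_smooth q W" "f * g \<in> even_smooth q W" "f + g \<in> even_smooth q W"
  using assms by (auto simp: even_smooth_def gsmooth_diff gsmooth_times gsmooth_add gens_diff gens_times gens_add)

lemma even_smooth_const: "(\<lambda>_. of_real r) \<in> even_smooth q W"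
  by (simp add: even_smooth_def)

lemma even_smooth_one: "1 \<in> even_smooth q W"
  by (simp add: even_smooth_def)

lemma epd_derivation:
  assumes W: "open W"
  shows "ring_derivation (even_smooth q W) (epd W a) (*)"
proof
  fix f g assume f: "f \<in> even_smooth q W" and g: "g \<in> even_smooth q W"
  have fg: "gsmooth W (\<lambda>w. eg (f w))" "gsmooth W (\<lambda>w. eg (g w))"
    using f g by (simp_all add: even_smooth_def)
  show "epd W a (f - g) = epd W a f - epd W a g"
    by (intro ext egrass_eqI) (simp add: eg_epd gpd_diff[OF W fg])
  show "epd W a (f * g) = f * epd W a g + g * epd W a f"
    by (intro ext egrass_eqI) (simp add: eg_epd gpd_times[OF W fg] eg_commute[of "g _"])
qed (use W in \<open>auto simp: even_smooth_one even_smooth_closed algebra_simps\<close>)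

lemma epd_closed:
  assumes "open W" "f \<in> even_smooth q W"
  shows "epd W a f \<in> even_smooth q W"
proof -
  have "gsmooth W (\<lambda>w. eg (epd W a f w))"
    by (rule gsmooth_cong[OF assms(1) _ gsmooth_gpd[of W "\<lambda>z. eg (f z)" a]])
      (use assms in \<open>simp_all add: eg_epd even_smooth_def\<close>)
  then show ?thesis using assms by (simp add: even_smooth_def eg_epd gens_gpd)
qed

lemma epd_commute:
  assumes W: "open W" and f: "f \<in> even_smooth q W"
  shows "epd W a (epd W b f) = epd W b (epd W a f)"
proof (intro ext egrass_eqI)
  fix w
  have "gpd a (\<lambda>z. eg (epd W b f z)) w = gpd a (gpd b (\<lambda>z. eg (f z))) w" if "w \<in> W" for a b
    by (rule gpd_cong[OF W that]) (simp add: eg_epd)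
  then show "eg (epd W a (epd W b f) w) = eg (epd W b (epd W a f) w)"
    using f gpd_commute[OF W] by (simp add: eg_epd even_smooth_def)
qed

lemma epd_diff_algebra:
  assumes W: "open W"
  shows "diff_algebra (even_smooth q W) (epd W) (\<lambda>r _. of_real r)"
proof (rule diff_algebra.intro)
  show "epd W a (\<lambda>_. of_real r) = 0" for a r
    by (intro ext egrass_eqI) (simp add: eg_epd)
qed (use W in \<open>auto simp: epd_derivation epd_closed epd_commute[of W _ q] even_smooth_const fun_eq_iff\<close>)

abbreviation "multi_pd W \<equiv> diff_algebra.dm (epd W)"

lemma multi_pd_local:
  fixes V W :: "(real ^ 'p::{finite,linorder}) set"
  assumes VW: "open V" "open W" "V \<subseteq> W" and "\<And>w. w \<in> V \<Longrightarrow> f w = g w" and w: "w \<in> V"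
  shows "multi_pd W i f w = multi_pd V i g w"
proof -
  \<comment> \<open>The operator \<open>dm\<close> depends on the derivations and not on the set of
    functions, so that any number of generators, here 0, gives access to its definition.\<close>
  interpret W: diff_algebra "even_smooth 0 W" "epd W" "\<lambda>r _. of_real r" by (rule epd_diff_algebra[OF VW(2)])
  interpret V: diff_algebra "even_smooth 0 V" "epd V" "\<lambda>r _. of_real r" by (rule epd_diff_algebra[OF VW(1)])
  define agree where "agree f g \<longleftrightarrow> (\<forall>w\<in>V. f w = g w)" for f g :: "real ^ 'p::{finite,linorder} \<Rightarrow> egrass"
  have 1: "agree (epd W a f) (epd V a g)" if "agree f g" for a f g
    unfolding agree_def
  proof
    fix w assume w: "w \<in> V"
    have "gpd a (\<lambda>z. eg (f z)) w = gpd a (\<lambda>z. eg (g z)) w"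
      using that by (intro gpd_cong[OF VW(1) w]) (simp add: agree_def)
    then show "epd W a f w = epd V a g w" using w VW by (auto simp: epd_def)
  qed
  have 2: "agree ((epd W a ^^ k) f) ((epd V a ^^ k) g)" if "agree f g" for a k f g
    using that by (induction k) (auto intro: 1)
  have "agree (fold (\<lambda>a. epd W a ^^ i a) xs f) (fold (\<lambda>a. epd V a ^^ i a) xs g)" if "agree f g" for xs f g
    using that by (induction xs arbitrary: f g) (auto intro: 2)
  then show ?thesis using assms(4) w by (simp add: W.dm_def V.dm_def agree_def)
qed

text \<open>On W this is the Jacobian determinant of w \<mapsto> w + n(w).\<close>

definition jac :: "(real ^ 'p) set \<Rightarrow> ('p \<Rightarrow> real ^ 'p \<Rightarrow> egrass) \<Rightarrow> real ^ 'p::finite \<Rightarrow> egrass" where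
  "jac W n w = ldet UNIV (\<lambda>a b. (if a = b then 1 else 0) + epd W a (n b) w)"

lemma ldet_fun:
  fixes A :: "'i \<Rightarrow> 'i \<Rightarrow> 'x \<Rightarrow> 'b::comm_ring_1"
  shows "ldet I A w = ldet I (\<lambda>i j. A i j w)"
proof -
  have "(of_nat m :: 'x \<Rightarrow> 'b) w = of_nat m" for m
    by (induction m) auto
  then have "(of_int k :: 'x \<Rightarrow> 'b) w = of_int k" for k :: int
    by (cases k rule: int_cases2) auto
  then show ?thesis by (simp add: ldet_def)
qed

section \<open>The Lagrange operator on even superfunctions\<close>

context
  fixes W :: "(real ^ 'p::{finite,linorder}) set" and q :: nat and n :: "'p \<Rightarrow> real ^ 'p::{finite,linorder} \<Rightarrow> egrass"
  assumes W: "open W" and n: "\<And>a. n a \<in> even_smooth q W"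
    and nil: "\<And>a w. gdeg_ge 2 (eg (n a w))"
begin

interpretation A: diff_algebra "even_smooth q W" "epd W" "\<lambda>r _. of_real r"
  by (rule epd_diff_algebra[OF W])

text \<open>Each step multiplies by some n_a, which starts in degree 2, and derivatives in the even
  directions do not lower the degree.\<close>

lemma T_gdeg_ge: "(\<And>w. gdeg_ge m (eg (f w))) \<Longrightarrow> gdeg_ge (m + 2 * k) (eg (A.T n k f w))"
proof (induction k arbitrary: f m w)
  case (Suc k)
  have "gdeg_ge (2 + m + 2 * k) (eg (A.T n k (n a * f) w))" for a w
  proof (rule Suc.IH)
    show "gdeg_ge (2 + m) (eg ((n a * f) w))" for w
      using gdeg_ge_times[OF nil[of a w] Suc.prems[of w]] by simp
  qed
  then have "gdeg_ge (m + 2 * Suc k) (eg (A.T n k (n a * f) w))" for a w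
    by (simp add: add.commute)
  then show ?case by (auto simp: eg_epd intro!: gdeg_ge_sum gdeg_ge_gpd)
qed simp

lemma T_nil: "f \<in> even_smooth q W \<Longrightarrow> A.T n (Suc q) f = 0"
proof
  fix w assume f: "f \<in> even_smooth q W"
  have "gens q (eg (A.T n (Suc q) f w))"
    using A.T_closed[OF n f] by (simp add: even_smooth_def del: A.T.simps)
  moreover have "gdeg_ge (2 * Suc q) (eg (A.T n (Suc q) f w))"
    using T_gdeg_ge[of 0 f "Suc q" w] by (simp del: A.T.simps)
  ultimately have "eg (A.T n (Suc q) f w) = 0" by (rule gens_gdeg_ge_eq_0) simp
  then show "A.T n (Suc q) f w = 0 w" by (intro egrass_eqI) simp
qed

lemma jac_fun: "jac W n = ldet UNIV (\<lambda>a b. (if a = b then 1 else 0) + epd W a (n b))"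
  unfolding jac_def fun_eq_iff ldet_fun by (auto intro!: ldet_cong)

lemma jac_closed: "jac W n \<in> even_smooth q W"
proof -
  interpret D: ring_derivation "even_smooth q W" "epd W a" "(*)" for a by (rule epd_derivation[OF W])
  show ?thesis unfolding jac_fun by (rule D.ldet_closed) (rule A.Mat_closed[OF n T_nil])
qed

lemma body_jac: "gcoeff (eg (jac W n w)) {} = 1"
  unfolding jac_def gcoeff_ldet_empty
proof (rule ldet_identity)
  fix a b
  have "gdeg_ge 2 (eg (epd W a (n b) w))" by (simp add: eg_epd gdeg_ge_gpd nil)
  then have "gcoeff (eg (epd W a (n b) w)) {} = 0" by (simp add: gdeg_ge_def)
  then show "gcoeff (eg ((if a = b then 1 else 0) + epd W a (n b) w)) {} = (if a = b then 1 else 0)"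
    by simp
qed simp

text \<open>The Euler derivation multiplies \<open>\<xi>\<^sup>I\<close> by \<open>card I\<close>, so it detects everything but the body.\<close>

lemma L_jac: "A.L n (Suc q) (jac W n) = 1"
proof -
  define D where "D f w = eeuler (f w)" for f :: "real ^ 'p::{finite,linorder} \<Rightarrow> egrass" and w
  have eD: "eg (D f w) = geuler (eg (f w))" for f w by (simp add: D_def eeuler.rep_eq)
  have gD: "gcoeff (geuler a - geuler b) I = gcoeff (geuler (a - b)) I" for a b I
    by (simp add: gcoeff_geuler algebra_simps)
  have D: "ring_derivation (even_smooth q W) D (*)"
  proof
    fix f g
    show "D (f - g) = D f - D g"
      by (intro ext egrass_eqI grass_eqI) (simp add: eD gD del: minus_grass.rep_eq)
    show "D (f * g) = f * D g + g * D f"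
      by (intro ext egrass_eqI) (simp add: eD geuler_times eg_commute[of "g _"] add.commute)
  qed (use W in \<open>auto simp: even_smooth_one even_smooth_closed algebra_simps\<close>)
  have DS: "D f \<in> even_smooth q W" if "f \<in> even_smooth q W" for f
    using that by (auto simp: even_smooth_def gsmooth_def eD gcoeff_geuler gens_def intro!: smooth_on_mult[OF W])
  have Dd: "D (epd W a f) = epd W a (D f)" if f: "f \<in> even_smooth q W" for f a
  proof (intro ext egrass_eqI grass_eqI)
    fix w I
    have "pd a (\<lambda>z. real (card I) * gcoeff (eg (f z)) I) w = real (card I) * pd a (\<lambda>z. gcoeff (eg (f z)) I) w"
      if "w \<in> W" using f gsmooth_differentiable[OF W _ that] by (intro pd_cmult) (auto simp: even_smooth_def)
    then show "gcoeff (eg (D (epd W a f) w)) I = gcoeff (eg (epd W a (D f) w)) I"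
      by (simp add: eD eg_epd gcoeff_geuler gcoeff_gpd)
  qed
  have DK: "D (\<lambda>_. of_real r) = 0" for r
    by (intro ext egrass_eqI grass_eqI) (simp add: eD gcoeff_geuler)
  have D0: "D (A.L n (Suc q) (jac W n)) = 0"
    unfolding jac_fun by (rule A.L_Jac_derivation[OF n T_nil D DS Dd DK])
  \<comment> \<open>The terms of L with k > 0 start in degree 2k and have no body.\<close>
  have body: "gcoeff (eg (A.L n (Suc q) (jac W n) w)) {} = 1" for w
  proof -
    have "gcoeff (eg (A.T n k (jac W n) w)) {} = (if k = 0 then 1 else 0)" for k
    proof (cases k)
      case (Suc j)
      then show ?thesis using T_gdeg_ge[of 0 "jac W n" k w] by (simp add: gdeg_ge_def)
    qed (simp add: body_jac)
    then have "gcoeff (eg (A.L n (Suc q) (jac W n) w)) {} =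
        (\<Sum>k\<le>Suc q. (-1) ^ k / fact k * (if k = 0 then 1 else 0))"
      by (subst A.L_def[OF n T_nil]) (simp_all del: sum.atMost_Suc)
    also have "\<dots> = (\<Sum>k\<in>{0}. (-1) ^ k / fact k)"
      by (rule sum.mono_neutral_cong_right) auto
    finally show ?thesis by simp
  qed
  show ?thesis
  proof (intro ext egrass_eqI grass_eqI')
    fix w and I :: "nat set" assume I: "finite I"
    have "gcoeff (eg (D (A.L n (Suc q) (jac W n)) w)) I = 0" using D0 by simp
    then have "real (card I) * gcoeff (eg (A.L n (Suc q) (jac W n) w)) I = 0"
      by (simp only: eD gcoeff_geuler)
    then show "gcoeff (eg (A.L n (Suc q) (jac W n) w)) I = gcoeff (eg (1 w)) I"
      using I body by auto
  qed
qed

text \<open>Under L, the factor w_a - w0_a + n_a becomes w_a - w0_a, which is 0 at w0. Of L(F J)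
  only c L(J) = c remains there.\<close>

lemma L_hadamard:
  assumes R: "\<And>a. R a \<in> even_smooth q W" and w0: "w0 \<in> W"
    and F: "\<And>w. w \<in> W \<Longrightarrow> F w = of_real c + (\<Sum>a\<in>UNIV. (of_real (w $ a - w0 $ a) + n a w) * R a w)"
  shows "(\<Sum>k\<le>Suc q. \<Sum>i\<in>multi_idx k. of_real ((-1) ^ k / (\<Prod>a\<in>UNIV. fact (i a))) *
    multi_pd W i (\<lambda>w. (\<Prod>a\<in>UNIV. n a w ^ i a) * (F w * jac W n w)) w0) = of_real c"
proof -
  let ?L = "A.L n (Suc q)"
  interpret D: ring_derivation "even_smooth q W" "epd W a" "(*)" for a by (rule epd_derivation[OF W])
  define x where "x a w = (of_real (w $ a - w0 $ a) :: egrass)" for a and w :: "real ^ 'p::{finite,linorder}"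
  \<comment> \<open>The derivative of a coordinate: since \<open>epd\<close> is cut off, it is the
    indicator function of W.\<close>
  define u where "u w = (if w \<in> W then 1 else 0 :: egrass)" for w
  have x: "x a \<in> even_smooth q W" for a
    by (auto simp: even_smooth_def x_def intro!: gsmooth_of_real gsmooth_diff[OF W] gens_diff)
  have dx: "epd W b (x a) = (if b = a then u else 0)" for a b
  proof (intro ext egrass_eqI)
    fix w
    have "gpd b (\<lambda>z. eg (x a z)) w = gpd b (\<lambda>z. of_real (z $ a) - of_real (w0 $ a)) w"
      by (simp add: x_def)
    also have "\<dots> = (if b = a then 1 else 0)" if "w \<in> W"
      by (subst gpd_diff[OF W]) (auto intro!: gsmooth_of_real that simp: gpd_coord)
    finally show "eg (epd W b (x a) w) = eg ((if b = a then u else 0) w)"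
      by (auto simp: eg_epd u_def)
  qed
  have u: "u \<in> even_smooth q W"
  proof -
    have "gsmooth W (\<lambda>w. eg (u w))"
      by (rule gsmooth_cong[OF W, of "\<lambda>_. 1"]) (simp_all add: u_def)
    then show ?thesis by (simp add: even_smooth_def u_def)
  qed
  have du: "epd W a u = 0" for a
  proof (intro ext egrass_eqI)
    fix w
    have "gpd a (\<lambda>z. eg (u z)) w = gpd a (\<lambda>_. 1) w" if "w \<in> W"
      by (rule gpd_cong[OF W that]) (simp add: u_def)
    then show "eg (epd W a u w) = eg (0 w)" by (auto simp: eg_epd)
  qed
  \<comment> \<open>The expansion of F holds on W only. F' is given by this expansion everywhere, so
    it belongs to the algebra, and agrees with F J on W; locality of the derivatives allows the
    replacement.\<close>
  define F' where "F' = (\<lambda>_. of_real c) * jac W n + (\<Sum>a\<in>UNIV. (x a + n a) * (R a * jac W n))"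
  have cl: "(x a + n a) * (R a * jac W n) \<in> even_smooth q W" for a
    by (intro even_smooth_closed W x n R jac_closed)
  have F': "F' \<in> even_smooth q W"
    unfolding F'_def by (intro even_smooth_closed(2,3) D.sum_closed W cl even_smooth_const jac_closed)
  have "?L F' = ?L ((\<lambda>_. of_real c) * jac W n) + (\<Sum>a\<in>UNIV. ?L ((x a + n a) * (R a * jac W n)))"
    unfolding F'_def
    by (simp add: A.L_add[OF n T_nil] A.L_sum[OF n T_nil] cl D.sum_closed even_smooth_closed(2)[OF W]
        even_smooth_const jac_closed)
  also have "?L ((\<lambda>_. of_real c) * jac W n) = (\<lambda>_. of_real c) * 1"
    by (simp add: A.L_K_mult[OF n T_nil jac_closed] L_jac)
  also have "(\<Sum>a\<in>UNIV. ?L ((x a + n a) * (R a * jac W n))) =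
      (\<Sum>a\<in>UNIV. x a * ?L (R a * jac W n) + (1 - u) * ?L (n a * (R a * jac W n)))"
    by (intro sum.cong refl A.L_coordinate[OF n T_nil x dx u du] even_smooth_closed W R jac_closed)
  finally have "?L F' w0 = of_real c"
    using w0 by (simp add: x_def u_def)
  moreover have "?L F' = (\<Sum>k\<le>Suc q. \<Sum>i\<in>multi_idx k.
      (\<lambda>_. of_real ((-1) ^ k / (\<Prod>a\<in>UNIV. fact (i a)))) * multi_pd W i ((\<Prod>a\<in>UNIV. n a ^ i a) * F'))"
    by (rule A.L_multi_idx[OF n _ F']) (rule T_nil)
  ultimately have "(\<Sum>k\<le>Suc q. \<Sum>i\<in>multi_idx k. of_real ((-1) ^ k / (\<Prod>a\<in>UNIV. fact (i a))) *
    multi_pd W i ((\<Prod>a\<in>UNIV. n a ^ i a) * F') w0) = of_real c"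
    by (simp del: sum.atMost_Suc of_real_divide)
  moreover have "multi_pd W i ((\<Prod>a\<in>UNIV. n a ^ i a) * F') w0 =
      multi_pd W i (\<lambda>w. (\<Prod>a\<in>UNIV. n a w ^ i a) * (F w * jac W n w)) w0" for i
    by (rule multi_pd_local[OF W W subset_refl _ w0])
      (simp add: F'_def F x_def distrib_right sum_distrib_right mult.assoc)
  ultimately show ?thesis by simp
qed

end

text \<open>Hadamard's expansion of F exists only on a neighbourhood B of w0. Derivatives and
  Jacobian at w0 are the same on B as on W, so the formula on B suffices.\<close>

lemma lagrange_inversion:
  fixes W :: "(real ^ 'p::{finite,linorder}) set"
  assumes W: "open W" and n: "\<And>a. n a \<in> even_smooth q W" and nil: "\<And>a w. gdeg_ge 2 (eg (n a w))"
    and B: "open B" "w0 \<in> B" "B \<subseteq> W" and R: "\<And>a. R a \<in> even_smooth q B"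
    and F: "\<And>w. w \<in> B \<Longrightarrow> F w = of_real c + (\<Sum>a\<in>UNIV. (of_real (w $ a - w0 $ a) + n a w) * R a w)"
  shows "(\<Sum>k\<le>Suc q. \<Sum>i\<in>multi_idx k. of_real ((-1) ^ k / (\<Prod>a\<in>UNIV. fact (i a))) *
    multi_pd W i (\<lambda>w. (\<Prod>a\<in>UNIV. n a w ^ i a) * (F w * jac W n w)) w0) = of_real c"
proof -
  have nB: "n a \<in> even_smooth q B" for a
    using n[of a] B by (auto simp: even_smooth_def intro: gsmooth_subset)
  have "jac W n w = jac B n w" if "w \<in> B" for w
    using that B by (auto simp: jac_def epd_def)
  then have "multi_pd W i (\<lambda>w. (\<Prod>a\<in>UNIV. n a w ^ i a) * (F w * jac W n w)) w0 =
      multi_pd B i (\<lambda>w. (\<Prod>a\<in>UNIV. n a w ^ i a) * (F w * jac B n w)) w0" for i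
    by (intro multi_pd_local W B) auto
  then show ?thesis using L_hadamard[of B n q R w0 F c, OF B(1) nB nil R B(2) F] by simp
qed

section \<open>Even homomorphisms lifting the identity\<close>

lemma gcoeff_times_gmon_subset:
  assumes "finite I" "finite K"
  shows "gcoeff (a * gmon I) K = (if I \<subseteq> K then gsgn (K - I) I * gcoeff a (K - I) else 0)"
proof -
  have "gcoeff (a * gmon I) K =
      (\<Sum>L\<in>Pow K. if L = K - I \<and> I \<subseteq> K then gsgn (K - I) I * gcoeff a (K - I) else 0)"
    unfolding gcoeff_times
  proof (rule sum.cong[OF refl])
    fix L assume "L \<in> Pow K"
    then have "K - L = I \<longleftrightarrow> L = K - I \<and> I \<subseteq> K" by auto
    then show "gsgn L (K - L) * gcoeff a L * gcoeff (gmon I) (K - L) =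
        (if L = K - I \<and> I \<subseteq> K then gsgn (K - I) I * gcoeff a (K - I) else 0)"
      using assms by (auto simp: gcoeff_gmon double_diff)
  qed
  then show ?thesis using assms by (cases "I \<subseteq> K") simp_all
qed

lemma gmon_times:
  assumes "finite I" "finite J"
  shows "gmon I * gmon J = (if I \<inter> J = {} then gsgn I J *\<^sub>R gmon (I \<union> J) else 0)"
proof (rule grass_eqI')
  fix K :: "nat set" assume K: "finite K"
  have e: "J \<subseteq> K \<and> K - J = I \<longleftrightarrow> I \<inter> J = {} \<and> K = I \<union> J" by auto
  have "gcoeff (gmon I * gmon J) K = (if J \<subseteq> K \<and> K - J = I then gsgn I J else 0)"
    using assms K by (simp add: gcoeff_times_gmon_subset gcoeff_gmon)
  also have "\<dots> = gcoeff (if I \<inter> J = {} then gsgn I J *\<^sub>R gmon (I \<union> J) else 0) K"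
    unfolding e using assms by (simp add: gcoeff_gmon)
  finally show "gcoeff (gmon I * gmon J) K =
      gcoeff (if I \<inter> J = {} then gsgn I J *\<^sub>R gmon (I \<union> J) else 0) K" .
qed

section \<open>Superfunctions on a domain\<close>

lemma domain_sectionsD:
  assumes "F \<in> domain_sections q V"
  shows "smooth_on V (\<lambda>w. gcoeff (F w) I)" "gens q (F w)" "w \<notin> V \<Longrightarrow> F w = 0" "gsmooth V F"
  using assms by (auto simp: domain_sections_def gens_def gsmooth_def)

lemma domain_sectionsI:
  assumes "gsmooth V F" "\<And>w. gens q (F w)" "\<And>w. w \<notin> V \<Longrightarrow> F w = 0"
  shows "F \<in> domain_sections q V"
  using assms by (auto simp: domain_sections_def gens_def gsmooth_def)

lemma domain_sections_cutI:
  assumes "open V" "gsmooth V F" "\<And>w. w \<in> V \<Longrightarrow> gens q (F w)"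
  shows "(\<lambda>w. if w \<in> V then F w else 0) \<in> domain_sections q V"
  by (rule domain_sectionsI, rule gsmooth_cong[OF assms(1) _ assms(2)]) (use assms in auto)

context
  fixes V :: "(real ^ 'p::finite) set" and q F G
  assumes V: "open V" and F: "F \<in> domain_sections q V" and G: "G \<in> domain_sections q V"
begin

lemma domain_sections_add: "(\<lambda>w. F w + G w) \<in> domain_sections q V"
  using domain_sectionsD[OF F] domain_sectionsD[OF G] V
  by (intro domain_sectionsI gsmooth_add gens_add) simp_all

lemma domain_sections_diff: "(\<lambda>w. F w - G w) \<in> domain_sections q V"
  using domain_sectionsD[OF F] domain_sectionsD[OF G] V
  by (intro domain_sectionsI gsmooth_diff gens_diff) simp_all

lemma domain_sections_mult: "(\<lambda>w. F w * G w) \<in> domain_sections q V"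
  using domain_sectionsD[OF F] domain_sectionsD[OF G] V
  by (intro domain_sectionsI gsmooth_times gens_times) simp_all

lemma domain_sections_scaleR: "(\<lambda>w. r *\<^sub>R F w) \<in> domain_sections q V"
  using domain_sectionsD[OF F] V
  by (intro domain_sectionsI gsmooth_scaleR gens_scaleR) simp_all

end

lemma domain_sections_restrict:
  assumes "open V'" "V' \<subseteq> V" "F \<in> domain_sections q V"
  shows "fun_res V V' F \<in> domain_sections q V'"
  unfolding fun_res_def
  by (rule domain_sections_cutI) (use assms domain_sectionsD[OF assms(3)] gsmooth_subset in auto)

lemma Eg_of_real [simp]: "Eg (of_real r) = of_real r"
  by (rule egrass_eqI) (simp add: eg_Eg)

lemma Eg_zero [simp]: "Eg 0 = 0"
  by (rule egrass_eqI) (simp add: eg_Eg)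

text \<open>
  A family of algebra homomorphisms from the smooth functions on \<open>V\<close> to the even superfunctions
  on \<open>V\<close>, compatible with restrictions and right inverse to the passage to the body.
\<close>

locale local_hom =
  fixes W :: "(real ^ 'p::{finite,linorder}) set" and q :: nat
    and h :: "(real ^ 'p::{finite,linorder}) set \<Rightarrow> (real ^ 'p::{finite,linorder} \<Rightarrow> real) \<Rightarrow> real ^ 'p::{finite,linorder} \<Rightarrow> grass"
  assumes W: "open W"
    and h_closed: "\<lbrakk>open V; V \<subseteq> W; smooth_on V f\<rbrakk> \<Longrightarrow> h V f \<in> domain_sections q V"
    and h_even: "\<lbrakk>open V; V \<subseteq> W; smooth_on V f\<rbrakk> \<Longrightarrow> gparity False (h V f w)"
    and h_body: "\<lbrakk>open V; V \<subseteq> W; smooth_on V f; w \<in> V\<rbrakk> \<Longrightarrow> gcoeff (h V f w) {} = f w"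
    and h_add: "\<lbrakk>open V; V \<subseteq> W; smooth_on V f; smooth_on V g\<rbrakk> \<Longrightarrow>
      h V (\<lambda>z. f z + g z) w = h V f w + h V g w"
    and h_mult: "\<lbrakk>open V; V \<subseteq> W; smooth_on V f; smooth_on V g\<rbrakk> \<Longrightarrow>
      h V (\<lambda>z. f z * g z) w = h V f w * h V g w"
    and h_const: "\<lbrakk>open V; V \<subseteq> W; w \<in> V\<rbrakk> \<Longrightarrow> h V (\<lambda>_. c) w = of_real c"
    and h_local: "\<lbrakk>open V; V \<subseteq> W; open V'; V' \<subseteq> V; smooth_on V f; w \<in> V'\<rbrakk> \<Longrightarrow> h V' f w = h V f w"
    and h_cong: "\<lbrakk>open V; V \<subseteq> W; \<And>z. z \<in> V \<Longrightarrow> f z = g z\<rbrakk> \<Longrightarrow> h V f w = h V g w"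
begin

context
  fixes V assumes V: "open V" "V \<subseteq> W"
begin

lemma h_outside: "smooth_on V f \<Longrightarrow> w \<notin> V \<Longrightarrow> h V f w = 0"
  by (rule domain_sectionsD(3)[OF h_closed[OF V]])

lemma h_zero: "h V (\<lambda>_. 0) w = 0"
  using h_const[OF V, of w 0] h_outside[of "\<lambda>_. 0" w] by (cases "w \<in> V") auto

lemma h_cmult:
  assumes "smooth_on V f"
  shows "h V (\<lambda>z. c * f z) w = c *\<^sub>R h V f w"
proof (cases "w \<in> V")
  case True
  then show ?thesis
    using h_mult[OF V smooth_on_const assms, of c w] h_const[OF V True] by (simp add: scaleR_conv_of_real)
next
  case False
  then show ?thesis using h_outside assms smooth_on_mult[OF V(1) smooth_on_const assms] by simp
qed

lemma h_sum: "finite X \<Longrightarrow> (\<And>x. x \<in> X \<Longrightarrow> smooth_on V (f x)) \<Longrightarrow>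
    h V (\<lambda>z. \<Sum>x\<in>X. f x z) w = (\<Sum>x\<in>X. h V (f x) w)"
  by (induction X rule: finite_induct) (simp_all add: h_zero h_add[OF V] smooth_on_sum[OF V(1)])

lemma eg_h: "smooth_on V f \<Longrightarrow> eg (Eg (h V f w)) = h V f w"
  by (simp add: eg_Eg h_even[OF V])

lemma h_even_smooth: "smooth_on V f \<Longrightarrow> (\<lambda>w. Eg (h V f w)) \<in> even_smooth q V"
  using domain_sectionsD[OF h_closed[OF V]] by (simp add: even_smooth_def eg_h)

text \<open>The difference is even and has no body, so it starts in degree 2.\<close>

lemma h_deg:
  assumes "smooth_on V f" "w \<in> V"
  shows "gdeg_ge 2 (h V f w - of_real (f w))"
  unfolding gdeg_ge_def
proof (intro allI impI)
  fix I :: "nat set" assume I: "card I < 2"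
  show "gcoeff (h V f w - of_real (f w)) I = 0"
  proof (cases "finite I \<and> I \<noteq> {}")
    case True
    then have "card I \<noteq> 0" by auto
    then have "card I = 1" using I by linarith
    then have "odd (card I)" by simp
    then show ?thesis using True h_even[OF V assms(1)] by (simp add: gparity_def)
  qed (use h_body[OF V assms] in auto)
qed

end

section \<open>The extension that fixes the odd generators\<close>

text \<open>The substitution \<Sum> f_I \<xi>^I \<mapsto> \<Sum> h(f_I) \<xi>^I: the pullback along
  the change of coordinates that alters the even coordinates as h does and keeps the odd
  ones.\<close>

definition E :: "(real ^ 'p::{finite,linorder}) set \<Rightarrow> (real ^ 'p::{finite,linorder} \<Rightarrow> grass) \<Rightarrow> real ^ 'p::{finite,linorder} \<Rightarrow> grass" where
  "E V F w = (\<Sum>I\<in>Pow {..<q}. h V (\<lambda>z. gcoeff (F z) I) w * gmon I)"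

context
  fixes V assumes V: "open V" "V \<subseteq> W"
begin

lemma E_closed: "F \<in> domain_sections q V \<Longrightarrow> E V F \<in> domain_sections q V"
proof (rule domain_sectionsI)
  assume F: "F \<in> domain_sections q V"
  note s = domain_sectionsD(1)[OF F]
  show "gsmooth V (E V F)"
    unfolding E_def[abs_def]
    by (intro gsmooth_sum gsmooth_times gsmooth_const V(1) domain_sectionsD(4)[OF h_closed[OF V s]])
  show "gens q (E V F w)" for w
    unfolding E_def by (intro gens_sum gens_times gens_gmon domain_sectionsD(2)[OF h_closed[OF V s]]) auto
  show "E V F w = 0" if "w \<notin> V" for w
    unfolding E_def using h_outside[OF V s that] by simp
qed

lemma E_cong: "(\<And>z. z \<in> V \<Longrightarrow> F z = G z) \<Longrightarrow> E V F w = E V G w"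
  unfolding E_def by (intro sum.cong refl arg_cong2[where f = "(*)"] h_cong[OF V]) simp

lemma E_add:
  assumes F: "F \<in> domain_sections q V" and G: "G \<in> domain_sections q V"
  shows "E V (\<lambda>z. F z + G z) w = E V F w + E V G w"
  by (simp add: E_def h_add[OF V domain_sectionsD(1)[OF F] domain_sectionsD(1)[OF G]]
      distrib_right sum.distrib)

lemma E_scaleR: "F \<in> domain_sections q V \<Longrightarrow> E V (\<lambda>z. r *\<^sub>R F z) w = r *\<^sub>R E V F w"
  by (simp add: E_def h_cmult[OF V domain_sectionsD(1)] scaleR_sum_right)

lemma E_scalar_gmon:
  assumes "I \<subseteq> {..<q}" "smooth_on V f"
  shows "E V (\<lambda>z. f z *\<^sub>R gmon I) w = h V f w * gmon I"
proof -
  have "finite I" using assms(1) finite_subset by blast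
  then have "h V (\<lambda>z. gcoeff (f z *\<^sub>R gmon I) J) w * gmon J = (if J = I then h V f w * gmon I else 0)" for J
    by (simp add: gcoeff_gmon h_zero[OF V])
  then show ?thesis using assms(1) by (simp add: E_def)
qed

lemma E_one: "w \<in> V \<Longrightarrow> E V (\<lambda>m. if m \<in> V then 1 else 0) w = 1"
proof -
  assume w: "w \<in> V"
  have "E V (\<lambda>m. if m \<in> V then 1 else 0) w = E V (\<lambda>m. 1 *\<^sub>R gmon {}) w"
    by (rule E_cong) simp
  also have "\<dots> = 1" using h_const[OF V w, of 1] by (subst E_scalar_gmon) auto
  finally show ?thesis .
qed

text \<open>The values of h are even, hence central, and h is multiplicative, so on both sides the
  only signs are those of the products of monomials. Subsets I of K correspond to disjoint pairs (I,
  J) with union K; the pairs that are not disjoint contribute 0.\<close>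

lemma E_mult:
  assumes F: "F \<in> domain_sections q V" and G: "G \<in> domain_sections q V"
  shows "E V (\<lambda>z. F z * G z) w = E V F w * E V G w"
proof -
  let ?Q = "Pow {..<q}"
  define hF hG where "hF I = h V (\<lambda>z. gcoeff (F z) I) w" and "hG I = h V (\<lambda>z. gcoeff (G z) I) w" for I
  note s = domain_sectionsD(1)[OF F] domain_sectionsD(1)[OF G]
  have fin: "finite K" if "K \<in> ?Q" for K using that finite_subset by auto
  have "E V (\<lambda>z. F z * G z) w = (\<Sum>K\<in>?Q. \<Sum>I\<in>Pow K. gsgn I (K - I) *\<^sub>R (hF I * hG (K - I)) * gmon K)"
    unfolding E_def
  proof (rule sum.cong[OF refl])
    fix K assume K: "K \<in> ?Q"
    have "h V (\<lambda>z. gcoeff (F z * G z) K) w =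
        h V (\<lambda>z. \<Sum>I\<in>Pow K. gsgn I (K - I) * (gcoeff (F z) I * gcoeff (G z) (K - I))) w"
      by (simp add: gcoeff_times mult.assoc)
    also have "\<dots> = (\<Sum>I\<in>Pow K. gsgn I (K - I) *\<^sub>R (hF I * hG (K - I)))"
      using fin[OF K]
      by (simp add: h_sum[OF V] h_cmult[OF V] h_mult[OF V] s smooth_on_mult[OF V(1)] hF_def hG_def)
    finally show "h V (\<lambda>z. gcoeff (F z * G z) K) w * gmon K =
        (\<Sum>I\<in>Pow K. gsgn I (K - I) *\<^sub>R (hF I * hG (K - I)) * gmon K)"
      by (simp add: sum_distrib_right)
  qed
  also have "\<dots> = (\<Sum>(K, I)\<in>Sigma ?Q Pow. gsgn I (K - I) *\<^sub>R (hF I * hG (K - I)) * gmon K)"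
    using fin by (subst sum.Sigma) auto
  also have "\<dots> = (\<Sum>(I, J)\<in>{(I, J) \<in> ?Q \<times> ?Q. I \<inter> J = {}}. gsgn I J *\<^sub>R (hF I * hG J) * gmon (I \<union> J))"
  proof (rule sum.reindex_bij_witness[where i = "\<lambda>(I, J). (I \<union> J, I)" and j = "\<lambda>(K, I). (I, K - I)"])
    fix z assume "z \<in> Sigma ?Q Pow"
    then obtain K I where z: "z = (K, I)" "K \<subseteq> {..<q}" "I \<subseteq> K" by auto
    have u: "I \<union> (K - I) = K" using z by auto
    show "(case (case z of (K, I) \<Rightarrow> (I, K - I)) of (I, J) \<Rightarrow> (I \<union> J, I)) = z"
      using z(1) u by simp
    show "(case z of (K, I) \<Rightarrow> (I, K - I)) \<in> {(I, J) \<in> ?Q \<times> ?Q. I \<inter> J = {}}"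
      using z by auto
    show "(case (case z of (K, I) \<Rightarrow> (I, K - I)) of
        (I, J) \<Rightarrow> gsgn I J *\<^sub>R (hF I * hG J) * gmon (I \<union> J)) =
      (case z of (K, I) \<Rightarrow> gsgn I (K - I) *\<^sub>R (hF I * hG (K - I)) * gmon K)"
      using z(1) u by simp
  next
    fix z assume "z \<in> {(I, J) \<in> ?Q \<times> ?Q. I \<inter> J = {}}"
    then obtain I J where z: "z = (I, J)" "I \<subseteq> {..<q}" "J \<subseteq> {..<q}" "I \<inter> J = {}" by auto
    have "I \<union> J - I = J" using z by auto
    then show "(case (case z of (I, J) \<Rightarrow> (I \<union> J, I)) of (K, I) \<Rightarrow> (I, K - I)) = z"
      using z(1) by simp
    show "(case z of (I, J) \<Rightarrow> (I \<union> J, I)) \<in> Sigma ?Q Pow" using z by auto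
  qed
  also have "\<dots> = (\<Sum>(I, J)\<in>?Q \<times> ?Q. (hF I * gmon I) * (hG J * gmon J))"
  proof (rule sum.mono_neutral_cong_left)
    have 1: "(hF I * gmon I) * (hG J * gmon J) =
        (if I \<inter> J = {} then gsgn I J *\<^sub>R (hF I * hG J) * gmon (I \<union> J) else 0)"
      if "I \<in> ?Q" "J \<in> ?Q" for I J
    proof -
      have "gmon I * hG J = hG J * gmon I"
        using eg_commute[of "Eg (hG J)" "gmon I"] eg_h[OF V s(2), of J w] by (simp add: hG_def)
      then have "(hF I * gmon I) * (hG J * gmon J) = (hF I * hG J) * (gmon I * gmon J)"
        by (metis mult.assoc)
      then show ?thesis using gmon_times[OF fin[OF that(1)] fin[OF that(2)]] by simp
    qed
    show "\<forall>i\<in>?Q \<times> ?Q - {(I, J) \<in> ?Q \<times> ?Q. I \<inter> J = {}}. (case i of (I, J) \<Rightarrow> hF I * gmon I * (hG J * gmon J)) = 0"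
    proof
      fix z assume "z \<in> ?Q \<times> ?Q - {(I, J) \<in> ?Q \<times> ?Q. I \<inter> J = {}}"
      then obtain I J where "z = (I, J)" "I \<in> ?Q" "J \<in> ?Q" "I \<inter> J \<noteq> {}" by auto
      then show "(case z of (I, J) \<Rightarrow> hF I * gmon I * (hG J * gmon J)) = 0" using 1[of I J] by simp
    qed
    show "(case z of (I, J) \<Rightarrow> gsgn I J *\<^sub>R (hF I * hG J) * gmon (I \<union> J)) =
        (case z of (I, J) \<Rightarrow> hF I * gmon I * (hG J * gmon J))"
      if "z \<in> {(I, J) \<in> ?Q \<times> ?Q. I \<inter> J = {}}" for z
      using that 1 by auto
  qed auto
  also have "\<dots> = E V F w * E V G w"
    by (simp add: E_def hF_def hG_def sum_product sum.cartesian_product)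
  finally show ?thesis .
qed

lemma E_parity:
  assumes F: "F \<in> domain_sections q V" and d: "\<And>w. gparity d (F w)"
  shows "gparity d (E V F w)"
  unfolding E_def
proof (rule gparity_sum)
  fix I assume "I \<in> Pow {..<q}"
  show "gparity d (h V (\<lambda>z. gcoeff (F z) I) w * gmon I)"
  proof (cases "odd (card I) = d")
    case True
    have "gparity (False \<noteq> odd (card I)) (h V (\<lambda>z. gcoeff (F z) I) w * gmon I)"
      by (rule gparity_times[OF h_even[OF V domain_sectionsD(1)[OF F]] gparity_gmon])
    then show ?thesis using True by simp
  next
    case False
    then have "(\<lambda>z. gcoeff (F z) I) = (\<lambda>_. 0)" using d by (auto simp: gparity_def)
    then show ?thesis by (simp add: h_zero[OF V])
  qed
qed

lemma E_local:
  assumes "open V'" "V' \<subseteq> V" "F \<in> domain_sections q V" "w \<in> V'"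
  shows "E V' F w = E V F w"
  unfolding E_def using h_local[OF V assms(1,2) domain_sectionsD(1)[OF assms(3)] assms(4)] by simp

text \<open>The monomial \<xi>^I is kept and its coefficient changes by terms of degree at least 2,
  so E differs from the identity by terms of higher degree. A gain of one degree is enough for
  \<open>E_bij\<close>.\<close>

lemma E_deg:
  assumes F: "F \<in> domain_sections q V" and k: "\<And>w. gdeg_ge k (F w)"
  shows "gdeg_ge (Suc k) (E V F w - F w)"
proof (cases "w \<in> V")
  case True
  have "F w = (\<Sum>I\<in>Pow {..<q}. of_real (gcoeff (F w) I) * gmon I)"
    by (unfold scaleR_conv_of_real[symmetric], rule gens_expand[OF domain_sectionsD(2)[OF F]])
  then have "E V F w - F w = E V F w - (\<Sum>I\<in>Pow {..<q}. of_real (gcoeff (F w) I) * gmon I)"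
    by (rule arg_cong)
  also have "\<dots> = (\<Sum>I\<in>Pow {..<q}. (h V (\<lambda>z. gcoeff (F z) I) w - of_real (gcoeff (F w) I)) * gmon I)"
    by (simp add: E_def left_diff_distrib sum_subtractf)
  also have "gdeg_ge (Suc k) \<dots>"
  proof (rule gdeg_ge_sum)
    fix I assume "I \<in> Pow {..<q}"
    show "gdeg_ge (Suc k) ((h V (\<lambda>z. gcoeff (F z) I) w - of_real (gcoeff (F w) I)) * gmon I)"
    proof (cases "card I < k")
      case True
      then have "(\<lambda>z. gcoeff (F z) I) = (\<lambda>_. 0)" using k by (auto simp: gdeg_ge_def)
      moreover from this have "gcoeff (F w) I = 0" by metis
      ultimately show ?thesis by (simp add: h_zero[OF V])
    next
      case False
      have "gdeg_ge (2 + card I) ((h V (\<lambda>z. gcoeff (F z) I) w - of_real (gcoeff (F w) I)) * gmon I)"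
        by (intro gdeg_ge_times h_deg[OF V domain_sectionsD(1)[OF F] True] gdeg_ge_gmon)
      then show ?thesis by (rule gdeg_ge_mono) (use False in simp)
    qed
  qed
  finally show ?thesis .
next
  case False
  then show ?thesis using domain_sectionsD(3)[OF F] domain_sectionsD(3)[OF E_closed[OF F]] by simp
qed

text \<open>E is unipotent with respect to the degree. A section in the kernel has every degree as a
  lower bound and so vanishes; a preimage arises by repeatedly adding the remaining error, until the
  error starts above degree q.\<close>

lemma E_bij: "bij_betw (E V) (domain_sections q V) (domain_sections q V)"
  unfolding bij_betw_def
proof
  show "inj_on (E V) (domain_sections q V)"
  proof (rule inj_onI)
    fix F G assume F: "F \<in> domain_sections q V" and G: "G \<in> domain_sections q V" and e: "E V F = E V G"
    define H where "H w = F w - G w" for w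
    have H: "H \<in> domain_sections q V" unfolding H_def[abs_def] by (rule domain_sections_diff[OF V(1) F G])
    have "E V F w = E V H w + E V G w" for w
      using E_add[OF H G, of w] by (simp add: H_def[abs_def])
    then have H0: "E V H w = 0" for w using e by simp
    have "gdeg_ge k (H w)" for k w
    proof (induction k arbitrary: w)
      case (Suc k)
      then have "gdeg_ge (Suc k) (E V H w - H w)" by (intro E_deg H)
      then show ?case using H0 by (simp add: gdeg_ge_def)
    qed simp
    then have "H w = 0" for w using gens_gdeg_ge_eq_0[OF domain_sectionsD(2)[OF H]] by blast
    then show "F = G" by (simp add: H_def fun_eq_iff)
  qed
  show "E V ` domain_sections q V = domain_sections q V"
  proof (intro subset_antisym subsetI)
    fix G assume G: "G \<in> domain_sections q V"
    have "\<exists>F\<in>domain_sections q V. \<forall>w. gdeg_ge k (G w - E V F w)" for k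
    proof (induction k)
      case 0
      show ?case using G by auto
    next
      case (Suc k)
      then obtain F where F: "F \<in> domain_sections q V" "\<And>w. gdeg_ge k (G w - E V F w)" by auto
      define r where "r w = G w - E V F w" for w
      have r: "r \<in> domain_sections q V"
        unfolding r_def[abs_def] by (intro domain_sections_diff V(1) G E_closed F)
      have "gdeg_ge (Suc k) (G w - E V (\<lambda>w. F w + r w) w)" for w
      proof -
        have "G w - E V (\<lambda>w. F w + r w) w = 0 - (E V r w - r w)"
          unfolding E_add[OF F(1) r] by (simp add: r_def)
        moreover have "gdeg_ge (Suc k) (E V r w - r w)"
          by (rule E_deg[OF r]) (use F(2) in \<open>simp add: r_def\<close>)
        ultimately show ?thesis by (metis gdeg_ge_diff gdeg_ge_zero)
      qed
      then show ?case using domain_sections_add[OF V(1) F(1) r] by blast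
    qed
    then obtain F where F: "F \<in> domain_sections q V" "\<And>w. gdeg_ge (Suc q) (G w - E V F w)" by blast
    have "G w - E V F w = 0" for w
      by (rule gens_gdeg_ge_eq_0[OF _ F(2)])
        (auto intro!: gens_diff domain_sectionsD(2)[OF G] domain_sectionsD(2)[OF E_closed[OF F(1)]])
    then have "E V F = G" by (simp add: fun_eq_iff)
    then show "G \<in> E V ` domain_sections q V" using F(1) by blast
  qed (use E_closed in auto)
qed

text \<open>Hadamard's expansion on a ball B about w0, with h applied to each term: compatibility
  with restrictions allows h to be used on B, where the remainders R_a live, and multiplicativity
  splits the products.\<close>

lemma h_hadamard:
  assumes f: "smooth_on V f" and w0: "w0 \<in> V"
  obtains B R where "open B" "w0 \<in> B" "B \<subseteq> V" "\<And>a. R a \<in> even_smooth q B"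
    "\<And>w. w \<in> B \<Longrightarrow> Eg (h V f w) = of_real (f w0) +
      (\<Sum>a\<in>UNIV. (of_real (w $ a - w0 $ a) + (Eg (h V (\<lambda>z. z $ a) w) - of_real (w $ a))) * R a w)"
proof -
  obtain r where r: "r > 0" "ball w0 r \<subseteq> V" using V(1) w0 openE by blast
  let ?B = "ball w0 r"
  have B: "open ?B" "?B \<subseteq> W" using r V by auto
  obtain R where R: "\<And>a. smooth_on ?B (R a)"
    "\<And>w. w \<in> ?B \<Longrightarrow> f w = f w0 + (\<Sum>a\<in>UNIV. (w $ a - w0 $ a) * R a w)"
    using hadamard[OF smooth_on_subset[OF f r(2)]] by metis
  show thesis
  proof (rule that[of ?B "\<lambda>a w. Eg (h ?B (R a) w)"])
    show "(\<lambda>w. Eg (h ?B (R a) w)) \<in> even_smooth q ?B" for a by (rule h_even_smooth[OF B R(1)])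
    fix w assume w: "w \<in> ?B"
    have s: "smooth_on ?B (\<lambda>z. (z $ a - w0 $ a) * R a z)" for a
      by (intro smooth_on_mult smooth_on_diff R(1) smooth_on_coord smooth_on_const open_ball)
    have c: "h ?B (\<lambda>z. z $ a - w0 $ a) w = h V (\<lambda>z. z $ a) w - of_real (w0 $ a)" for a
      using h_add[OF B smooth_on_coord smooth_on_const, of a "- w0 $ a" w]
        h_local[OF V open_ball r(2) smooth_on_coord w] h_const[OF B w, of "- w0 $ a"] by simp
    have "h V f w = h ?B f w" by (rule h_local[OF V open_ball r(2) f w, symmetric])
    also have "\<dots> = h ?B (\<lambda>w. f w0 + (\<Sum>a\<in>UNIV. (w $ a - w0 $ a) * R a w)) w"
      by (rule h_cong[OF B R(2)])
    also have "\<dots> = of_real (f w0) + (\<Sum>a\<in>UNIV. h ?B (\<lambda>w. (w $ a - w0 $ a) * R a w) w)"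
      by (simp add: h_add[OF B] smooth_on_sum s h_sum[OF B] h_const[OF B w])
    also have "\<dots> = of_real (f w0) + (\<Sum>a\<in>UNIV. (h V (\<lambda>z. z $ a) w - of_real (w0 $ a)) * h ?B (R a) w)"
      by (simp add: h_mult[OF B] smooth_on_diff R(1) c)
    finally have e: "h V f w = of_real (f w0) +
        (\<Sum>a\<in>UNIV. (h V (\<lambda>z. z $ a) w - of_real (w0 $ a)) * h ?B (R a) w)" .
    show "Eg (h V f w) = of_real (f w0) + (\<Sum>a\<in>UNIV. (of_real (w $ a - w0 $ a) +
        (Eg (h V (\<lambda>z. z $ a) w) - of_real (w $ a))) * Eg (h ?B (R a) w))"
      by (rule egrass_eqI, subst eg_h[OF V f])
        (simp add: e eg_h[OF V smooth_on_coord] eg_h[OF B R(1)])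
  qed (use r in auto)
qed

text \<open>The smooth functions are generated by the coordinates as far as such families are concerned.\<close>

lemma h_trivial:
  assumes "\<And>a w. w \<in> V \<Longrightarrow> h V (\<lambda>z. z $ a) w = of_real (w $ a)"
    and f: "smooth_on V f" and w0: "w0 \<in> V"
  shows "h V f w0 = of_real (f w0)"
proof -
  have "Eg (h V f w0) = of_real (f w0)"
  proof (rule h_hadamard[OF f w0])
    fix B R assume "w0 \<in> B" "\<And>w. w \<in> B \<Longrightarrow> Eg (h V f w) = of_real (f w0) +
      (\<Sum>a\<in>UNIV. (of_real (w $ a - w0 $ a) + (Eg (h V (\<lambda>z. z $ a) w) - of_real (w $ a))) * R a w)"
    then show ?thesis using assms(1)[OF w0] by simp
  qed
  then show ?thesis using eg_h[OF V f, of w0] by simp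
qed

end

section \<open>Inversion of the extension\<close>

text \<open>The nilpotent displacement n_a = h(w_a) - w_a. The coordinate is cut off because h has
  the value 0 outside of W.\<close>

definition shift :: "'p \<Rightarrow> real ^ 'p::{finite,linorder} \<Rightarrow> egrass" where
  "shift a w = Eg (h W (\<lambda>z. z $ a) w) - (if w \<in> W then of_real (w $ a) else 0)"

lemma shift_closed: "shift a \<in> even_smooth q W"
proof -
  have "gsmooth W (\<lambda>w. if w \<in> W then of_real (w $ a) else 0)"
    by (rule gsmooth_cong[OF W _ gsmooth_of_real[OF smooth_on_coord, of W a]]) auto
  then have "(\<lambda>w. if w \<in> W then of_real (w $ a) else 0) \<in> even_smooth q W"
    by (simp add: even_smooth_def if_distrib[of eg] if_distrib[of "gens q"] cong: if_cong)
  then have "(\<lambda>w. Eg (h W (\<lambda>z. z $ a) w)) - (\<lambda>w. if w \<in> W then of_real (w $ a) else 0) \<in> even_smooth q W"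
    using h_even_smooth[OF W subset_refl smooth_on_coord] even_smooth_closed(1)[OF W] by blast
  then show ?thesis by (simp add: shift_def[abs_def] fun_diff_def)
qed

lemma shift_deg: "gdeg_ge 2 (eg (shift a w))"
proof (cases "w \<in> W")
  case True
  then show ?thesis using h_deg[OF W subset_refl smooth_on_coord True, of a]
    by (simp add: shift_def eg_h[OF W subset_refl])
next
  case False
  then show ?thesis using h_outside[OF W subset_refl smooth_on_coord False, of a]
    by (simp add: shift_def eg_h[OF W subset_refl])
qed

text \<open>Lagrange inversion is applied to each coefficient of G separately, with F = h(G_I); the
  monomials are constant factors. The range up to |i| = q + 1 is the one of
  \<open>T_nil\<close>.\<close>

theorem E_inversion:
  assumes G: "G \<in> domain_sections q W" and w0: "w0 \<in> W"
  shows "G w0 = (\<Sum>k\<le>Suc q. \<Sum>i\<in>multi_idx k. ((-1) ^ k / (\<Prod>a\<in>UNIV. fact (i a))) *\<^sub>R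
    (\<Sum>I\<in>Pow {..<q}. eg (multi_pd W i (\<lambda>w. (\<Prod>a\<in>UNIV. shift a w ^ i a) *
      (Eg (h W (\<lambda>z. gcoeff (G z) I) w) * jac W shift w)) w0) * gmon I))"
proof -
  define c where "c k i = (-1) ^ k / (\<Prod>a\<in>UNIV. fact (i a) :: real)" for k :: nat and i :: "'p \<Rightarrow> nat"
  define M where "M i I = multi_pd W i (\<lambda>w. (\<Prod>a\<in>UNIV. shift a w ^ i a) *
      (Eg (h W (\<lambda>z. gcoeff (G z) I) w) * jac W shift w)) w0" for i I
  have *: "(\<Sum>k\<le>Suc q. \<Sum>i\<in>multi_idx k. of_real (c k i) * M i I) = of_real (gcoeff (G w0) I)" for I
  proof -
    show ?thesis
    proof (rule h_hadamard[OF W subset_refl domain_sectionsD(1)[OF G, of I] w0])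
      fix B R assume B: "open B" "w0 \<in> B" "B \<subseteq> W" "\<And>a. R a \<in> even_smooth q B"
        "\<And>w. w \<in> B \<Longrightarrow> Eg (h W (\<lambda>z. gcoeff (G z) I) w) = of_real (gcoeff (G w0) I) +
          (\<Sum>a\<in>UNIV. (of_real (w $ a - w0 $ a) + (Eg (h W (\<lambda>z. z $ a) w) - of_real (w $ a))) * R a w)"
      show ?thesis unfolding c_def M_def
      proof (rule lagrange_inversion[OF W shift_closed shift_deg B(1-4)])
        fix w assume w: "w \<in> B"
        then have "w \<in> W" using B(3) by auto
        then show "Eg (h W (\<lambda>z. gcoeff (G z) I) w) = of_real (gcoeff (G w0) I) +
            (\<Sum>a\<in>UNIV. (of_real (w $ a - w0 $ a) + shift a w) * R a w)"
          using B(5)[OF w] by (simp add: shift_def)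
      qed
    qed
  qed
  have "G w0 = (\<Sum>I\<in>Pow {..<q}. eg (of_real (gcoeff (G w0) I)) * gmon I)"
    by (unfold eg_of_real scaleR_conv_of_real[symmetric], rule gens_expand[OF domain_sectionsD(2)[OF G]])
  also have "\<dots> = (\<Sum>I\<in>Pow {..<q}. \<Sum>k\<le>Suc q. \<Sum>i\<in>multi_idx k. c k i *\<^sub>R (eg (M i I) * gmon I))"
    unfolding *[symmetric]
    by (simp only: eg_sum sum_distrib_right times_egrass.rep_eq eg_of_real mult.assoc scaleR_conv_of_real)
  also have "\<dots> = (\<Sum>k\<le>Suc q. \<Sum>I\<in>Pow {..<q}. \<Sum>i\<in>multi_idx k. c k i *\<^sub>R (eg (M i I) * gmon I))"
    by (rule sum.swap)
  also have "\<dots> = (\<Sum>k\<le>Suc q. \<Sum>i\<in>multi_idx k. \<Sum>I\<in>Pow {..<q}. c k i *\<^sub>R (eg (M i I) * gmon I))"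
    by (rule sum.cong[OF refl]) (rule sum.swap)
  finally show ?thesis unfolding c_def M_def by (simp only: scaleR_sum_right)
qed

end

section \<open>Charts\<close>

lemma gsmooth_grecip:
  assumes W: "open W" and F: "gsmooth W F" and nz: "\<And>w. w \<in> W \<Longrightarrow> gcoeff (F w) {} \<noteq> 0"
  shows "gsmooth W (\<lambda>w. grecip q (F w))"
proof -
  have "smooth_on W (\<lambda>w. gcoeff (F w) {})" using F by (simp add: gsmooth_def)
  then have "smooth_on W (\<lambda>w. inverse (gcoeff (F w) {}))" by (rule smooth_on_inverse[OF W _ nz])
  then have i: "smooth_on W (\<lambda>w. 1 / gcoeff (F w) {})" by (simp add: inverse_eq_divide)
  show ?thesis unfolding grecip_def
    by (intro gsmooth_scaleR gsmooth_sum gsmooth_power gsmooth_diff gsmooth_const W F i)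
qed

definition gpart :: "bool \<Rightarrow> grass \<Rightarrow> grass" where
  "gpart d a = Grass (\<lambda>I. if odd (card I) = d then gcoeff a I else 0)"

lemma gcoeff_gpart: "gcoeff (gpart d a) I = (if odd (card I) = d then gcoeff a I else 0)"
  unfolding gpart_def by (subst gcoeff_Grass) auto

lemma gpart_add: "gpart False a + gpart True a = a"
  by (rule grass_eqI) (simp add: gcoeff_gpart)

lemma gparity_gpart: "gparity d (gpart d a)"
  by (simp add: gparity_def gcoeff_gpart)

lemma gpart_gparity: "gparity d a \<Longrightarrow> gpart d a = a" "gparity d a \<Longrightarrow> gpart (\<not> d) a = 0"
  by (rule grass_eqI; auto simp: gparity_def gcoeff_gpart)+

lemma domain_sections_gpart:
  assumes "F \<in> domain_sections q V"
  shows "(\<lambda>w. gpart d (F w)) \<in> domain_sections q V"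
proof (rule domain_sectionsI)
  show "gsmooth V (\<lambda>w. gpart d (F w))" unfolding gsmooth_def
  proof
    fix I
    show "smooth_on V (\<lambda>w. gcoeff (gpart d (F w)) I)"
      using domain_sectionsD(1)[OF assms, of I] by (cases "odd (card I) = d") (simp_all add: gcoeff_gpart)
  qed
  show "gens q (gpart d (F w))" for w
    using domain_sectionsD(2)[OF assms, of w] by (simp add: gens_def gcoeff_gpart)
  show "gpart d (F w) = 0" if "w \<notin> V" for w
    using domain_sectionsD(3)[OF assms that] gpart_gparity[of d 0] by simp
qed

lemma superalgebra_homD:
  assumes "f \<in> superalgebra_hom A B"
  shows "f \<in> ring_hom A B" "a \<in> carrier A \<Longrightarrow> f (r \<odot>\<^bsub>A\<^esub> a) = r \<odot>\<^bsub>B\<^esub> f a"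
    "a \<in> grade A d \<Longrightarrow> f a \<in> grade B d"
  using assms unfolding superalgebra_hom_def by blast+

text \<open>Uniqueness of the decomposition resolves the definite description. The case distinction
  is due to \<open>grade_decomp\<close>, which lists the even part first.\<close>

lemma hpart_unique:
  assumes "superalgebra A" "g \<in> grade A d" "h \<in> grade A (\<not> d)"
  shows "hpart A d (g \<oplus>\<^bsub>A\<^esub> h) = g"
proof -
  interpret R: ring A by (rule superalgebra.axioms(1)[OF assms(1)])
  interpret A: superalgebra A by (rule assms)
  have c: "g \<in> carrier A" "h \<in> carrier A" using assms A.grade_carrier by auto
  have u: "g1 = g2 \<and> h1 = h2" if "g1 \<in> grade A False" "h1 \<in> grade A True" "g2 \<in> grade A False"
    "h2 \<in> grade A True" "g1 \<oplus>\<^bsub>A\<^esub> h1 = g2 \<oplus>\<^bsub>A\<^esub> h2" for g1 h1 g2 h2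
  proof -
    have "g1 \<oplus>\<^bsub>A\<^esub> h1 \<in> carrier A" using that A.grade_carrier by blast
    from A.grade_decomp[OF this]
    obtain z where z: "\<And>y. (case y of (g, h) \<Rightarrow>
        g \<in> grade A False \<and> h \<in> grade A True \<and> g1 \<oplus>\<^bsub>A\<^esub> h1 = g \<oplus>\<^bsub>A\<^esub> h) \<Longrightarrow> y = z"
      by (rule ex1E) blast
    have "(g1, h1) = z" "(g2, h2) = z" by (rule z; use that in simp)+
    then show ?thesis by auto
  qed
  show ?thesis
    unfolding hpart_def
  proof (rule the_equality)
    show "g \<in> grade A d \<and> (\<exists>ha\<in>grade A (\<not> d). g \<oplus>\<^bsub>A\<^esub> h = g \<oplus>\<^bsub>A\<^esub> ha)" using assms by auto
    fix g' assume "g' \<in> grade A d \<and> (\<exists>ha\<in>grade A (\<not> d). g \<oplus>\<^bsub>A\<^esub> h = g' \<oplus>\<^bsub>A\<^esub> ha)"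
    then obtain h' where g': "g' \<in> grade A d" "h' \<in> grade A (\<not> d)" "g \<oplus>\<^bsub>A\<^esub> h = g' \<oplus>\<^bsub>A\<^esub> h'" by auto
    have c': "g' \<in> carrier A" "h' \<in> carrier A" using g' A.grade_carrier by auto
    show "g' = g"
    proof (cases d)
      case True
      then show ?thesis
        using u[of h' g' h g] g' assms R.a_comm[OF c'(2,1)] R.a_comm[OF c(2,1)] by simp
    next
      case False
      then show ?thesis using u[of g' h' g h] g' assms by simp
    qed
  qed
qed

section \<open>Superfunctions in a coordinate system\<close>

locale chart =
  fixes X :: "('m, 's) superspace" and q :: nat and x :: "('m, 'p::{finite,linorder}, 's) chart"
  assumes X: "superringed_space X" and x: "coord_sys X q x"
begin

abbreviation "T \<equiv> topspace (base X)"
abbreviation "W \<equiv> crange X x"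
abbreviation "\<phi> \<equiv> fst x"
abbreviation "pre \<equiv> preimg X x"
abbreviation "P \<equiv> snd x"
abbreviation "D \<equiv> domain_sections q"
abbreviation "A V \<equiv> sect X (pre V)"

lemma sect_superalgebra: "openin (base X) O' \<Longrightarrow> superalgebra (sect X O')"
  using X[unfolded superringed_space_def, THEN conjunct1] by simp

lemma W_open: "open W"
  using x by (simp add: coord_sys_def)

lemma morph: "morphism X (superdomain q W) x"
  and homeo: "homeomorphic_map (base X) (top_of_set W) \<phi>"
  using x by (auto simp: coord_sys_def isomorphism_def superdomain_def)

lemma openin_W: "openin (base (superdomain q W)) V \<longleftrightarrow> open V \<and> V \<subseteq> W"
  using openin_open_eq[OF W_open] by (simp add: superdomain_def)

lemma P_bij: "open V \<Longrightarrow> V \<subseteq> W \<Longrightarrow> bij_betw (P V) (D V) (carrier (A V))"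
proof -
  assume "open V" "V \<subseteq> W"
  then have "bij_betw (P V) (carrier (sect (superdomain q W) V)) (carrier (A V))"
    using x openin_W unfolding coord_sys_def isomorphism_def by blast
  then show ?thesis by (simp add: superdomain_def fun_superalg_def)
qed

lemma inj_\<phi>: "inj_on \<phi> T"
  by (rule homeomorphic_imp_injective_map[OF homeo])

lemma pre_subset: "pre V \<subseteq> T" by (auto simp: preimg_def)

lemma pre_W: "pre W = T" by (auto simp: preimg_def crange_def)

lemma pre_mono: "V' \<subseteq> V \<Longrightarrow> pre V' \<subseteq> pre V" by (auto simp: preimg_def)

lemma mem_pre: "m \<in> pre V \<longleftrightarrow> m \<in> T \<and> \<phi> m \<in> V" by (simp add: preimg_def)

lemma pre_open: "open V \<Longrightarrow> V \<subseteq> W \<Longrightarrow> openin (base X) (pre V)"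
  using openin_continuous_map_preimage[OF homeomorphic_imp_continuous_map[OF homeo], of V]
    openin_open_eq[OF W_open, of V] by (simp add: preimg_def)

lemma image_open:
  assumes "openin (base X) O'"
  shows "open (\<phi> ` O')" "\<phi> ` O' \<subseteq> W" "pre (\<phi> ` O') = O'"
proof -
  have "O' \<subseteq> T" using assms by (rule openin_subset)
  have "openin (top_of_set W) (\<phi> ` O')"
    using homeomorphic_imp_open_map[OF homeo] assms by (simp add: open_map_def)
  then show "open (\<phi> ` O')" "\<phi> ` O' \<subseteq> W" using openin_open_eq[OF W_open] by auto
  show "pre (\<phi> ` O') = O'"
    using \<open>O' \<subseteq> T\<close> inj_\<phi> by (auto simp: preimg_def inj_on_def)
qed

lemma image_pre: "V \<subseteq> W \<Longrightarrow> \<phi> ` pre V = V"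
  by (auto simp: preimg_def crange_def)

text \<open>The coordinate expression of a section over an arbitrary open subset; V = W is the case
  of \<open>crep\<close>. Smaller sets are needed because bodies and reduced sections are local
  notions.\<close>

definition cr :: "(real ^ 'p::{finite,linorder}) set \<Rightarrow> 's \<Rightarrow> real ^ 'p::{finite,linorder} \<Rightarrow> grass" where
  "cr V f = the_inv_into (D V) (P V) f"

lemma crep_cr: "crep X q x f = cr W f"
  by (simp add: crep_def cr_def)

text \<open>A function of the even coordinates as a function on the points, normalised to 0 like the
  sections of the reduced space.\<close>

definition lift :: "(real ^ 'p::{finite,linorder}) set \<Rightarrow> (real ^ 'p::{finite,linorder} \<Rightarrow> real) \<Rightarrow> 'm \<Rightarrow> real" where
  "lift V F m = (if m \<in> pre V then F (\<phi> m) else 0)"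

context
  fixes V assumes V: "open V" "V \<subseteq> W"
begin

lemma A_superalgebra: "superalgebra (A V)"
  by (rule sect_superalgebra[OF pre_open[OF V]])

interpretation R: ring "A V" by (rule superalgebra.axioms(1)[OF A_superalgebra])
interpretation A: superalgebra "A V" by (rule A_superalgebra)

lemma P_hom: "P V \<in> superalgebra_hom (sect (superdomain q W) V) (A V)"
  using morph[unfolded morphism_def, THEN conjunct2, THEN conjunct1] V openin_W by simp

lemma sd_simps: "carrier (sect (superdomain q W) V) = D V"
  "mult (sect (superdomain q W) V) = (\<lambda>f g m. f m * g m)"
  "add (sect (superdomain q W) V) = (\<lambda>f g m. f m + g m)"
  "one (sect (superdomain q W) V) = (\<lambda>m. if m \<in> V then 1 else 0)"
  "smult (sect (superdomain q W) V) = (\<lambda>r f m. r *\<^sub>R f m)"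
  "grade (sect (superdomain q W) V) d = {f \<in> D V. \<forall>w. gparity d (f w)}"
  by (auto simp: superdomain_def fun_superalg_def gparity_def)

lemma P_closed: "F \<in> D V \<Longrightarrow> P V F \<in> carrier (A V)"
  using P_bij[OF V] by (auto simp: bij_betw_def)

lemma P_add: "F \<in> D V \<Longrightarrow> G \<in> D V \<Longrightarrow> P V F \<oplus>\<^bsub>A V\<^esub> P V G = P V (\<lambda>w. F w + G w)"
  using ring_hom_add[OF superalgebra_homD(1)[OF P_hom]] by (simp add: sd_simps)

lemma P_mult: "F \<in> D V \<Longrightarrow> G \<in> D V \<Longrightarrow> P V F \<otimes>\<^bsub>A V\<^esub> P V G = P V (\<lambda>w. F w * G w)"
  using ring_hom_mult[OF superalgebra_homD(1)[OF P_hom]] by (simp add: sd_simps)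

lemma P_one: "\<one>\<^bsub>A V\<^esub> = P V (\<lambda>w. if w \<in> V then 1 else 0)"
  using ring_hom_one[OF superalgebra_homD(1)[OF P_hom]] by (simp add: sd_simps)

lemma P_smult: "F \<in> D V \<Longrightarrow> r \<odot>\<^bsub>A V\<^esub> P V F = P V (\<lambda>w. r *\<^sub>R F w)"
  using superalgebra_homD(2)[OF P_hom] by (simp add: sd_simps)

lemma P_grade: "F \<in> D V \<Longrightarrow> (\<And>w. gparity d (F w)) \<Longrightarrow> P V F \<in> grade (A V) d"
  using superalgebra_homD(3)[OF P_hom] by (simp add: sd_simps)

lemma D_zero: "(\<lambda>_. 0) \<in> D V"
  by (rule domain_sectionsI) auto

lemma D_of_real: "smooth_on V f \<Longrightarrow> (\<lambda>w. if w \<in> V then of_real (f w) else 0) \<in> D V"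
  by (rule domain_sections_cutI[OF V(1)]) (auto intro: gsmooth_of_real)

lemma D_one: "(\<lambda>w. if w \<in> V then 1 else 0) \<in> D V"
  using D_of_real[of "\<lambda>_. 1"] unfolding of_real_1 by simp

lemma D_minus: "F \<in> D V \<Longrightarrow> (\<lambda>w. - F w) \<in> D V"
  using domain_sections_diff[OF V(1) D_zero] by simp

lemma P_zero: "\<zero>\<^bsub>A V\<^esub> = P V (\<lambda>_. 0)"
proof -
  have "P V (\<lambda>_. 0) \<oplus>\<^bsub>A V\<^esub> P V (\<lambda>_. 0) = P V (\<lambda>_. 0)"
    using P_add[OF D_zero D_zero] by simp
  then show ?thesis using P_closed[OF D_zero]
    by (metis R.a_assoc R.a_inv_closed R.l_neg R.l_zero)
qed

lemma P_minus: "F \<in> D V \<Longrightarrow> \<ominus>\<^bsub>A V\<^esub> P V F = P V (\<lambda>w. - F w)"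
  using P_add[OF D_minus, of F F] P_closed D_minus by (intro R.minus_equality) (auto simp: P_zero)

lemma P_diff: "F \<in> D V \<Longrightarrow> G \<in> D V \<Longrightarrow> P V F \<ominus>\<^bsub>A V\<^esub> P V G = P V (\<lambda>w. F w - G w)"
  by (simp add: a_minus_def P_minus P_add D_minus)

lemma P_sum:
  assumes "finite I" "\<And>i. i \<in> I \<Longrightarrow> F i \<in> D V"
  shows "(\<lambda>w. \<Sum>i\<in>I. F i w) \<in> D V" "(\<Oplus>\<^bsub>A V\<^esub>i\<in>I. P V (F i)) = P V (\<lambda>w. \<Sum>i\<in>I. F i w)"
proof -
  have "(\<lambda>w. \<Sum>i\<in>I. F i w) \<in> D V \<and> (\<Oplus>\<^bsub>A V\<^esub>i\<in>I. P V (F i)) = P V (\<lambda>w. \<Sum>i\<in>I. F i w)"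
    using assms
  proof (induction I)
    case (insert i I)
    then have 1: "F i \<in> D V" "(\<lambda>w. \<Sum>i\<in>I. F i w) \<in> D V"
      "(\<Oplus>\<^bsub>A V\<^esub>i\<in>I. P V (F i)) = P V (\<lambda>w. \<Sum>i\<in>I. F i w)" by auto
    have "(\<Oplus>\<^bsub>A V\<^esub>i\<in>insert i I. P V (F i)) = P V (F i) \<oplus>\<^bsub>A V\<^esub> (\<Oplus>\<^bsub>A V\<^esub>i\<in>I. P V (F i))"
      using insert by (intro R.finsum_insert) (auto intro: P_closed)
    then show ?case using 1 insert domain_sections_add[OF V(1) 1(1,2)] by (simp add: P_add)
  qed (simp add: D_zero P_zero)
  then show "(\<lambda>w. \<Sum>i\<in>I. F i w) \<in> D V" "(\<Oplus>\<^bsub>A V\<^esub>i\<in>I. P V (F i)) = P V (\<lambda>w. \<Sum>i\<in>I. F i w)" by auto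
qed

lemma cr_P [simp]: "F \<in> D V \<Longrightarrow> cr V (P V F) = F"
  unfolding cr_def using P_bij[OF V] by (simp add: bij_betw_def the_inv_into_f_f)

lemma P_cr [simp]: "f \<in> carrier (A V) \<Longrightarrow> P V (cr V f) = f"
  unfolding cr_def using P_bij[OF V] by (simp add: bij_betw_def f_the_inv_into_f)

lemma cr_closed: "f \<in> carrier (A V) \<Longrightarrow> cr V f \<in> D V"
  unfolding cr_def using P_bij[OF V] by (simp add: bij_betw_def the_inv_into_into)

lemma P_eq_iff: "F \<in> D V \<Longrightarrow> G \<in> D V \<Longrightarrow> P V F = P V G \<longleftrightarrow> F = G"
  by (metis cr_P)

lemma P_res:
  assumes V': "open V'" "V' \<subseteq> V" and F: "F \<in> D V"
  shows "res X (pre V) (pre V') (P V F) = P V' (fun_res V V' F)"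
proof -
  have "openin (base (superdomain q W)) V" "openin (base (superdomain q W)) V'"
    using V V' by (auto simp: openin_W)
  moreover have "F \<in> carrier (sect (superdomain q W) V)" using F by (simp add: sd_simps)
  ultimately have "P V' (res (superdomain q W) V V' F) = res X (pre V) (pre V') (P V F)"
    using morph[unfolded morphism_def, THEN conjunct2, THEN conjunct2] V' by simp
  then show ?thesis by (simp add: superdomain_def)
qed

lemma P_hpart: "F \<in> D V \<Longrightarrow> hpart (A V) d (P V F) = P V (\<lambda>w. gpart d (F w))"
proof -
  assume F: "F \<in> D V"
  have "P V F = P V (\<lambda>w. gpart d (F w)) \<oplus>\<^bsub>A V\<^esub> P V (\<lambda>w. gpart (\<not> d) (F w))"
    using gpart_add by (cases d) (simp_all add: P_add domain_sections_gpart[OF F] add.commute)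
  then show ?thesis
    using hpart_unique[OF A_superalgebra P_grade P_grade, of "\<lambda>w. gpart d (F w)" d "\<lambda>w. gpart (\<not> d) (F w)"]
    by (simp add: domain_sections_gpart[OF F] gparity_gpart)
qed

text \<open>An isomorphism is only required to map each grade into the same grade. That it also
  reflects parity follows from the uniqueness of homogeneous parts.\<close>

lemma P_grade_iff: "F \<in> D V \<Longrightarrow> P V F \<in> grade (A V) d \<Longrightarrow> gparity d (F w)"
proof -
  assume F: "F \<in> D V" and d: "P V F \<in> grade (A V) d"
  have "hpart (A V) d (P V F \<oplus>\<^bsub>A V\<^esub> \<zero>\<^bsub>A V\<^esub>) = P V F"
    by (rule hpart_unique[OF A_superalgebra d A.grade_zero])
  then have "P V (\<lambda>w. gpart d (F w)) = P V F" using P_hpart[OF F] P_closed[OF F] by simp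
  then have "(\<lambda>w. gpart d (F w)) = F" using P_eq_iff[OF domain_sections_gpart[OF F] F] by simp
  then show ?thesis using gparity_gpart by metis
qed

text \<open>The body is multiplicative, so a unit has a body without zeros; conversely
  \<open>grecip\<close> inverts pointwise and depends smoothly on the point.\<close>

lemma P_Units: "F \<in> D V \<Longrightarrow> P V F \<in> Units (A V) \<longleftrightarrow> (\<forall>w\<in>V. gcoeff (F w) {} \<noteq> 0)"
proof
  assume F: "F \<in> D V" and "P V F \<in> Units (A V)"
  then obtain g where g: "g \<in> carrier (A V)" "P V F \<otimes>\<^bsub>A V\<^esub> g = \<one>\<^bsub>A V\<^esub>" by (auto simp: Units_def)
  have "P V (\<lambda>w. F w * cr V g w) = P V (\<lambda>w. if w \<in> V then 1 else 0)"
    using g P_mult[OF F cr_closed[OF g(1)]] by (simp add: P_one)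
  then have "(\<lambda>w. F w * cr V g w) = (\<lambda>w. if w \<in> V then 1 else 0)"
    by (subst (asm) P_eq_iff) (auto intro: domain_sections_mult V F cr_closed g D_one)
  then have "F w * cr V g w = 1" if "w \<in> V" for w using that by (metis (no_types, lifting))
  then have "gcoeff (F w * cr V g w) {} = 1" if "w \<in> V" for w using that by simp
  then show "\<forall>w\<in>V. gcoeff (F w) {} \<noteq> 0" by (metis gcoeff_times_empty mult_zero_left zero_neq_one)
next
  assume F: "F \<in> D V" and nz: "\<forall>w\<in>V. gcoeff (F w) {} \<noteq> 0"
  define G where "G w = (if w \<in> V then grecip q (F w) else 0)" for w
  have G: "G \<in> D V" unfolding G_def[abs_def]
    by (rule domain_sections_cutI[OF V(1) gsmooth_grecip[OF V(1)]])
      (use nz domain_sectionsD[OF F] in \<open>auto intro: gens_grecip\<close>)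
  have "(\<lambda>w. F w * G w) = (\<lambda>w. if w \<in> V then 1 else 0)" "(\<lambda>w. G w * F w) = (\<lambda>w. if w \<in> V then 1 else 0)"
    using grecip[OF domain_sectionsD(2)[OF F]] nz by (auto simp: G_def)
  then have "P V F \<otimes>\<^bsub>A V\<^esub> P V G = \<one>\<^bsub>A V\<^esub>" "P V G \<otimes>\<^bsub>A V\<^esub> P V F = \<one>\<^bsub>A V\<^esub>"
    by (simp_all add: P_mult F G P_one)
  then show "P V F \<in> Units (A V)" using P_closed[OF F] P_closed[OF G] by (auto simp: Units_def)
qed

end

section \<open>Bodies and the underlying manifold\<close>

text \<open>The value of a superfunction is defined by invertibility alone. By
  \<open>P_Units\<close>, f - t is invertible over an open set exactly if the body of f avoids t
  there; if t is not the body at m, continuity provides such a neighbourhood of m.\<close>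

lemma bval_P:
  assumes V: "open V" "V \<subseteq> W" and F: "F \<in> D V" and m: "m \<in> pre V"
  shows "bval X (pre V) (P V F) m = gcoeff (F (\<phi> m)) {}"
proof -
  have key: "res X (pre V) (pre V') (P V F) \<ominus>\<^bsub>A V'\<^esub> t \<odot>\<^bsub>A V'\<^esub> \<one>\<^bsub>A V'\<^esub> \<notin> Units (A V') \<longleftrightarrow>
      (\<exists>w\<in>V'. gcoeff (F w) {} = t)" if V': "open V'" "V' \<subseteq> V" for V' t
  proof -
    have V'W: "V' \<subseteq> W" using V' V by auto
    note o = V'(1) V'W
    have r: "fun_res V V' F \<in> D V'" by (rule domain_sections_restrict[OF V' F])
    have t: "(\<lambda>w. t *\<^sub>R (if w \<in> V' then 1 else 0 :: grass)) \<in> D V'"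
      by (rule domain_sections_scaleR[OF o(1) D_one[OF o] D_one[OF o]])
    define G where "G = (\<lambda>w. fun_res V V' F w - t *\<^sub>R (if w \<in> V' then 1 else 0))"
    have G: "G \<in> D V'" unfolding G_def by (rule domain_sections_diff[OF V'(1) r t])
    have "res X (pre V) (pre V') (P V F) \<ominus>\<^bsub>A V'\<^esub> t \<odot>\<^bsub>A V'\<^esub> \<one>\<^bsub>A V'\<^esub> = P V' G"
      unfolding P_res[OF V V' F] P_one[OF o] P_smult[OF o D_one[OF o]] P_diff[OF o r t] G_def ..
    moreover have "gcoeff (G w) {} = gcoeff (F w) {} - t" if "w \<in> V'" for w
      using that by (simp add: G_def fun_res_def)
    ultimately show ?thesis using P_Units[OF o G] by auto
  qed
  have m': "m \<in> T" "\<phi> m \<in> V" using m by (auto simp: mem_pre)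
  show ?thesis
    unfolding bval_def
  proof (rule the_equality)
    show "\<forall>O'. openin (base X) O' \<longrightarrow> m \<in> O' \<longrightarrow> O' \<subseteq> pre V \<longrightarrow>
      res X (pre V) O' (P V F) \<ominus>\<^bsub>sect X O'\<^esub> gcoeff (F (\<phi> m)) {} \<odot>\<^bsub>sect X O'\<^esub> \<one>\<^bsub>sect X O'\<^esub> \<notin> Units (sect X O')"
    proof (intro allI impI)
      fix O' assume O': "openin (base X) O'" "m \<in> O'" "O' \<subseteq> pre V"
      have "\<phi> ` O' \<subseteq> V" using O'(3) by (auto simp: mem_pre)
      moreover have "\<exists>w\<in>\<phi> ` O'. gcoeff (F w) {} = gcoeff (F (\<phi> m)) {}" using O'(2) by blast
      ultimately show "res X (pre V) O' (P V F) \<ominus>\<^bsub>sect X O'\<^esub> gcoeff (F (\<phi> m)) {} \<odot>\<^bsub>sect X O'\<^esub> \<one>\<^bsub>sect X O'\<^esub>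
          \<notin> Units (sect X O')"
        using key[OF image_open(1)[OF O'(1)], of "gcoeff (F (\<phi> m)) {}"]
        unfolding image_open(3)[OF O'(1)] by blast
    qed
  next
    fix t assume t: "\<forall>O'. openin (base X) O' \<longrightarrow> m \<in> O' \<longrightarrow> O' \<subseteq> pre V \<longrightarrow>
      res X (pre V) O' (P V F) \<ominus>\<^bsub>sect X O'\<^esub> t \<odot>\<^bsub>sect X O'\<^esub> \<one>\<^bsub>sect X O'\<^esub> \<notin> Units (sect X O')"
    show "t = gcoeff (F (\<phi> m)) {}"
    proof (rule ccontr)
      assume ne: "t \<noteq> gcoeff (F (\<phi> m)) {}"
      \<comment> \<open>The open set over which f - t is invertible; it contains the image of
        m.\<close>
      define V' where "V' = {w \<in> V. gcoeff (F w) {} \<in> - {t}}"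
      have "V' = V \<inter> (\<lambda>w. gcoeff (F w) {}) -` (- {t})" by (auto simp: V'_def)
      moreover have "open (V \<inter> (\<lambda>w. gcoeff (F w) {}) -` (- {t}))"
        by (intro continuous_open_preimage smooth_on_continuous domain_sectionsD(1)[OF F] V(1)
            open_Compl closed_singleton)
      ultimately have o: "open V'" by simp
      have V': "V' \<subseteq> V" "\<phi> m \<in> V'" using ne m' by (auto simp: V'_def)
      have "openin (base X) (pre V')" using o V'(1) V by (intro pre_open) auto
      moreover have "m \<in> pre V'" using V' m' by (simp add: mem_pre)
      ultimately have "\<exists>w\<in>V'. gcoeff (F w) {} = t"
        using key[OF o V'(1), of t] t pre_mono[OF V'(1)] by blast
      then show False by (auto simp: V'_def)
    qed
  qed
qed

lemma bval_cr:
  assumes "openin (base X) O'" "f \<in> carrier (sect X O')" "m \<in> O'"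
  shows "bval X O' f m = gcoeff (cr (\<phi> ` O') f (\<phi> m)) {}"
proof -
  note o = image_open[OF assms(1)]
  have f: "f \<in> carrier (A (\<phi> ` O'))" using assms(2) o(3) by simp
  have "bval X (pre (\<phi> ` O')) (P (\<phi> ` O') (cr (\<phi> ` O') f)) m = gcoeff (cr (\<phi> ` O') f (\<phi> m)) {}"
    by (rule bval_P[OF o(1,2) cr_closed[OF o(1,2) f]]) (use assms(3) o(3) in simp)
  then show ?thesis using f o by simp
qed

text \<open>Locally a reduced section is a body, and bodies are smooth in the coordinates.
  Conversely, a smooth function of the even coordinates is itself a superfunction with the given
  body.\<close>

lemma reduced_sections_eq:
  assumes V: "open V" "V \<subseteq> W"
  shows "reduced_sections X (pre V) = lift V ` {F. smooth_on V F}"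
proof (intro subset_antisym subsetI)
  fix g assume g: "g \<in> reduced_sections X (pre V)"
  define F where "F w = g (inv_into T \<phi> w)" for w
  have gF: "g m = F (\<phi> m)" if "m \<in> T" for m
    using that inj_\<phi> by (simp add: F_def inv_into_f_f)
  have "smooth_on V F"
  proof (rule smooth_on_local)
    fix w assume w: "w \<in> V"
    then obtain m where m: "m \<in> T" "\<phi> m = w" using V by (auto simp: crange_def)
    then have "m \<in> pre V" using w by (simp add: mem_pre)
    then have "\<exists>W f. openin (base X) W \<and> m \<in> W \<and> W \<subseteq> pre V \<and> f \<in> carrier (sect X W) \<and>
        (\<forall>z\<in>W. g z = bval X W f z)"
      using g by (simp add: reduced_sections_def)
    then obtain O' f where O': "openin (base X) O'" "m \<in> O'" "O' \<subseteq> pre V" "f \<in> carrier (sect X O')"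
      "\<And>z. z \<in> O' \<Longrightarrow> g z = bval X O' f z"
      by blast
    note o = image_open[OF O'(1)]
    have f: "f \<in> carrier (A (\<phi> ` O'))" using O'(4) o(3) by simp
    have "smooth_on (\<phi> ` O') F"
    proof (rule smooth_on_cong[OF o(1) _ domain_sectionsD(1)[OF cr_closed[OF o(1,2) f]]])
      fix z assume "z \<in> \<phi> ` O'"
      then obtain m' where m': "m' \<in> O'" "z = \<phi> m'" by auto
      then have mT: "m' \<in> T" using O'(3) pre_subset by auto
      show "gcoeff (cr (\<phi> ` O') f z) {} = F z"
        using gF[OF mT] O'(5)[OF m'(1)] bval_cr[OF O'(1,4) m'(1)] m'(2) by metis
    qed
    then show "\<exists>V'. open V' \<and> w \<in> V' \<and> V' \<subseteq> V \<and> smooth_on V' F"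
      using o m O'(2,3) by (intro exI[of _ "\<phi> ` O'"]) (auto simp: mem_pre)
  qed
  moreover have "g = lift V F"
    using g gF pre_subset by (auto simp: lift_def reduced_sections_def fun_eq_iff)
  ultimately show "g \<in> lift V ` {F. smooth_on V F}" by blast
next
  fix g assume "g \<in> lift V ` {F. smooth_on V F}"
  then obtain F where F: "smooth_on V F" "g = lift V F" by auto
  have "g m = bval X (pre V) (P V (\<lambda>w. if w \<in> V then of_real (F w) else 0)) m" if "m \<in> pre V" for m
    using bval_P[OF V D_of_real[OF V F(1)] that] that by (simp add: F(2) lift_def mem_pre)
  then show "g \<in> reduced_sections X (pre V)"
    unfolding reduced_sections_def using pre_open[OF V] P_closed[OF V D_of_real[OF V F(1)]] F(2)
    by (auto simp: lift_def)
qed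

end

section \<open>Retractions\<close>

context chart
begin

lemma ucoord_P: "ucoord X x a = P W (\<lambda>w. if w \<in> W then of_real (w $ a) else 0)"
  by (simp add: ucoord_def cpull_def)

lemma xicoord_P: "xicoord X x j = P W (\<lambda>w. if w \<in> W then ggen j else 0)"
  by (simp add: xicoord_def cpull_def)

lemma D_coord: "(\<lambda>w. if w \<in> W then of_real (w $ a) else 0) \<in> D W"
  using D_of_real[OF W_open subset_refl smooth_on_coord] .

lemma D_ggen: "j < q \<Longrightarrow> (\<lambda>w. if w \<in> W then ggen j else 0) \<in> D W"
  by (rule domain_sections_cutI[OF W_open]) (auto intro: gens_ggen)

lemma lift_cong: "(\<And>w. w \<in> V \<Longrightarrow> F w = G w) \<Longrightarrow> lift V F = lift V G"
  by (auto simp: lift_def mem_pre fun_eq_iff)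

lemma jmor_P: "F \<in> D W \<Longrightarrow> snd (jmor X) T (P W F) = lift W (\<lambda>w. gcoeff (F w) {})"
  using bval_P[OF W_open subset_refl, of F] by (auto simp: jmor_def lift_def pre_W fun_eq_iff)

lemma jmor_ucoord: "snd (jmor X) T (ucoord X x a) = lift W (\<lambda>w. w $ a)"
  unfolding ucoord_P jmor_P[OF D_coord] by (rule lift_cong) simp

text \<open>An orientation compares coordinate systems of the reduced space, so the underlying map
  \<open>\<phi>\<close> has to be exhibited as the map of one.\<close>

definition reduced_chart :: "('m, 'p, 'm \<Rightarrow> real) chart" where
  "reduced_chart = (\<phi>, \<lambda>V F. lift V (\<lambda>w. gcoeff (F w) {}))"

lemma reduced_chart: "coord_sys (reduced_space X) 0 reduced_chart"
proof -
  have pre': "preimg (reduced_space X) reduced_chart V = pre V" for V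
    by (simp add: preimg_def reduced_space_def reduced_chart_def)
  have W': "crange (reduced_space X) reduced_chart = W"
    by (simp add: crange_def reduced_space_def reduced_chart_def)
  have oW: "openin (base (superdomain 0 W)) V \<longleftrightarrow> open V \<and> V \<subseteq> W" for V
    using openin_open_eq[OF W_open] by (simp add: superdomain_def)
  have base: "base (reduced_space X) = base X" "res (reduced_space X) = fun_res"
    "base (superdomain 0 W) = top_of_set W" "res (superdomain 0 W) = fun_res" "fst reduced_chart = \<phi>"
    by (simp_all add: reduced_space_def superdomain_def reduced_chart_def)
  have red: "sect (reduced_space X) O' = fun_superalg O'
      (\<lambda>d. if d then {\<lambda>_. 0} else reduced_sections X O') (reduced_sections X O')" for O'
    by (simp add: reduced_space_def)
  have mem: "lift V F \<in> reduced_sections X (pre V)" if "open V" "V \<subseteq> W" "smooth_on V F" for V F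
    using that reduced_sections_eq[OF that(1,2)] by blast
  have hom: "snd reduced_chart V \<in> superalgebra_hom (sect (superdomain 0 W) V) (sect (reduced_space X) (pre V))"
    if V: "open V" "V \<subseteq> W" for V
    unfolding superalgebra_hom_def
  proof (intro CollectI conjI allI ballI)
    show "snd reduced_chart V \<in> ring_hom (sect (superdomain 0 W) V) (sect (reduced_space X) (pre V))"
      by (rule ring_hom_memI)
        (auto simp: reduced_chart_def superdomain_def red fun_superalg_def lift_def mem_pre fun_eq_iff
          intro!: mem[OF V] domain_sectionsD(1))
    fix r f assume "f \<in> carrier (sect (superdomain 0 W) V)"
    then show "snd reduced_chart V (r \<odot>\<^bsub>sect (superdomain 0 W) V\<^esub> f) =
        r \<odot>\<^bsub>sect (reduced_space X) (pre V)\<^esub> snd reduced_chart V f"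
      by (simp add: reduced_chart_def superdomain_def red fun_superalg_def lift_def fun_eq_iff)
  next
    fix d
    show "snd reduced_chart V ` grade (sect (superdomain 0 W) V) d \<subseteq> grade (sect (reduced_space X) (pre V)) d"
    proof (cases d)
      case True
      then show ?thesis
        by (auto simp: reduced_chart_def superdomain_def red fun_superalg_def lift_def fun_eq_iff)
    next
      case False
      then show ?thesis
        by (auto simp: reduced_chart_def superdomain_def red fun_superalg_def
            intro!: mem[OF V] domain_sectionsD(1))
    qed
  qed
  have bij: "bij_betw (snd reduced_chart V) (domain_sections 0 V) (reduced_sections X (pre V))"
    if V: "open V" "V \<subseteq> W" for V
  proof (rule bij_betwI')
    fix F G assume FG: "F \<in> domain_sections 0 V" "G \<in> domain_sections 0 V"
    have 0: "gcoeff (H w) I = 0" if "H \<in> domain_sections 0 V" "I \<noteq> {}" for H w I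
      using domain_sectionsD(2)[OF that(1), of w] that(2) by (simp add: gens_def)
    show "snd reduced_chart V F = snd reduced_chart V G \<longleftrightarrow> F = G"
    proof
      assume e: "snd reduced_chart V F = snd reduced_chart V G"
      show "F = G"
      proof (intro ext grass_eqI)
        fix w I
        show "gcoeff (F w) I = gcoeff (G w) I"
        proof (cases "w \<in> V \<and> I = {}")
          case True
          then obtain m where "m \<in> pre V" "\<phi> m = w" using image_pre[OF V(2)] by (metis imageE)
          then show ?thesis using fun_cong[OF e, of m] True by (simp add: reduced_chart_def lift_def)
        next
          case False
          then show ?thesis using 0 FG domain_sectionsD(3)[OF FG(1)] domain_sectionsD(3)[OF FG(2)] by metis
        qed
      qed
    qed simp
  next
    fix F assume "F \<in> domain_sections 0 V"
    then show "snd reduced_chart V F \<in> reduced_sections X (pre V)"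
      by (simp add: reduced_chart_def mem[OF V] domain_sectionsD(1))
  next
    fix g assume "g \<in> reduced_sections X (pre V)"
    then obtain F where F: "smooth_on V F" "g = lift V F" using reduced_sections_eq[OF V] by auto
    have "(\<lambda>w. if w \<in> V then of_real (F w) else 0) \<in> domain_sections 0 V"
      by (rule domain_sections_cutI[OF V(1)]) (auto intro: gsmooth_of_real F)
    moreover have "g = snd reduced_chart V (\<lambda>w. if w \<in> V then of_real (F w) else 0)"
      unfolding F(2) reduced_chart_def snd_conv by (rule lift_cong) simp
    ultimately show "\<exists>F\<in>domain_sections 0 V. g = snd reduced_chart V F" by blast
  qed
  have carr: "carrier (sect (superdomain 0 W) V) = domain_sections 0 V"
    "carrier (sect (reduced_space X) O') = reduced_sections X O'" for V O'
    by (simp_all add: superdomain_def red fun_superalg_def)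
  have res: "snd reduced_chart V' (fun_res V V' F) = fun_res (pre V) (pre V') (snd reduced_chart V F)"
    if "V' \<subseteq> V" for V V' F
    using that by (auto simp: reduced_chart_def fun_res_def lift_def mem_pre fun_eq_iff)
  show ?thesis
    unfolding coord_sys_def isomorphism_def morphism_def W' base
    using W_open homeo homeomorphic_imp_continuous_map[OF homeo] hom bij res oW
    by (simp add: pre' carr base flip: base(3))
qed

end

section \<open>A retraction in coordinates\<close>

locale retraction = chart X q x
  for X :: "('m, 's) superspace" and q and x :: "('m, 'p::{finite,linorder}, 's) chart" +
  fixes \<gamma> :: "('m, 'm, 's, 'm \<Rightarrow> real) morph"
  assumes ret: "super_retraction X \<gamma>"
begin

lemma \<gamma>_morph: "morphism X (reduced_space X) \<gamma>"
  and \<gamma>_fst: "m \<in> T \<Longrightarrow> fst \<gamma> m = m"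
  using ret by (auto simp: super_retraction_def morph_eq_def comp_morph_def jmor_def id_morph_def
      reduced_space_def)

lemma preimg_\<gamma>: "openin (base X) O' \<Longrightarrow> preimg X \<gamma> O' = O'"
  using \<gamma>_fst openin_subset[of "base X" O'] by (auto simp: preimg_def)

lemma red_base: "base (reduced_space X) = base X" "res (reduced_space X) = fun_res"
  by (simp_all add: reduced_space_def)

lemma \<gamma>_hom: "openin (base X) O' \<Longrightarrow>
    snd \<gamma> O' \<in> superalgebra_hom (sect (reduced_space X) O') (sect X O')"
  using \<gamma>_morph[unfolded morphism_def red_base, THEN conjunct2, THEN conjunct1] preimg_\<gamma>
  by metis

lemma red_simps: "carrier (sect (reduced_space X) O') = reduced_sections X O'"
  "mult (sect (reduced_space X) O') = (\<lambda>f g m. f m * g m)"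
  "add (sect (reduced_space X) O') = (\<lambda>f g m. f m + g m)"
  "one (sect (reduced_space X) O') = (\<lambda>m. if m \<in> O' then 1 else 0)"
  "smult (sect (reduced_space X) O') = (\<lambda>r f m. r *\<^sub>R f m)"
  "grade (sect (reduced_space X) O') False = reduced_sections X O'"
  by (simp_all add: reduced_space_def fun_superalg_def)

lemma \<gamma>_body:
  assumes "openin (base X) O'" "f \<in> reduced_sections X O'" "m \<in> O'"
  shows "bval X O' (snd \<gamma> O' f) m = f m"
proof -
  have "snd (comp_morph X \<gamma> (jmor X)) O' f = snd id_morph O' f"
    using ret assms unfolding super_retraction_def morph_eq_def by (simp add: red_base red_simps)
  then have "(\<lambda>m. if m \<in> O' then bval X O' (snd \<gamma> O' f) m else 0) = f"
    by (simp only: comp_morph_def jmor_def id_morph_def preimg_\<gamma>[OF assms(1)] o_apply snd_conv)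
  from fun_cong[OF this, of m] show ?thesis using assms(3) by simp
qed

text \<open>The pullback along \<gamma>, read in the coordinates x on both sides. The coordinate
  system x need not be associated with \<gamma>, so h is in general not the identity.\<close>

definition h :: "(real ^ 'p::{finite,linorder}) set \<Rightarrow> (real ^ 'p::{finite,linorder} \<Rightarrow> real) \<Rightarrow>
    real ^ 'p::{finite,linorder} \<Rightarrow> grass" where
  "h V F = cr V (snd \<gamma> (pre V) (lift V F))"

context
  fixes V assumes V: "open V" "V \<subseteq> W"
begin

lemma lift_closed: "smooth_on V F \<Longrightarrow> lift V F \<in> reduced_sections X (pre V)"
  using reduced_sections_eq[OF V] by blast

lemma \<gamma>_closed: "smooth_on V F \<Longrightarrow> snd \<gamma> (pre V) (lift V F) \<in> carrier (A V)"
  using ring_hom_closed[OF superalgebra_homD(1)[OF \<gamma>_hom[OF pre_open[OF V]]]] lift_closed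
  by (simp add: red_simps)

lemma P_h: "smooth_on V F \<Longrightarrow> P V (h V F) = snd \<gamma> (pre V) (lift V F)"
  by (simp add: h_def \<gamma>_closed P_cr[OF V])

lemma h_D: "smooth_on V F \<Longrightarrow> h V F \<in> D V"
  by (simp add: h_def \<gamma>_closed cr_closed[OF V])

lemma h_eqI:
  assumes "G \<in> D V" "P V G = snd \<gamma> (pre V) (lift V F)"
  shows "h V F = G"
  unfolding h_def assms(2)[symmetric] by (rule cr_P[OF V assms(1)])

end

text \<open>Evenness holds because the reduced space is purely even and pullbacks preserve parity,
  the statement on bodies because \<gamma> composed with j is the identity, and locality because
  morphisms commute with restrictions.\<close>

sublocale local_hom W q h
proof
  fix V assume V: "open V" "V \<subseteq> W"
  note hom = \<gamma>_hom[OF pre_open[OF V]]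
  show "h V f \<in> D V" if "smooth_on V f" for f by (rule h_D[OF V that])
  show "gparity False (h V f w)" if f: "smooth_on V f" for f w
  proof (rule P_grade_iff[OF V h_D[OF V f]])
    show "P V (h V f) \<in> grade (A V) False"
      unfolding P_h[OF V f] by (rule superalgebra_homD(3)[OF hom]) (simp add: red_simps lift_closed[OF V f])
  qed
  show "gcoeff (h V f w) {} = f w" if f: "smooth_on V f" and w: "w \<in> V" for f w
  proof -
    obtain m where m: "m \<in> pre V" "\<phi> m = w" using image_pre[OF V(2)] w by (metis imageE)
    have "gcoeff (h V f (\<phi> m)) {} = bval X (pre V) (P V (h V f)) m"
      by (rule bval_P[OF V h_D[OF V f] m(1), symmetric])
    also have "\<dots> = lift V f m"
      unfolding P_h[OF V f] by (rule \<gamma>_body[OF pre_open[OF V] lift_closed[OF V f] m(1)])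
    finally show ?thesis using m by (simp add: lift_def)
  qed
  fix f g :: "real ^ 'p::{finite,linorder} \<Rightarrow> real" and w :: "real ^ 'p::{finite,linorder}"
  show "h V f w = h V g w" if "\<And>z. z \<in> V \<Longrightarrow> f z = g z"
    unfolding h_def using lift_cong[of V f g] that by metis
  show "h V (\<lambda>_. c) w = of_real c" if w: "w \<in> V" for c
  proof -
    have 1: "lift V (\<lambda>_. 1) = (\<lambda>m. if m \<in> pre V then 1 else 0)" by (simp add: lift_def fun_eq_iff)
    have "lift V (\<lambda>_. c) = c \<odot>\<^bsub>sect (reduced_space X) (pre V)\<^esub> \<one>\<^bsub>sect (reduced_space X) (pre V)\<^esub>"
      by (auto simp: lift_def fun_eq_iff red_simps)
    then have "snd \<gamma> (pre V) (lift V (\<lambda>_. c)) =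
        c \<odot>\<^bsub>A V\<^esub> snd \<gamma> (pre V) \<one>\<^bsub>sect (reduced_space X) (pre V)\<^esub>"
      using superalgebra_homD(2)[OF hom, of "\<one>\<^bsub>sect (reduced_space X) (pre V)\<^esub>" c]
        lift_closed[OF V smooth_on_const, of 1] by (simp add: red_simps 1)
    also have "snd \<gamma> (pre V) \<one>\<^bsub>sect (reduced_space X) (pre V)\<^esub> = \<one>\<^bsub>A V\<^esub>"
      by (rule ring_hom_one[OF superalgebra_homD(1)[OF hom]])
    also have "c \<odot>\<^bsub>A V\<^esub> \<one>\<^bsub>A V\<^esub> = P V (\<lambda>w. c *\<^sub>R (if w \<in> V then 1 else 0))"
      unfolding P_one[OF V] by (rule P_smult[OF V D_one[OF V]])
    finally have "h V (\<lambda>_. c) = (\<lambda>w. c *\<^sub>R (if w \<in> V then 1 else 0))"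
      by (intro h_eqI[OF V] domain_sections_scaleR[OF V(1) D_one[OF V] D_one[OF V]]) simp
    then show ?thesis using w by (simp add: of_real_def)
  qed
  assume f: "smooth_on V f"
  show "h V' f w = h V f w" if V': "open V'" "V' \<subseteq> V" and w: "w \<in> V'" for V'
  proof -
    have V'W: "V' \<subseteq> W" using V' V by auto
    have "lift V' f = fun_res (pre V) (pre V') (lift V f)"
      using V' by (auto simp: lift_def fun_res_def mem_pre fun_eq_iff)
    moreover have "snd \<gamma> (pre V') (fun_res (pre V) (pre V') (lift V f)) =
        res X (pre V) (pre V') (snd \<gamma> (pre V) (lift V f))"
      using \<gamma>_morph[unfolded morphism_def red_base, THEN conjunct2, THEN conjunct2] lift_closed[OF V f]
        pre_open[OF V] pre_open[OF V'(1) V'W] pre_mono[OF V'(2)]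
      by (simp add: red_simps preimg_\<gamma>)
    ultimately have "P V' (fun_res V V' (h V f)) = snd \<gamma> (pre V') (lift V' f)"
      by (simp add: P_res[OF V V' h_D[OF V f], symmetric] P_h[OF V f])
    then have "h V' f = fun_res V V' (h V f)"
      by (intro h_eqI[OF V'(1) V'W] domain_sections_restrict[OF V' h_D[OF V f]])
    then show ?thesis using w by (simp add: fun_res_def)
  qed
  assume g: "smooth_on V g"
  note cl = lift_closed[OF V f] lift_closed[OF V g]
  have "lift V (\<lambda>z. f z + g z) = lift V f \<oplus>\<^bsub>sect (reduced_space X) (pre V)\<^esub> lift V g"
    "lift V (\<lambda>z. f z * g z) = lift V f \<otimes>\<^bsub>sect (reduced_space X) (pre V)\<^esub> lift V g"
    by (auto simp: lift_def fun_eq_iff red_simps)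
  then have "snd \<gamma> (pre V) (lift V (\<lambda>z. f z + g z)) = P V (h V f) \<oplus>\<^bsub>A V\<^esub> P V (h V g)"
    "snd \<gamma> (pre V) (lift V (\<lambda>z. f z * g z)) = P V (h V f) \<otimes>\<^bsub>A V\<^esub> P V (h V g)"
    using ring_hom_add[OF superalgebra_homD(1)[OF hom]] ring_hom_mult[OF superalgebra_homD(1)[OF hom]] cl
    by (simp_all add: P_h[OF V f] P_h[OF V g] red_simps)
  then have "h V (\<lambda>z. f z + g z) = (\<lambda>w. h V f w + h V g w)" "h V (\<lambda>z. f z * g z) = (\<lambda>w. h V f w * h V g w)"
    using h_D[OF V f] h_D[OF V g]
    by (auto intro!: h_eqI[OF V] domain_sections_add domain_sections_mult simp: P_add[OF V] P_mult[OF V] V(1))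
  then show "h V (\<lambda>z. f z + g z) w = h V f w + h V g w" "h V (\<lambda>z. f z * g z) w = h V f w * h V g w"
    by simp_all
qed (rule W_open)

lemma associated_iff: "associated X x \<gamma> \<longleftrightarrow> (\<forall>a. snd \<gamma> T (lift W (\<lambda>w. w $ a)) = ucoord X x a)"
  by (simp add: associated_def jmor_ucoord)

text \<open>Here h fixes the coordinate functions, so by \<open>h_trivial\<close> it fixes every
  smooth function.\<close>

lemma associated_h:
  assumes "associated X x \<gamma>" "smooth_on W F"
  shows "snd \<gamma> T (lift W F) = P W (\<lambda>w. if w \<in> W then of_real (F w) else 0)"
proof -
  have "h W (\<lambda>z. z $ a) w = of_real (w $ a)" if "w \<in> W" for a w
  proof -
    have "h W (\<lambda>z. z $ a) = (\<lambda>w. if w \<in> W then of_real (w $ a) else 0)"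
      using assms(1) by (intro h_eqI[OF W_open subset_refl D_coord]) (simp add: associated_iff ucoord_P pre_W)
    then show ?thesis using that by simp
  qed
  then have "h W F w = of_real (F w)" if "w \<in> W" for w
    using h_trivial[OF W_open subset_refl _ assms(2) that] by blast
  then have "h W F = (\<lambda>w. if w \<in> W then of_real (F w) else 0)"
    using h_outside[OF W_open subset_refl assms(2)] by auto
  then show ?thesis using P_h[OF W_open subset_refl assms(2)] by (simp add: pre_W)
qed

text \<open>The coordinate system \<open>(\<gamma>\<^sup>*(u\<^sub>0), \<xi>)\<close>.\<close>

definition rchart :: "('m, 'p, 's) chart" where
  "rchart = (\<phi>, \<lambda>V F. P V (E V F))"

lemma rchart_simps: "fst rchart = \<phi>" "snd rchart V F = P V (E V F)" "crange X rchart = W"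
  "preimg X rchart V = pre V"
  by (simp_all add: rchart_def crange_def preimg_def)

text \<open>The coordinate system x composed with the automorphism E of the domain. E is bijective,
  commutes with restrictions and keeps parity, and it lifts the identity, so the underlying map and
  its range are those of x.\<close>

lemma rchart: "coord_sys X q rchart"
proof -
  have hom: "snd rchart V \<in> superalgebra_hom (sect (superdomain q W) V) (A V)"
    if V: "open V" "V \<subseteq> W" for V
    unfolding superalgebra_hom_def
  proof (intro CollectI conjI allI ballI)
    have one: "E V (\<lambda>w. if w \<in> V then 1 else 0) = (\<lambda>w. if w \<in> V then 1 else 0)"
      using E_one[OF V] domain_sectionsD(3)[OF E_closed[OF V D_one[OF V]]] by (auto simp: fun_eq_iff)
    show "snd rchart V \<in> ring_hom (sect (superdomain q W) V) (A V)"
    proof (rule ring_hom_memI)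
      fix F assume "F \<in> carrier (sect (superdomain q W) V)"
      then have F: "F \<in> D V" by (simp add: sd_simps[OF V])
      show "snd rchart V F \<in> carrier (A V)" by (simp add: rchart_simps P_closed[OF V] E_closed[OF V F])
      fix G assume "G \<in> carrier (sect (superdomain q W) V)"
      then have G: "G \<in> D V" by (simp add: sd_simps[OF V])
      show "snd rchart V (F \<otimes>\<^bsub>sect (superdomain q W) V\<^esub> G) = snd rchart V F \<otimes>\<^bsub>A V\<^esub> snd rchart V G"
        "snd rchart V (F \<oplus>\<^bsub>sect (superdomain q W) V\<^esub> G) = snd rchart V F \<oplus>\<^bsub>A V\<^esub> snd rchart V G"
        by (simp_all add: rchart_simps sd_simps[OF V] P_mult[OF V] P_add[OF V] E_closed[OF V] F G
            E_mult[OF V F G, abs_def] E_add[OF V F G, abs_def])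
    qed (simp add: rchart_simps sd_simps[OF V] P_one[OF V] one)
    fix r F assume "F \<in> carrier (sect (superdomain q W) V)"
    then have F: "F \<in> D V" by (simp add: sd_simps[OF V])
    show "snd rchart V (r \<odot>\<^bsub>sect (superdomain q W) V\<^esub> F) = r \<odot>\<^bsub>A V\<^esub> snd rchart V F"
      by (simp add: rchart_simps sd_simps[OF V] P_smult[OF V E_closed[OF V F]] E_scaleR[OF V F, abs_def])
  next
    fix d
    show "snd rchart V ` grade (sect (superdomain q W) V) d \<subseteq> grade (A V) d"
      by (auto simp: rchart_simps sd_simps[OF V] intro!: P_grade[OF V] E_closed[OF V] E_parity[OF V])
  qed
  have res: "snd rchart V' (res (superdomain q W) V V' F) = res X (pre V) (pre V') (snd rchart V F)"
    if V: "open V" "V \<subseteq> W" and V': "open V'" "V' \<subseteq> V" and F: "F \<in> D V" for V V' F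
  proof -
    have V'W: "V' \<subseteq> W" using V' V by auto
    have "E V' (fun_res V V' F) w = fun_res V V' (E V F) w" for w
    proof (cases "w \<in> V'")
      case True
      have "E V' (fun_res V V' F) w = E V' F w" by (rule E_cong[OF V'(1) V'W]) (simp add: fun_res_def)
      then show ?thesis using E_local[OF V V' F True] True by (simp add: fun_res_def)
    next
      case False
      then show ?thesis
        using domain_sectionsD(3)[OF E_closed[OF V'(1) V'W domain_sections_restrict[OF V' F]]]
        by (simp add: fun_res_def)
    qed
    then have "E V' (fun_res V V' F) = fun_res V V' (E V F)" by (simp add: fun_eq_iff)
    then show ?thesis
      by (simp add: rchart_simps P_res[OF V V' E_closed[OF V F]]) (simp add: superdomain_def)
  qed
  have bij: "bij_betw (snd rchart V) (D V) (carrier (A V))" if V: "open V" "V \<subseteq> W" for V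
  proof -
    have "snd rchart V = P V \<circ> E V" by (simp add: fun_eq_iff rchart_simps)
    then show ?thesis using bij_betw_trans[OF E_bij[OF V] P_bij[OF V]] by simp
  qed
  have base: "base (superdomain q W) = top_of_set W" by (simp add: superdomain_def)
  have carr: "carrier (sect (superdomain q W) V) = D V" for V
    by (simp add: superdomain_def fun_superalg_def)
  show ?thesis
    unfolding coord_sys_def isomorphism_def morphism_def rchart_simps(1,3,4) openin_W
    using W_open homeo homeomorphic_imp_continuous_map[OF homeo] hom res bij
    by (simp add: base carr)
qed

lemma ucoord_rchart: "ucoord X rchart a = snd \<gamma> T (lift W (\<lambda>w. w $ a))"
proof -
  have "E W (\<lambda>w. if w \<in> W then of_real (w $ a) else 0) = h W (\<lambda>w. w $ a)"
  proof
    fix w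
    have "E W (\<lambda>w. if w \<in> W then of_real (w $ a) else 0) w = E W (\<lambda>w. (w $ a) *\<^sub>R gmon {}) w"
      by (rule E_cong[OF W_open subset_refl]) (simp add: of_real_def)
    then show "E W (\<lambda>w. if w \<in> W then of_real (w $ a) else 0) w = h W (\<lambda>w. w $ a) w"
      by (simp only: E_scalar_gmon[OF W_open subset_refl empty_subsetI smooth_on_coord]) simp
  qed
  then show ?thesis
    using P_h[OF W_open subset_refl smooth_on_coord, of a]
    by (simp add: ucoord_def cpull_def rchart_simps pre_W)
qed

lemma associated_rchart: "associated X rchart \<gamma>"
proof -
  have "snd (jmor X) T (ucoord X rchart a) = lift W (\<lambda>w. w $ a)" for a
  proof -
    have "ucoord X rchart a = P W (h W (\<lambda>w. w $ a))"
      using P_h[OF W_open subset_refl smooth_on_coord, of a] by (simp add: ucoord_rchart pre_W)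
    then show ?thesis
      unfolding jmor_P[OF h_D[OF W_open subset_refl smooth_on_coord]]
      by (metis (no_types, lifting) jmor_P[OF h_D[OF W_open subset_refl smooth_on_coord]] lift_cong
          h_body[OF W_open subset_refl smooth_on_coord])
  qed
  then show ?thesis by (simp add: associated_def ucoord_rchart)
qed

lemma xicoord_rchart:
  assumes j: "j < q" and w: "w \<in> W"
  shows "cr W (xicoord X rchart j) w = ggen j"
proof -
  have e: "gmon {j} = ggen j" by (rule grass_eqI) (auto simp: gcoeff_gmon gcoeff_ggen)
  have "cr W (xicoord X rchart j) = E W (\<lambda>w. if w \<in> W then ggen j else 0)"
    by (simp add: xicoord_def cpull_def rchart_simps cr_P[OF W_open subset_refl E_closed[OF W_open subset_refl D_ggen[OF j]]])
  moreover have "E W (\<lambda>w. if w \<in> W then ggen j else 0) w = E W (\<lambda>w. 1 *\<^sub>R gmon {j}) w"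
    by (rule E_cong[OF W_open subset_refl]) (simp add: e)
  moreover have "E W (\<lambda>w. 1 *\<^sub>R gmon {j}) w = h W (\<lambda>_. 1) w * gmon {j}"
    by (rule E_scalar_gmon[OF W_open subset_refl _ smooth_on_const]) (use j in simp)
  ultimately show ?thesis
    using h_const[OF W_open subset_refl w, of 1] by (simp add: e)
qed

lemma cr_ucoord_rchart:
  assumes w: "w \<in> W"
  shows "cr W (ucoord X rchart a) w = eg (of_real (w $ a) + shift a w)"
proof -
  have "cr W (ucoord X rchart a) = h W (\<lambda>w. w $ a)"
    by (simp add: ucoord_rchart h_def pre_W)
  then show ?thesis using w by (simp add: shift_def eg_h[OF W_open subset_refl smooth_on_coord])
qed

end

section \<open>The action of the even coordinate derivations\<close>

lemma gpart_even_eg: "gpart False (eg a) = eg a" "gpart True (eg a) = 0"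
  using gpart_gparity[OF gparity_eg[of a]] by simp_all

context chart
begin

abbreviation cutW :: "(real ^ 'p::{finite,linorder} \<Rightarrow> grass) \<Rightarrow> real ^ 'p::{finite,linorder} \<Rightarrow> grass" where
  "cutW F \<equiv> (\<lambda>w. if w \<in> W then F w else 0)"

lemmas gl_closed = P_closed[OF W_open subset_refl, unfolded pre_W]
lemmas gl_mult = P_mult[OF W_open subset_refl, unfolded pre_W]
lemmas gl_one = P_one[OF W_open subset_refl, unfolded pre_W]
lemmas gl_zero = P_zero[OF W_open subset_refl, unfolded pre_W]
lemmas gl_minus = P_minus[OF W_open subset_refl, unfolded pre_W]
lemmas gl_diff = P_diff[OF W_open subset_refl, unfolded pre_W]
lemmas gl_sum = P_sum[OF W_open subset_refl, unfolded pre_W]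
lemmas gl_hpart = P_hpart[OF W_open subset_refl, unfolded pre_W]
lemmas gl_cr = P_cr[OF W_open subset_refl, unfolded pre_W]
lemmas gl_cr_closed = cr_closed[OF W_open subset_refl, unfolded pre_W]
lemmas cr_gl = cr_P[OF W_open subset_refl]

section \<open>Berezinians of special coordinate changes\<close>

text \<open>In every term of S V^-1 T a factor of S or of T vanishes, so the Berezinian is det R det
  V^-1. There are two occasions for this: the coordinate systems share their odd coordinates (S =
  0), or they are associated with the same retraction (T = 0).\<close>

lemma quot_split:
  assumes S: "\<And>w a j. w \<in> W \<Longrightarrow> j < q \<Longrightarrow> gpd a (cr W (xicoord X z j)) w = 0 \<or>
      (\<forall>i b. i < q \<longrightarrow> gder i (cr W (ucoord X z b) w) = 0)"
    and R: "\<And>w a b. w \<in> W \<Longrightarrow> gpd a (cr W (ucoord X z b)) w = eg (R w a b)"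
    and VB: "\<And>w i j. w \<in> W \<Longrightarrow> i < q \<Longrightarrow> j < q \<Longrightarrow>
      (\<Sum>k<q. gder i (cr W (xicoord X z k) w) * eg (B w k j)) = (if i = j then 1 else 0)"
    and BV: "\<And>w i j. w \<in> W \<Longrightarrow> i < q \<Longrightarrow> j < q \<Longrightarrow>
      (\<Sum>k<q. eg (B w i k) * gder k (cr W (xicoord X z j) w)) = (if i = j then 1 else 0)"
  shows "quot k X q z x = P W (cutW (\<lambda>w.
    (case k of Density \<Rightarrow> of_real (sgn (gcoeff (eg (ldet UNIV (R w))) {})) | Form \<Rightarrow> 1) *
    (eg (ldet UNIV (R w)) * eg (ldet {..<q} (B w)))))"
  unfolding quot_def cpull_def crep_cr Let_def
proof (intro arg_cong[where f = "P W"] ext if_cong refl arg_cong2[where f = "(*)"])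
  fix w assume w: "w \<in> W"
  define V where "V i j = gder i (cr W (xicoord X z j) w)" for i j
  have R': "gdet UNIV (\<lambda>a b. gpd a (cr W (ucoord X z b)) w) = eg (ldet UNIV (R w))"
    by (rule gdet_eg) (simp_all add: R[OF w])
  show "(case k of Density \<Rightarrow> of_real (sgn (gcoeff (gdet UNIV (\<lambda>a b. gpd a (cr W (ucoord X z b)) w)) {})) | Form \<Rightarrow> 1) =
      (case k of Density \<Rightarrow> of_real (sgn (gcoeff (eg (ldet UNIV (R w))) {})) | Form \<Rightarrow> 1)"
    by (simp only: R')
  have gi: "ginv q V = (\<lambda>i j. if i < q \<and> j < q then eg (B w i j) else 0)"
    by (rule ginv_eq) (simp_all add: V_def VB[OF w] BV[OF w])
  have g2: "gdet {..<q} (ginv q V) = eg (ldet {..<q} (B w))"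
    by (rule gdet_eg) (simp_all add: gi)
  have "(\<Sum>k<q. \<Sum>l<q. gpd a (cr W (xicoord X z k)) w * ginv q V k l * gder l (cr W (ucoord X z b) w)) = 0" for a b
    using S[OF w] by (intro sum.neutral ballI) (metis lessThan_iff mult_zero_left mult_zero_right)
  then show "gber q (\<lambda>a b. gpd a (cr W (ucoord X z b)) w) (\<lambda>a j. gpd a (cr W (xicoord X z j)) w)
      (\<lambda>i b. gder i (cr W (ucoord X z b) w)) (\<lambda>i j. gder i (cr W (xicoord X z j) w)) =
    eg (ldet UNIV (R w)) * eg (ldet {..<q} (B w))"
    unfolding gber_def V_def[abs_def, symmetric] by (simp add: R' g2)
qed

text \<open>V is the unit matrix. As the determinant has body 1, the sign factor of densities is 1,
  and densities and forms give the same result.\<close>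

lemma quot_same_odd:
  assumes u: "\<And>w b. w \<in> W \<Longrightarrow> cr W (ucoord X z b) w = eg (r b w)"
    and xi: "\<And>w j. w \<in> W \<Longrightarrow> j < q \<Longrightarrow> cr W (xicoord X z j) w = ggen j"
    and body: "\<And>w. w \<in> W \<Longrightarrow> gcoeff (eg (ldet UNIV (\<lambda>a b. epd W a (r b) w))) {} = 1"
  shows "quot k X q z x = P W (cutW (\<lambda>w. eg (ldet UNIV (\<lambda>a b. epd W a (r b) w))))"
proof -
  have "quot k X q z x = P W (cutW (\<lambda>w.
    (case k of Density \<Rightarrow> of_real (sgn (gcoeff (eg (ldet UNIV (\<lambda>a b. epd W a (r b) w))) {})) | Form \<Rightarrow> 1) *
    (eg (ldet UNIV (\<lambda>a b. epd W a (r b) w)) * eg (ldet {..<q} (\<lambda>i j. if i = j then 1 else 0)))))"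
  proof (rule quot_split)
    fix w assume w: "w \<in> W"
    show "gpd a (cr W (xicoord X z j)) w = 0 \<or> (\<forall>i b. i < q \<longrightarrow> gder i (cr W (ucoord X z b) w) = 0)"
      if "j < q" for a j
    proof -
      have "gpd a (cr W (xicoord X z j)) w = gpd a (\<lambda>_. ggen j) w"
        by (rule gpd_cong[OF W_open w xi[OF _ that]])
      then show ?thesis by simp
    qed
    show "gpd a (cr W (ucoord X z b)) w = eg (epd W a (r b) w)" for a b
    proof -
      have "gpd a (cr W (ucoord X z b)) w = gpd a (\<lambda>w. eg (r b w)) w"
        by (rule gpd_cong[OF W_open w u])
      then show ?thesis using w by (simp add: eg_epd)
    qed
    show "(\<Sum>k<q. gder i (cr W (xicoord X z k) w) * eg (if k = j then 1 else 0)) = (if i = j then 1 else 0)"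
      if "i < q" "j < q" for i j
    proof -
      have "(\<Sum>k<q. gder i (cr W (xicoord X z k) w) * eg (if k = j then 1 else 0)) =
          (\<Sum>k<q. if k = j then (if i = j then 1 else 0) else 0)"
        by (rule sum.cong) (auto simp: xi[OF w] gder_ggen)
      then show ?thesis using that by simp
    qed
    show "(\<Sum>k<q. eg (if i = k then 1 else 0) * gder k (cr W (xicoord X z j) w)) = (if i = j then 1 else 0)"
      if "i < q" "j < q" for i j
    proof -
      have "(\<Sum>k<q. eg (if i = k then 1 else 0) * gder k (cr W (xicoord X z j) w)) =
          (\<Sum>k<q. if k = i then (if i = j then 1 else 0) else 0)"
        by (rule sum.cong) (use that in \<open>auto simp: xi[OF w] gder_ggen\<close>)
      then show ?thesis using that by simp
    qed
  qed
  also have "\<dots> = P W (cutW (\<lambda>w. eg (ldet UNIV (\<lambda>a b. epd W a (r b) w))))"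
    by (intro arg_cong[where f = "P W"] ext if_cong refl)
      (simp add: body ldet_identity split: kind.split)
  finally show ?thesis .
qed

lemma cr_ucoord: "cr W (ucoord X x a) = cutW (\<lambda>w. of_real (w $ a))"
  by (simp add: ucoord_P cr_gl D_coord)

lemma cr_xicoord: "j < q \<Longrightarrow> cr W (xicoord X x j) = cutW (\<lambda>w. ggen j)"
  by (simp add: xicoord_P cr_gl D_ggen)

lemma gpd_cut_coord: "w \<in> W \<Longrightarrow> gpd a (cutW (\<lambda>w. of_real (w $ b))) w = (if a = b then 1 else 0)"
  using gpd_cong[OF W_open, of w "cutW (\<lambda>w. of_real (w $ b))" "\<lambda>w. of_real (w $ b)" a] gpd_coord[of a b w]
  by simp

lemma quot_self: "quot k X q x x = \<one>\<^bsub>sect X T\<^esub>"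
proof -
  have e: "epd W a (\<lambda>w. of_real (w $ b)) w = (if a = b then 1 else 0)" if "w \<in> W" for a b w
    by (rule egrass_eqI) (use that gpd_coord[of a b w] in \<open>simp add: eg_epd\<close>)
  have d: "ldet UNIV (\<lambda>a b. epd W a (\<lambda>w. of_real (w $ b)) w) = 1" if "w \<in> W" for w
    by (rule ldet_identity) (simp_all add: e[OF that])
  have "quot k X q x x = P W (cutW (\<lambda>w. eg (ldet UNIV (\<lambda>a b. epd W a (\<lambda>w. of_real (w $ b)) w))))"
    by (rule quot_same_odd) (simp_all add: cr_ucoord cr_xicoord d)
  also have "\<dots> = \<one>\<^bsub>sect X T\<^esub>"
    unfolding gl_one by (intro arg_cong[where f = "P W"] ext if_cong refl) (simp add: d)
  finally show ?thesis .
qed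

section \<open>Lie derivatives along the even coordinates\<close>

lemma D_cut: "gsmooth W F \<Longrightarrow> (\<And>w. gens q (F w)) \<Longrightarrow> cutW F \<in> D W"
  by (rule domain_sections_cutI[OF W_open])

lemma D_gpd: "F \<in> D W \<Longrightarrow> cutW (gpd a F) \<in> D W"
  by (rule D_cut) (simp_all add: gsmooth_gpd gens_gpd domain_sectionsD)

lemma D_gder: "F \<in> D W \<Longrightarrow> cutW (\<lambda>w. gder j (F w)) \<in> D W"
  by (rule D_cut) (simp_all add: gsmooth_gder W_open gens_gder domain_sectionsD)

lemma du_P: "F \<in> D W \<Longrightarrow> du X q x a (P W F) = P W (cutW (gpd a F))"
  by (simp add: du_def cpull_def crep_cr cr_gl)

lemma dxi_P: "F \<in> D W \<Longrightarrow> dxi X q x j (P W F) = P W (cutW (\<lambda>w. gder j (F w)))"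
  by (simp add: dxi_def cpull_def crep_cr cr_gl)

lemma D0: "(\<lambda>_. 0) \<in> D W" by (rule D_zero[OF W_open subset_refl])

text \<open>\<partial>_a has the constant components \<delta>_ac in the even directions and 0 in the
  odd ones, so that one summand survives.\<close>

lemma lie_coeff_du:
  assumes F: "F \<in> D W"
  shows "lie_coeff X q x False (du X q x a) (P W F) = P W (cutW (gpd a F))"
proof -
  define \<delta> where "\<delta> c = (if c = a then F else (\<lambda>_. 0))" for c
  have \<delta>: "\<delta> c \<in> D W" for c by (simp add: \<delta>_def F D0)
  have g0: "cutW (gpd c (\<lambda>_. 0)) = (\<lambda>_. 0)" for c by auto
  have 1: "du X q x a (ucoord X x c) \<otimes>\<^bsub>sect X T\<^esub> P W F = P W (\<delta> c)" for c
  proof -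
    have "du X q x a (ucoord X x c) = P W (cutW (\<lambda>w. if a = c then 1 else 0))"
      unfolding ucoord_P du_P[OF D_coord]
      by (intro arg_cong[where f = "P W"] ext if_cong refl) (simp add: gpd_cut_coord)
    moreover have "cutW (\<lambda>w. if a = c then 1 else 0) \<in> D W"
      by (rule D_cut, rule gsmooth_const, simp add: gens_def)
    moreover have "(\<lambda>w. cutW (\<lambda>w. if a = c then 1 else 0) w * F w) = \<delta> c"
      using domain_sectionsD(3)[OF F] by (auto simp: \<delta>_def fun_eq_iff)
    ultimately show ?thesis by (simp only: gl_mult[OF _ F])
  qed
  have 2: "dxi X q x j (du X q x a (xicoord X x j) \<otimes>\<^bsub>sect X T\<^esub> P W F) = \<zero>\<^bsub>sect X T\<^esub>" if j: "j < q" for j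
  proof -
    have "du X q x a (xicoord X x j) = P W (\<lambda>_. 0)"
      unfolding xicoord_P du_P[OF D_ggen[OF j]]
    proof (intro arg_cong[where f = "P W"] ext)
      fix w
      show "cutW (gpd a (cutW (\<lambda>_. ggen j))) w = 0"
        using gpd_cong[OF W_open, of w "cutW (\<lambda>_. ggen j)" "\<lambda>_. ggen j" a] by simp
    qed
    moreover have "cutW (\<lambda>w. gder j 0) = (\<lambda>_. 0)" by (auto simp: gder_zero)
    ultimately show ?thesis by (simp only: gl_mult[OF D0 F] dxi_P[OF D0] gl_zero mult_zero_left)
  qed
  interpret R: ring "sect X T"
    using superalgebra.axioms(1)[OF sect_superalgebra] by blast
  have 3: "(\<Oplus>\<^bsub>sect X T\<^esub>j\<in>{..<q}. let h = dxi X q x j (du X q x a (xicoord X x j) \<otimes>\<^bsub>sect X T\<^esub> P W F) in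
      if False then h else \<ominus>\<^bsub>sect X T\<^esub> h) = (\<Oplus>\<^bsub>sect X T\<^esub>j\<in>{..<q}. \<zero>\<^bsub>sect X T\<^esub>)"
    by (rule R.finsum_cong') (simp_all add: 2)
  have 4: "(\<Oplus>\<^bsub>sect X T\<^esub>c\<in>UNIV. du X q x c (P W (\<delta> c))) = P W (\<lambda>w. \<Sum>c\<in>UNIV. cutW (gpd c (\<delta> c)) w)"
    unfolding du_P[OF \<delta>] by (rule gl_sum(2)) (simp_all add: D_gpd \<delta>)
  have "(\<Sum>c\<in>UNIV. cutW (gpd c (\<delta> c)) w) = (\<Sum>c\<in>UNIV. if c = a then cutW (gpd a F) w else 0)" for w
    by (rule sum.cong) (auto simp: \<delta>_def)
  then have 5: "(\<lambda>w. \<Sum>c\<in>UNIV. cutW (gpd c (\<delta> c)) w) = cutW (gpd a F)" by simp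
  show ?thesis
    unfolding lie_coeff_def Let_def[of "sect X T"] 1 3 4 5
    by (simp add: gl_closed[OF D_gpd[OF F]])
qed

lemma ber_of_self: "F \<in> D W \<Longrightarrow> ber_of k X q x (P W F) x = P W F"
proof -
  interpret R: ring "sect X T"
    using superalgebra.axioms(1)[OF sect_superalgebra] by blast
  show "F \<in> D W \<Longrightarrow> ?thesis" using gl_closed[of F] by (simp add: ber_of_def quot_self)
qed

text \<open>For an even derivation the sign -(-1)^(|D| |\<omega>|) is -1 whether \<omega> is even or
  odd, so the homogeneous parts can be put together again.\<close>

lemma ract_du1:
  assumes F: "F \<in> D W" and \<omega>: "\<omega> x = P W F"
  shows "ract \<beta> k X q x False (du X q x a) \<omega> = ber_of k X q x (P W (cutW (\<lambda>w. - gpd a F w)))"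
proof -
  interpret R: ring "sect X T"
    using superalgebra.axioms(1)[OF sect_superalgebra] by blast
  have G: "(\<lambda>w. gpart d (F w)) \<in> D W" for d by (rule domain_sections_gpart[OF F])
  define H where "H d = (\<lambda>w. - cutW (gpd a (\<lambda>w. gpart d (F w))) w)" for d
  have H: "H d \<in> D W" for d unfolding H_def by (rule D_minus[OF W_open subset_refl D_gpd[OF G]])
  have 1: "\<ominus>\<^bsub>sect X T\<^esub> lie_coeff X q x False (du X q x a) (hpart (sect X T) d (P W F)) = P W (H d)" for d
    unfolding gl_hpart[OF F] lie_coeff_du[OF G] H_def by (rule gl_minus[OF D_gpd[OF G]])
  have 2: "(\<Sum>d\<in>UNIV. H d w) = cutW (\<lambda>w. - gpd a F w) w" for w
  proof (cases "w \<in> W")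
    case True
    have "gpd a F w = gpd a (\<lambda>w. gpart False (F w) + gpart True (F w)) w" by (simp add: gpart_add)
    also have "\<dots> = gpd a (\<lambda>w. gpart False (F w)) w + gpd a (\<lambda>w. gpart True (F w)) w"
      by (rule gpd_add[OF W_open _ _ True]) (rule domain_sectionsD(4)[OF G])+
    finally show ?thesis using True by (simp add: UNIV_bool H_def)
  qed (simp add: H_def)
  have "(\<Oplus>\<^bsub>sect X T\<^esub>d\<in>UNIV. P W (H d)) = P W (cutW (\<lambda>w. - gpd a F w))"
    using gl_sum(2)[of UNIV H] H by (simp add: 2)
  then show ?thesis
    by (simp add: ract_def \<omega> 1)
qed

text \<open>Induction along the fold with the invariant \<open>Q\<close>, in which m counts the
  derivations applied so far. Only the value of \<omega> in x is known at the start. Every action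
  rebuilds the density from its coefficient in x by \<open>ber_of\<close>, which is why the
  transformation law holds as soon as m > 0.\<close>

lemma ract_du_fold:
  assumes f: "\<And>I. f I \<in> even_smooth q W" and \<omega>: "\<omega> x = P W (cutW (\<lambda>w. \<Sum>I\<in>Pow {..<q}. eg (f I w) * gmon I))"
  shows "ract_du \<beta> k X q x i \<omega> x = P W (cutW (\<lambda>w. (-1) ^ sum i UNIV *\<^sub>R
      (\<Sum>I\<in>Pow {..<q}. eg (multi_pd W i (f I) w) * gmon I)))" (is ?act)
    and "sum i UNIV > 0 \<Longrightarrow> ract_du \<beta> k X q x i \<omega> z = ract_du \<beta> k X q x i \<omega> x \<otimes>\<^bsub>sect X T\<^esub> quot k X q x z" (is "_ \<Longrightarrow> ?ber")
proof -
  interpret M: diff_algebra "even_smooth q W" "epd W" "\<lambda>r _. of_real r" by (rule epd_diff_algebra[OF W_open])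
  define Q where "Q m f \<omega> \<longleftrightarrow> (\<forall>I. f I \<in> even_smooth q W) \<and>
      \<omega> x = P W (cutW (\<lambda>w. (-1) ^ m *\<^sub>R (\<Sum>I\<in>Pow {..<q}. eg (f I w) * gmon I))) \<and>
      (m > 0 \<longrightarrow> \<omega> z = \<omega> x \<otimes>\<^bsub>sect X T\<^esub> quot k X q x z)"
    for m :: nat and f :: "nat set \<Rightarrow> real ^ 'p::{finite,linorder} \<Rightarrow> egrass" and \<omega> :: "('m, 'p::{finite,linorder}, 's) berezin"
  define act where "act a = ract \<beta> k X q x False (du X q x a)" for a
  have 1: "Q (Suc m) (\<lambda>I. epd W a (f I)) (act a \<omega>)" if "Q m f \<omega>" for m f \<omega> a
  proof -
    have f: "f I \<in> even_smooth q W" for I using that by (simp add: Q_def)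
    define F where "F = (\<lambda>w. (-1) ^ m *\<^sub>R (\<Sum>I\<in>Pow {..<q}. eg (f I w) * gmon I))"
    have s: "gsmooth W (\<lambda>w. eg (f I w) * gmon I)" "gens q (eg (f I w))" for I w
      using f[of I] by (auto simp: even_smooth_def intro!: gsmooth_times W_open)
    have F: "cutW F \<in> D W"
      unfolding F_def
      by (intro D_cut gsmooth_scaleR gsmooth_sum gens_scaleR gens_sum gens_times s gens_gmon W_open smooth_on_const)
        auto
    have "cutW (\<lambda>w. - gpd a (cutW F) w) w =
        cutW (\<lambda>w. (-1) ^ Suc m *\<^sub>R (\<Sum>I\<in>Pow {..<q}. eg (epd W a (f I) w) * gmon I)) w" for w
    proof (cases "w \<in> W")
      case True
      have 0: "gpd a (cutW F) w = gpd a F w" by (rule gpd_cong[OF W_open True]) simp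
      have "F = (\<lambda>w. \<Sum>I\<in>Pow {..<q}. eg (f I w) * ((-1) ^ m *\<^sub>R gmon I))"
        by (simp add: F_def scaleR_sum_right)
      from arg_cong[OF this, of "\<lambda>F. gpd a F w"]
      have "gpd a F w = gpd a (\<lambda>w. \<Sum>I\<in>Pow {..<q}. eg (f I w) * ((-1) ^ m *\<^sub>R gmon I)) w"
        .
      also have "\<dots> = (\<Sum>I\<in>Pow {..<q}. gpd a (\<lambda>w. eg (f I w) * ((-1) ^ m *\<^sub>R gmon I)) w)"
        using f by (intro gpd_sum[OF W_open _ _ True] gsmooth_times) (auto simp: even_smooth_def W_open)
      also have "\<dots> = (\<Sum>I\<in>Pow {..<q}. eg (epd W a (f I) w) * ((-1) ^ m *\<^sub>R gmon I))"
        using f True by (intro sum.cong refl, subst gpd_times[OF W_open _ _ True]) (auto simp: even_smooth_def eg_epd)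
      finally have "gpd a (cutW F) w = (\<Sum>I\<in>Pow {..<q}. eg (epd W a (f I) w) * ((-1) ^ m *\<^sub>R gmon I))"
        using 0 by (rule trans[rotated])
      then show ?thesis using True by (simp only: if_True) (simp add: scaleR_sum_right sum_negf)
    qed simp
    note 2 = this
    have "\<omega> x = P W (cutW F)" using that unfolding Q_def F_def by (elim conjE)
    from ract_du1[OF F, where \<omega> = \<omega> and \<beta> = \<beta> and k = k and a = a, OF this] have *: "act a \<omega> = ber_of k X q x (P W (cutW (\<lambda>w. (-1) ^ Suc m *\<^sub>R (\<Sum>I\<in>Pow {..<q}. eg (epd W a (f I) w) * gmon I))))"
      unfolding act_def 2 .
    have s': "gsmooth W (\<lambda>w. eg (epd W a (f I) w) * gmon I)" "gens q (eg (epd W a (f I) w))" for I w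
      using M.d_closed[OF f[of I], of a] by (auto simp: even_smooth_def intro!: gsmooth_times W_open)
    have "cutW (\<lambda>w. (-1) ^ Suc m *\<^sub>R (\<Sum>I\<in>Pow {..<q}. eg (epd W a (f I) w) * gmon I)) \<in> D W"
      by (intro D_cut gsmooth_scaleR gsmooth_sum gens_scaleR gens_sum gens_times s' gens_gmon W_open smooth_on_const)
        auto
    from ber_of_self[OF this, of k] have **: "act a \<omega> x = P W (cutW (\<lambda>w. (-1) ^ Suc m *\<^sub>R
        (\<Sum>I\<in>Pow {..<q}. eg (epd W a (f I) w) * gmon I)))"
      unfolding * .
    moreover have "act a \<omega> z = act a \<omega> x \<otimes>\<^bsub>sect X T\<^esub> quot k X q x z"
      unfolding ** unfolding * ber_of_def ..
    ultimately show ?thesis using f by (simp only: Q_def M.closed simp_thms)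
  qed
  have 2: "Q (m + l) (\<lambda>I. (epd W a ^^ l) (f I)) ((act a ^^ l) \<omega>)" if "Q m f \<omega>" for m l f \<omega> a
    using that by (induction l) (auto dest: 1)
  have 3: "Q (m + sum_list (map i xs)) (\<lambda>I. fold (\<lambda>a. epd W a ^^ i a) xs (f I)) (fold (\<lambda>a. act a ^^ i a) xs \<omega>)"
    if "Q m f \<omega>" for m f \<omega> xs
    using that
  proof (induction xs arbitrary: m f \<omega>)
    case (Cons a xs)
    have "Q (m + i a) (\<lambda>I. (epd W a ^^ i a) (f I)) ((act a ^^ i a) \<omega>)" by (rule 2[OF Cons.prems])
    from Cons.IH[OF this] show ?case by (simp add: add.assoc)
  qed simp
  have "sum_list (map i (rev (sorted_list_of_set UNIV))) = sum i UNIV"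
    by (simp add: rev_map[symmetric] sum_list_distinct_conv_sum_set)
  moreover have "Q 0 f \<omega>" using f \<omega> by (simp add: Q_def cong: if_cong)
  ultimately show ?act "sum i UNIV > 0 \<Longrightarrow> ?ber"
    using 3[of 0 f \<omega> "rev (sorted_list_of_set UNIV)"] unfolding Q_def ract_du_def act_def M.dm_def by (simp_all cong: if_cong)
qed

end

lemma mult_fun_unfold: "(\<lambda>w. (\<Prod>a\<in>UNIV. n a w ^ (i a :: nat)) * (f w * g w)) = (\<Prod>a\<in>UNIV. n a ^ i a) * (f * g)"
  for n :: "'p::finite \<Rightarrow> 'x \<Rightarrow> egrass"
  by (simp add: fun_eq_iff)

section \<open>The integrand in coordinates\<close>

context retraction
begin

text \<open>The difference of the two retractions on the a-th coordinate: the \<gamma> of this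
  locale is the second retraction of the theorem, while x belongs to the first.\<close>

abbreviation "N a \<equiv> snd \<gamma> T (lift W (\<lambda>w. w $ a)) \<ominus>\<^bsub>sect X T\<^esub> ucoord X x a"

lemma shift_monomial_closed: "(\<Prod>a\<in>B. shift a ^ i a) \<in> even_smooth q W"
proof -
  interpret M: diff_algebra "even_smooth q W" "epd W" "\<lambda>r _. of_real r" by (rule epd_diff_algebra[OF W_open])
  show ?thesis by (intro M.closed shift_closed)
qed

lemma D_eg: "f \<in> even_smooth q W \<Longrightarrow> cutW (\<lambda>w. eg (f w)) \<in> D W"
  by (rule D_cut) (simp_all add: even_smooth_def)

lemma N_P: "N a = P W (cutW (\<lambda>w. eg (shift a w)))"
proof -
  note s = smooth_on_coord[of W a]
  have "snd \<gamma> T (lift W (\<lambda>w. w $ a)) = P W (h W (\<lambda>w. w $ a))"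
    using P_h[OF W_open subset_refl s] by (simp add: pre_W)
  moreover have "(\<lambda>w. h W (\<lambda>w. w $ a) w - cutW (\<lambda>w. of_real (w $ a)) w) = cutW (\<lambda>w. eg (shift a w))"
    using h_outside[OF W_open subset_refl s] by (auto simp: shift_def fun_eq_iff eg_h[OF W_open subset_refl s])
  ultimately show ?thesis
    by (simp add: ucoord_P gl_diff[OF h_D[OF W_open subset_refl s] D_coord])
qed

lemma N_power: "N a [^]\<^bsub>sect X T\<^esub> m = P W (cutW (\<lambda>w. eg (shift a w ^ m)))" for m :: nat
proof (induction m)
  interpret M: diff_algebra "even_smooth q W" "epd W" "\<lambda>r _. of_real r" by (rule epd_diff_algebra[OF W_open])
  interpret R: ring "sect X T"
    using superalgebra.axioms(1)[OF sect_superalgebra] by blast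
  have c: "cutW (\<lambda>w. eg (shift a w ^ m)) \<in> D W" for m
    using D_eg[of "shift a ^ m"] by (simp add: M.closed shift_closed cong: if_cong)
  case 0
  show ?case by (simp add: gl_one cong: if_cong)
  case (Suc m)
  have "(\<lambda>w. cutW (\<lambda>w. eg (shift a w ^ m)) w * cutW (\<lambda>w. eg (shift a w)) w) = cutW (\<lambda>w. eg (shift a w ^ Suc m))"
    by (auto simp: fun_eq_iff power_commutes)
  then show ?case
    using gl_mult[OF c[of m] D_eg[OF shift_closed]] by (simp only: R.nat_pow_Suc Suc.IH) (simp only: N_P)
qed

lemma mpow_N: "mpow (sect X T) N i = P W (cutW (\<lambda>w. eg (\<Prod>a\<in>UNIV. shift a w ^ i a)))"
proof -
  interpret M: diff_algebra "even_smooth q W" "epd W" "\<lambda>r _. of_real r" by (rule epd_diff_algebra[OF W_open])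
  interpret R: ring "sect X T"
    using superalgebra.axioms(1)[OF sect_superalgebra] by blast
  have "foldr (\<lambda>a g. (N a [^]\<^bsub>sect X T\<^esub> i a) \<otimes>\<^bsub>sect X T\<^esub> g) xs \<one>\<^bsub>sect X T\<^esub> =
      P W (cutW (\<lambda>w. eg (\<Prod>a\<in>set xs. shift a w ^ i a)))" if "distinct xs" for xs
    using that
  proof (induction xs)
    case Nil
    show ?case by (simp add: gl_one cong: if_cong)
  next
    case (Cons b xs)
    have 1: "cutW (\<lambda>w. eg (\<Prod>a\<in>set xs. shift a w ^ i a)) \<in> D W"
      using D_eg[OF shift_monomial_closed[of i "set xs"]] by (simp cong: if_cong)
    have 2: "cutW (\<lambda>w. eg (shift b w ^ i b)) \<in> D W"
      using D_eg[of "shift b ^ i b"] by (simp add: M.closed shift_closed cong: if_cong)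
    have "(\<lambda>w. cutW (\<lambda>w. eg (shift b w ^ i b)) w * cutW (\<lambda>w. eg (\<Prod>a\<in>set xs. shift a w ^ i a)) w) =
        cutW (\<lambda>w. eg (\<Prod>a\<in>set (b # xs). shift a w ^ i a))"
      using Cons.prems by (auto simp: fun_eq_iff)
    then show ?case using Cons gl_mult[OF 2 1] by (simp only: foldr.simps o_apply N_power distinct.simps simp_thms)
  qed
  from this[of "sorted_list_of_set UNIV"] show ?thesis by (simp add: mpow_def cong: if_cong)
qed

text \<open>The even coordinates of \<open>rchart\<close> are w + n and the odd ones are those of
  x.\<close>

lemma quot_rchart: "quot k X q rchart x = P W (cutW (\<lambda>w. eg (jac W shift w)))"
proof -
  define r where "r b w = of_real (w $ b) + shift b w" for b w
  have e: "epd W a (r b) w = (if a = b then 1 else 0) + epd W a (shift b) w" if w: "w \<in> W" for a b w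
  proof (rule egrass_eqI)
    have "gpd a (\<lambda>z. of_real (z $ b) + eg (shift b z)) w =
        gpd a (\<lambda>z. of_real (z $ b)) w + gpd a (\<lambda>z. eg (shift b z)) w"
      using shift_closed[of b]
      by (intro gpd_add[OF W_open _ _ w]) (auto simp: even_smooth_def intro!: gsmooth_of_real smooth_on_coord)
    then show "eg (epd W a (r b) w) = eg ((if a = b then 1 else 0) + epd W a (shift b) w)"
      using w gpd_coord[of a b w] by (simp add: eg_epd r_def)
  qed
  have j: "ldet UNIV (\<lambda>a b. epd W a (r b) w) = jac W shift w" if "w \<in> W" for w
    unfolding jac_def by (rule ldet_cong) (rule e[OF that])
  have "quot k X q rchart x = P W (cutW (\<lambda>w. eg (ldet UNIV (\<lambda>a b. epd W a (r b) w))))"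
    by (rule quot_same_odd)
      (simp_all add: cr_ucoord_rchart r_def[symmetric] xicoord_rchart j
        body_jac[OF W_open shift_closed shift_deg])
  also have "\<dots> = P W (cutW (\<lambda>w. eg (jac W shift w)))"
    by (intro arg_cong[where f = "P W"] ext if_cong refl) (simp add: j)
  finally show ?thesis .
qed

text \<open>The integrand at \<open>i\<close>, for \<open>\<omega> = G |Dy|\<close> with \<open>y\<close> the coordinate system \<open>rchart\<close>.\<close>

theorem integrand_rchart:
  fixes i :: "'p \<Rightarrow> nat"
  assumes G: "G \<in> D W" and \<omega>: "\<omega> x = P W (E W G) \<otimes>\<^bsub>sect X T\<^esub> quot k X q rchart x"
  shows "ract_du \<beta> k X q x i (rmult \<beta> X \<omega> (mpow (sect X T) N i)) x =
    P W (cutW (\<lambda>w. (-1) ^ sum i UNIV *\<^sub>R (\<Sum>I\<in>Pow {..<q}.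
      eg (multi_pd W i (\<lambda>w. (\<Prod>a\<in>UNIV. shift a w ^ i a) *
        (Eg (h W (\<lambda>z. gcoeff (G z) I) w) * jac W shift w)) w) * gmon I)))"
    and "sum i UNIV > 0 \<Longrightarrow> ract_du \<beta> k X q x i (rmult \<beta> X \<omega> (mpow (sect X T) N i)) z =
      ract_du \<beta> k X q x i (rmult \<beta> X \<omega> (mpow (sect X T) N i)) x \<otimes>\<^bsub>sect X T\<^esub> quot k X q x z"
proof -
  note s = domain_sectionsD(1)[OF G]
  note h = h_even_smooth[OF W_open subset_refl s]
  note jc = jac_closed[OF W_open shift_closed shift_deg]
  have cl: "(\<lambda>w. (\<Prod>a\<in>UNIV. shift a w ^ i a) * (Eg (h W (\<lambda>z. gcoeff (G z) I) w) * jac W shift w)) \<in> even_smooth q W" for I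
    unfolding mult_fun_unfold by (intro even_smooth_closed W_open shift_monomial_closed h jc)
  define m where "m w = (\<Prod>a\<in>UNIV. shift a w ^ i a)" for w
  define J where "J = jac W shift"
  have m: "cutW (\<lambda>w. eg (m w)) \<in> D W"
    using D_eg[OF shift_monomial_closed[of i UNIV]] by (simp add: m_def cong: if_cong)
  have J: "cutW (\<lambda>w. eg (J w)) \<in> D W" unfolding J_def by (rule D_eg[OF jc])
  note E = E_closed[OF W_open subset_refl G]
  define F where "F = (\<lambda>w. E W G w * cutW (\<lambda>w. eg (J w)) w)"
  have F: "F \<in> D W" unfolding F_def by (rule domain_sections_mult[OF W_open E J])
  have \<omega>F: "\<omega> x = P W F"
    unfolding \<omega> quot_rchart F_def J_def[symmetric] by (rule gl_mult[OF E J])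
  interpret R: ring "sect X T"
    using superalgebra.axioms(1)[OF sect_superalgebra] by blast
  \<comment> \<open>The power n^i has odd part 0, so \<open>rmult\<close> reduces to the product in
    x.\<close>
  have g: "(\<lambda>w. gpart False (cutW (\<lambda>w. eg (m w)) w)) = cutW (\<lambda>w. eg (m w))"
    "(\<lambda>w. gpart True (cutW (\<lambda>w. eg (m w)) w)) = (\<lambda>_. 0)"
    using gpart_even_eg[of 0] by (auto simp: fun_eq_iff gpart_even_eg)
  have "rmult \<beta> X \<omega> (P W (cutW (\<lambda>w. eg (m w)))) x = P W (\<lambda>w. F w * cutW (\<lambda>w. eg (m w)) w)"
    using gl_closed[OF domain_sections_mult[OF W_open F m]]
    by (simp add: rmult_def Let_def gl_hpart[OF m] g \<omega>F gl_mult[OF F m] gl_zero[symmetric] gl_closed[OF F])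
  also have "(\<lambda>w. F w * cutW (\<lambda>w. eg (m w)) w) = cutW (\<lambda>w. \<Sum>I\<in>Pow {..<q}.
      eg (m w * (Eg (h W (\<lambda>z. gcoeff (G z) I) w) * J w)) * gmon I)"
  proof
    fix w
    show "F w * cutW (\<lambda>w. eg (m w)) w = cutW (\<lambda>w. \<Sum>I\<in>Pow {..<q}.
        eg (m w * (Eg (h W (\<lambda>z. gcoeff (G z) I) w) * J w)) * gmon I) w"
    proof (cases "w \<in> W")
      case True
      have "F w * eg (m w) = (\<Sum>I\<in>Pow {..<q}. eg (Eg (h W (\<lambda>z. gcoeff (G z) I) w)) * gmon I * eg (J w) * eg (m w))"
        using True by (simp add: F_def E_def sum_distrib_right eg_h[OF W_open subset_refl s])
      also have "\<dots> = (\<Sum>I\<in>Pow {..<q}. eg (m w * (Eg (h W (\<lambda>z. gcoeff (G z) I) w) * J w)) * gmon I)"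
      proof (rule sum.cong[OF refl])
        fix I
        let ?e = "Eg (h W (\<lambda>z. gcoeff (G z) I) w)"
        have "eg ?e * gmon I * eg (J w) * eg (m w) = eg (?e * (J w * m w)) * gmon I"
          using eg_commute[of "J w * m w" "gmon I"] by (simp add: mult.assoc)
        also have "?e * (J w * m w) = m w * (?e * J w)" by (simp add: mult_ac)
        finally show "eg ?e * gmon I * eg (J w) * eg (m w) = eg (m w * (?e * J w)) * gmon I" .
      qed
      finally show ?thesis using True by simp
    qed simp
  qed
  finally have rm: "rmult \<beta> X \<omega> (mpow (sect X T) N i) x = P W (cutW (\<lambda>w. \<Sum>I\<in>Pow {..<q}.
      eg ((\<Prod>a\<in>UNIV. shift a w ^ i a) * (Eg (h W (\<lambda>z. gcoeff (G z) I) w) * jac W shift w)) * gmon I))"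
    unfolding mpow_N m_def J_def .
  note fold = ract_du_fold[where f = "\<lambda>I w. (\<Prod>a\<in>UNIV. shift a w ^ i a) *
    (Eg (h W (\<lambda>z. gcoeff (G z) I) w) * jac W shift w)"
    and \<omega> = "rmult \<beta> X \<omega> (mpow (sect X T) N i)", OF cl rm]
  show "ract_du \<beta> k X q x i (rmult \<beta> X \<omega> (mpow (sect X T) N i)) x =
    P W (cutW (\<lambda>w. (-1) ^ sum i UNIV *\<^sub>R (\<Sum>I\<in>Pow {..<q}.
      eg (multi_pd W i (\<lambda>w. (\<Prod>a\<in>UNIV. shift a w ^ i a) *
        (Eg (h W (\<lambda>z. gcoeff (G z) I) w) * jac W shift w)) w) * gmon I)))"
    by (rule fold(1))
  show "ract_du \<beta> k X q x i (rmult \<beta> X \<omega> (mpow (sect X T) N i)) z =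
      ract_du \<beta> k X q x i (rmult \<beta> X \<omega> (mpow (sect X T) N i)) x \<otimes>\<^bsub>sect X T\<^esub> quot k X q x z"
    if "sum i UNIV > 0"
    by (rule fold(2)[OF that])
qed

text \<open>The empty power is 1. This identifies the term i = 0 of the Lagrange sum with the
  original density.\<close>

lemma rmult_mpow_zero:
  assumes "\<omega> x \<in> carrier (sect X T)"
  shows "rmult \<beta> X \<omega> (mpow (sect X T) N (\<lambda>_. 0)) x = \<omega> x"
proof -
  interpret R: ring "sect X T"
    using superalgebra.axioms(1)[OF sect_superalgebra] by blast
  have 1: "mpow (sect X T) N (\<lambda>_. 0) = P W (cutW (\<lambda>w. 1))"
    by (simp add: mpow_N cong: if_cong)
  have D1: "cutW (\<lambda>w. 1) \<in> D W" by (rule D_one[OF W_open subset_refl])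
  have g: "(\<lambda>w. gpart False (cutW (\<lambda>w. 1) w)) = cutW (\<lambda>w. 1)" "(\<lambda>w. gpart True (cutW (\<lambda>w. 1) w)) = (\<lambda>_. 0)"
    using gpart_even_eg[of 0] gpart_even_eg[of 1] by (auto simp: fun_eq_iff)
  show ?thesis
    using assms unfolding rmult_def Let_def 1 gl_hpart[OF D1] g unfolding gl_one[symmetric] gl_zero[symmetric] by simp
qed

end

section \<open>Change of variables\<close>

lemma set_borel_continuous:
  fixes f :: "'a::euclidean_space \<Rightarrow> real"
  assumes "open S" "continuous_on S f"
  shows "(\<lambda>x. indicator S x *\<^sub>R f x) \<in> borel_measurable borel"
  using borel_measurable_continuous_on_indicator[OF borel_open[OF assms(1)] assms(2)] by simp

text \<open>The integrals of the theorem are taken with respect to \<open>lborel\<close>, the change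
  of variables with respect to its completion; on Borel functions the two agree.\<close>

lemma set_integrable_lebesgue_iff:
  fixes f :: "'a::euclidean_space \<Rightarrow> real"
  assumes "open S" "continuous_on S f"
  shows "set_integrable lebesgue S f \<longleftrightarrow> set_integrable lborel S f"
  unfolding set_integrable_def
  by (rule integrable_completion) (use set_borel_continuous[OF assms] in simp)

lemma change_of_variables_wellorder:
  fixes \<psi> :: "real ^ 'n::{finite,wellorder} \<Rightarrow> real ^ 'n::{finite,wellorder}"
  assumes S: "open S" "open (\<psi> ` S)" and inj: "inj_on \<psi> S"
    and der: "\<And>w. w \<in> S \<Longrightarrow> (\<psi> has_derivative \<psi>' w) (at w)"
    and cont: "continuous_on S (\<lambda>w. det (matrix (\<psi>' w)))" "continuous_on (\<psi> ` S) f"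
    and f: "set_integrable lborel (\<psi> ` S) f"
  shows "set_integrable lborel S (\<lambda>w. \<bar>det (matrix (\<psi>' w))\<bar> * f (\<psi> w))"
    and "set_lebesgue_integral lborel S (\<lambda>w. \<bar>det (matrix (\<psi>' w))\<bar> * f (\<psi> w)) =
      set_lebesgue_integral lborel (\<psi> ` S) f"
proof -
  have c\<psi>: "continuous_on S \<psi>"
    using der by (intro continuous_at_imp_continuous_on ballI has_derivative_continuous) auto
  have c: "continuous_on S (\<lambda>w. \<bar>det (matrix (\<psi>' w))\<bar> * f (\<psi> w))"
    by (intro continuous_intros cont(1) continuous_on_compose2[OF cont(2) c\<psi>]) auto
  have f': "f absolutely_integrable_on \<psi> ` S"
    using f set_integrable_lebesgue_iff[OF S(2) cont(2)] by simp
  \<comment> \<open>The change of variables theorem is about vector-valued functions, so f is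
    regarded as a function into \<open>real ^ 1\<close>.\<close>
  define v where "v y = (\<chi> i. f y :: real ^ 1)" for y
  have v: "v = vec \<circ> f" by (simp add: v_def vec_def fun_eq_iff)
  have "v absolutely_integrable_on \<psi> ` S \<and> integral (\<psi> ` S) v = vec (integral (\<psi> ` S) f)"
    using f' by (simp add: absolutely_integrable_on_1_iff integral_on_1_eq v_def vec_def o_def)
  then have *: "(\<lambda>w. \<bar>det (matrix (\<psi>' w))\<bar> *\<^sub>R v (\<psi> w)) absolutely_integrable_on S \<and>
      integral S (\<lambda>w. \<bar>det (matrix (\<psi>' w))\<bar> *\<^sub>R v (\<psi> w)) = vec (integral (\<psi> ` S) f)"
    by (subst has_absolute_integral_change_of_variables[of S \<psi> \<psi>' v])
      (use S(1) der inj in \<open>auto intro: has_derivative_at_withinI\<close>)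
  then have a: "(\<lambda>w. \<bar>det (matrix (\<psi>' w))\<bar> * f (\<psi> w)) absolutely_integrable_on S"
    by (simp add: absolutely_integrable_on_1_iff v_def)
  have i: "integral S (\<lambda>w. \<bar>det (matrix (\<psi>' w))\<bar> * f (\<psi> w)) = integral (\<psi> ` S) f"
    using * by (simp add: integral_on_1_eq v_def vec_def vec_eq_iff)
  show 1: "set_integrable lborel S (\<lambda>w. \<bar>det (matrix (\<psi>' w))\<bar> * f (\<psi> w))"
    using a set_integrable_lebesgue_iff[OF S(1) c] by simp
  show "set_lebesgue_integral lborel S (\<lambda>w. \<bar>det (matrix (\<psi>' w))\<bar> * f (\<psi> w)) =
      set_lebesgue_integral lborel (\<psi> ` S) f"
    using i by (simp add: set_borel_integral_eq_integral(2)[OF 1] set_borel_integral_eq_integral(2)[OF f])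
qed

text \<open>The library requires well-ordered index types; a finite linear order is one up to a copy of the type.\<close>

typedef 'a wcopy = "UNIV :: 'a set" ..

instance wcopy :: (finite) finite
proof
  have "range Abs_wcopy = (UNIV :: 'a wcopy set)" by (metis Abs_wcopy_cases surjI surj_def)
  then show "finite (UNIV :: 'a wcopy set)" by (metis finite finite_imageI)
qed

instantiation wcopy :: ("{finite,linorder}") wellorder
begin

definition less_eq_wcopy :: "'a wcopy \<Rightarrow> 'a wcopy \<Rightarrow> bool" where
  "less_eq_wcopy a b \<longleftrightarrow> Rep_wcopy a \<le> Rep_wcopy b"

definition less_wcopy :: "'a wcopy \<Rightarrow> 'a wcopy \<Rightarrow> bool" where
  "less_wcopy a b \<longleftrightarrow> Rep_wcopy a < Rep_wcopy b"

instance
proof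
  fix P :: "'a wcopy \<Rightarrow> bool" and a
  assume step: "\<And>x. (\<And>y. y < x \<Longrightarrow> P y) \<Longrightarrow> P x"
  have "wfP ((<) :: 'a wcopy \<Rightarrow> 'a wcopy \<Rightarrow> bool)"
    unfolding wfp_def
  proof (rule finite_acyclic_wf)
    have "trans {(a, b :: 'a wcopy). a < b}" by (auto simp: trans_def less_wcopy_def)
    then show "acyclic {(a, b :: 'a wcopy). a < b}" by (auto simp: acyclic_def less_wcopy_def)
  qed (simp add: finite_subset[of _ UNIV])
  then show "P a" using step by (induction a rule: wfp_induct_rule) auto
qed (auto simp: less_eq_wcopy_def less_wcopy_def Rep_wcopy_inject order_less_le)

end

section \<open>Renaming of coordinates\<close>

definition reindex :: "('b \<Rightarrow> 'a) \<Rightarrow> real ^ 'a \<Rightarrow> real ^ 'b" where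
  "reindex r v = (\<chi> i. v $ r i)"

lemma linear_reindex: "linear (reindex r)"
  by (rule linearI) (simp_all add: reindex_def vec_eq_iff)

lemma reindex_reindex:
  assumes "\<And>a. r (r' a) = a"
  shows "reindex r' (reindex r v) = v"
  by (simp add: reindex_def vec_eq_iff assms)

lemma measurable_reindex [measurable]:
  "reindex (r :: 'b::finite \<Rightarrow> 'a::finite) \<in> borel_measurable borel"
  by (intro borel_measurable_continuous_onI linear_continuous_on linear_conv_bounded_linear[THEN iffD1] linear_reindex)

lemma distr_reindex:
  fixes r :: "'b::finite \<Rightarrow> 'a::finite"
  assumes "bij r"
  shows "distr lborel borel (reindex r) = lborel"
proof (rule lborel_eqI[symmetric])
  fix l u :: "real ^ 'b" assume le: "\<And>b. b \<in> Basis \<Longrightarrow> l \<bullet> b \<le> u \<bullet> b"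
  define r' where "r' = inv_into UNIV r"
  have r: "r (r' a) = a" "r' (r i) = i" for a i
    using assms by (simp_all add: r'_def bij_is_inj bij_is_surj surj_f_inv_f)
  have prod: "(\<Prod>b\<in>Basis. z \<bullet> b) = (\<Prod>i\<in>UNIV. z $ i)" for z :: "real ^ 'c::finite"
  proof -
    have B: "Basis = (\<lambda>i. axis i (1::real)) ` (UNIV :: 'c set)" by (auto simp: Basis_vec_def)
    show ?thesis unfolding B
      by (subst prod.reindex) (auto simp: inj_on_def axis_eq_axis inner_axis)
  qed
  have le': "l $ i \<le> u $ i" for i using le[of "axis i 1"] by (simp add: inner_axis Basis_vec_def) blast
  have "reindex r -` box l u = box (reindex r' l) (reindex r' u)"
    by (auto simp: mem_box_cart reindex_def) (metis r)+
  then have "emeasure (distr lborel borel (reindex r)) (box l u) = emeasure lborel (box (reindex r' l) (reindex r' u))"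
    by (simp add: emeasure_distr)
  also have "\<dots> = (\<Prod>b\<in>Basis. (reindex r' u - reindex r' l) \<bullet> b)"
    by (rule emeasure_lborel_box) (auto simp: Basis_vec_def inner_axis reindex_def le')
  also have "\<dots> = ennreal (\<Prod>a\<in>UNIV. (\<lambda>i. u $ i - l $ i) (r' a))"
    unfolding prod by (simp add: reindex_def)
  also have "(\<Prod>a\<in>UNIV. (\<lambda>i. u $ i - l $ i) (r' a)) = (\<Prod>i\<in>UNIV. u $ i - l $ i)"
    by (rule prod.reindex_bij_betw) (metis assms bij_imp_bij_inv r'_def)
  finally show "emeasure (distr lborel borel (reindex r)) (box l u) = (\<Prod>b\<in>Basis. (u - l) \<bullet> b)"
    unfolding prod by simp
qed simp

lemma lborel_reindex:
  fixes r :: "'b::finite \<Rightarrow> 'a::finite"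
  assumes r: "\<And>a. r (r' a) = a" "\<And>i. r' (r i) = i"
    and S: "open S" and f: "continuous_on S f"
  shows "set_integrable lborel (reindex r' -` S) (\<lambda>u. f (reindex r' u)) \<longleftrightarrow> set_integrable lborel S f"
    and "set_lebesgue_integral lborel (reindex r' -` S) (\<lambda>u. f (reindex r' u)) = set_lebesgue_integral lborel S (f :: real ^ 'a \<Rightarrow> real)"
proof -
  define F where "F x = indicator S x *\<^sub>R f x" for x
  have F: "F \<in> borel_measurable borel" unfolding F_def[abs_def] by (rule set_borel_continuous[OF S f])
  have "bij r'" using r by (metis bijI')
  then have d: "distr lborel borel (reindex r') = (lborel :: (real ^ 'a) measure)" by (rule distr_reindex)
  have e: "(\<lambda>u. indicator (reindex r' -` S) u *\<^sub>R f (reindex r' u)) = (\<lambda>u. F (reindex r' u))"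
    by (auto simp: F_def fun_eq_iff indicator_def)
  show "set_integrable lborel (reindex r' -` S) (\<lambda>u. f (reindex r' u)) \<longleftrightarrow> set_integrable lborel S f"
    unfolding set_integrable_def e F_def[abs_def, symmetric]
    by (subst d[symmetric], subst integrable_distr_eq) (use F in simp_all)
  show "set_lebesgue_integral lborel (reindex r' -` S) (\<lambda>u. f (reindex r' u)) = set_lebesgue_integral lborel S f"
    unfolding set_lebesgue_integral_def e F_def[abs_def, symmetric]
    by (subst d[symmetric], subst integral_distr) (use F in simp_all)
qed


text \<open>Conjugation with r is a bijection between the permutations of the two index types; it
  takes transpositions to transpositions and so keeps the sign.\<close>

lemma det_reindex:
  fixes r :: "'b::finite \<Rightarrow> 'a::finite" and M :: "'a \<Rightarrow> 'a \<Rightarrow> real"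
  assumes r: "\<And>a. r (r' a) = a" "\<And>i. r' (r i) = i"
  shows "det (\<chi> i j. M (r i) (r j)) = det (\<chi> a b. M a b)"
proof -
  have sgn: "sign (r \<circ> \<pi> \<circ> r') = sign \<pi>" 
    if "\<pi> permutes UNIV" for \<pi>
    using that finite[of UNIV]
  proof (induction \<pi> rule: permutes_induct)
      case id
      have "r \<circ> id \<circ> r' = id" by (simp add: fun_eq_iff r)
      then show ?case by simp
    next
      case (swap a b p)
      have "r \<circ> (Transposition.transpose a b \<circ> p) \<circ> r' = Transposition.transpose (r a) (r b) \<circ> (r \<circ> p \<circ> r')"
        by (auto simp: fun_eq_iff Transposition.transpose_def) (metis r(2))+
      moreover have "permutation p" "permutation (r \<circ> p \<circ> r')"
      proof -
        have p: "bij p" using swap.hyps permutes_bij by blast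
        then show "permutation p" by (simp add: permutation)
        have "bij (r \<circ> p \<circ> r')" using p r by (intro bij_comp) (metis bijI')+
        then show "permutation (r \<circ> p \<circ> r')" by (simp add: permutation)
      qed
      moreover have "r a = r b \<longleftrightarrow> a = b" by (metis r(2))
      ultimately show ?case using swap.IH by (simp only: sign_compose permutation_swap_id sign_swap_id)
  qed
  have rr: "r \<circ> (r' \<circ> \<pi> \<circ> r) \<circ> r' = \<pi>" and rr': "r' \<circ> (r \<circ> \<rho> \<circ> r') \<circ> r = \<rho>" for \<pi> \<rho>
    by (simp_all add: fun_eq_iff r)
  have "det (\<chi> a b. M a b) = (\<Sum>\<pi> | \<pi> permutes UNIV. of_int (sign \<pi>) * (\<Prod>a\<in>UNIV. M a (\<pi> a)))"
    by (simp add: det_def)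
  also have "\<dots> = (\<Sum>\<pi> | \<pi> permutes UNIV. of_int (sign (r \<circ> \<pi> \<circ> r')) * (\<Prod>a\<in>UNIV. M a ((r \<circ> \<pi> \<circ> r') a)))"
  proof (rule sum.reindex_bij_witness[where i = "\<lambda>\<pi>. r \<circ> \<pi> \<circ> r'" and j = "\<lambda>\<pi>. r' \<circ> \<pi> \<circ> r"])
    have br: "bij r" "bij r'" using r by (metis bijI')+
    show "r' \<circ> \<pi> \<circ> r \<in> {\<pi>. \<pi> permutes UNIV}" if "\<pi> \<in> {\<pi>. \<pi> permutes UNIV}" for \<pi>
      using that br by (auto intro!: bij_imp_permutes bij_comp dest: permutes_bij)
    show "r \<circ> \<pi> \<circ> r' \<in> {\<pi>. \<pi> permutes UNIV}" if "\<pi> \<in> {\<pi>. \<pi> permutes UNIV}" for \<pi>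
      using that br by (auto intro!: bij_imp_permutes bij_comp dest: permutes_bij)
  qed (simp_all add: rr rr')
  also have "\<dots> = (\<Sum>\<pi> | \<pi> permutes UNIV. of_int (sign \<pi>) * (\<Prod>i\<in>UNIV. M (r i) (r (\<pi> i))))"
  proof (intro sum.cong refl arg_cong2[where f = "(*)"])
    fix \<pi> :: "'b \<Rightarrow> 'b"
    have "(\<Prod>i\<in>UNIV. M (r i) ((r \<circ> \<pi> \<circ> r') (r i))) = (\<Prod>a\<in>UNIV. M a ((r \<circ> \<pi> \<circ> r') a))"
      using r by (intro prod.reindex_bij_betw) (metis bijI')
    then show "(\<Prod>a\<in>UNIV. M a ((r \<circ> \<pi> \<circ> r') a)) = (\<Prod>i\<in>UNIV. M (r i) (r (\<pi> i)))" by (simp add: r)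
  qed (simp add: sgn)
  finally show ?thesis by (simp add: det_def)
qed

lemma has_derivative_components:
  fixes \<psi> :: "'a::real_normed_vector \<Rightarrow> real ^ 'b::finite"
  assumes "\<And>b. ((\<lambda>z. \<psi> z $ b) has_derivative (\<lambda>h. D h $ b)) F"
  shows "(\<psi> has_derivative D) F"
proof -
  have e: "(\<Sum>b\<in>UNIV. v $ b *\<^sub>R axis b 1) = v" for v :: "real ^ 'b"
    using basis_expansion[of v] by (simp add: scalar_mult_eq_scaleR)
  have "((\<lambda>z. \<Sum>b\<in>UNIV. \<psi> z $ b *\<^sub>R axis b (1::real)) has_derivative (\<lambda>h. \<Sum>b\<in>UNIV. D h $ b *\<^sub>R axis b 1)) F"
    by (intro has_derivative_sum has_derivative_scaleR_left assms)
  then show ?thesis by (simp add: e)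
qed

lemma pd_continuous: "open S \<Longrightarrow> smooth_on S f \<Longrightarrow> continuous_on S (pd a f)"
  by (intro smooth_on_continuous smooth_on_pd)

text \<open>Conjugating \<psi> with the renaming L gives a map \<eta> over the well-ordered index
  type. Lebesgue measure and Jacobian determinant are invariant under the renaming, so the result
  carries over.\<close>

theorem change_of_variables:
  fixes \<psi> :: "real ^ 'p::{finite,linorder} \<Rightarrow> real ^ 'p::{finite,linorder}"
  assumes S: "open S" "open (\<psi> ` S)" and inj: "inj_on \<psi> S"
    and sm: "\<And>b. smooth_on S (\<lambda>w. \<psi> w $ b)"
    and cont: "continuous_on (\<psi> ` S) f"
    and f: "set_integrable lborel (\<psi> ` S) f"
  shows "set_integrable lborel S (\<lambda>w. \<bar>det (\<chi> a b. pd a (\<lambda>z. \<psi> z $ b) w)\<bar> * f (\<psi> w))"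
    and "set_lebesgue_integral lborel S (\<lambda>w. \<bar>det (\<chi> a b. pd a (\<lambda>z. \<psi> z $ b) w)\<bar> * f (\<psi> w)) =
      set_lebesgue_integral lborel (\<psi> ` S) f"
proof -
  define L :: "real ^ 'p::{finite,linorder} \<Rightarrow> real ^ ('p::{finite,linorder} wcopy)" where "L = reindex Rep_wcopy"
  define L' :: "real ^ ('p::{finite,linorder} wcopy) \<Rightarrow> real ^ 'p::{finite,linorder}" where "L' = reindex Abs_wcopy"
  have ra: "Rep_wcopy (Abs_wcopy a) = a" "Abs_wcopy (Rep_wcopy i) = i" for a :: 'p and i :: "'p wcopy"
    by (simp_all add: Abs_wcopy_inverse Rep_wcopy_inverse)
  have LL: "L' (L v) = v" "L (L' u) = u" for v u
    unfolding L_def L'_def by (simp_all add: reindex_reindex ra)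
  have lin: "bounded_linear L" "bounded_linear L'"
    unfolding L_def L'_def by (simp_all add: linear_conv_bounded_linear[symmetric] linear_reindex)
  have oL: "open (L' -` B)" if "open B" for B
    using that lin(2) by (intro continuous_open_vimage) (simp_all add: linear_continuous_at)
  define \<eta> where "\<eta> u = L (\<psi> (L' u))" for u
  define J where "J w = det (\<chi> a b. pd a (\<lambda>z. \<psi> z $ b) w)" for w
  have \<eta>S: "\<eta> ` (L' -` S) = L' -` (\<psi> ` S)"
  proof (intro subset_antisym subsetI)
    fix u assume "u \<in> L' -` (\<psi> ` S)"
    then obtain w where "w \<in> S" "L' u = \<psi> w" by auto
    then have "u = \<eta> (L w)" "L w \<in> L' -` S" by (simp_all add: \<eta>_def LL) (metis LL)
    then show "u \<in> \<eta> ` (L' -` S)" by blast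
  qed (auto simp: \<eta>_def LL)
  define D where "D w h = (\<chi> b. \<Sum>a\<in>UNIV. h $ a * pd a (\<lambda>z. \<psi> z $ b) w)" for w h
  have d\<psi>: "(\<psi> has_derivative D w) (at w)" if "w \<in> S" for w
    using has_derivative_pd[OF smooth_on_differentiable[OF S(1) sm that]]
    by (intro has_derivative_components) (simp add: D_def)
  define \<eta>' where "\<eta>' u h = L (D (L' u) (L' h))" for u h
  have d\<eta>: "(\<eta> has_derivative \<eta>' u) (at u)" if "u \<in> L' -` S" for u
  proof -
    have "((\<lambda>u. \<psi> (L' u)) has_derivative (\<lambda>h. D (L' u) (L' h))) (at u)"
      by (rule has_derivative_compose[OF bounded_linear_imp_has_derivative[OF lin(2)] d\<psi>]) (use that in simp)
    from bounded_linear.has_derivative[OF lin(1) this] show ?thesis by (simp add: \<eta>_def[abs_def] \<eta>'_def[abs_def])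
  qed
  have det: "det (matrix (\<eta>' u)) = J (L' u)" for u
  proof -
    have ax: "L' (axis j 1) = axis (Rep_wcopy j) 1" for j
      by (auto simp: L'_def reindex_def vec_eq_iff axis_def ra Abs_wcopy_inject)
    have "matrix (\<eta>' u) = (\<chi> i j. pd (Rep_wcopy j) (\<lambda>z. \<psi> z $ (Rep_wcopy i)) (L' u))"
      by (simp add: matrix_def \<eta>'_def ax D_def vec_eq_iff) (simp add: L_def reindex_def axis_sum)
    \<comment> \<open>\<open>matrix\<close> puts the directions of differentiation into the columns
      and J puts them into the rows, hence the transposition.\<close>
    then have "det (matrix (\<eta>' u)) = det (\<chi> i j. pd (Rep_wcopy i) (\<lambda>z. \<psi> z $ (Rep_wcopy j)) (L' u))"
      using det_transpose[of "\<chi> i j. pd (Rep_wcopy i) (\<lambda>z. \<psi> z $ (Rep_wcopy j)) (L' u)"]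
      by (simp add: Finite_Cartesian_Product.transpose_def)
    also have "\<dots> = J (L' u)"
      unfolding J_def by (rule det_reindex[of Rep_wcopy Abs_wcopy "\<lambda>a b. pd a (\<lambda>z. \<psi> z $ b) (L' u)"]) (simp_all add: ra)
    finally show ?thesis .
  qed
  have cJ: "continuous_on S J"
    unfolding J_def det_def by (intro continuous_intros) (simp add: pd_continuous[OF S(1) sm])
  have cL: "continuous_on B L'" for B using lin(2) by (rule linear_continuous_on)
  have c1: "continuous_on (L' -` S) (\<lambda>u. det (matrix (\<eta>' u)))"
    unfolding det by (rule continuous_on_compose2[OF cJ cL]) auto
  have c2: "continuous_on (\<eta> ` (L' -` S)) (\<lambda>u. f (L' u))"
    unfolding \<eta>S by (rule continuous_on_compose2[OF cont cL]) auto
  have i: "set_integrable lborel (\<eta> ` (L' -` S)) (\<lambda>u. f (L' u))"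
    unfolding \<eta>S using lborel_reindex(1)[of Rep_wcopy Abs_wcopy, OF ra S(2) cont, folded L'_def] f by simp
  have inj\<eta>: "inj_on \<eta> (L' -` S)"
    using inj unfolding inj_on_def \<eta>_def by (metis LL vimageE)
  note cv = change_of_variables_wellorder[OF oL[OF S(1)] oL[OF S(2), folded \<eta>S] inj\<eta> d\<eta> c1 c2 i]
  have L\<eta>: "L' (\<eta> u) = \<psi> (L' u)" for u by (simp add: \<eta>_def LL)
  have c\<psi>: "continuous_on S \<psi>"
    using d\<psi> by (intro continuous_at_imp_continuous_on ballI has_derivative_continuous) auto
  have c3: "continuous_on S (\<lambda>w. \<bar>J w\<bar> * f (\<psi> w))"
    by (intro continuous_intros cJ continuous_on_compose2[OF cont c\<psi>]) auto
  note lr = lborel_reindex[of Rep_wcopy Abs_wcopy, OF ra S(1) c3, folded L'_def]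
  show "set_integrable lborel S (\<lambda>w. \<bar>det (\<chi> a b. pd a (\<lambda>z. \<psi> z $ b) w)\<bar> * f (\<psi> w))"
    using cv(1) lr(1) by (simp add: det L\<eta> J_def)
  show "set_lebesgue_integral lborel S (\<lambda>w. \<bar>det (\<chi> a b. pd a (\<lambda>z. \<psi> z $ b) w)\<bar> * f (\<psi> w)) =
      set_lebesgue_integral lborel (\<psi> ` S) f"
    using cv(2) lr(2) lborel_reindex(2)[of Rep_wcopy Abs_wcopy, OF ra S(2) cont, folded L'_def] 
    by (simp add: det L\<eta> J_def \<eta>S)
qed

section \<open>Independence of the coordinate system\<close>

text \<open>The sign of a continuous function without zeros is locally constant.\<close>

lemma smooth_on_sgn:
  assumes W: "open W" and f: "smooth_on W f" and nz: "\<And>w. w \<in> W \<Longrightarrow> f w \<noteq> 0"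
  shows "smooth_on W (\<lambda>w. sgn (f w))"
proof (rule smooth_on_local)
  fix w assume w: "w \<in> W"
  define V where "V = W \<inter> f -` (if f w > 0 then {0<..} else {..<0})"
  have V: "open V" "w \<in> V" "V \<subseteq> W"
    using nz[OF w] w by (auto simp: V_def intro!: continuous_open_preimage smooth_on_continuous f W)
  have "sgn (f z) = sgn (f w)" if "z \<in> V" for z
    using that nz[OF w] by (auto simp: V_def split: if_splits)
  then have "smooth_on V (\<lambda>z. sgn (f z))"
    by (intro smooth_on_cong[OF V(1) _ smooth_on_const[of V "sgn (f w)"]]) simp
  then show "\<exists>V. open V \<and> w \<in> V \<and> V \<subseteq> W \<and> smooth_on V (\<lambda>z. sgn (f z))" using V by blast
qed

lemma gsmooth_ldet:
  assumes W: "open W" and I: "finite I" and A: "\<And>i j. i \<in> I \<Longrightarrow> j \<in> I \<Longrightarrow> gsmooth W (\<lambda>w. eg (A w i j))"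
  shows "gsmooth W (\<lambda>w. eg (ldet I (A w)))"
proof -
  have p: "gsmooth W (\<lambda>w. eg (\<Prod>i\<in>J. A w i (\<pi> i)))" if "\<pi> permutes I" "J \<subseteq> I" for \<pi> J
  proof -
    have "finite J" using that I finite_subset by blast
    then show ?thesis using that
      by (induction J) (auto intro!: gsmooth_times W A simp: permutes_in_image)
  qed
  show ?thesis unfolding ldet_def
    by (auto intro!: gsmooth_sum gsmooth_times W p)
qed

lemma gens_ldet:
  assumes I: "finite I" and A: "\<And>i j. i \<in> I \<Longrightarrow> j \<in> I \<Longrightarrow> gens q (eg (A i j))"
  shows "gens q (eg (ldet I A))"
proof -
  have p: "gens q (eg (\<Prod>i\<in>J. A i (\<pi> i)))" if "\<pi> permutes I" "J \<subseteq> I" for \<pi> J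
  proof -
    have "finite J" using that I finite_subset by blast
    then show ?thesis using that
      by (induction J) (auto intro!: gens_times A simp: permutes_in_image)
  qed
  have "gens q (of_int k)" for k using gens_scaleR[OF gens_one, of q "of_int k"] by (simp add: of_real_def[symmetric])
  then show ?thesis unfolding ldet_def
    by (auto intro!: gens_sum gens_times p)
qed

section \<open>Two coordinate systems associated with one retraction\<close>

locale chart_pair = retraction X q x \<gamma> + y: retraction X q y \<gamma>
  for X :: "('m, 's) superspace" and q and x :: "('m, 'p::{finite,linorder}, 's) chart"
    and y :: "('m, 'p::{finite,linorder}, 's) chart" and \<gamma> :: "('m, 'm, 's, 'm \<Rightarrow> real) morph" +
  assumes ass: "associated X x \<gamma>" and yass: "associated X y \<gamma>"
begin

text \<open>The transition map of the underlying manifold, from the coordinates y to the coordinates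
  x.\<close>

definition \<psi> :: "real ^ 'p::{finite,linorder} \<Rightarrow> real ^ 'p::{finite,linorder}" where
  "\<psi> w = \<phi> (inv_into T y.\<phi> w)"

lemma \<psi>_\<phi>: "m \<in> T \<Longrightarrow> \<psi> (y.\<phi> m) = \<phi> m"
  using y.inj_\<phi> by (simp add: \<psi>_def inv_into_f_f)

lemma W_cases:
  assumes "w \<in> y.W" obtains m where "m \<in> T" "w = y.\<phi> m"
  using assms by (auto simp: crange_def)

lemma \<psi>_image: "\<psi> ` y.W = W"
proof -
  have "\<psi> ` y.W = (\<lambda>m. \<psi> (y.\<phi> m)) ` T" by (simp add: crange_def image_image)
  also have "\<dots> = W" by (simp add: \<psi>_\<phi> crange_def)
  finally show ?thesis .
qed

lemma \<psi>_W: "w \<in> y.W \<Longrightarrow> \<psi> w \<in> W"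
  using \<psi>_image by blast

lemma \<psi>_inj: "inj_on \<psi> y.W"
proof (rule inj_onI)
  fix v w assume "v \<in> y.W" "w \<in> y.W" "\<psi> v = \<psi> w"
  then show "v = w"
    by (elim W_cases) (use inj_\<phi> in \<open>auto simp: \<psi>_\<phi> inj_on_def\<close>)
qed

lemma lift_\<psi>: "lift W F = y.lift y.W (\<lambda>w. F (\<psi> w))"
proof
  fix m
  show "lift W F m = y.lift y.W (\<lambda>w. F (\<psi> w)) m"
    by (simp add: lift_def y.lift_def pre_W y.pre_W \<psi>_\<phi>)
qed

text \<open>A smooth function of the coordinates x is a section of the reduced space, and such
  sections are smooth in every coordinate system.\<close>

lemma smooth_\<psi>: "smooth_on W F \<Longrightarrow> smooth_on y.W (\<lambda>w. F (\<psi> w))"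
proof -
  assume "smooth_on W F"
  then have "lift W F \<in> reduced_sections X T"
    using lift_closed[OF W_open subset_refl] by (simp add: pre_W)
  then obtain G where G: "smooth_on y.W G" "lift W F = y.lift y.W G"
    using y.reduced_sections_eq[OF y.W_open subset_refl] by (auto simp: y.pre_W)
  have "G w = F (\<psi> w)" if "w \<in> y.W" for w
  proof -
    note w = that
    obtain m where m: "m \<in> T" "w = y.\<phi> m" by (rule W_cases[OF w])
    then show ?thesis
      using fun_cong[OF G(2), of m] w by (simp add: lift_def y.lift_def pre_W y.pre_W \<psi>_\<phi>)
  qed
  then show ?thesis by (rule smooth_on_cong[OF y.W_open _ G(1)])
qed

lemma smooth_\<psi>_coord: "smooth_on y.W (\<lambda>w. \<psi> w $ b)"
  by (rule smooth_\<psi>[OF smooth_on_coord])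

text \<open>Both sides are the pullback along \<gamma> of one function on the underlying manifold,
  since x and y are associated with \<gamma>. So the even coordinates of x are functions of the even
  coordinates of y alone, without nilpotent corrections.\<close>

lemma P_of_real: "smooth_on W F \<Longrightarrow> P W (cutW (\<lambda>w. of_real (F w))) = y.P y.W (y.cutW (\<lambda>w. of_real (F (\<psi> w))))"
  using associated_h[OF ass, of F] y.associated_h[OF yass smooth_\<psi>, of F] by (simp add: lift_\<psi>)

text \<open>Rewrites the expansion of a superfunction in x as its expansion in y.\<close>

definition \<Theta> :: "(real ^ 'p::{finite,linorder} \<Rightarrow> grass) \<Rightarrow> real ^ 'p::{finite,linorder} \<Rightarrow> grass" where
  "\<Theta> F = y.cr y.W (P W F)"

lemma \<Theta>_D: "F \<in> D W \<Longrightarrow> \<Theta> F \<in> D y.W"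
  unfolding \<Theta>_def by (rule y.gl_cr_closed[OF gl_closed])

lemma P_\<Theta>: "F \<in> D W \<Longrightarrow> y.P y.W (\<Theta> F) = P W F"
  unfolding \<Theta>_def by (rule y.gl_cr[OF gl_closed])

lemma \<Theta>_eqI: "G \<in> D y.W \<Longrightarrow> P W F = y.P y.W G \<Longrightarrow> \<Theta> F = G"
  unfolding \<Theta>_def by (simp add: y.cr_gl)

lemma \<Theta>_mult: "F \<in> D W \<Longrightarrow> G \<in> D W \<Longrightarrow> \<Theta> (\<lambda>w. F w * G w) = (\<lambda>w. \<Theta> F w * \<Theta> G w)"
  by (rule \<Theta>_eqI)
    (simp_all add: domain_sections_mult[OF y.W_open] \<Theta>_D P_\<Theta> gl_mult[symmetric] y.gl_mult[symmetric])

lemma \<Theta>_sum: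
  assumes "finite I" "\<And>i. i \<in> I \<Longrightarrow> F i \<in> D W"
  shows "\<Theta> (\<lambda>w. \<Sum>i\<in>I. F i w) = (\<lambda>w. \<Sum>i\<in>I. \<Theta> (F i) w)"
proof (rule \<Theta>_eqI)
  show "(\<lambda>w. \<Sum>i\<in>I. \<Theta> (F i) w) \<in> D y.W" by (rule y.gl_sum(1)) (simp_all add: assms \<Theta>_D)
  interpret R: ring "sect X T"
    using superalgebra.axioms(1)[OF sect_superalgebra] by blast
  have "P W (\<lambda>w. \<Sum>i\<in>I. F i w) = (\<Oplus>\<^bsub>sect X T\<^esub>i\<in>I. P W (F i))" by (rule gl_sum(2)[symmetric]) (simp_all add: assms)
  also have "\<dots> = (\<Oplus>\<^bsub>sect X T\<^esub>i\<in>I. y.P y.W (\<Theta> (F i)))"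
    by (rule R.finsum_cong') (auto simp: assms P_\<Theta> gl_closed)
  also have "\<dots> = y.P y.W (\<lambda>w. \<Sum>i\<in>I. \<Theta> (F i) w)" by (rule y.gl_sum(2)) (simp_all add: assms \<Theta>_D)
  finally show "P W (\<lambda>w. \<Sum>i\<in>I. F i w) = y.P y.W (\<lambda>w. \<Sum>i\<in>I. \<Theta> (F i) w)" .
qed

lemma \<Theta>_of_real: "smooth_on W F \<Longrightarrow> \<Theta> (cutW (\<lambda>w. of_real (F w))) = y.cutW (\<lambda>w. of_real (F (\<psi> w)))"
  by (rule \<Theta>_eqI[OF y.D_of_real[OF y.W_open subset_refl smooth_\<psi>] P_of_real])

lemma \<Theta>_even:
  assumes "F \<in> D W" "\<And>w. gparity d (F w)"
  shows "gparity d (\<Theta> F w)"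
proof (rule y.P_grade_iff[OF y.W_open subset_refl \<Theta>_D[OF assms(1)]])
  show "y.P y.W (\<Theta> F) \<in> grade (y.A y.W) d"
    using P_grade[OF W_open subset_refl assms] by (simp add: P_\<Theta>[OF assms(1)] pre_W y.pre_W)
qed

text \<open>The odd coordinates of x, expanded in y; \<open>\<kappa>\<close> below goes in the other
  direction.\<close>

definition \<theta> :: "nat \<Rightarrow> real ^ 'p::{finite,linorder} \<Rightarrow> grass" where
  "\<theta> j = \<Theta> (cutW (\<lambda>w. ggen j))"

lemma \<theta>: "j < q \<Longrightarrow> \<theta> j \<in> D y.W" "j < q \<Longrightarrow> gparity True (\<theta> j w)"
  unfolding \<theta>_def
  using \<Theta>_D[OF D_ggen] \<Theta>_even[OF D_ggen, of j True] by (auto simp: gparity_ggen)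

lemma D_gmon: "I \<subseteq> {..<q} \<Longrightarrow> cutW (\<lambda>w. gmon I) \<in> D W"
  by (rule D_cut) (simp_all add: gens_gmon)

lemma \<Theta>_gmon:
  assumes "I \<subseteq> {..<q}"
  shows "\<Theta> (cutW (\<lambda>w. gmon I)) = y.cutW (\<lambda>w. thmon (\<lambda>j. \<theta> j w) I)"
proof -
  have "finite I" using assms finite_subset by blast
  then show ?thesis using assms
  proof (induction I rule: finite_linorder_min_induct)
    case empty
    show ?case using \<Theta>_of_real[of "\<lambda>_. 1"] by (simp cong: if_cong)
  next
    case (insert m I)
    have "cutW (\<lambda>w. gmon (insert m I)) = (\<lambda>w. cutW (\<lambda>w. ggen m) w * cutW (\<lambda>w. gmon I) w)"
      using gmon_insert[of I m] insert by (auto simp: fun_eq_iff)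
    then have "\<Theta> (cutW (\<lambda>w. gmon (insert m I))) = (\<lambda>w. \<theta> m w * y.cutW (\<lambda>w. thmon (\<lambda>j. \<theta> j w) I) w)"
      using insert by (simp only: \<Theta>_mult[OF D_ggen D_gmon] \<theta>_def[symmetric]) (simp add: \<Theta>_mult D_ggen D_gmon \<theta>_def)
    also have "\<dots> = y.cutW (\<lambda>w. thmon (\<lambda>j. \<theta> j w) (insert m I))"
      using insert by (auto simp: fun_eq_iff thmon_insert)
    finally show ?case .
  qed
qed

text \<open>\<Theta> respects sums and products, sends a function of the even coordinates to its
  composition with \<psi>, and sends \<xi>_j to \<theta>_j; this determines it on every
  expansion.\<close>

lemma \<Theta>_gsubst:
  assumes F: "F \<in> D W" and w: "w \<in> y.W"
  shows "\<Theta> F w = gsubst q (\<lambda>j. \<theta> j w) (F (\<psi> w))"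
proof -
  note s = domain_sectionsD(1)[OF F]
  note d = D_of_real[OF W_open subset_refl s]
  have "F = (\<lambda>w. \<Sum>I\<in>Pow {..<q}. cutW (\<lambda>w. of_real (gcoeff (F w) I)) w * cutW (\<lambda>w. gmon I) w)"
  proof
    fix w
    show "F w = (\<Sum>I\<in>Pow {..<q}. cutW (\<lambda>w. of_real (gcoeff (F w) I)) w * cutW (\<lambda>w. gmon I) w)"
    proof (cases "w \<in> W")
      case True
      then show ?thesis
        using gens_expand[OF domain_sectionsD(2)[OF F, of w]] by (simp only: if_True) (simp add: of_real_def)
    qed (simp add: domain_sectionsD(3)[OF F])
  qed
  then have "\<Theta> F w = \<Theta> (\<lambda>w. \<Sum>I\<in>Pow {..<q}. cutW (\<lambda>w. of_real (gcoeff (F w) I)) w * cutW (\<lambda>w. gmon I) w) w"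
    by simp
  also have "\<dots> = (\<Sum>I\<in>Pow {..<q}. \<Theta> (\<lambda>w. cutW (\<lambda>w. of_real (gcoeff (F w) I)) w * cutW (\<lambda>w. gmon I) w) w)"
    by (subst \<Theta>_sum) (auto intro!: domain_sections_mult[OF W_open] d D_gmon)
  also have "\<dots> = (\<Sum>I\<in>Pow {..<q}. gcoeff (F (\<psi> w)) I *\<^sub>R thmon (\<lambda>j. \<theta> j w) I)"
    using w by (intro sum.cong refl, subst \<Theta>_mult[OF d D_gmon])
      (simp_all add: \<Theta>_of_real[OF s] \<Theta>_gmon, simp add: of_real_def)
  finally show ?thesis by (simp add: gsubst_def)
qed

definition \<kappa> :: "nat \<Rightarrow> real ^ 'p::{finite,linorder} \<Rightarrow> grass" where
  "\<kappa> k = cr W (xicoord X y k)"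

lemma \<kappa>:
  assumes k: "k < q"
  shows "\<kappa> k \<in> D W" "\<Theta> (\<kappa> k) = y.cutW (\<lambda>w. ggen k)" "gparity True (\<kappa> k w)"
proof -
  have g: "y.cutW (\<lambda>w. ggen k) \<in> D y.W" by (rule y.D_ggen[OF k])
  have c: "xicoord X y k \<in> carrier (sect X T)" unfolding y.xicoord_P by (rule y.gl_closed[OF g])
  show \<kappa>: "\<kappa> k \<in> D W" unfolding \<kappa>_def by (rule gl_cr_closed[OF c])
  have P: "P W (\<kappa> k) = xicoord X y k" unfolding \<kappa>_def by (rule gl_cr[OF c])
  then show "\<Theta> (\<kappa> k) = y.cutW (\<lambda>w. ggen k)" by (intro \<Theta>_eqI g) (simp add: y.xicoord_P)
  have "xicoord X y k \<in> grade (sect X T) True"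
    unfolding y.xicoord_P
    using y.P_grade[OF y.W_open subset_refl g, of True] gparity_ggen[of k]
    by (auto simp: y.pre_W gparity_def)
  then show "gparity True (\<kappa> k w)"
    using P_grade_iff[OF W_open subset_refl \<kappa>, of True] by (simp add: P pre_W)
qed

definition Vm :: "real ^ 'p::{finite,linorder} \<Rightarrow> nat \<Rightarrow> nat \<Rightarrow> egrass" where
  "Vm w i j = Eg (gder i (\<theta> j w))"

text \<open>The derivatives of the odd coordinates of y by those of x, rewritten in y: the matrix
  inverse to \<open>Vm\<close> by the chain rule.\<close>

definition Bm :: "real ^ 'p::{finite,linorder} \<Rightarrow> nat \<Rightarrow> nat \<Rightarrow> egrass" where
  "Bm w j k = Eg (\<Theta> (cutW (\<lambda>z. gder j (\<kappa> k z))) w)"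

lemma eg_Vm: "j < q \<Longrightarrow> eg (Vm w i j) = gder i (\<theta> j w)"
  using gparity_gder[OF \<theta>(2), of j] by (simp add: Vm_def eg_Eg)

lemma eg_Bm: "k < q \<Longrightarrow> eg (Bm w j k) = \<Theta> (cutW (\<lambda>z. gder j (\<kappa> k z))) w"
  unfolding Bm_def
  by (rule eg_Eg, rule \<Theta>_even[OF D_gder[OF \<kappa>(1)]])
    (use gparity_gder[OF \<kappa>(3)] in \<open>auto simp: gparity_def\<close>)

text \<open>Substituting \<psi> and \<theta> into \<kappa>_j gives back the j-th odd coordinate of
  y; this is differentiated by the i-th one.\<close>

lemma Vm_Bm:
  assumes w: "w \<in> y.W" and ij: "i < q" "j < q"
  shows "(\<Sum>k<q. Vm w i k * Bm w k j) = (if i = j then 1 else 0)"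
proof (rule egrass_eqI)
  have "ggen j = gsubst q (\<lambda>j. \<theta> j w) (\<kappa> j (\<psi> w))"
    using \<Theta>_gsubst[OF \<kappa>(1)[OF ij(2)] w] w by (simp add: \<kappa>(2)[OF ij(2)])
  then have "gder i (ggen j) = gder i (gsubst q (\<lambda>j. \<theta> j w) (\<kappa> j (\<psi> w)))" by simp
  also have "\<dots> = (\<Sum>k<q. gder i (\<theta> k w) * gsubst q (\<lambda>j. \<theta> j w) (gder k (\<kappa> j (\<psi> w))))"
    by (rule gder_gsubst) (rule \<theta>(2))
  also have "\<dots> = (\<Sum>k<q. eg (Vm w i k) * eg (Bm w k j))"
    using \<psi>_W[OF w]
    by (intro sum.cong refl) (simp add: eg_Vm eg_Bm[OF ij(2)] \<Theta>_gsubst[OF D_gder[OF \<kappa>(1)[OF ij(2)]] w])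
  finally show "eg (\<Sum>k<q. Vm w i k * Bm w k j) = eg (if i = j then 1 else 0)"
    by (cases "i = j") (simp_all add: gder_ggen)
qed

lemma Bm_Vm:
  assumes w: "w \<in> y.W" and ij: "i < q" "j < q"
  shows "(\<Sum>k<q. Bm w i k * Vm w k j) = (if i = j then 1 else 0)"
  by (rule egrass_right_inverse_left[OF _ _ ij])
    (use Vm_Bm[OF w] in \<open>simp_all add: eg_Vm gens_gder domain_sectionsD(2)[OF \<theta>(1)]\<close>)

definition \<Delta> :: "real ^ 'p::{finite,linorder} \<Rightarrow> real" where
  "\<Delta> w = det (\<chi> a b. pd a (\<lambda>z. \<psi> z $ b) w)"

lemma \<Delta>_ldet: "ldet UNIV (\<lambda>a b. of_real (pd a (\<lambda>z. \<psi> z $ b) w)) = of_real (\<Delta> w)"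
  by (simp add: ldet_def \<Delta>_def det_def)

lemma \<Delta>_smooth: "smooth_on y.W \<Delta>"
proof -
  have "gsmooth y.W (\<lambda>w. eg (ldet UNIV (\<lambda>a b. of_real (pd a (\<lambda>z. \<psi> z $ b) w))))"
    by (rule gsmooth_ldet[OF y.W_open]) (auto intro!: gsmooth_of_real smooth_on_pd smooth_\<psi>_coord)
  then have "smooth_on y.W (\<lambda>w. gcoeff (eg (of_real (\<Delta> w))) {})"
    unfolding \<Delta>_ldet gsmooth_def by (rule spec)
  then show ?thesis by simp
qed


lemma has_derivative_\<psi>:
  assumes w: "w \<in> y.W"
  shows "(\<psi> has_derivative (\<lambda>h. \<chi> b. \<Sum>a\<in>UNIV. h $ a * pd a (\<lambda>z. \<psi> z $ b) w)) (at w)"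
  using has_derivative_pd[OF smooth_on_differentiable[OF y.W_open smooth_\<psi>_coord w]]
  by (intro has_derivative_components) simp

end

lemma chart_pair_sym: "chart_pair X q x y \<gamma> \<Longrightarrow> chart_pair X q y x \<gamma>"
  by (auto simp: chart_pair_def chart_pair_axioms_def)

context chart_pair
begin

text \<open>The same pair with the roles of x and y exchanged; its transition map is the inverse of
  \<psi>.\<close>

interpretation r: chart_pair X q y x \<gamma> by (rule chart_pair_sym[OF chart_pair_axioms])

lemma \<Delta>_mult:
  assumes w: "w \<in> y.W"
  shows "\<Delta> w * r.\<Delta> (\<psi> w) = 1"
proof -
  define M where "M = (\<chi> a c. pd a (\<lambda>z. \<psi> z $ c) w)"
  define N where "N = (\<chi> c b. pd c (\<lambda>z. r.\<psi> z $ b) (\<psi> w))"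
  have inv: "r.\<psi> (\<psi> z) = z" if "z \<in> y.W" for z
    using that by (elim W_cases) (simp add: \<psi>_\<phi> r.\<psi>_\<phi>)
  have "(\<Sum>c\<in>UNIV. pd a (\<lambda>z. \<psi> z $ c) w * pd c (\<lambda>z. r.\<psi> z $ b) (\<psi> w)) = (if a = b then 1 else 0)" for a b
  proof -
    have "((\<lambda>z. r.\<psi> z $ b) has_derivative (\<lambda>h. \<Sum>c\<in>UNIV. h $ c * pd c (\<lambda>z. r.\<psi> z $ b) (\<psi> w))) (at (\<psi> w))"
      by (rule has_derivative_pd[OF smooth_on_differentiable[OF W_open r.smooth_\<psi>_coord \<psi>_W[OF w]]])
    from has_derivative_compose[OF has_derivative_\<psi>[OF w] this]
    have "pd a (\<lambda>z. r.\<psi> (\<psi> z) $ b) w =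
        (\<Sum>c\<in>UNIV. (\<Sum>a'\<in>UNIV. axis a 1 $ a' * pd a' (\<lambda>z. \<psi> z $ c) w) * pd c (\<lambda>z. r.\<psi> z $ b) (\<psi> w))"
      by (simp add: pd_eq)
    moreover have "pd a (\<lambda>z. r.\<psi> (\<psi> z) $ b) w = pd a (\<lambda>z. z $ b) w"
      by (rule pd_cong[OF y.W_open w]) (simp add: inv)
    ultimately show ?thesis by (simp add: axis_sum pd_coord)
  qed
  then have "M ** N = mat 1" by (simp add: M_def N_def matrix_matrix_mult_def mat_def vec_eq_iff)
  then have "det M * det N = 1" using det_mul[of M N] by simp
  then show ?thesis by (simp add: \<Delta>_def r.\<Delta>_def M_def N_def)
qed

lemma \<Delta>_nz: "w \<in> y.W \<Longrightarrow> \<Delta> w \<noteq> 0"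
  using \<Delta>_mult[of w] by auto

text \<open>The contribution of the even coordinates to the quotient: for densities the sign factor
  turns the determinant into its absolute value.\<close>

abbreviation "\<sigma> k w \<equiv> (case k of Density \<Rightarrow> \<bar>\<Delta> w\<bar> | Form \<Rightarrow> \<Delta> w)"

text \<open>The even coordinates of x do not involve the odd coordinates of y, so T = 0 and
  \<open>quot_split\<close> applies, with a real matrix R and with the inverse odd Jacobian
  \<open>Bm\<close>.\<close>

lemma quot_P: "quot k X q x y = y.P y.W (y.cutW (\<lambda>w. of_real (\<sigma> k w) * eg (ldet {..<q} (Bm w))))"
proof -
  define R where "R w a b = (of_real (pd a (\<lambda>z. \<psi> z $ b) w) :: egrass)" for w a b
  have u: "y.cr y.W (ucoord X x b) = y.cutW (\<lambda>w. of_real (\<psi> w $ b))" for b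
    unfolding ucoord_P \<Theta>_def[symmetric] by (rule \<Theta>_of_real[OF smooth_on_coord])
  have xi: "y.cr y.W (xicoord X x j) = \<theta> j" for j
    unfolding xicoord_P \<Theta>_def[symmetric] \<theta>_def ..
  have "quot k X q x y = y.P y.W (y.cutW (\<lambda>w.
    (case k of Density \<Rightarrow> of_real (sgn (gcoeff (eg (ldet UNIV (R w))) {})) | Form \<Rightarrow> 1) *
    (eg (ldet UNIV (R w)) * eg (ldet {..<q} (Bm w)))))"
  proof (rule y.quot_split)
    fix w assume w: "w \<in> y.W"
    have "gder i (of_real t) = 0" for i t
      by (rule grass_eqI) (simp add: gcoeff_gder)
    then show "gpd a (y.cr y.W (xicoord X x j)) w = 0 \<or> (\<forall>i b. i < q \<longrightarrow> gder i (y.cr y.W (ucoord X x b) w) = 0)" for a j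
      using w by (simp add: u)
    have "gpd a (y.cr y.W (ucoord X x b)) w = gpd a (\<lambda>w. of_real (\<psi> w $ b)) w" for a b
      by (rule gpd_cong[OF y.W_open w]) (simp add: u)
    moreover have "gpd a (\<lambda>w. of_real (\<psi> w $ b)) w = eg (R w a b)" for a b
    proof (rule grass_eqI)
      fix I
      show "gcoeff (gpd a (\<lambda>w. of_real (\<psi> w $ b)) w) I = gcoeff (eg (R w a b)) I"
        by (cases "I = {}") (simp_all add: gcoeff_gpd R_def)
    qed
    ultimately show "gpd a (y.cr y.W (ucoord X x b)) w = eg (R w a b)" for a b by simp
    have e: "eg (if i = j then 1 else 0) = (if i = j then 1 else 0)" for i j :: nat by simp
    show "(\<Sum>k<q. gder i (y.cr y.W (xicoord X x k) w) * eg (Bm w k j)) = (if i = j then 1 else 0)"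
      if "i < q" "j < q" for i j
      using arg_cong[OF Vm_Bm[OF w that], of eg] by (simp only: xi e eg_sum eg_simps) (simp add: eg_Vm)
    show "(\<Sum>k<q. eg (Bm w i k) * gder k (y.cr y.W (xicoord X x j) w)) = (if i = j then 1 else 0)"
      if "i < q" "j < q" for i j
      using arg_cong[OF Bm_Vm[OF w that], of eg] by (simp only: xi e eg_sum eg_simps) (simp add: eg_Vm[OF that(2)])
  qed
  moreover have R\<Delta>: "ldet UNIV (R w) = of_real (\<Delta> w)" for w
    unfolding R_def by (rule \<Delta>_ldet)
  have "y.P y.W (y.cutW (\<lambda>w.
    (case k of Density \<Rightarrow> of_real (sgn (gcoeff (eg (ldet UNIV (R w))) {})) | Form \<Rightarrow> 1) *
    (eg (ldet UNIV (R w)) * eg (ldet {..<q} (Bm w))))) = y.P y.W (y.cutW (\<lambda>w. of_real (\<sigma> k w) * eg (ldet {..<q} (Bm w))))"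
    by (intro arg_cong[where f = "y.P y.W"] ext if_cong refl)
      (simp add: R\<Delta> mult.assoc[symmetric] of_real_mult[symmetric] abs_sgn mult.commute del: of_real_mult split: kind.split)
  ultimately show ?thesis by (simp only:)
qed

lemma \<sigma>_smooth: "smooth_on y.W (\<sigma> k)"
proof (cases k)
  case Density
  have "smooth_on y.W (\<lambda>w. \<Delta> w * sgn (\<Delta> w))"
    by (intro smooth_on_mult y.W_open \<Delta>_smooth smooth_on_sgn \<Delta>_nz)
  then show ?thesis using Density by (simp add: abs_sgn)
qed (use \<Delta>_smooth in simp)

lemma quot_D: "y.cutW (\<lambda>w. of_real (\<sigma> k w) * eg (ldet {..<q} (Bm w))) \<in> D y.W"
proof (rule y.D_cut)
  show "gsmooth y.W (\<lambda>w. of_real (\<sigma> k w) * eg (ldet {..<q} (Bm w)))"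
    by (intro gsmooth_times gsmooth_of_real \<sigma>_smooth y.W_open gsmooth_ldet)
      (auto simp: eg_Bm intro!: domain_sectionsD(4) \<Theta>_D D_gder \<kappa>)
  show "gens q (of_real (\<sigma> k w) * eg (ldet {..<q} (Bm w)))" for w
    unfolding of_real_def scaleR_one mult_scaleR_left mult_1_left
    by (intro gens_scaleR gens_ldet)
      (simp_all add: eg_Bm domain_sectionsD(2)[OF \<Theta>_D[OF D_gder[OF \<kappa>(1)]]])
qed

text \<open>At each point this is \<open>top_gsubst\<close>: the factor det \<open>Bm\<close> of the
  Berezinian compensates for the odd substitution, and only \<sigma> remains.\<close>

lemma top_coefficient:
  assumes c: "\<omega> x \<in> carrier (sect X T)" "\<omega> y = \<omega> x \<otimes>\<^bsub>sect X T\<^esub> quot k X q x y" and w: "w \<in> y.W"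
  shows "gcoeff (crep X q y (\<omega> y) w) {..<q} = \<sigma> k w * gcoeff (crep X q x (\<omega> x) (\<psi> w)) {..<q}"
proof -
  define F where "F = cr W (\<omega> x)"
  have F: "F \<in> D W" "P W F = \<omega> x" unfolding F_def using gl_cr_closed[OF c(1)] gl_cr[OF c(1)] by auto
  have "\<omega> y = y.P y.W (\<lambda>w. \<Theta> F w * y.cutW (\<lambda>w. of_real (\<sigma> k w) * eg (ldet {..<q} (Bm w))) w)"
    unfolding c(2) F(2)[symmetric] P_\<Theta>[OF F(1), symmetric] quot_P by (rule y.gl_mult[OF \<Theta>_D[OF F(1)] quot_D])
  then have "crep X q y (\<omega> y) w = \<Theta> F w * (of_real (\<sigma> k w) * eg (ldet {..<q} (Bm w)))"
    using w y.cr_gl[OF domain_sections_mult[OF y.W_open \<Theta>_D[OF F(1)] quot_D]] by (simp add: y.crep_cr)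
  also have "\<dots> = \<sigma> k w *\<^sub>R (gsubst q (\<lambda>j. \<theta> j w) (F (\<psi> w)) * eg (ldet {..<q} (Bm w)))"
    by (simp add: \<Theta>_gsubst[OF F(1) w] of_real_def)
  finally have "gcoeff (crep X q y (\<omega> y) w) {..<q} =
      \<sigma> k w * gcoeff (gsubst q (\<lambda>j. \<theta> j w) (F (\<psi> w)) * eg (ldet {..<q} (Bm w))) {..<q}"
    by simp
  also have "gcoeff (gsubst q (\<lambda>j. \<theta> j w) (F (\<psi> w)) * eg (ldet {..<q} (Bm w))) {..<q} = gcoeff (F (\<psi> w)) {..<q}"
    by (rule top_gsubst[where V = "Vm w"])
      (use \<theta> domain_sectionsD(2)[OF \<theta>(1)] Vm_Bm[OF w] Bm_Vm[OF w] in \<open>auto simp: eg_Vm\<close>)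
  finally show ?thesis by (simp add: F_def crep_cr)
qed


text \<open>For forms, the orientations of the two coordinate systems differ by the sign of
  \<Delta>, so in both cases the absolute value results that the change of variables for Lebesgue
  measure requires.\<close>

lemma weight:
  assumes e: "integration_weight k X e" and w: "w \<in> y.W"
  shows "e y.\<phi> (inv_into T y.\<phi> w) * \<sigma> k w = e \<phi> (inv_into T \<phi> (\<psi> w)) * \<bar>\<Delta> w\<bar>"
proof (cases k)
  case Density
  then show ?thesis using e by (simp add: integration_weight_def)
next
  case Form
  then have e: "orientation TYPE('p) X e" using e by (simp add: integration_weight_def)
  obtain m where m: "m \<in> T" "w = y.\<phi> m" by (rule W_cases[OF w])
  have i: "inv_into T y.\<phi> w = m" "inv_into T \<phi> (\<psi> w) = m"
    using m inj_\<phi> y.inj_\<phi> by (simp_all add: \<psi>_\<phi> inv_into_f_f)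
  have f: "fst reduced_chart = \<phi>" "fst y.reduced_chart = y.\<phi>"
    by (simp_all add: reduced_chart_def y.reduced_chart_def)
  have "e (fst y.reduced_chart) m = e (fst reduced_chart) m *
      sgn (det (\<chi> a b. pd a (\<lambda>z. fst reduced_chart (inv_into T (fst y.reduced_chart) z) $ b) (fst y.reduced_chart m)))"
    using e reduced_chart y.reduced_chart m(1) unfolding orientation_def by blast
  then have "e y.\<phi> m = e \<phi> m * sgn (\<Delta> w)"
    by (simp add: f \<Delta>_def \<psi>_def m(2))
  then show ?thesis using Form by (simp add: i mult.assoc abs_sgn mult.commute[of "sgn _"])
qed

lemma fibre_integrand_pair:
  assumes "\<omega> x \<in> carrier (sect X T)" "\<omega> y = \<omega> x \<otimes>\<^bsub>sect X T\<^esub> quot k X q x y"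
    and "integration_weight k X e" and w: "w \<in> y.W"
  shows "fibre_integrand s e X q y \<omega> w = \<bar>\<Delta> w\<bar> * fibre_integrand s e X q x \<omega> (\<psi> w)"
  using weight[OF assms(3) w] top_coefficient[of \<omega> k, OF assms(1,2) w]
  by (simp add: fibre_integrand_def fibre_coeff_def)

end

context chart
begin

lemma continuous_inv_\<phi>: "continuous_map (top_of_set W) (base X) (inv_into T \<phi>)"
proof -
  obtain g where g: "homeomorphic_maps (base X) (top_of_set W) \<phi> g"
    using homeo by (auto simp: homeomorphic_map_maps)
  have e: "g w = inv_into T \<phi> w" if "w \<in> W" for w
    using that g inj_\<phi> by (auto simp: crange_def homeomorphic_maps_def)
  have "continuous_map (top_of_set W) (base X) g" using g by (simp add: homeomorphic_maps_def)
  then show ?thesis by (rule continuous_map_eq) (simp add: e)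
qed

text \<open>The change of variables is applied to continuous integrands, which settles
  measurability; the weight is continuous by the definition of an orientation.\<close>

lemma fibre_integrand_continuous:
  assumes c: "\<omega> x \<in> carrier (sect X T)" and e: "integration_weight k X e"
  shows "continuous_on W (fibre_integrand s e X q x \<omega>)"
proof -
  have 1: "continuous_on W (fibre_coeff s X q x \<omega>)"
    unfolding fibre_coeff_def crep_cr
    by (intro continuous_intros smooth_on_continuous domain_sectionsD(1)[OF gl_cr_closed[OF c]])
  have "continuous_on W (\<lambda>w. e \<phi> (inv_into T \<phi> w))"
  proof (cases k)
    case Density
    then show ?thesis using e by (simp add: integration_weight_def)
  next
    case Form
    then have "orientation TYPE('p) X e" using e by (simp add: integration_weight_def)
    then have "continuous_map (base X) euclideanreal (e (fst reduced_chart))"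
      using reduced_chart unfolding orientation_def by blast
    then have "continuous_map (base X) euclideanreal (e \<phi>)" by (simp add: reduced_chart_def)
    from continuous_map_compose[OF continuous_inv_\<phi> this] show ?thesis by (simp add: o_def)
  qed
  then show ?thesis unfolding fibre_integrand_def by (intro continuous_on_mult 1)
qed

end

section \<open>The integral in two coordinate systems\<close>

context chart_pair
begin

lemma integral_pair:
  fixes f g :: "real ^ 'p::{finite,linorder} \<Rightarrow> real"
  assumes c: "continuous_on W f" and eq: "\<And>w. w \<in> y.W \<Longrightarrow> g w = \<bar>\<Delta> w\<bar> * f (\<psi> w)"
    and i: "set_integrable lborel W f"
  shows "set_integrable lborel y.W g"
    and "set_lebesgue_integral lborel y.W g = set_lebesgue_integral lborel W f"
proof -
  have o: "open (\<psi> ` y.W)" unfolding \<psi>_image by (rule W_open)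
  have c: "continuous_on (\<psi> ` y.W) f" unfolding \<psi>_image by (rule c)
  have i': "set_integrable lborel (\<psi> ` y.W) f" unfolding \<psi>_image by (rule i)
  note cv = change_of_variables[OF y.W_open o \<psi>_inj smooth_\<psi>_coord c i', folded \<Delta>_def]
  show "set_integrable lborel y.W g"
    using cv(1) eq by (simp cong: set_integrable_cong)
  have "set_lebesgue_integral lborel y.W g = set_lebesgue_integral lborel y.W (\<lambda>w. \<bar>\<Delta> w\<bar> * f (\<psi> w))"
    by (rule set_lebesgue_integral_cong) (use y.W_open eq in auto)
  then show "set_lebesgue_integral lborel y.W g = set_lebesgue_integral lborel W f"
    using cv(2) by (simp add: \<psi>_image)
qed

text \<open>The change of variables along \<psi> transfers integrability from x to y, and the
  exchanged pair transfers it back, which gives the equivalence.\<close>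

theorem fibre_integral_pair:
  assumes \<omega>: "\<omega> x \<in> carrier (sect X T)" "\<omega> y = \<omega> x \<otimes>\<^bsub>sect X T\<^esub> quot k X q x y"
    and e: "integration_weight k X e"
  shows "set_integrable lborel y.W (fibre_integrand s e X q y \<omega>) \<longleftrightarrow>
      set_integrable lborel W (fibre_integrand s e X q x \<omega>)"
    and "set_integrable lborel W (fibre_integrand s e X q x \<omega>) \<Longrightarrow>
      set_lebesgue_integral lborel y.W (fibre_integrand s e X q y \<omega>) =
      set_lebesgue_integral lborel W (fibre_integrand s e X q x \<omega>)"
proof -
  interpret r: chart_pair X q y x \<gamma> by (rule chart_pair_sym[OF chart_pair_axioms])
  interpret R: ring "sect X T"
    using superalgebra.axioms(1)[OF sect_superalgebra] by blast
  note fib = fibre_integrand_pair[where \<omega> = \<omega> and k = k and e = e and s = s, OF \<omega> e]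
  have cx: "continuous_on W (fibre_integrand s e X q x \<omega>)"
    by (rule fibre_integrand_continuous[of \<omega>]) (rule \<omega>(1), rule e)
  have "quot k X q x y \<in> carrier (sect X T)" unfolding quot_P by (rule y.gl_closed[OF quot_D])
  then have "\<omega> y \<in> carrier (sect X T)" using \<omega> by simp
  then have cy: "continuous_on y.W (fibre_integrand s e X q y \<omega>)"
    by (rule y.fibre_integrand_continuous[of \<omega>]) (rule e)
  \<comment> \<open>The relation between the integrands, solved for the one in x by means of
    \<open>r.\<Delta>_mult\<close>.\<close>
  have inv: "fibre_integrand s e X q x \<omega> w = \<bar>r.\<Delta> w\<bar> * fibre_integrand s e X q y \<omega> (r.\<psi> w)" if w: "w \<in> W" for w
  proof -
    have p: "r.\<psi> w \<in> y.W" "\<psi> (r.\<psi> w) = w"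
      using r.\<psi>_W[OF w] w by (auto elim!: r.W_cases simp: \<psi>_\<phi> r.\<psi>_\<phi>)
    have "\<bar>r.\<Delta> w\<bar> * \<bar>\<Delta> (r.\<psi> w)\<bar> = 1"
      using r.\<Delta>_mult[OF w] by (simp add: abs_mult[symmetric] mult.commute)
    then show ?thesis using fib[OF p(1)] by (simp add: p(2) mult.assoc[symmetric])
  qed
  show "set_integrable lborel y.W (fibre_integrand s e X q y \<omega>) \<longleftrightarrow>
      set_integrable lborel W (fibre_integrand s e X q x \<omega>)"
    using integral_pair(1)[OF cx fib] r.integral_pair(1)[OF cy inv] by blast
  show "set_lebesgue_integral lborel y.W (fibre_integrand s e X q y \<omega>) =
      set_lebesgue_integral lborel W (fibre_integrand s e X q x \<omega>)"
    if "set_integrable lborel W (fibre_integrand s e X q x \<omega>)"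
    by (rule integral_pair(2)[OF cx fib that])
qed

end

section \<open>Change of retraction\<close>

lemma open_subspace_superringed:
  assumes M: "superringed_space M" and U0: "openin (base M) U\<^sub>0"
  shows "superringed_space (open_subspace M U\<^sub>0)" "topspace (base (open_subspace M U\<^sub>0)) = U\<^sub>0"
proof -
  have s: "sect (open_subspace M U\<^sub>0) = sect M" "res (open_subspace M U\<^sub>0) = res M"
    "base (open_subspace M U\<^sub>0) = subtopology (base M) U\<^sub>0"
    by (simp_all add: open_subspace_def)
  have o: "openin (subtopology (base M) U\<^sub>0) V \<Longrightarrow> openin (base M) V" for V
    using U0 openin_trans_full by blast
  show "superringed_space (open_subspace M U\<^sub>0)"
    unfolding superringed_space_def s
  proof (intro conjI)
    note m = M[unfolded superringed_space_def]
    show "\<forall>V. openin (subtopology (base M) U\<^sub>0) V \<longrightarrow> superalgebra (sect M V)"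
      using m[THEN conjunct1] o by simp
    show "\<forall>V W. openin (subtopology (base M) U\<^sub>0) V \<longrightarrow> openin (subtopology (base M) U\<^sub>0) W \<longrightarrow> W \<subseteq> V \<longrightarrow>
        res M V W \<in> superalgebra_hom (sect M V) (sect M W)"
      using m[THEN conjunct2, THEN conjunct1] o by simp
    show "\<forall>V. openin (subtopology (base M) U\<^sub>0) V \<longrightarrow> (\<forall>f\<in>carrier (sect M V). res M V V f = f)"
      using m[THEN conjunct2, THEN conjunct2, THEN conjunct1] o by simp
    show "\<forall>V W T. openin (subtopology (base M) U\<^sub>0) V \<longrightarrow> openin (subtopology (base M) U\<^sub>0) W \<longrightarrow>
        openin (subtopology (base M) U\<^sub>0) T \<longrightarrow> T \<subseteq> W \<longrightarrow> W \<subseteq> V \<longrightarrow>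
        (\<forall>f\<in>carrier (sect M V). res M W T (res M V W f) = res M V T f)"
      using m[THEN conjunct2, THEN conjunct2, THEN conjunct2, THEN conjunct1] o by simp
    show "\<forall>\<V>. (\<forall>V\<in>\<V>. openin (subtopology (base M) U\<^sub>0) V) \<longrightarrow>
      (\<forall>f\<in>carrier (sect M (\<Union>\<V>)). \<forall>g\<in>carrier (sect M (\<Union>\<V>)).
        (\<forall>V\<in>\<V>. res M (\<Union>\<V>) V f = res M (\<Union>\<V>) V g) \<longrightarrow> f = g)"
    proof (intro allI impI)
      fix \<V> assume "\<forall>V\<in>\<V>. openin (subtopology (base M) U\<^sub>0) V"
      then have "\<forall>V\<in>\<V>. openin (base M) V" using o by blast
      then show "\<forall>f\<in>carrier (sect M (\<Union>\<V>)). \<forall>g\<in>carrier (sect M (\<Union>\<V>)).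
          (\<forall>V\<in>\<V>. res M (\<Union>\<V>) V f = res M (\<Union>\<V>) V g) \<longrightarrow> f = g"
        by (rule m[THEN conjunct2, THEN conjunct2, THEN conjunct2, THEN conjunct2, THEN conjunct1, THEN spec, THEN mp])
    qed
    show "\<forall>\<V> s. (\<forall>V\<in>\<V>. openin (subtopology (base M) U\<^sub>0) V \<and> s V \<in> carrier (sect M V)) \<longrightarrow>
      (\<forall>V\<in>\<V>. \<forall>W\<in>\<V>. res M V (V \<inter> W) (s V) = res M W (V \<inter> W) (s W)) \<longrightarrow>
      (\<exists>f\<in>carrier (sect M (\<Union>\<V>)). \<forall>V\<in>\<V>. res M (\<Union>\<V>) V f = s V)"
    proof (intro allI impI)
      fix \<V> s assume "\<forall>V\<in>\<V>. openin (subtopology (base M) U\<^sub>0) V \<and> s V \<in> carrier (sect M V)"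
        and *: "\<forall>V\<in>\<V>. \<forall>W\<in>\<V>. res M V (V \<inter> W) (s V) = res M W (V \<inter> W) (s W)"
      then have "\<forall>V\<in>\<V>. openin (base M) V \<and> s V \<in> carrier (sect M V)" using o by blast
      from m[THEN conjunct2, THEN conjunct2, THEN conjunct2, THEN conjunct2, THEN conjunct2, THEN spec, THEN spec, THEN mp, OF this, THEN mp, OF *]
      show "\<exists>f\<in>carrier (sect M (\<Union>\<V>)). \<forall>V\<in>\<V>. res M (\<Union>\<V>) V f = s V" .
    qed
  qed
  show "topspace (base (open_subspace M U\<^sub>0)) = U\<^sub>0"
    using openin_subset[OF U0] by (auto simp: s)
qed

lemma ucoord_reduced:
  assumes "coord_sys (reduced_space X) 0 u"
  shows "ucoord (reduced_space X) u a \<in> reduced_sections X (topspace (base X))"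
proof -
  define W where "W = crange (reduced_space X) u"
  have W: "open W" and i: "isomorphism (reduced_space X) (superdomain 0 W) u"
    using assms by (auto simp: coord_sys_def W_def)
  have "openin (base (superdomain 0 W)) W" by (simp add: superdomain_def)
  moreover have "preimg (reduced_space X) u W = topspace (base X)"
    by (auto simp: preimg_def W_def crange_def reduced_space_def)
  ultimately have h: "snd u W \<in> superalgebra_hom (sect (superdomain 0 W) W) (sect (reduced_space X) (topspace (base X)))"
    using i[unfolded isomorphism_def, THEN conjunct1, unfolded morphism_def, THEN conjunct2, THEN conjunct1] by metis
  have "(\<lambda>w. if w \<in> W then of_real (w $ a) else 0) \<in> domain_sections 0 W"
    by (rule domain_sections_cutI[OF W]) (auto intro!: gsmooth_of_real smooth_on_coord)
  then have "(\<lambda>w. if w \<in> W then of_real (w $ a) else 0) \<in> carrier (sect (superdomain 0 W) W)"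
    by (simp add: superdomain_def fun_superalg_def)
  from ring_hom_closed[OF superalgebra_homD(1)[OF h] this]
  show ?thesis by (simp add: ucoord_def cpull_def W_def[symmetric]) (simp add: reduced_space_def fun_superalg_def)
qed

lemma set_lebesgue_integral_sum:
  fixes f :: "'i \<Rightarrow> 'a \<Rightarrow> real"
  assumes "\<And>i. i \<in> I \<Longrightarrow> set_integrable M S (f i)"
  shows "set_integrable M S (\<lambda>w. \<Sum>i\<in>I. f i w)"
    and "set_lebesgue_integral M S (\<lambda>w. \<Sum>i\<in>I. f i w) = (\<Sum>i\<in>I. set_lebesgue_integral M S (f i))"
  using assms unfolding set_integrable_def set_lebesgue_integral_def scaleR_sum_right
  by (auto intro: Bochner_Integration.integrable_sum Bochner_Integration.integral_sum)

lemma multi_idx_Union: "(\<Union>j\<le>m. multi_idx j) = {i :: 'p::finite \<Rightarrow> nat. sum i UNIV \<le> m}"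
  by (auto simp: multi_idx_def)

lemma finite_idx: "finite {i :: 'p::finite \<Rightarrow> nat. sum i UNIV \<le> m}"
  unfolding multi_idx_Union[symmetric] by simp

context retraction
begin

text \<open>Restricting u = \<gamma>^*(f) to the underlying manifold recovers f, since \<gamma>
  composed with j is the identity. So the coordinates given on the underlying manifold are those
  induced by x.\<close>

lemma reduced_coordinates:
  assumes f: "f \<in> reduced_sections X T" and u: "ucoord X x a = snd \<gamma> T f"
  shows "f = lift W (\<lambda>w. w $ a)"
proof -
  have "lift W (\<lambda>w. w $ a) = snd (jmor X) T (snd \<gamma> T f)"
    unfolding u[symmetric] by (rule jmor_ucoord[symmetric])
  also have "\<dots> = f"
    using \<gamma>_body[OF openin_topspace f] f by (auto simp: jmor_def reduced_sections_def fun_eq_iff)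
  finally show ?thesis ..
qed

text \<open>The definition of the integral picks some coordinate system associated with \<gamma>. By
  \<open>fibre_integral_pair\<close> any other one computes the same integral.\<close>

lemma berezin_integral_chart:
  assumes ass: "associated X x \<gamma>" and e: "integration_weight k X e"
    and c: "\<omega> x \<in> carrier (sect X T)" "\<And>z. coord_sys X q z \<Longrightarrow> \<omega> z = \<omega> x \<otimes>\<^bsub>sect X T\<^esub> quot k X q x z"
  shows "berezin_integrable s e X q \<gamma> \<omega> \<longleftrightarrow> set_integrable lborel W (fibre_integrand s e X q x \<omega>)"
    and "set_integrable lborel W (fibre_integrand s e X q x \<omega>) \<Longrightarrow>
      berezin_integral s e X q \<gamma> \<omega> = set_lebesgue_integral lborel W (fibre_integrand s e X q x \<omega>)"
proof -
  define z where "z = (assoc_coords X q \<gamma> :: ('m, 'p, 's) chart)"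
  have "coord_sys X q z \<and> associated X z \<gamma>"
    unfolding z_def assoc_coords_def by (rule someI[of "\<lambda>x. coord_sys X q x \<and> associated X x \<gamma>" x]) (use x ass in simp)
  then have z: "coord_sys X q z" "associated X z \<gamma>" by auto
  interpret cp: chart_pair X q x z \<gamma>
    by unfold_locales (use X z ass ret in auto)
  note fib = cp.fibre_integral_pair[of \<omega> k e, OF c(1) c(2)[OF z(1)] e]
  show "berezin_integrable s e X q \<gamma> \<omega> \<longleftrightarrow> set_integrable lborel W (fibre_integrand s e X q x \<omega>)"
    using fib(1) by (simp add: berezin_integrable_def Let_def z_def)
  show "berezin_integral s e X q \<gamma> \<omega> = set_lebesgue_integral lborel W (fibre_integrand s e X q x \<omega>)"
    if "set_integrable lborel W (fibre_integrand s e X q x \<omega>)"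
    using fib(2)[OF that] by (simp add: berezin_integral_def Let_def z_def)
qed

section \<open>The terms of the formula and their integrals\<close>

abbreviation "\<tau> \<beta> k \<omega> i \<equiv> ract_du \<beta> k X q x i (rmult \<beta> X \<omega> (mpow (sect X T) N i))"

context
  fixes k and \<omega> :: "('m, 'p::{finite,linorder}, 's) berezin" assumes \<omega>: "\<omega> \<in> berezin_sections k X q"
begin

definition "G = (SOME G. G \<in> D W \<and> \<omega> rchart = P W (E W G))"

lemma G: "G \<in> D W" "\<omega> rchart = P W (E W G)"
proof -
  interpret y: chart X q rchart by unfold_locales (rule X, rule rchart)
  have "\<omega> rchart \<in> carrier (sect X T)" using \<omega> rchart unfolding berezin_sections_def by blast
  from y.gl_cr_closed[OF this] y.gl_cr[OF this]
  have "\<exists>G. G \<in> D W \<and> \<omega> rchart = P W (E W G)" by (intro exI[of _ "y.cr y.W (\<omega> rchart)"]) (simp add: rchart_simps)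
  from someI_ex[OF this] show "G \<in> D W" "\<omega> rchart = P W (E W G)" unfolding G_def by auto
qed

lemma \<omega>_closed: "\<omega> x \<in> carrier (sect X T)"
  using \<omega> x unfolding berezin_sections_def by blast

lemma \<omega>_rchart: "\<omega> x = P W (E W G) \<otimes>\<^bsub>sect X T\<^esub> quot k X q rchart x"
  using \<omega> x rchart unfolding G(2)[symmetric] berezin_sections_def by blast

lemma crep_\<omega>_rchart: "crep X q rchart (\<omega> rchart) = G"
proof -
  interpret y: chart X q rchart by unfold_locales (rule X, rule rchart)
  show ?thesis using y.cr_gl[of G] G by (simp add: y.crep_cr rchart_simps)
qed

definition "S i w = (\<Sum>I\<in>Pow {..<q}. eg (multi_pd W i (\<lambda>w. (\<Prod>a\<in>UNIV. shift a w ^ i a) *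
  (Eg (h W (\<lambda>z. gcoeff (G z) I) w) * jac W shift w)) w) * gmon I)" for i :: "'p \<Rightarrow> nat"

lemma \<tau>_P: "\<tau> \<beta> k \<omega> i x = P W (cutW (\<lambda>w. (-1) ^ sum i UNIV *\<^sub>R S i w))"
  unfolding S_def by (rule integrand_rchart(1)[where \<omega> = \<omega>, OF G(1)]) (rule \<omega>_rchart)

lemma S_D: "cutW (\<lambda>w. (-1) ^ sum i UNIV *\<^sub>R S i w) \<in> D W"
proof (rule D_cut)
  interpret M: diff_algebra "even_smooth q W" "epd W" "\<lambda>r _. of_real r" by (rule epd_diff_algebra[OF W_open])
  have "(\<lambda>w. (\<Prod>a\<in>UNIV. shift a w ^ i a) * (Eg (h W (\<lambda>z. gcoeff (G z) I) w) * jac W shift w)) \<in> even_smooth q W" for I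
    unfolding mult_fun_unfold
    by (intro even_smooth_closed W_open shift_monomial_closed jac_closed[OF W_open shift_closed shift_deg]
        h_even_smooth[OF W_open subset_refl domain_sectionsD(1)[OF G(1)]])
  note m = M.dm_closed[OF this]
  show "gsmooth W (\<lambda>w. (-1) ^ sum i UNIV *\<^sub>R S i w)"
    unfolding S_def using m
    by (intro gsmooth_scaleR gsmooth_sum gsmooth_times W_open smooth_on_const gsmooth_const) (simp add: even_smooth_def)
  show "gens q ((-1) ^ sum i UNIV *\<^sub>R S i w)" for w
    unfolding S_def using m
    by (intro gens_scaleR gens_sum gens_times gens_gmon) (auto simp: even_smooth_def)
qed

lemma \<tau>_closed: "\<tau> \<beta> k \<omega> i x \<in> carrier (sect X T)"
  unfolding \<tau>_P by (rule gl_closed[OF S_D])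

lemma \<tau>_crep: "w \<in> W \<Longrightarrow> crep X q x (\<tau> \<beta> k \<omega> i x) w = (-1) ^ sum i UNIV *\<^sub>R S i w"
  unfolding \<tau>_P crep_cr cr_gl[OF S_D] by simp

lemma \<tau>_ber: "i \<noteq> (\<lambda>_. 0) \<Longrightarrow> \<tau> \<beta> k \<omega> i z = \<tau> \<beta> k \<omega> i x \<otimes>\<^bsub>sect X T\<^esub> quot k X q x z"
  by (rule integrand_rchart(2)[where \<omega> = \<omega>, OF G(1)], rule \<omega>_rchart) (auto simp: fun_eq_iff intro: gr0I)

lemma \<tau>_zero: "\<tau> \<beta> k \<omega> (\<lambda>_. 0) x = \<omega> x"
proof -
  have "fold (\<lambda>a. id) xs v = v" for xs :: "'p list" and v :: "('m, 'p, 's) berezin" by (induction xs) auto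
  then show ?thesis using rmult_mpow_zero[of \<omega>, OF \<omega>_closed] by (simp add: ract_du_def)
qed

text \<open>The power n^i starts in degree 2|i|, which exceeds q.\<close>

lemma \<tau>_large:
  assumes "q < sum i UNIV"
  shows "\<tau> \<beta> k \<omega> i x = \<zero>\<^bsub>sect X T\<^esub>"
proof -
  have deg: "gdeg_ge (2 * sum i B) (eg (\<Prod>a\<in>B. shift a w ^ i a))" if "finite B" for w B
    using that
  proof (induction B)
    case (insert b B)
    have "gdeg_ge (2 * j) (eg (shift b w) ^ j)" for j
      by (induction j) (use gdeg_ge_times[OF shift_deg] in \<open>auto simp: gdeg_ge_def\<close>)
    from gdeg_ge_times[OF this insert.IH] show ?case using insert by (simp add: distrib_left)
  qed (simp add: gdeg_ge_def)
  have "(\<Prod>a\<in>UNIV. shift a w ^ i a) = 0" for w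
  proof (rule egrass_eqI)
    have "gens q (eg (\<Prod>a\<in>UNIV. shift a w ^ i a))"
      using shift_monomial_closed[of i UNIV] by (simp add: even_smooth_def)
    from gens_gdeg_ge_eq_0[OF this deg] show "eg (\<Prod>a\<in>UNIV. shift a w ^ i a) = eg 0" using assms by simp
  qed
  moreover interpret M: diff_algebra "even_smooth q W" "epd W" "\<lambda>r _. of_real r" by (rule epd_diff_algebra[OF W_open])
  have "multi_pd W i (\<lambda>_. 0) = 0"
  proof -
    have d0: "epd W a 0 = 0" for a by (intro ext egrass_eqI) (simp add: eg_epd)
    have p0: "(epd W a ^^ m) 0 = 0" for a m by (induction m) (simp_all only: funpow.simps id_apply o_apply d0)
    have "fold (\<lambda>a. epd W a ^^ i a) xs 0 = 0" for xs by (induction xs) (simp_all only: fold.simps id_apply o_apply p0)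
    then show ?thesis unfolding M.dm_def zero_fun_def[symmetric] by simp
  qed
  ultimately have "S i w = 0" for w by (simp add: S_def)
  then show ?thesis unfolding \<tau>_P gl_zero by (simp cong: if_cong)
qed

text \<open>Lagrange inversion, before any integration. Its sign (-1)^|i| cancels against the sign
  that |i| right actions of coordinate derivations produce, so the weights are 1 / i!.\<close>

lemma fibre_rchart:
  assumes w: "w \<in> W"
  shows "fibre_integrand s e X q rchart \<omega> w =
    (\<Sum>i | sum i UNIV \<le> Suc q. 1 / (\<Prod>a\<in>UNIV. fact (i a)) * fibre_integrand s e X q x (\<tau> \<beta> k \<omega> i) w)"
proof -
  have "G w = (\<Sum>j\<le>Suc q. \<Sum>i\<in>multi_idx j. ((-1) ^ j / (\<Prod>a\<in>UNIV. fact (i a))) *\<^sub>R S i w)"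
    unfolding S_def by (rule E_inversion[OF G(1) w])
  also have "\<dots> = (\<Sum>j\<le>Suc q. \<Sum>i\<in>multi_idx j. (1 / (\<Prod>a\<in>UNIV. fact (i a))) *\<^sub>R crep X q x (\<tau> \<beta> k \<omega> i x) w)"
    by (intro sum.cong refl) (simp add: \<tau>_crep[OF w] multi_idx_def)
  also have "\<dots> = (\<Sum>i\<in>(\<Union>j\<le>Suc q. multi_idx j). (1 / (\<Prod>a\<in>UNIV. fact (i a))) *\<^sub>R crep X q x (\<tau> \<beta> k \<omega> i x) w)"
    by (subst sum.UNION_disjoint) (auto simp: multi_idx_def[symmetric], auto simp: multi_idx_def)
  finally have "gcoeff (G w) {..<q} =
      (\<Sum>i | sum i UNIV \<le> Suc q. 1 / (\<Prod>a\<in>UNIV. fact (i a)) * gcoeff (crep X q x (\<tau> \<beta> k \<omega> i x) w) {..<q})"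
    unfolding multi_idx_Union by simp
  then show ?thesis
    by (simp add: fibre_integrand_def fibre_coeff_def crep_\<omega>_rchart rchart_simps sum_distrib_left mult_ac sum_negf)
qed

text \<open>\<open>rchart\<close> has the underlying map of x, so both integrals are over W with the
  same orientation weight, and the pointwise identity \<open>fibre_rchart\<close> can be integrated
  term by term. The term i = 0 is the integral of \<omega> with respect to the first
  retraction.\<close>

theorem change_of_retraction:
  fixes \<gamma>\<^sub>0
  assumes ret0: "super_retraction X \<gamma>\<^sub>0" and ass: "associated X x \<gamma>\<^sub>0" and e: "integration_weight k X e"
    and i0: "berezin_integrable s e X q \<gamma>\<^sub>0 \<omega>"
    and i: "\<And>i. i \<noteq> (\<lambda>_. 0) \<Longrightarrow> berezin_integrable s e X q \<gamma>\<^sub>0 (\<tau> \<beta> k \<omega> i)"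
  shows "berezin_integrable s e X q \<gamma> \<omega>"
    and "berezin_integral s e X q \<gamma> \<omega> = berezin_integral s e X q \<gamma>\<^sub>0 \<omega> +
      (\<Sum>\<^sub>\<infinity>i\<in>{i. i \<noteq> (\<lambda>_. 0)}. 1 / (\<Prod>a\<in>UNIV. fact (i a)) * berezin_integral s e X q \<gamma>\<^sub>0 (\<tau> \<beta> k \<omega> i))"
proof -
  interpret r0: retraction X q x \<gamma>\<^sub>0 by unfold_locales (rule ret0)
  interpret y: retraction X q rchart \<gamma> by unfold_locales (rule X, rule rchart, rule ret)
  define F where "F i = fibre_integrand s e X q x (\<tau> \<beta> k \<omega> i)" for i
  define c where "c i = 1 / (\<Prod>a\<in>UNIV. fact (i a) :: real)" for i :: "'p \<Rightarrow> nat"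
  define K where "K = {i :: 'p \<Rightarrow> nat. sum i UNIV \<le> Suc q}"
  define J where "J i = set_lebesgue_integral lborel W (F i)" for i
  have K: "finite K" unfolding K_def by (rule finite_idx)
  have \<omega>q: "\<omega> z = \<omega> x' \<otimes>\<^bsub>sect X T\<^esub> quot k X q x' z" if "coord_sys X q z" "coord_sys X q x'" for z x'
    using \<omega> that unfolding berezin_sections_def by blast
  note b0 = r0.berezin_integral_chart[of k e \<omega>, OF ass e \<omega>_closed \<omega>q[OF _ x]]
  note bi = r0.berezin_integral_chart[of k e "\<tau> \<beta> k \<omega> i" for i, OF ass e \<tau>_closed \<tau>_ber]
  have F0: "F (\<lambda>_. 0) = fibre_integrand s e X q x \<omega>"
    by (simp add: F_def fibre_integrand_def[abs_def] fibre_coeff_def \<tau>_zero)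
  have iF: "set_integrable lborel W (F i)" for i
    using b0(1) i0 bi(1)[of i] i[of i] F0 by (cases "i = (\<lambda>_. 0)") (auto simp: F_def)
  have J0: "J (\<lambda>_. 0) = berezin_integral s e X q \<gamma>\<^sub>0 \<omega>"
    using b0(2) iF[of "\<lambda>_. 0"] by (simp add: J_def F0)
  have J: "J i = berezin_integral s e X q \<gamma>\<^sub>0 (\<tau> \<beta> k \<omega> i)" if "i \<noteq> (\<lambda>_. 0)" for i
    using bi(2)[OF that] iF[of i] by (simp add: J_def F_def)
  have Jz: "J i = 0" if "i \<notin> K" for i
  proof -
    have "\<tau> \<beta> k \<omega> i x = P W (\<lambda>_. 0)" using that by (simp add: K_def \<tau>_large gl_zero)
    then have "F i = (\<lambda>_. 0)"
      by (simp add: F_def fibre_integrand_def[abs_def] fibre_coeff_def crep_cr cr_gl[OF D0])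
    then show ?thesis by (simp add: J_def set_lebesgue_integral_def)
  qed
  have yW: "y.W = W" by (rule rchart_simps(3))
  have eq: "fibre_integrand s e X q rchart \<omega> w = (\<Sum>i\<in>K. c i * F i w)" if "w \<in> W" for w
    unfolding K_def c_def F_def by (rule fibre_rchart[OF that])
  have 1: "set_integrable lborel W (\<lambda>w. \<Sum>i\<in>K. c i * F i w)"
    by (rule set_lebesgue_integral_sum) (use iF in simp)
  then have 2: "set_integrable lborel W (fibre_integrand s e X q rchart \<omega>)"
    using eq by (simp cong: set_integrable_cong)
  have "set_lebesgue_integral lborel W (fibre_integrand s e X q rchart \<omega>) =
      set_lebesgue_integral lborel W (\<lambda>w. \<Sum>i\<in>K. c i * F i w)"
    by (rule set_lebesgue_integral_cong) (use W_open eq in auto)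
  also have "\<dots> = (\<Sum>i\<in>K. c i * J i)"
    unfolding J_def by (subst set_lebesgue_integral_sum) (use iF in simp_all)
  also have "\<dots> = J (\<lambda>_. 0) + (\<Sum>i\<in>K - {\<lambda>_. 0}. c i * J i)"
    by (subst sum.remove[OF K, of "\<lambda>_. 0"]) (simp_all add: K_def c_def)
  also have "(\<Sum>i\<in>K - {\<lambda>_. 0}. c i * J i) = (\<Sum>\<^sub>\<infinity>i\<in>K - {\<lambda>_. 0}. c i * J i)"
    using K by (simp add: infsum_finite)
  \<comment> \<open>Outside of K the integrands vanish, so the sum over all i \<noteq> 0 reduces to
    the finite one.\<close>
  also have "\<dots> = (\<Sum>\<^sub>\<infinity>i\<in>{i. i \<noteq> (\<lambda>_. 0)}. c i * berezin_integral s e X q \<gamma>\<^sub>0 (\<tau> \<beta> k \<omega> i))"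
  proof (rule infsum_cong_neutral)
    fix i assume "i \<in> {i. i \<noteq> (\<lambda>_. 0)} - (K - {\<lambda>_. 0})"
    then show "c i * berezin_integral s e X q \<gamma>\<^sub>0 (\<tau> \<beta> k \<omega> i) = 0" using J[of i] Jz[of i] by auto
  qed (auto simp: J)
  finally have 3: "set_lebesgue_integral lborel W (fibre_integrand s e X q rchart \<omega>) = berezin_integral s e X q \<gamma>\<^sub>0 \<omega> +
      (\<Sum>\<^sub>\<infinity>i\<in>{i. i \<noteq> (\<lambda>_. 0)}. c i * berezin_integral s e X q \<gamma>\<^sub>0 (\<tau> \<beta> k \<omega> i))"
    unfolding J0 .
  have "\<omega> rchart \<in> carrier (sect X T)" using \<omega> rchart unfolding berezin_sections_def by blast
  note yi = y.berezin_integral_chart[of k e \<omega>, OF associated_rchart e this \<omega>q[OF _ rchart], unfolded yW]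
  show "berezin_integrable s e X q \<gamma> \<omega>" using yi(1)[of s] 2 by blast
  show "berezin_integral s e X q \<gamma> \<omega> = berezin_integral s e X q \<gamma>\<^sub>0 \<omega> +
      (\<Sum>\<^sub>\<infinity>i\<in>{i. i \<noteq> (\<lambda>_. 0)}. 1 / (\<Prod>a\<in>UNIV. fact (i a)) * berezin_integral s e X q \<gamma>\<^sub>0 (\<tau> \<beta> k \<omega> i))"
    using yi(2)[OF _ 2] 3 by (simp only: c_def)
qed

end

end


theorem theorem4p4:
  fixes M :: "('m, 's) superspace"
    and q :: nat
    and U\<^sub>0 :: "'m set"
    and \<gamma> \<gamma>' :: "('m, 'm, 's, 'm \<Rightarrow> real) morph"
    and u0 :: "('m, 'p::{finite,linorder}, 'm \<Rightarrow> real) chart"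
    and x :: "('m, 'p::{finite,linorder}, 's) chart"
    and k :: kind
    and e :: "('m \<Rightarrow> real ^ 'p::{finite,linorder}) \<Rightarrow> 'm \<Rightarrow> real"
    and \<omega> :: "('m, 'p::{finite,linorder}, 's) berezin"
    and b :: "nat \<Rightarrow> nat \<Rightarrow> bool"
    and s :: "nat \<Rightarrow> nat \<Rightarrow> bool"
  defines "U \<equiv> open_subspace M U\<^sub>0"
  defines "A \<equiv> sect U U\<^sub>0"
  defines "n \<equiv> \<lambda>a. snd \<gamma>' U\<^sub>0 (ucoord (reduced_space U) u0 a) \<ominus>\<^bsub>A\<^esub> snd \<gamma> U\<^sub>0 (ucoord (reduced_space U) u0 a)"
  defines "\<tau> \<equiv> \<lambda>i. ract_du (b CARD('p) q) k U q x i (rmult (b CARD('p) q) U \<omega> (mpow A n i))"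
  assumes "supermanifold TYPE('p) q M"
    and "openin (base M) U\<^sub>0"
    and "super_retraction U \<gamma>" and "super_retraction U \<gamma>'"
    and "coord_sys (reduced_space U) 0 u0"
    and "coord_sys U q x"
    and "\<And>a. ucoord U x a = snd \<gamma> U\<^sub>0 (ucoord (reduced_space U) u0 a)"
    and "integration_weight k U e"
    and "\<omega> \<in> berezin_sections k U q"
  shows "finite {i. \<tau> i x \<noteq> \<zero>\<^bsub>A\<^esub>} \<and>
    (berezin_integrable s e U q \<gamma> \<omega> \<longrightarrow>
      (\<forall>i. i \<noteq> (\<lambda>_. 0) \<longrightarrow> berezin_integrable s e U q \<gamma> (\<tau> i)) \<longrightarrow>
      berezin_integrable s e U q \<gamma>' \<omega> \<and>
      berezin_integral s e U q \<gamma>' \<omega> = berezin_integral s e U q \<gamma> \<omega> +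
        (\<Sum>\<^sub>\<infinity>i\<in>{i. i \<noteq> (\<lambda>_. 0)}. 1 / (\<Prod>a\<in>UNIV. fact (i a)) * berezin_integral s e U q \<gamma> (\<tau> i)))"
proof -
  have "superringed_space M" using assms(5) by (simp add: supermanifold_def)
  note U = open_subspace_superringed[OF this assms(6), folded U_def]
  interpret r: retraction U q x \<gamma> by unfold_locales (fact U(1) assms(10) assms(7))+
  \<comment> \<open>The coordinate system x is associated with \<gamma> only; for \<gamma>' it
    serves as the reference in which \<open>rchart\<close> and n are expressed.\<close>
  interpret r': retraction U q x \<gamma>' by unfold_locales (fact assms(8))
  define f where "f a = ucoord (reduced_space U) u0 a" for a
  have f: "f a \<in> reduced_sections U r.T" for a
    unfolding f_def by (rule ucoord_reduced[OF assms(9)])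
  have u: "ucoord U x a = snd \<gamma> r.T (f a)" for a
    using assms(11)[of a] by (simp add: U(2) f_def)
  \<comment> \<open>The given coordinates on the underlying manifold are the bodies of the even
    coordinates of x.\<close>
  have fl: "f a = r.lift r.W (\<lambda>w. w $ a)" for a by (rule r.reduced_coordinates[OF f u])
  have ass: "associated U x \<gamma>" using u by (simp add: r.associated_iff fl)
  have n: "n = (\<lambda>a. r'.N a)"
    using u by (simp add: n_def A_def fun_eq_iff U(2) f_def[symmetric] fl)
  have \<tau>: "\<tau> = r'.\<tau> (b CARD('p) q) k \<omega>"
    by (simp add: \<tau>_def n A_def U(2) fun_eq_iff)
  have "{i. \<tau> i x \<noteq> \<zero>\<^bsub>A\<^esub>} \<subseteq> {i. sum i UNIV \<le> q}"
    using r'.\<tau>_large[OF assms(13), of _ "b CARD('p) q"] by (auto simp: \<tau> A_def U(2) not_le[symmetric])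
  then have fin: "finite {i. \<tau> i x \<noteq> \<zero>\<^bsub>A\<^esub>}" by (rule finite_subset) (rule finite_idx)
  show ?thesis
  proof (intro conjI impI)
    assume i0: "berezin_integrable s e U q \<gamma> \<omega>"
      and i: "\<forall>i. i \<noteq> (\<lambda>_. 0) \<longrightarrow> berezin_integrable s e U q \<gamma> (\<tau> i)"
    have i': "berezin_integrable s e U q \<gamma> (r'.\<tau> (b CARD('p) q) k \<omega> i)" if "i \<noteq> (\<lambda>_. 0)" for i
      using i that unfolding \<tau> by simp
    note c = r'.change_of_retraction[OF assms(13) assms(7) ass assms(12) i0 i']
    show "berezin_integrable s e U q \<gamma>' \<omega>" by (rule c(1))
    show "berezin_integral s e U q \<gamma>' \<omega> = berezin_integral s e U q \<gamma> \<omega> +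
        (\<Sum>\<^sub>\<infinity>i\<in>{i. i \<noteq> (\<lambda>_. 0)}. 1 / (\<Prod>a\<in>UNIV. fact (i a)) * berezin_integral s e U q \<gamma> (\<tau> i))"
      unfolding \<tau> by (rule c(2))
  qed (rule fin)
qed

end
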